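(* For every $\ell\ge 2$ and $r\ge 4$ there exist $c,K>0$ such that for all sufficiently large $n$ and every $t\ge K$, there exists a collection $\mathcal{C}$ of $r$-graphs on $[n]$ such that (a) $|\mathcal{C}|\le\exp\left(c(\log n)^{2r-2}n^{\frac{2\ell}{2\ell-1}}\right)$; (b) $e(G)\le tn^{r-1}$ for every $G\in\mathcal{C}$; (c) every $C^r_{2\ell}$-free $r$-graph on $[n]$ is a subgraph of some $G\in\mathcal{C}$.
   Context: An $r$-graph is an $r$-uniform hypergraph; $e(G)$ is the number of edges. The linear cycle $C^r_k$ ($k\ge3$) has vertices $v_1,\dots,v_{k(r-1)}$ and edges $e_i=\{v_{(i-1)(r-1)},\dots,v_{i(r-1)}\}$, $1\le i\le k$, with $v_0=v_{k(r-1)}$. *)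

theory Defs
  imports Complex_Main
begin

text \<open>A hypergraph is given by its vertex set and its edge set. For hypergraphs sharing one
  vertex set, being a subgraph is inclusion of the edge sets.\<close>

definition r_graph_on :: "nat \<Rightarrow> 'a set \<Rightarrow> 'a set set \<Rightarrow> bool" where
  "r_graph_on r V E \<longleftrightarrow> (\<forall>e\<in>E. e \<subseteq> V \<and> finite e \<and> card e = r)"

definition contains_copy ::
  "'a set \<Rightarrow> 'a set set \<Rightarrow> 'b set \<Rightarrow> 'b set set \<Rightarrow> bool" where
  "contains_copy V E W F \<longleftrightarrow>
     (\<exists>f. inj_on f W \<and> f ` W \<subseteq> V \<and> (\<forall>e\<in>F. f ` e \<in> E))"

text \<open>The vertex \<open>v\<^sub>j\<close> of the linear cycle is the number \<open>j\<close>; the index \<open>0\<close> is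
  identified with \<open>k * (r - 1)\<close>.\<close>

definition lin_cycle_verts :: "nat \<Rightarrow> nat \<Rightarrow> nat set" where
  "lin_cycle_verts r k = {1..k * (r - 1)}"

definition lin_cycle_vertex :: "nat \<Rightarrow> nat \<Rightarrow> nat \<Rightarrow> nat" where
  "lin_cycle_vertex r k j = (if j = 0 then k * (r - 1) else j)"

definition lin_cycle_edge :: "nat \<Rightarrow> nat \<Rightarrow> nat \<Rightarrow> nat set" where
  "lin_cycle_edge r k i = lin_cycle_vertex r k ` {(i - 1) * (r - 1)..i * (r - 1)}"

definition lin_cycle_edges :: "nat \<Rightarrow> nat \<Rightarrow> nat set set" where
  "lin_cycle_edges r k = lin_cycle_edge r k ` {1..k}"

definition lin_cycle_free :: "nat \<Rightarrow> nat \<Rightarrow> 'a set \<Rightarrow> 'a set set \<Rightarrow> bool" where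
  "lin_cycle_free r k V E \<longleftrightarrow>
     \<not> contains_copy V E (lin_cycle_verts r k) (lin_cycle_edges r k)"

end

theory Submission
  imports Defs "HOL-Library.Multiset" "HOL-Library.FuncSet"
begin

text \<open>Containers for a weighted hypergraph: if a weight on the \<open>2l\<close>-subsets of \<open>X\<close> has total mass of
  order \<open>1\<close> and every set of \<open>j\<close> elements has weighted degree at most of order \<open>\<tau> ^ (j - 1) / card X\<close>, then
  the independent sets are covered by few sets that miss a fixed proportion of \<open>X\<close>. Here \<open>X\<close> is the edge
  set of an \<open>r\<close>-graph \<open>G\<close> with more than \<open>K n ^ (r - 1)\<close> edges and the weight is carried by the linear
  \<open>2l\<close>-cycles in \<open>G\<close>, with \<open>\<tau> = n powr (2l / (2l - 1)) / card G\<close>; starting from the complete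
  \<open>r\<close>-graph, \<open>O(log n)\<close> applications bring all containers below \<open>K n ^ (r - 1)\<close> edges.

  To find the weight, pass to a subgraph in which every \<open>(r - 1)\<close>-set lies in no edge or in many, so
  that a cycle of junction vertices extends greedily to a linear cycle. As \<open>r \<ge> 4\<close>, most edges contain
  a pair whose codegree is small compared with the degrees of its ends; these pairs carry a
  reversible random walk with well spread transition probabilities. Let \<open>t \<le> l\<close> be the least length
  (at least \<open>2\<close>) such that a constant proportion of the walks of length \<open>t\<close> joins pairs of density at least
  \<open>n powr ((l - t) / (2l - 1)) / 2\<close>. The random cycle follows a walk of length \<open>t\<close> from \<open>x\<close>, zigzags \<open>2 (l - t)\<close> steps between the vertices
  reached from \<open>x\<close> after \<open>t\<close> and \<open>t - 1\<close> steps, and returns to \<open>x\<close> by a reversed walk of length \<open>t\<close>.\<close>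

section \<open>Iterated sums over the coordinates of a tuple\<close>

text \<open>The container lemma asks the following of the random cycle: prescribing the edges at any
  set \<open>J\<close> of positions costs at most a constant times
  \<open>(n * D) ^ (card J - 1)\<close>, where \<open>D ^ (2 * l - 1) = n\<close>. A walk
  conditioned to close up need not satisfy this, because walks may concentrate on few pairs.
  \<open>lev i = D ^ (l - i)\<close> is the concentration tolerated at length \<open>i\<close>: it
  is 1 at length \<open>l\<close>, and a single step obeys \<open>lev 1\<close> up to a constant.
  The choice of \<open>t\<close> gives a lower bound of order \<open>lev t\<close> for joined pairs,
  its minimality upper bounds of order \<open>lev g\<close> for subwalks of length
  \<open>g < t\<close>. Conditioning on the ends of a walk with \<open>g\<close> consecutive free
  steps thus loses at most \<open>lev g / lev t = D ^ (t - g)\<close>, one factor \<open>D\<close>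
  for each tested step. Given \<open>x\<close>, the zigzag is a chain with known stationary laws, so
  it adds steps at a controlled price. Four vertices in an edge are what makes single steps obey
  \<open>lev 1\<close>: a path of three pairs leads to \<open>\<kappa> = n powr (-2/3)\<close>, and
  \<open>\<kappa> * n = n powr (1/3)\<close> is at most \<open>D ^ (l - 1)\<close> for every
  \<open>l \<ge> 2\<close>, with equality at \<open>l = 2\<close>.\<close>

definition isum :: "'v set \<Rightarrow> nat \<Rightarrow> ((nat \<Rightarrow> 'v) \<Rightarrow> real) \<Rightarrow> (nat \<Rightarrow> 'v) \<Rightarrow> real" where
  "isum V i f c = (\<Sum>v\<in>V. f (c(i := v)))"

text \<open>Tuples are total functions, and the base point supplies the coordinates outside the
  list. Blocks of coordinates can then be summed out in any order, and what is left is again a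
  function of a total tuple.\<close>

primrec isums :: "'v set \<Rightarrow> nat list \<Rightarrow> ((nat \<Rightarrow> 'v) \<Rightarrow> real) \<Rightarrow> (nat \<Rightarrow> 'v) \<Rightarrow> real" where
  "isums V [] f = f"
| "isums V (i # is) f = isum V i (isums V is f)"

text \<open>Plays the role of measurability with respect to the coordinates in \<open>A\<close>:
  such factors move out of sums over other coordinates.\<close>

definition depends_on :: "nat set \<Rightarrow> ((nat \<Rightarrow> 'v) \<Rightarrow> 'b) \<Rightarrow> bool" where
  "depends_on A f \<longleftrightarrow> (\<forall>c c'. (\<forall>j\<in>A. c j = c' j) \<longrightarrow> f c = f c')"

lemma isums_append: "isums V (is @ js) f = isums V is (isums V js f)"
  by (induction "is") auto

lemma isum_mono: "(\<And>c. f c \<le> g c) \<Longrightarrow> isum V i f c \<le> isum V i g c"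
  unfolding isum_def by (auto intro: sum_mono)

lemma isums_mono: "(\<And>c. f c \<le> g c) \<Longrightarrow> isums V is f c \<le> isums V is g c"
  by (induction "is" arbitrary: c) (auto intro: isum_mono)

lemma isums_nonneg: "(\<And>c. 0 \<le> f c) \<Longrightarrow> 0 \<le> isums V is f c"
  by (induction "is" arbitrary: c) (auto simp: isum_def intro: sum_nonneg)

lemma isums_cmult: "isums V is (\<lambda>c. a * f c) c = a * isums V is f c"
proof (induction "is" arbitrary: c)
  case (Cons i "is")
  have "isums V is (\<lambda>c. a * f c) = (\<lambda>c. a * isums V is f c)" using Cons by blast
  then show ?case by (simp add: isum_def sum_distrib_left)
qed simp

lemma isums_sum: "isums V is (\<lambda>c. \<Sum>x\<in>A. f x c) c = (\<Sum>x\<in>A. isums V is (f x) c)"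
proof (induction "is" arbitrary: c)
  case (Cons i "is")
  have "isums V is (\<lambda>c. \<Sum>x\<in>A. f x c) = (\<lambda>c. \<Sum>x\<in>A. isums V is (f x) c)" using Cons by blast
  then show ?case by (simp add: isum_def sum.swap[of _ A V])
qed simp

lemma isums_factor:
  assumes "depends_on A g" "A \<inter> set is = {}"
  shows "isums V is (\<lambda>c. g c * f c) c = g c * isums V is f c"
  using assms(2)
proof (induction "is" arbitrary: c)
  case (Cons i "is")
  then have "isums V is (\<lambda>c. g c * f c) = (\<lambda>c. g c * isums V is f c)" by auto
  moreover have "g (c(i := v)) = g c" for v
    using assms(1) Cons.prems unfolding depends_on_def by (metis disjoint_iff fun_upd_other list.set_intros(1))
  ultimately show ?case by (simp add: isum_def sum_distrib_left)
qed simp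

lemma isum_isums: "isum V i (isums V is f) = isums V is (isum V i f)"
proof (induction "is")
  case (Cons j "is")
  have "isum V i (isum V j h) = isum V j (isum V i h)" for h :: "(nat \<Rightarrow> 'a) \<Rightarrow> real"
  proof (cases "i = j")
    case False
    show ?thesis
    proof
      fix c show "isum V i (isum V j h) c = isum V j (isum V i h) c"
        unfolding isum_def by (subst sum.swap) (use False in \<open>simp add: fun_upd_twist\<close>)
    qed
  qed simp
  then show ?case using Cons by simp
qed simp

lemma isums_perm: "mset is = mset js \<Longrightarrow> isums V is f = isums V js f"
proof (induction "is" arbitrary: js)
  case (Cons i "is")
  then have "i \<in> set js" by (metis list.set_intros(1) set_mset_mset)
  then obtain xs ys where js: "js = xs @ i # ys" by (meson split_list)
  then have "mset is = mset (xs @ ys)" using Cons.prems by simp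
  then have "isums V is f = isums V (xs @ ys) f" by (rule Cons.IH)
  then show ?case unfolding js by (simp add: isums_append isum_isums)
qed simp

lemma isums_set: "set is = set js \<Longrightarrow> distinct is \<Longrightarrow> distinct js \<Longrightarrow> isums V is f = isums V js f"
  by (intro isums_perm) (metis mset_set_set)

lemma depends_onD: "depends_on A f \<Longrightarrow> (\<And>j. j \<in> A \<Longrightarrow> c j = c' j) \<Longrightarrow> f c = f c'"
  unfolding depends_on_def by blast

lemma depends_on_mono: "depends_on A f \<Longrightarrow> A \<subseteq> B \<Longrightarrow> depends_on B f"
  unfolding depends_on_def by blast

lemma depends_on_isum: "depends_on A f \<Longrightarrow> depends_on (A - {i}) (isum V i f)"
  unfolding depends_on_def isum_def by (intro allI impI sum.cong refl) (metis DiffI fun_upd_apply singletonD)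

lemma depends_on_isums: "depends_on A f \<Longrightarrow> depends_on (A - set is) (isums V is f)"
proof (induction "is")
  case (Cons i "is")
  have "A - set (i # is) = A - set is - {i}" by auto
  then show ?case using depends_on_isum[of "A - set is" "isums V is f" i V] Cons by (simp only: isums.simps)
qed simp

text \<open>Needed for the reflection of the cycle, which turns sums over its final walk into sums
  over its initial walk.\<close>

lemma isums_involution:
  assumes "\<And>i. \<sigma> (\<sigma> i) = i"
  shows "isums V is (\<lambda>c. f (c \<circ> \<sigma>)) c = isums V (map \<sigma> is) f (c \<circ> \<sigma>)"
proof (induction "is" arbitrary: c)
  case (Cons i "is")
  have "(c(i := v)) \<circ> \<sigma> = (c \<circ> \<sigma>)(\<sigma> i := v)" for v
    using assms by (auto simp: fun_eq_iff)
  moreover have "isums V is (\<lambda>c. f (c \<circ> \<sigma>)) = (\<lambda>c. isums V (map \<sigma> is) f (c \<circ> \<sigma>))" using Cons by blast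
  ultimately show ?case by (simp only: isum_def isums.simps list.map)
qed simp

text \<open>Integrates a chain from its last step backwards: each removed coordinate costs the
  factor \<open>b k\<close>.\<close>

lemma isums_peel:
  assumes "\<And>k c. a \<le> k \<Longrightarrow> k < e \<Longrightarrow> isum V (Suc k) (F (Suc k)) c \<le> b k * F k c"
    and "\<And>k. a \<le> k \<Longrightarrow> k < e \<Longrightarrow> 0 \<le> b k" and "a \<le> e"
  shows "isums V [Suc a..<Suc e] (F e) c \<le> (\<Prod>k\<in>{a..<e}. b k) * F a c"
  using assms(3) assms(1,2)
proof (induction e rule: dec_induct)
  case (step e)
  have "isums V [Suc a..<Suc (Suc e)] (F (Suc e)) c = isums V [Suc a..<Suc e] (isum V (Suc e) (F (Suc e))) c"
    using step by (simp add: isums_append)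
  also have "\<dots> \<le> isums V [Suc a..<Suc e] (\<lambda>c. b e * F e c) c"
    using step by (intro isums_mono) auto
  also have "\<dots> = b e * isums V [Suc a..<Suc e] (F e) c" by (rule isums_cmult)
  also have "\<dots> \<le> b e * ((\<Prod>k\<in>{a..<e}. b k) * F a c)" using step by (intro mult_left_mono) auto
  also have "\<dots> = (\<Prod>k\<in>{a..<Suc e}. b k) * F a c" using step by (simp add: mult_ac prod.atLeastLessThan_Suc)
  finally show ?case .
qed simp

lemma isum_factor:
  assumes "depends_on A g" "i \<notin> A"
  shows "isum V i (\<lambda>c. g c * f c) c = g c * isum V i f c"
  using isums_factor[OF assms(1), of "[i]"] assms(2) by simp

section \<open>Reversible kernels\<close>

text \<open>\<open>\<rho>\<close> is the joint distribution of the two ends of a random step; \<open>pp\<close> is its marginal, \<open>R\<close> the transition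
  matrix, \<open>pr c a b\<close> the probability of the walk \<open>c a, \<dots>, c b\<close>, and \<open>PM T a g u v\<close> the total probability of the walks
  of length \<open>g\<close> from \<open>u\<close> to \<open>v\<close> in which the step from time \<open>i\<close> to \<open>i + 1\<close> is weighted by \<open>T i\<close>.\<close>

locale rev_kernel =
  fixes V :: "'v set" and \<rho> :: "'v \<Rightarrow> 'v \<Rightarrow> real"
  assumes finV: "finite V" and rho_nonneg: "0 \<le> \<rho> u v" and rho_sym: "\<rho> u v = \<rho> v u"
    and rho_supp: "\<rho> u v \<noteq> 0 \<Longrightarrow> u \<in> V"
begin

definition pp :: "'v \<Rightarrow> real" where "pp u = (\<Sum>v\<in>V. \<rho> u v)"
definition R :: "'v \<Rightarrow> 'v \<Rightarrow> real" where "R u v = \<rho> u v / pp u"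
definition ang :: "('v \<Rightarrow> 'v \<Rightarrow> real) \<Rightarrow> real" where "ang T = (\<Sum>u\<in>V. \<Sum>v\<in>V. \<rho> u v * T u v)"

lemma pp_nonneg: "0 \<le> pp u" unfolding pp_def by (intro sum_nonneg rho_nonneg)

lemma rho_le_pp: "\<rho> u v \<le> pp u"
proof (cases "v \<in> V")
  case True
  then show ?thesis unfolding pp_def using finV rho_nonneg by (intro member_le_sum) auto
next
  case False
  then have "\<rho> u v = 0" using rho_supp[of v u] rho_sym[of u v] by auto
  then show ?thesis using pp_nonneg by simp
qed

lemma pp_zero: "pp u = 0 \<Longrightarrow> \<rho> u v = 0" "pp u = 0 \<Longrightarrow> \<rho> v u = 0"
  using rho_le_pp[of u v] rho_nonneg[of u v] rho_sym[of u v] by auto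

lemma pp_supp: "u \<notin> V \<Longrightarrow> pp u = 0"
  unfolding pp_def using rho_supp[of u] by (intro sum.neutral) auto

lemma R_nonneg: "0 \<le> R u v" unfolding R_def using rho_nonneg pp_nonneg by simp

text \<open>Where \<open>pp u = 0\<close> the division yields zero, and so does
  \<open>\<rho>\<close>; no positivity assumption is therefore carried along.\<close>

lemma pp_R: "pp u * R u v = \<rho> u v" unfolding R_def using pp_zero by (cases "pp u = 0") auto

lemma pp_R_sym: "pp u * R u v = pp v * R v u" using pp_R rho_sym by simp

lemma R_sum: "(\<Sum>v\<in>V. R u v) \<le> 1"
  unfolding R_def by (simp add: sum_divide_distrib[symmetric] pp_def[symmetric])

lemma R_sum_eq: "pp u \<noteq> 0 \<Longrightarrow> (\<Sum>v\<in>V. R u v) = 1"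
  unfolding R_def by (simp add: sum_divide_distrib[symmetric] pp_def[symmetric])

lemma R_zero: "pp u = 0 \<Longrightarrow> R u v = 0" "pp v = 0 \<Longrightarrow> R u v = 0"
  unfolding R_def using pp_zero by auto

definition pr :: "(nat \<Rightarrow> 'v) \<Rightarrow> nat \<Rightarrow> nat \<Rightarrow> real" where
  "pr c a b = pp (c a) * (\<Prod>i\<in>{a..<b}. R (c i) (c (Suc i)))"

lemma pr_nonneg: "0 \<le> pr c a b" unfolding pr_def by (intro mult_nonneg_nonneg pp_nonneg prod_nonneg ballI R_nonneg)

lemma pr_Suc: "a \<le> b \<Longrightarrow> pr c a (Suc b) = pr c a b * R (c b) (c (Suc b))"
  unfolding pr_def by (simp add: prod.atLeastLessThan_Suc)

lemma depends_on_pr: "depends_on {a..max a b} (\<lambda>c. pr c a b)"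
  unfolding depends_on_def pr_def by (auto intro!: arg_cong2[where f = times] arg_cong[where f = pp] prod.cong arg_cong2[where f = R])

primrec PM :: "(nat \<Rightarrow> 'v \<Rightarrow> 'v \<Rightarrow> real) \<Rightarrow> nat \<Rightarrow> nat \<Rightarrow> 'v \<Rightarrow> 'v \<Rightarrow> real" where
  "PM T a 0 u v = (if u = v then pp u else 0)"
| "PM T a (Suc g) u v = (\<Sum>w\<in>V. PM T a g u w * R w v * T (a + g) w v)"

lemma PM_nonneg: "(\<And>i u v. 0 \<le> T i u v) \<Longrightarrow> 0 \<le> PM T a g u v"
  by (induction g arbitrary: v) (auto intro!: sum_nonneg mult_nonneg_nonneg pp_nonneg R_nonneg)

lemma PM_one: "PM T a (Suc 0) u v = \<rho> u v * T a u v"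
proof -
  have "PM T a (Suc 0) u v = (\<Sum>w\<in>V. if u = w then pp u * R u v * T a u v else 0)"
    by (auto intro!: sum.cong)
  also have "\<dots> = \<rho> u v * T a u v"
    using finV pp_R pp_supp[of u] pp_zero[of u v] by (auto simp: sum.delta)
  finally show ?thesis .
qed

lemma PM_zero: "pp v = 0 \<Longrightarrow> PM T a g u v = 0"
  by (cases g) (auto simp: R_zero)

text \<open>The Chapman-Kolmogorov identity for joint weights: both parts contain the mass
  \<open>pp w\<close> of the middle vertex, hence the division. Where that mass is zero,
  \<open>PM\<close> vanishes as well.\<close>

lemma PM_add: "PM T a (g + h) u v = (\<Sum>w\<in>V. PM T a g u w * PM T (a + g) h w v / pp w)"
proof (induction h arbitrary: v)
  case 0
  have "(\<Sum>w\<in>V. PM T a g u w * PM T (a + g) 0 w v / pp w) = (\<Sum>w\<in>V. if w = v then (if pp v = 0 then 0 else PM T a g u v) else 0)"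
    by (intro sum.cong refl) auto
  also have "\<dots> = PM T a g u v"
    using finV PM_zero[of v T a g u] pp_supp[of v] by (auto simp: sum.delta)
  finally show ?case by simp
next
  case (Suc h)
  have "PM T a (g + Suc h) u v = (\<Sum>w\<in>V. (\<Sum>x\<in>V. PM T a g u x * PM T (a + g) h x w / pp x) * R w v * T (a + g + h) w v)"
    using Suc by (simp add: add.assoc)
  also have "\<dots> = (\<Sum>w\<in>V. \<Sum>x\<in>V. PM T a g u x * (PM T (a + g) h x w * R w v * T (a + g + h) w v) / pp x)"
    by (simp only: sum_distrib_right) (simp add: mult_ac)
  also have "\<dots> = (\<Sum>x\<in>V. \<Sum>w\<in>V. PM T a g u x * (PM T (a + g) h x w * R w v * T (a + g + h) w v) / pp x)"
    by (rule sum.swap)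
  also have "\<dots> = (\<Sum>x\<in>V. PM T a g u x * PM T (a + g) (Suc h) x v / pp x)"
    by (simp add: sum_distrib_left sum_divide_distrib)
  finally show ?case .
qed

lemma PM_cong: "(\<And>i. a \<le> i \<Longrightarrow> i < a + g \<Longrightarrow> T i = T' i) \<Longrightarrow> PM T a g u v = PM T' a g u v"
  by (induction g arbitrary: v) auto

lemma isums_pr:
  assumes "a < b"
  shows "isums V [Suc a..<b] (\<lambda>c. pr c a b * (\<Prod>i\<in>{a..<b}. T i (c i) (c (Suc i)))) c = PM T a (b - a) (c a) (c b)"
  using assms
proof (induction b arbitrary: c)
  case (Suc b)
  show ?case
  proof (cases "a = b")
    case True
    then show ?thesis by (simp add: PM_one pr_def pp_R del: PM.simps)
  next
    case False
    then have ab: "a < b" using Suc.prems by simp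
    let ?F = "\<lambda>c. pr c a b * (\<Prod>i\<in>{a..<b}. T i (c i) (c (Suc i)))"
    let ?G = "\<lambda>c. R (c b) (c (Suc b)) * T b (c b) (c (Suc b))"
    have "isums V [Suc a..<Suc b] (\<lambda>c. pr c a (Suc b) * (\<Prod>i\<in>{a..<Suc b}. T i (c i) (c (Suc i)))) c
       = isums V (b # [Suc a..<b]) (\<lambda>c. ?G c * ?F c) c"
    proof -
      have "isums V [Suc a..<Suc b] = (isums V (b # [Suc a..<b]) :: _ \<Rightarrow> (nat \<Rightarrow> 'v) \<Rightarrow> real)"
        by (rule ext, rule isums_perm) (use ab in simp)
      moreover have "(\<lambda>c. pr c a (Suc b) * (\<Prod>i\<in>{a..<Suc b}. T i (c i) (c (Suc i)))) = (\<lambda>c. ?G c * ?F c)"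
        using ab by (simp add: pr_Suc prod.atLeastLessThan_Suc fun_eq_iff)
      ultimately show ?thesis by simp
    qed
    also have "\<dots> = isum V b (\<lambda>c. ?G c * isums V [Suc a..<b] ?F c) c"
    proof -
      have "isums V [Suc a..<b] (\<lambda>c. ?G c * ?F c) = (\<lambda>c. ?G c * isums V [Suc a..<b] ?F c)"
        by (rule ext, rule isums_factor[where A = "{b, Suc b}"]) (auto simp: depends_on_def)
      then show ?thesis by simp
    qed
    also have "\<dots> = isum V b (\<lambda>c. ?G c * PM T a (b - a) (c a) (c b)) c"
      using Suc.IH ab by simp
    also have "\<dots> = PM T a (Suc (b - a)) (c a) (c (Suc b))"
      unfolding isum_def using ab by (simp add: mult_ac)
    finally show ?thesis using ab by (simp add: Suc_diff_le)
  qed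
qed simp

text \<open>Rows and columns are both bounded because walks are summed out forwards from a fixed
  start and, by reversibility, backwards from a fixed end.\<close>

definition cost :: "(nat \<Rightarrow> 'v \<Rightarrow> 'v \<Rightarrow> real) \<Rightarrow> (nat \<Rightarrow> real) \<Rightarrow> bool" where
  "cost T b \<longleftrightarrow> (\<forall>i u v. 0 \<le> T i u v) \<and> (\<forall>i. 0 \<le> b i) \<and>
     (\<forall>i u. (\<Sum>v\<in>V. R u v * T i u v) \<le> b i) \<and> (\<forall>i v. (\<Sum>u\<in>V. R v u * T i u v) \<le> b i)"

lemma costD: assumes "cost T b"
  shows "0 \<le> T i u v" "0 \<le> b i" "(\<Sum>v\<in>V. R u v * T i u v) \<le> b i" "(\<Sum>u\<in>V. R v u * T i u v) \<le> b i"
  using assms unfolding cost_def by auto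

lemma PM_row:
  assumes "cost T b"
  shows "(\<Sum>v\<in>V. PM T a g u v) \<le> pp u * (\<Prod>i\<in>{a..<a + g}. b i)"
proof (induction g)
  case 0
  show ?case using finV pp_nonneg[of u] by (simp add: sum.delta)
next
  case (Suc g)
  have "(\<Sum>v\<in>V. PM T a (Suc g) u v) = (\<Sum>w\<in>V. PM T a g u w * (\<Sum>v\<in>V. R w v * T (a + g) w v))"
    by (simp add: sum_distrib_left mult.assoc) (rule sum.swap)
  also have "\<dots> \<le> (\<Sum>w\<in>V. PM T a g u w * b (a + g))"
    using costD[OF assms] by (intro sum_mono mult_left_mono PM_nonneg) auto
  also have "\<dots> = (\<Sum>w\<in>V. PM T a g u w) * b (a + g)" by (simp add: sum_distrib_right)
  also have "\<dots> \<le> pp u * (\<Prod>i\<in>{a..<a + g}. b i) * b (a + g)"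
    using Suc costD[OF assms] by (intro mult_right_mono) auto
  finally show ?case by (simp add: prod.atLeastLessThan_Suc mult.assoc)
qed

lemma PM_col:
  assumes "cost T b"
  shows "(\<Sum>u\<in>V. PM T a g u v) \<le> pp v * (\<Prod>i\<in>{a..<a + g}. b i)"
proof (induction g arbitrary: a)
  case 0
  show ?case using finV pp_nonneg[of v] by (simp add: sum.delta')
next
  case (Suc g)
  have "PM T a (Suc g) u v = (\<Sum>w\<in>V. R w u * T a u w * PM T (Suc a) g w v)" for u
    using PM_add[of T a "Suc 0" g u v] unfolding PM_one R_def by (simp add: rho_sym[of u] mult_ac)
  then have "(\<Sum>u\<in>V. PM T a (Suc g) u v) = (\<Sum>w\<in>V. PM T (Suc a) g w v * (\<Sum>u\<in>V. R w u * T a u w))"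
    by (simp only: sum_distrib_left) (subst sum.swap, simp add: mult_ac)
  also have "\<dots> \<le> (\<Sum>w\<in>V. PM T (Suc a) g w v * b a)"
    using costD[OF assms] by (intro sum_mono mult_left_mono PM_nonneg) auto
  also have "\<dots> = (\<Sum>w\<in>V. PM T (Suc a) g w v) * b a" by (simp add: sum_distrib_right)
  also have "\<dots> \<le> pp v * (\<Prod>i\<in>{Suc a..<Suc a + g}. b i) * b a"
    by (rule mult_right_mono[OF Suc costD(2)[OF assms]])
  also have "\<dots> = pp v * (\<Prod>i\<in>{a..<a + Suc g}. b i)"
  proof -
    have "{a..<a + Suc g} = insert a {Suc a..<Suc a + g}" by auto
    then show ?thesis by simp
  qed
  finally show ?case .
qed

lemma ang_nonneg: "(\<And>u v. 0 \<le> T u v) \<Longrightarrow> 0 \<le> ang T"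
  unfolding ang_def by (auto intro!: sum_nonneg mult_nonneg_nonneg rho_nonneg)

text \<open>Cut the walk at step \<open>i0\<close>, collapse the part before it by column sums and
  the part after it by row sums. The test at \<open>i0\<close> is then averaged under
  \<open>\<rho>\<close> instead of being bounded by \<open>b i0\<close>; this saves a factor of
  order \<open>n\<close> and is one source of the exponent \<open>card J - 1\<close>.\<close>

lemma PM_mid:
  assumes c: "cost T b" and i0: "a \<le> i0" "i0 < a + g"
  shows "(\<Sum>u\<in>V. \<Sum>v\<in>V. PM T a g u v) \<le> (\<Prod>i\<in>{a..<a + g} - {i0}. b i) * ang (T i0)"
proof -
  obtain g1 where g1: "i0 = a + g1" using i0 le_Suc_ex by blast
  obtain g2 where g2: "g = g1 + Suc g2" using i0 g1 by (metis add_less_cancel_left less_iff_Suc_add add_Suc_right)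
  let ?P1 = "\<Prod>i\<in>{a..<i0}. b i" and ?P2 = "\<Prod>i\<in>{Suc i0..<a + g}. b i"
  have tn: "\<And>i u v. 0 \<le> T i u v" and bn: "\<And>i. 0 \<le> b i" using costD[OF c] by auto
  \<comment> \<open>Splitting on both sides of step \<open>i0\<close> leaves
    \<open>\<rho> w x\<close> as the only link between the two parts.\<close>
  have eq: "PM T a g u v = (\<Sum>w\<in>V. \<Sum>x\<in>V. PM T a g1 u w / pp w * (\<rho> w x * T i0 w x) * (PM T (Suc i0) g2 x v / pp x))" for u v
  proof -
    have "PM T (a + g1) (Suc g2) w v = (\<Sum>x\<in>V. \<rho> w x * T i0 w x * PM T (Suc i0) g2 x v / pp x)" for w
      using PM_add[of T i0 "Suc 0" g2 w v] unfolding PM_one g1 by simp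
    then show ?thesis unfolding g2 PM_add[of T a g1 "Suc g2" u v] by (simp add: sum_distrib_left sum_divide_distrib mult_ac)
  qed
  have "(\<Sum>u\<in>V. \<Sum>v\<in>V. PM T a g u v) = (\<Sum>w\<in>V. \<Sum>x\<in>V. ((\<Sum>u\<in>V. PM T a g1 u w) / pp w) * (\<rho> w x * T i0 w x) * ((\<Sum>v\<in>V. PM T (Suc i0) g2 x v) / pp x))"
  proof -
    have "(\<Sum>u\<in>V. \<Sum>v\<in>V. PM T a g u v) = (\<Sum>u\<in>V. \<Sum>w\<in>V. \<Sum>v\<in>V. \<Sum>x\<in>V. PM T a g1 u w / pp w * (\<rho> w x * T i0 w x) * (PM T (Suc i0) g2 x v / pp x))"
      unfolding eq by (rule sum.cong[OF refl], rule sum.swap)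
    also have "\<dots> = (\<Sum>w\<in>V. \<Sum>u\<in>V. \<Sum>v\<in>V. \<Sum>x\<in>V. PM T a g1 u w / pp w * (\<rho> w x * T i0 w x) * (PM T (Suc i0) g2 x v / pp x))"
      by (rule sum.swap)
    also have "\<dots> = (\<Sum>w\<in>V. \<Sum>u\<in>V. \<Sum>x\<in>V. \<Sum>v\<in>V. PM T a g1 u w / pp w * (\<rho> w x * T i0 w x) * (PM T (Suc i0) g2 x v / pp x))"
      by (rule sum.cong[OF refl], rule sum.cong[OF refl], rule sum.swap)
    also have "\<dots> = (\<Sum>w\<in>V. \<Sum>x\<in>V. \<Sum>u\<in>V. \<Sum>v\<in>V. PM T a g1 u w / pp w * (\<rho> w x * T i0 w x) * (PM T (Suc i0) g2 x v / pp x))"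
      by (rule sum.cong[OF refl], rule sum.swap)
    also have "\<dots> = (\<Sum>w\<in>V. \<Sum>x\<in>V. ((\<Sum>u\<in>V. PM T a g1 u w) / pp w) * (\<rho> w x * T i0 w x) * ((\<Sum>v\<in>V. PM T (Suc i0) g2 x v) / pp x))"
    proof (rule sum.cong[OF refl], rule sum.cong[OF refl])
      fix w x
      have "(\<Sum>u\<in>V. \<Sum>v\<in>V. f u * k * g v) = sum f V * k * sum g V" for f g :: "'v \<Rightarrow> real" and k
      proof -
        have "(\<Sum>u\<in>V. \<Sum>v\<in>V. f u * k * g v) = (\<Sum>u\<in>V. f u * k * sum g V)" by (simp only: sum_distrib_left)
        then show ?thesis by (simp only: sum_distrib_right)
      qed
      then show "(\<Sum>u\<in>V. \<Sum>v\<in>V. PM T a g1 u w / pp w * (\<rho> w x * T i0 w x) * (PM T (Suc i0) g2 x v / pp x)) =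
        ((\<Sum>u\<in>V. PM T a g1 u w) / pp w) * (\<rho> w x * T i0 w x) * ((\<Sum>v\<in>V. PM T (Suc i0) g2 x v) / pp x)"
        unfolding sum_divide_distrib .
    qed
    finally show ?thesis .
  qed
  also have "\<dots> \<le> (\<Sum>w\<in>V. \<Sum>x\<in>V. ?P1 * (\<rho> w x * T i0 w x) * ?P2)"
  proof (intro sum_mono)
    fix w x
    have d: "s / pp y \<le> P" if "s \<le> pp y * P" "0 \<le> P" for s y P
      using that pp_nonneg[of y] by (cases "pp y = 0") (auto simp: field_simps)
    have 1: "(\<Sum>u\<in>V. PM T a g1 u w) / pp w \<le> ?P1"
      using PM_col[OF c, of a g1 w] bn by (intro d) (auto simp: g1 intro: prod_nonneg)
    have 2: "(\<Sum>v\<in>V. PM T (Suc i0) g2 x v) / pp x \<le> ?P2"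

    proof (rule d)
      have "Suc i0 + g2 = a + g" using g1 g2 by simp
      then show "(\<Sum>v\<in>V. PM T (Suc i0) g2 x v) \<le> pp x * ?P2" using PM_row[OF c, of "Suc i0" g2 x] by simp
      show "0 \<le> ?P2" using bn by (intro prod_nonneg) simp
    qed
    show "((\<Sum>u\<in>V. PM T a g1 u w) / pp w) * (\<rho> w x * T i0 w x) * ((\<Sum>v\<in>V. PM T (Suc i0) g2 x v) / pp x) \<le> ?P1 * (\<rho> w x * T i0 w x) * ?P2"
      using 1 2 tn bn by (intro mult_mono) (auto intro!: sum_nonneg divide_nonneg_nonneg PM_nonneg pp_nonneg mult_nonneg_nonneg rho_nonneg prod_nonneg)
  qed
  also have "\<dots> = ?P1 * ?P2 * ang (T i0)"
    unfolding ang_def by (simp only: sum_distrib_left sum_distrib_right mult_ac)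
  also have "?P1 * ?P2 = (\<Prod>i\<in>{a..<a + g} - {i0}. b i)"
  proof -
    have "{a..<a + g} - {i0} = {a..<i0} \<union> {Suc i0..<a + g}" using i0 by auto
    then show ?thesis by (simp add: prod.union_disjoint)
  qed
  finally show ?thesis .
qed

text \<open>With both ends fixed, the first step is bounded by its own \<open>ang\<close>; each
  later step also pays \<open>1 / pp \<le> N\<close> for the passage from \<open>\<rho>\<close> to
  \<open>R\<close>.\<close>

lemma PM_full:
  assumes T: "\<And>i u v. 0 \<le> T i u v" and N: "\<And>u. pp u \<noteq> 0 \<Longrightarrow> 1 / pp u \<le> N" "0 \<le> N"
  shows "PM T a (Suc g) u v \<le> N ^ g * (\<Prod>i\<in>{a..<a + Suc g}. ang (T i))"
proof (induction g arbitrary: v)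
  have rle: "\<rho> u v * T i u v \<le> ang (T i)" for i u v
  proof (cases "u \<in> V \<and> v \<in> V")
    case True
    have "\<rho> u v * T i u v \<le> (\<Sum>v\<in>V. \<rho> u v * T i u v)"
      using True finV T rho_nonneg by (intro member_le_sum) auto
    also have "\<dots> \<le> ang (T i)" unfolding ang_def
      using True finV T rho_nonneg by (intro member_le_sum[where f = "\<lambda>u. \<Sum>v\<in>V. \<rho> u v * T i u v"]) (auto intro: sum_nonneg)
    finally show ?thesis .
  next
    case False
    then have "\<rho> u v = 0" using rho_supp[of u v] rho_supp[of v u] rho_sym[of u v] by auto
    then show ?thesis using ang_nonneg[of "T i"] T by simp
  qed
  {
    case 0
    then show ?case using rle by (simp add: PM_one del: PM.simps)
  next
    case (Suc g)
    let ?P = "N ^ g * (\<Prod>i\<in>{a..<a + Suc g}. ang (T i))"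
    have P0: "0 \<le> ?P" using N T by (intro mult_nonneg_nonneg prod_nonneg ballI ang_nonneg) auto
    have "PM T a (Suc (Suc g)) u v = (\<Sum>w\<in>V. PM T a (Suc g) u w * (R w v * T (a + Suc g) w v))"
      by (simp add: mult.assoc)
    also have "\<dots> \<le> (\<Sum>w\<in>V. ?P * (N * (\<rho> w v * T (a + Suc g) w v)))"
    proof (rule sum_mono, rule mult_mono[OF Suc _ P0])
      fix w
      have "R w v \<le> N * \<rho> w v"
      proof (cases "pp w = 0")
        case False
        have "R w v = (1 / pp w) * \<rho> w v" unfolding R_def by simp
        also have "\<dots> \<le> N * \<rho> w v" using N(1)[OF False] rho_nonneg by (intro mult_right_mono) auto
        finally show ?thesis .
      qed (use N rho_nonneg in \<open>simp add: R_zero\<close>)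
      then have "R w v * T (a + Suc g) w v \<le> N * \<rho> w v * T (a + Suc g) w v" using T by (intro mult_right_mono) auto
      then show "R w v * T (a + Suc g) w v \<le> N * (\<rho> w v * T (a + Suc g) w v)" by (simp add: mult.assoc)
      show "0 \<le> R w v * T (a + Suc g) w v" using T R_nonneg by simp
    qed
    also have "\<dots> = ?P * N * (\<Sum>w\<in>V. \<rho> w v * T (a + Suc g) w v)" by (simp only: sum_distrib_left mult_ac)
    also have "\<dots> \<le> ?P * N * ang (T (a + Suc g))"
    proof (intro mult_left_mono)
      show "(\<Sum>w\<in>V. \<rho> w v * T (a + Suc g) w v) \<le> ang (T (a + Suc g))"
      proof (cases "v \<in> V")
        case True
        then show ?thesis unfolding ang_def using finV T rho_nonneg by (intro sum_mono member_le_sum) auto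
      next
        case False
        then have "\<rho> w v = 0" for w using rho_supp[of v w] rho_sym[of w v] by auto
        then show ?thesis using ang_nonneg[of "T (a + Suc g)"] T by simp
      qed
      show "0 \<le> ?P * N" using P0 N by simp
    qed
    also have "\<dots> = N ^ Suc g * (\<Prod>i\<in>{a..<a + Suc (Suc g)}. ang (T i))"
      by (simp add: prod.atLeastLessThan_Suc mult_ac)
    finally show ?case .
  }
qed

end

section \<open>Weighted containers\<close>

text \<open>Delete light classes one at a time: each deletion loses less than
  \<open>\<tau> i\<close>, and a class once deleted stays empty. The same cleaning serves for
  fullness, for the vertex weights of the kernel and for the conditional weights of walks.\<close>

lemma remove_light_classes:
  fixes w :: "'e \<Rightarrow> real" and \<tau> :: "'i \<Rightarrow> real"
  assumes "finite I" "finite E" "\<And>e. e \<in> E \<Longrightarrow> 0 \<le> w e" "\<And>i. i \<in> I \<Longrightarrow> 0 \<le> \<tau> i"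
  shows "\<exists>E'\<subseteq>E. sum w E' \<ge> sum w E - sum \<tau> I \<and>
    (\<forall>i\<in>I. S i \<inter> E' = {} \<or> sum w (S i \<inter> E') \<ge> \<tau> i)"
  using assms
proof (induction "card I" arbitrary: I E)
  case 0
  then show ?case by auto
next
  case (Suc k)
  show ?case
  proof (cases "\<forall>i\<in>I. S i \<inter> E = {} \<or> sum w (S i \<inter> E) \<ge> \<tau> i")
    case True
    then show ?thesis using Suc.prems by (intro exI[of _ E]) (auto intro: sum_nonneg)
  next
    case False
    then obtain i where i: "i \<in> I" "sum w (S i \<inter> E) < \<tau> i" by force
    have "\<exists>E'\<subseteq>E - S i. sum w E' \<ge> sum w (E - S i) - sum \<tau> (I - {i}) \<and>
      (\<forall>j\<in>I - {i}. S j \<inter> E' = {} \<or> sum w (S j \<inter> E') \<ge> \<tau> j)"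
      using Suc i by (intro Suc.hyps(1)) auto
    then obtain E' where E': "E' \<subseteq> E - S i" "sum w E' \<ge> sum w (E - S i) - sum \<tau> (I - {i})"
      "\<forall>j\<in>I - {i}. S j \<inter> E' = {} \<or> sum w (S j \<inter> E') \<ge> \<tau> j" by blast
    have "sum w E = sum w (S i \<inter> E) + sum w (E - S i)"
      using Suc.prems(2) by (metis Int_commute sum.Int_Diff)
    moreover have "sum \<tau> I = \<tau> i + sum \<tau> (I - {i})"
      using Suc.prems i by (simp add: sum.remove)
    ultimately have "sum w E' \<ge> sum w E - sum \<tau> I" using E' i by linarith
    moreover have "S i \<inter> E' = {}" using E' by blast
    ultimately show ?thesis using E' by (intro exI[of _ E']) auto
  qed
qed

definition uniform_weight :: "'a set \<Rightarrow> nat \<Rightarrow> ('a set \<Rightarrow> real) \<Rightarrow> bool" where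
  "uniform_weight X i \<mu> \<longleftrightarrow> (\<forall>\<tau>. 0 \<le> \<mu> \<tau> \<and> (\<mu> \<tau> \<noteq> 0 \<longrightarrow> \<tau> \<subseteq> X \<and> card \<tau> = i))"

definition wdeg :: "'a set \<Rightarrow> ('a set \<Rightarrow> real) \<Rightarrow> 'a set \<Rightarrow> real" where
  "wdeg X \<mu> \<sigma> = (\<Sum>\<tau> | \<tau> \<subseteq> X \<and> \<sigma> \<subseteq> \<tau>. \<mu> \<tau>)"

definition weight_indep :: "('a set \<Rightarrow> real) \<Rightarrow> 'a set \<Rightarrow> bool" where
  "weight_indep \<mu> I \<longleftrightarrow> (\<forall>\<tau>. \<tau> \<subseteq> I \<longrightarrow> \<mu> \<tau> = 0)"

definition covered_by :: "'a set \<Rightarrow> real \<Rightarrow> nat \<Rightarrow> 'a set set \<Rightarrow> bool" where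
  "covered_by X B N \<I> \<longleftrightarrow> (\<exists>\<D>. finite \<D> \<and> card \<D> \<le> N \<and> (\<forall>D\<in>\<D>. D \<subseteq> X \<and> real (card D) \<le> B) \<and>
     (\<forall>I\<in>\<I>. \<exists>D\<in>\<D>. I \<subseteq> D))"

lemma covered_by_mono:
  assumes "covered_by X B N \<I>" "N \<le> N'" "B \<le> B'" "\<I>' \<subseteq> \<I>"
  shows "covered_by X B' N' \<I>'"
  using assms unfolding covered_by_def by (meson order_trans subsetD)

lemma covered_by_Un:
  assumes "covered_by X B N \<I>" "covered_by X B N' \<I>'"
  shows "covered_by X B (N + N') (\<I> \<union> \<I>')"
proof -
  from assms(1) obtain A where A: "finite A" "card A \<le> N" "\<forall>D\<in>A. D \<subseteq> X \<and> real (card D) \<le> B"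
     "\<forall>I\<in>\<I>. \<exists>D\<in>A. I \<subseteq> D" unfolding covered_by_def by (elim exE conjE) (rule that)
  from assms(2) obtain A' where A': "finite A'" "card A' \<le> N'" "\<forall>D\<in>A'. D \<subseteq> X \<and> real (card D) \<le> B"
     "\<forall>I\<in>\<I>'. \<exists>D\<in>A'. I \<subseteq> D" unfolding covered_by_def by (elim exE conjE) (rule that)
  have "card (A \<union> A') \<le> N + N'" using A(2) A'(2) card_Un_le[of A A'] by linarith
  then show ?thesis unfolding covered_by_def bex_Un
    using A A' by (intro exI[of _ "A \<union> A'"]) (auto simp: bex_Un)
qed

lemma covered_by_single:
  assumes "D \<subseteq> X" "real (card D) \<le> B" "\<And>I. I \<in> \<I> \<Longrightarrow> I \<subseteq> D" "1 \<le> N"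
  shows "covered_by X B N \<I>"
  unfolding covered_by_def using assms by (intro exI[of _ "{D}"]) auto

lemma wdeg_empty: "wdeg X \<mu> {} = (\<Sum>\<tau>\<in>Pow X. \<mu> \<tau>)"
  unfolding wdeg_def by (rule sum.cong) auto

lemma wdeg_add: "finite X \<Longrightarrow> wdeg X (\<lambda>\<tau>. \<mu> \<tau> + \<nu> \<tau>) \<sigma> = wdeg X \<mu> \<sigma> + wdeg X \<nu> \<sigma>"
  unfolding wdeg_def by (simp add: sum.distrib)

lemma wdeg_mono: "finite X \<Longrightarrow> (\<And>\<tau>. \<mu> \<tau> \<le> \<nu> \<tau>) \<Longrightarrow> wdeg X \<mu> \<sigma> \<le> wdeg X \<nu> \<sigma>"
  unfolding wdeg_def by (simp add: sum_mono)

lemma wdeg_eq_if: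
  assumes "finite X"
  shows "wdeg X \<mu> \<sigma> = (\<Sum>\<tau>\<in>Pow X. if \<sigma> \<subseteq> \<tau> then \<mu> \<tau> else 0)"
proof -
  have "{\<tau>. \<tau> \<subseteq> X \<and> \<sigma> \<subseteq> \<tau>} = {\<tau> \<in> Pow X. \<sigma> \<subseteq> \<tau>}" by auto
  then show ?thesis unfolding wdeg_def using assms by (simp only: sum.inter_filter finite_Pow_iff)
qed

lemma sum_wdeg:
  assumes "finite X" "finite \<S>"
  shows "(\<Sum>\<sigma>\<in>\<S>. wdeg X \<mu> \<sigma>) = (\<Sum>\<tau>\<in>Pow X. real (card {\<sigma>\<in>\<S>. \<sigma> \<subseteq> \<tau>}) * \<mu> \<tau>)"
proof -
  have "(\<Sum>\<sigma>\<in>\<S>. wdeg X \<mu> \<sigma>) = (\<Sum>\<sigma>\<in>\<S>. \<Sum>\<tau>\<in>Pow X. if \<sigma> \<subseteq> \<tau> then \<mu> \<tau> else 0)"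
    unfolding wdeg_eq_if[OF assms(1)] by simp
  also have "\<dots> = (\<Sum>\<tau>\<in>Pow X. \<Sum>\<sigma>\<in>\<S>. if \<sigma> \<subseteq> \<tau> then \<mu> \<tau> else 0)"
    by (rule sum.swap)
  also have "\<dots> = (\<Sum>\<tau>\<in>Pow X. real (card {\<sigma>\<in>\<S>. \<sigma> \<subseteq> \<tau>}) * \<mu> \<tau>)"
    using assms by (intro sum.cong refl) (simp add: sum.If_cases Int_def)
  finally show ?thesis .
qed

definition wlink :: "('a set \<Rightarrow> real) \<Rightarrow> 'a \<Rightarrow> 'a set \<Rightarrow> real" where
  "wlink \<mu> v \<sigma> = (if v \<in> \<sigma> then 0 else \<mu> (insert v \<sigma>))"

lemma wdeg_wlink:
  assumes "finite X" "v \<in> X"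
  shows "wdeg X (wlink \<mu> v) \<sigma> = (if v \<in> \<sigma> then 0 else wdeg X \<mu> (insert v \<sigma>))"
proof (cases "v \<in> \<sigma>")
  case True
  then show ?thesis unfolding wdeg_def wlink_def by (auto intro!: sum.neutral)
next
  case False
  have "wdeg X (wlink \<mu> v) \<sigma> = (\<Sum>\<tau> | \<tau> \<subseteq> X \<and> \<sigma> \<subseteq> \<tau> \<and> v \<notin> \<tau>. \<mu> (insert v \<tau>))"
    unfolding wdeg_def wlink_def using assms by (intro sum.mono_neutral_cong_right) auto
  also have "\<dots> = wdeg X \<mu> (insert v \<sigma>)"
    unfolding wdeg_def
    by (rule sum.reindex_bij_witness[where i="\<lambda>\<tau>. \<tau> - {v}" and j="insert v"])
       (use assms False in \<open>auto simp: insert_absorb\<close>)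
  finally show ?thesis using False by simp
qed

text \<open>Lowers the uniformity by one. Querying vertices in order of influence, an independent
  set either is caught in a small set or reveals \<open>b\<close> of its elements. The links of
  these elements add up to an \<open>i\<close>-uniform weight for which the set is independent too,
  so \<open>nxt\<close> applies.\<close>

lemma container_stage:
  fixes X :: "'a set" and \<tau> m C \<delta> :: real and b i N :: nat
  assumes X: "finite X" "X \<noteq> {}" and C: "C \<ge> 1" and i: "i \<ge> 1" and m: "m > 0"
    and \<tau>: "\<tau> > 0" "\<tau> * card X \<le> b" "b \<le> 2 * \<tau> * card X" "b \<le> \<delta> * card X"
    and \<delta>: "\<delta> \<le> 1 / (8 * C)" "\<delta> > 0"
    and \<mu>: "uniform_weight X (Suc i) \<mu>" "wdeg X \<mu> {} \<ge> m"
    and deg: "\<And>\<sigma>. 1 \<le> card \<sigma> \<Longrightarrow> card \<sigma> \<le> Suc i \<Longrightarrow> wdeg X \<mu> \<sigma> \<le> C * (m / card X) * \<tau> ^ (card \<sigma> - 1)"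
    and Cs: "Cs = real i * 2 ^ (i + 6) * C^2"
    and nxt: "\<And>\<nu>. uniform_weight X i \<nu> \<Longrightarrow> wdeg X \<nu> {} \<ge> \<tau> * m / 2 \<Longrightarrow>
       (\<And>\<sigma>. 1 \<le> card \<sigma> \<Longrightarrow> card \<sigma> \<le> i \<Longrightarrow> wdeg X \<nu> \<sigma> \<le> Cs * (m / card X) * \<tau> ^ card \<sigma>) \<Longrightarrow>
       covered_by X ((1 - \<delta>) * card X) N {I. I \<subseteq> X \<and> weight_indep \<nu> I}"
    and N: "N \<ge> 1"
  shows "covered_by X ((1 - \<delta>) * card X) (N * (card X + 1) ^ b) {I. I \<subseteq> X \<and> weight_indep \<mu> I}"
proof -
  let ?M = "real (card X)"
  have M: "?M > 0" using X by (simp add: card_gt_0_iff)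
  define cap where "cap = (\<lambda>j::nat. Cs * (m / ?M) * \<tau> ^ j)"
  have Cs2: "Cs \<ge> 2 * C"
  proof -
    have "(2::real) * C \<le> 2 * C^2" using C by (simp add: power2_eq_square)
    also have "\<dots> \<le> real i * 2 ^ (i+6) * C^2"
    proof (rule mult_right_mono)
      have "(2::real)^1 \<le> 2^(i+6)" by (rule power_increasing) auto
      also have "\<dots> \<le> real i * 2^(i+6)" using i by simp
      finally show "2 \<le> real i * 2 ^ (i+6)" by simp
    qed simp
    finally show ?thesis using Cs by simp
  qed
  have Cs0: "Cs > 0" using Cs2 C by linarith
  \<comment> \<open>\<open>A\<close> holds the vertices not yet queried, \<open>T\<close> the
    queried ones found in the independent set, \<open>p\<close> the number still to be found, and
    \<open>\<nu>\<close> the sum of the links so far. Each link contributes between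
    \<open>m / (2 * card X)\<close> and \<open>C * m / card X\<close> to the total of
    \<open>\<nu>\<close>.\<close>
  have key: "covered_by X ((1 - \<delta>) * ?M) (N * (card A + 1) ^ p)
      {I. I \<subseteq> X \<and> I \<inter> (X - A) \<subseteq> T \<and> weight_indep \<mu> I \<and> weight_indep \<nu> I}"
    if "A \<subseteq> X" "T \<subseteq> X" "card T + p \<le> b" "uniform_weight X i \<nu>"
      "\<And>\<sigma>. 1 \<le> card \<sigma> \<Longrightarrow> card \<sigma> \<le> i \<Longrightarrow> wdeg X \<nu> \<sigma> \<le> cap (card \<sigma>)"
      "wdeg X \<nu> {} \<le> real (b - p) * (C * (m / ?M))" "wdeg X \<nu> {} \<ge> real (b - p) * (m / (2 * ?M))" "p \<le> b"
    for A T \<nu> p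
    using that
  proof (induction "card A" arbitrary: A T \<nu> p rule: less_induct)
    case less
    note A = less.prems(1) and T = less.prems(2,3) and \<nu> = less.prems(4) and dn = less.prems(5) and tot = less.prems(6,7) and p = less.prems(8)
    have finA: "finite A" using A X finite_subset by blast
    consider "real (card A) \<le> (1 - 2*\<delta>) * ?M" | "p = 0" | "real (card A) > (1 - 2*\<delta>) * ?M" "p > 0" by linarith
    then show ?case
    proof cases
      case 1
      have "real (card (A \<union> T)) \<le> real (card A) + real (card T)"
        by (metis card_Un_le of_nat_add of_nat_le_iff)
      also have "\<dots> \<le> (1 - 2*\<delta>) * ?M + \<delta> * ?M" using 1 T \<tau> by linarith
      finally have "real (card (A \<union> T)) \<le> (1 - \<delta>) * ?M" by (simp add: algebra_simps)
      then show ?thesis using A T N by (intro covered_by_single[of "A \<union> T"]) auto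
    next
      case 2
      have "\<tau> * m / 2 \<le> real b * (m / (2 * ?M))"
        using \<tau>(2) m M by (simp add: field_simps)
      then have "wdeg X \<nu> {} \<ge> \<tau> * m / 2" using tot(2) unfolding 2 by (metis diff_zero order_trans)
      then have "covered_by X ((1 - \<delta>) * card X) N {I. I \<subseteq> X \<and> weight_indep \<nu> I}"
        using \<nu> dn unfolding cap_def by (intro nxt) blast+
      then show ?thesis by (rule covered_by_mono) (use 2 in auto)
    next
      case 3
      \<comment> \<open>Sets whose degree in \<open>\<nu>\<close> exceeds half their cap are frozen:
        nothing above them is added any more. The other half leaves room for one link, because
        \<open>Cs \<ge> 2 * C\<close>.\<close>
      define sat where "sat = {\<sigma>. \<sigma> \<subseteq> X \<and> 1 \<le> card \<sigma> \<and> card \<sigma> \<le> i \<and> wdeg X \<nu> \<sigma> > cap (card \<sigma>) / 2}"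
      have finsat: "finite sat" unfolding sat_def using X by auto
      define lam where "lam = (\<lambda>\<tau>'. if \<tau>' \<subseteq> A \<and> (\<forall>\<sigma>\<in>sat. \<not> \<sigma> \<subseteq> \<tau>') then \<mu> \<tau>' else 0)"
      have mu0: "0 \<le> \<mu> \<tau>'" for \<tau>' using \<mu>(1) unfolding uniform_weight_def by blast
      have lamle: "lam \<tau>' \<le> \<mu> \<tau>'" "0 \<le> lam \<tau>'" for \<tau>' unfolding lam_def using mu0 by auto
      have lamu: "uniform_weight X (Suc i) lam" using \<mu>(1) unfolding uniform_weight_def lam_def by auto
      have mle: "\<mu> \<tau>' \<le> lam \<tau>' + (\<Sum>v\<in>X - A. if {v} \<subseteq> \<tau>' then \<mu> \<tau>' else 0) + (\<Sum>\<sigma>\<in>sat. if \<sigma> \<subseteq> \<tau>' then \<mu> \<tau>' else 0)"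
        if tX: "\<tau>' \<subseteq> X" for \<tau>'
      proof -
        have p1: "0 \<le> (\<Sum>v\<in>X - A. if {v} \<subseteq> \<tau>' then \<mu> \<tau>' else 0)" using mu0 by (intro sum_nonneg) auto
        have p2: "0 \<le> (\<Sum>\<sigma>\<in>sat. if \<sigma> \<subseteq> \<tau>' then \<mu> \<tau>' else 0)" using mu0 by (intro sum_nonneg) auto
        consider "\<not> \<tau>' \<subseteq> A" | "\<exists>\<sigma>\<in>sat. \<sigma> \<subseteq> \<tau>'" | "lam \<tau>' = \<mu> \<tau>'" unfolding lam_def by metis
        then show ?thesis
        proof cases
          case 1
          then obtain v where v: "v \<in> \<tau>'" "v \<in> X - A" using tX by blast
          have "(if {v} \<subseteq> \<tau>' then \<mu> \<tau>' else 0) \<le> (\<Sum>v\<in>X - A. if {v} \<subseteq> \<tau>' then \<mu> \<tau>' else 0)"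
            using v X mu0 by (intro member_le_sum) auto
          then show ?thesis using p2 lamle(2)[of \<tau>'] v by simp
        next
          case 2
          then obtain \<sigma> where v: "\<sigma> \<in> sat" "\<sigma> \<subseteq> \<tau>'" by blast
          have "(if \<sigma> \<subseteq> \<tau>' then \<mu> \<tau>' else 0) \<le> (\<Sum>\<sigma>\<in>sat. if \<sigma> \<subseteq> \<tau>' then \<mu> \<tau>' else 0)"
            using v finsat mu0 by (intro member_le_sum) auto
          then show ?thesis using p1 lamle(2)[of \<tau>'] v by simp
        next
          case 3
          then show ?thesis using p1 p2 by simp
        qed
      qed
      have ifsum: "(\<Sum>\<tau>'\<in>Pow X. if \<sigma> \<subseteq> \<tau>' then \<mu> \<tau>' else 0) = wdeg X \<mu> \<sigma>" for \<sigma>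
        unfolding wdeg_eq_if[OF X(1)] by simp
      \<comment> \<open>What \<open>lam\<close> misses either contains a vertex outside
        \<open>A\<close> or a frozen set. Each kind carries at most \<open>m / 4\<close>, so
        \<open>lam\<close> keeps at least \<open>m / 2\<close>.\<close>
      have s1: "wdeg X \<mu> {} \<le> wdeg X lam {} + (\<Sum>v\<in>X - A. wdeg X \<mu> {v}) + (\<Sum>\<sigma>\<in>sat. wdeg X \<mu> \<sigma>)"
      proof -
        have "wdeg X \<mu> {} \<le> (\<Sum>\<tau>'\<in>Pow X. lam \<tau>' + (\<Sum>v\<in>X - A. if {v} \<subseteq> \<tau>' then \<mu> \<tau>' else 0) + (\<Sum>\<sigma>\<in>sat. if \<sigma> \<subseteq> \<tau>' then \<mu> \<tau>' else 0))"
          unfolding wdeg_empty using mle by (intro sum_mono) auto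
        also have "\<dots> = wdeg X lam {} + (\<Sum>\<tau>'\<in>Pow X. \<Sum>v\<in>X - A. if {v} \<subseteq> \<tau>' then \<mu> \<tau>' else 0) + (\<Sum>\<tau>'\<in>Pow X. \<Sum>\<sigma>\<in>sat. if \<sigma> \<subseteq> \<tau>' then \<mu> \<tau>' else 0)"
          unfolding wdeg_empty by (simp add: sum.distrib)
        also have "(\<Sum>\<tau>'\<in>Pow X. \<Sum>v\<in>X - A. if {v} \<subseteq> \<tau>' then \<mu> \<tau>' else 0) = (\<Sum>v\<in>X - A. wdeg X \<mu> {v})"
          by (subst sum.swap) (simp only: ifsum)
        also have "(\<Sum>\<tau>'\<in>Pow X. \<Sum>\<sigma>\<in>sat. if \<sigma> \<subseteq> \<tau>' then \<mu> \<tau>' else 0) = (\<Sum>\<sigma>\<in>sat. wdeg X \<mu> \<sigma>)"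
          by (subst sum.swap) (simp only: ifsum)
        finally show ?thesis .
      qed
      have s2: "(\<Sum>v\<in>X - A. wdeg X \<mu> {v}) \<le> m / 4"
      proof -
        have "(\<Sum>v\<in>X - A. wdeg X \<mu> {v}) \<le> (\<Sum>v\<in>X - A. C * (m / ?M))"
          using deg[of "{_}"] by (intro sum_mono) simp
        also have "\<dots> = real (card (X - A)) * (C * (m / ?M))" by simp
        also have "real (card (X - A)) = ?M - real (card A)"
          using A X by (simp add: card_Diff_subset finA card_mono of_nat_diff)
        also have "(?M - real (card A)) * (C * (m / ?M)) \<le> (2 * \<delta> * ?M) * (C * (m / ?M))"
          using 3 C m M by (intro mult_right_mono) (auto simp: algebra_simps)
        also have "\<dots> = 2 * (\<delta> * C) * m" using M by simp
        also have "\<dots> \<le> 2 * (1/8) * m" using \<delta> C m by (intro mult_right_mono mult_left_mono) (auto simp: field_simps)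
        finally show ?thesis by simp
      qed
      have s3: "(\<Sum>\<sigma>\<in>sat. wdeg X \<mu> \<sigma>) \<le> m / 4"
      proof -
        define sj where "sj = (\<lambda>j. {\<sigma>\<in>sat. card \<sigma> = j})"
        \<comment> \<open>Few sets are frozen: \<open>\<nu>\<close> has total of order
          \<open>\<tau> * m\<close>, and a set in its support has at most \<open>2 ^ i\<close>
          subsets.\<close>
        have satj: "real (card (sj j)) * (cap j / 2) \<le> 2 ^ i * (2 * \<tau> * ?M * (C * (m / ?M)))" for j
        proof -
          have "real (card (sj j)) * (cap j / 2) = (\<Sum>\<sigma>\<in>sj j. cap j / 2)" by simp
          also have "\<dots> \<le> (\<Sum>\<sigma>\<in>sj j. wdeg X \<nu> \<sigma>)"
            by (intro sum_mono) (auto simp: sj_def sat_def)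
          also have "\<dots> = (\<Sum>\<tau>'\<in>Pow X. real (card {\<sigma>\<in>sj j. \<sigma> \<subseteq> \<tau>'}) * \<nu> \<tau>')"
            using X finsat by (intro sum_wdeg) (auto simp: sj_def)
          also have "\<dots> \<le> (\<Sum>\<tau>'\<in>Pow X. 2 ^ i * \<nu> \<tau>')"
          proof (intro sum_mono)
            fix \<tau>' assume t: "\<tau>' \<in> Pow X"
            show "real (card {\<sigma>\<in>sj j. \<sigma> \<subseteq> \<tau>'}) * \<nu> \<tau>' \<le> 2 ^ i * \<nu> \<tau>'"
            proof (cases "\<nu> \<tau>' = 0")
              case False
              then have ci: "card \<tau>' = i" "0 \<le> \<nu> \<tau>'" using \<nu> unfolding uniform_weight_def by auto
              have ft: "finite \<tau>'" using t X finite_subset by blast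
              have "card {\<sigma>\<in>sj j. \<sigma> \<subseteq> \<tau>'} \<le> card (Pow \<tau>')" using ft by (intro card_mono) auto
              also have "\<dots> = 2 ^ i" using ft ci by (simp add: card_Pow)
              finally have "real (card {\<sigma>\<in>sj j. \<sigma> \<subseteq> \<tau>'}) \<le> 2 ^ i" by (metis of_nat_le_iff of_nat_numeral of_nat_power)
              then show ?thesis using ci by (intro mult_right_mono)
            qed simp
          qed
          also have "\<dots> = 2 ^ i * wdeg X \<nu> {}" unfolding wdeg_empty by (simp add: sum_distrib_left)
          also have "\<dots> \<le> 2 ^ i * (real (b - p) * (C * (m / ?M)))" using tot by (intro mult_left_mono) auto
          also have "\<dots> \<le> 2 ^ i * (2 * \<tau> * ?M * (C * (m / ?M)))"
            using \<tau>(3) p C m M by (intro mult_left_mono mult_right_mono) (auto simp: of_nat_diff)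
          finally show ?thesis .
        qed
        \<comment> \<open>The factor \<open>real i * 2 ^ (i + 6)\<close> in \<open>Cs\<close> is
          chosen for this estimate, which leaves \<open>m / 4\<close> after summation over the
          \<open>i\<close> sizes.\<close>
        have lossj: "real (card (sj j)) * (C * (m / ?M) * \<tau> ^ (j - 1)) \<le> m / (4 * real i)" if j: "1 \<le> j" for j
        proof -
          have capp: "cap j > 0" unfolding cap_def using Cs0 m M \<tau> by simp
          have "real (card (sj j)) \<le> 2 ^ i * (2 * \<tau> * ?M * (C * (m / ?M))) / (cap j / 2)"
            using satj[of j] capp by (simp add: field_simps)
          then have "real (card (sj j)) * (C * (m / ?M) * \<tau> ^ (j - 1)) \<le> 2 ^ i * (2 * \<tau> * ?M * (C * (m / ?M))) / (cap j / 2) * (C * (m / ?M) * \<tau> ^ (j - 1))"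
            using C m M \<tau> by (intro mult_right_mono) auto
          also have "\<dots> = 2 ^ i * 4 * C^2 * m / Cs"
          proof -
            have "\<tau> ^ j = \<tau> * \<tau> ^ (j - 1)" using j by (cases j) auto
            then show ?thesis unfolding cap_def using M m \<tau> Cs0 by (simp add: field_simps power2_eq_square)
          qed
          also have "\<dots> \<le> m / (4 * real i)"
            unfolding Cs using i C m by (simp add: field_simps power_add)
          finally show ?thesis .
        qed
        have "(\<Sum>\<sigma>\<in>sat. wdeg X \<mu> \<sigma>) = (\<Sum>j\<in>{1..i}. \<Sum>\<sigma>\<in>sj j. wdeg X \<mu> \<sigma>)"
          unfolding sj_def by (rule sum.group[symmetric, OF finsat]) (auto simp: sat_def)
        also have "\<dots> \<le> (\<Sum>j\<in>{1..i}. m / (4 * real i))"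
        proof (intro sum_mono)
          fix j assume j: "j \<in> {1..i}"
          have "(\<Sum>\<sigma>\<in>sj j. wdeg X \<mu> \<sigma>) \<le> (\<Sum>\<sigma>\<in>sj j. C * (m / ?M) * \<tau> ^ (j - 1))"
            using deg j by (intro sum_mono) (auto simp: sj_def)
          also have "\<dots> = real (card (sj j)) * (C * (m / ?M) * \<tau> ^ (j - 1))" by simp
          finally show "(\<Sum>\<sigma>\<in>sj j. wdeg X \<mu> \<sigma>) \<le> m / (4 * real i)" using lossj[of j] j by simp
        qed
        also have "\<dots> = m / 4" using i by simp
        finally show ?thesis .
      qed
      have lamtot: "wdeg X lam {} \<ge> m / 2" using s1 s2 s3 \<mu>(2) by linarith
      have "1 / (8 * C) \<le> 1 / 8" using C by (simp add: field_simps)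
      then have d8: "\<delta> \<le> 1 / 8" using \<delta> by linarith
      \<comment> \<open>Averaging: sets in the support of \<open>lam\<close> are nonempty and lie in
        \<open>A\<close>, so the degrees over \<open>A\<close> sum to at least
        \<open>m / 2\<close>.\<close>
      have "\<exists>v\<in>A. wdeg X lam {v} \<ge> m / (2 * ?M)"
      proof (rule ccontr)
        assume "\<not> ?thesis"
        then have neg: "\<And>v. v \<in> A \<Longrightarrow> wdeg X lam {v} < m / (2 * ?M)" by force
        have "(1 - 2*\<delta>) * ?M > 0" using d8 M by simp
        then have Ane: "A \<noteq> {}" using 3 by auto
        have "wdeg X lam {} \<le> (\<Sum>\<tau>'\<in>Pow X. real (card {\<sigma>\<in>(\<lambda>v. {v}) ` A. \<sigma> \<subseteq> \<tau>'}) * lam \<tau>')"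
          unfolding wdeg_empty
        proof (intro sum_mono)
          fix \<tau>' assume "\<tau>' \<in> Pow X"
          show "lam \<tau>' \<le> real (card {\<sigma>\<in>(\<lambda>v. {v}) ` A. \<sigma> \<subseteq> \<tau>'}) * lam \<tau>'"
          proof (cases "lam \<tau>' = 0")
            case False
            then have "\<tau>' \<subseteq> A" "card \<tau>' = Suc i" using lamu unfolding lam_def uniform_weight_def by (auto split: if_splits)
            then obtain v where "v \<in> \<tau>'" "v \<in> A" by (metis card.empty nat.distinct(1) ex_in_conv subsetD)
            then have "{v} \<in> {\<sigma>\<in>(\<lambda>v. {v}) ` A. \<sigma> \<subseteq> \<tau>'}" by auto
            moreover have "finite {\<sigma>\<in>(\<lambda>v. {v}) ` A. \<sigma> \<subseteq> \<tau>'}" using finA by auto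
            ultimately have "card {{v}} \<le> card {\<sigma>\<in>(\<lambda>v. {v}) ` A. \<sigma> \<subseteq> \<tau>'}" by (intro card_mono) simp_all
            then have "card {\<sigma>\<in>(\<lambda>v. {v}) ` A. \<sigma> \<subseteq> \<tau>'} \<ge> 1" by simp
            then show ?thesis using lamle(2)[of \<tau>'] by (simp add: mult_le_cancel_right1)
          qed simp
        qed
        also have "\<dots> = (\<Sum>\<sigma>\<in>(\<lambda>v. {v}) ` A. wdeg X lam \<sigma>)" using X finA by (intro sum_wdeg[symmetric]) auto
        also have "\<dots> = (\<Sum>v\<in>A. wdeg X lam {v})" by (subst sum.reindex) (auto simp: inj_on_def)
        also have "\<dots> < (\<Sum>v\<in>A. m / (2 * ?M))" using neg finA Ane by (intro sum_strict_mono) auto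
        also have "\<dots> = real (card A) * (m / (2 * ?M))" by simp
        also have "\<dots> \<le> ?M * (m / (2 * ?M))" using A X m by (intro mult_right_mono) (auto simp: card_mono)
        also have "\<dots> = m / 2" using M by simp
        finally show False using lamtot by simp
      qed
      then obtain v where v: "v \<in> A" "wdeg X lam {v} \<ge> m / (2 * ?M)" by blast
      define \<nu>' where "\<nu>' = (\<lambda>\<sigma>. \<nu> \<sigma> + wlink lam v \<sigma>)"
      have vX: "v \<in> X" using v A by blast
      have d\<nu>': "wdeg X \<nu>' \<sigma> = wdeg X \<nu> \<sigma> + (if v \<in> \<sigma> then 0 else wdeg X lam (insert v \<sigma>))" for \<sigma>
        unfolding \<nu>'_def using wdeg_add[OF X(1)] wdeg_wlink[OF X(1) vX] by simp
      have cA: "card (A - {v}) < card A" using v finA by (meson card_Diff1_less)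
      have cA1: "card A = card (A - {v}) + 1" using v finA by (metis Suc_eq_plus1 card_Suc_Diff1)
      \<comment> \<open>If \<open>v\<close> is not in the independent set, only \<open>A\<close>
        shrinks. Otherwise, in the second branch, \<open>v\<close> joins \<open>T\<close>, its link
        in \<open>lam\<close> joins \<open>\<nu>\<close>, and \<open>p\<close> drops by one.\<close>
      have "covered_by X ((1 - \<delta>) * ?M) (N * (card (A - {v}) + 1) ^ p)
         {I. I \<subseteq> X \<and> I \<inter> (X - (A - {v})) \<subseteq> T \<and> weight_indep \<mu> I \<and> weight_indep \<nu> I}"
        by (rule less.hyps[OF cA]) (use A T \<nu> dn tot p in auto)
      moreover have "covered_by X ((1 - \<delta>) * ?M) (N * (card (A - {v}) + 1) ^ (p - 1))
         {I. I \<subseteq> X \<and> I \<inter> (X - (A - {v})) \<subseteq> insert v T \<and> weight_indep \<mu> I \<and> weight_indep \<nu>' I}"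
      proof (rule less.hyps[OF cA])
        show "card (insert v T) + (p - 1) \<le> b"
        proof -
          have "card (insert v T) \<le> Suc (card T)" by (rule card_insert_le_m1[of "Suc (card T)" T v, simplified])
          then show ?thesis using T 3 by linarith
        qed
        show "uniform_weight X i \<nu>'"
          unfolding uniform_weight_def
        proof (intro allI conjI impI)
          fix \<sigma> show "0 \<le> \<nu>' \<sigma>" using \<nu> lamle(2) unfolding \<nu>'_def wlink_def uniform_weight_def by auto
          assume nz: "\<nu>' \<sigma> \<noteq> 0"
          then consider "\<nu> \<sigma> \<noteq> 0" | "v \<notin> \<sigma>" "lam (insert v \<sigma>) \<noteq> 0" unfolding \<nu>'_def wlink_def by (cases "\<nu> \<sigma> = 0") (auto split: if_splits)
          then have "\<sigma> \<subseteq> X \<and> card \<sigma> = i"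
          proof cases
            case 2
            then have "insert v \<sigma> \<subseteq> X" "card (insert v \<sigma>) = Suc i" using lamu unfolding uniform_weight_def by auto
            then show ?thesis using 2 X by (metis card_insert_disjoint finite_insert insert_subset nat.inject rev_finite_subset)
          qed (use \<nu> in \<open>auto simp: uniform_weight_def\<close>)
          then show "\<sigma> \<subseteq> X" "card \<sigma> = i" by auto
        qed
        fix \<sigma> :: "'a set" assume c: "1 \<le> card \<sigma>" "card \<sigma> \<le> i"
        have cp: "cap (card \<sigma>) > 0" unfolding cap_def using Cs0 m M \<tau> by simp
        show "wdeg X \<nu>' \<sigma> \<le> cap (card \<sigma>)"
        proof (cases "v \<in> \<sigma>")
          case True
          then show ?thesis using d\<nu>' dn c by simp
        next
          case False
          show ?thesis
          proof (cases "\<sigma> \<in> sat")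
            case True
            then have "wdeg X lam (insert v \<sigma>) = 0" unfolding wdeg_def lam_def by (auto intro!: sum.neutral)
            then show ?thesis using d\<nu>' dn c by simp
          next
            case False
            show ?thesis
            proof (cases "\<sigma> \<subseteq> X")
              case True
              then have 1: "wdeg X \<nu> \<sigma> \<le> cap (card \<sigma>) / 2" using False c unfolding sat_def by auto
              have fs: "finite \<sigma>" using c by (intro card_ge_0_finite) auto
              have "wdeg X lam (insert v \<sigma>) \<le> wdeg X \<mu> (insert v \<sigma>)" using lamle X by (intro wdeg_mono) auto
              also have "\<dots> \<le> C * (m / ?M) * \<tau> ^ card \<sigma>" if "v \<notin> \<sigma>" using deg[of "insert v \<sigma>"] fs that c by simp
              also have "\<dots> \<le> cap (card \<sigma>) / 2"
              proof -
                have "C * (m / ?M * \<tau> ^ card \<sigma>) \<le> (Cs / 2) * (m / ?M * \<tau> ^ card \<sigma>)"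
                  using Cs2 m M \<tau>(1) by (intro mult_right_mono) auto
                then show ?thesis unfolding cap_def by (simp add: mult.assoc)
              qed
              finally show ?thesis using 1 d\<nu>'[of \<sigma>] cp by (cases "v \<in> \<sigma>") auto
            next
              case False
              then have "{\<tau>'. \<tau>' \<subseteq> X \<and> \<sigma> \<subseteq> \<tau>'} = {}" by auto
              then have "wdeg X \<nu>' \<sigma> = 0" unfolding wdeg_def by (simp only: sum.empty)
              then show ?thesis using cp by simp
            qed
          qed
        qed
      next
        have e: "real (b - (p - 1)) = real (b - p) + 1" using 3 p by (simp add: of_nat_diff)
        have t': "wdeg X \<nu>' {} = wdeg X \<nu> {} + wdeg X lam {v}" using d\<nu>'[of "{}"] by simp
        have "wdeg X lam {v} \<le> wdeg X \<mu> {v}" using lamle X by (intro wdeg_mono) auto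
        also have "\<dots> \<le> C * (m / ?M)" using deg[of "{v}"] by simp
        finally have "wdeg X lam {v} \<le> C * (m / ?M)" .
        then show "wdeg X \<nu>' {} \<le> real (b - (p - 1)) * (C * (m / ?M))" using tot(1) unfolding t' e distrib_right by linarith
        show "wdeg X \<nu>' {} \<ge> real (b - (p - 1)) * (m / (2 * ?M))" using tot(2) v(2) unfolding t' e distrib_right by linarith
      qed (use A T vX p in auto)
      ultimately have "covered_by X ((1 - \<delta>) * ?M) (N * (card (A - {v}) + 1) ^ p + N * (card (A - {v}) + 1) ^ (p - 1))
        ({I. I \<subseteq> X \<and> I \<inter> (X - (A - {v})) \<subseteq> T \<and> weight_indep \<mu> I \<and> weight_indep \<nu> I} \<union>
         {I. I \<subseteq> X \<and> I \<inter> (X - (A - {v})) \<subseteq> insert v T \<and> weight_indep \<mu> I \<and> weight_indep \<nu>' I})"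
        by (rule covered_by_Un)
      then show ?thesis
      proof (rule covered_by_mono)
        let ?a = "card (A - {v}) + 1"
        \<comment> \<open>This recurrence is that of binomial counting: the number of leaves stays
          polynomial in \<open>card X\<close> with exponent \<open>p\<close>, although the recursion
          may be as deep as \<open>card X\<close>.\<close>
        have "?a ^ p + ?a ^ (p - 1) = ?a ^ (p - 1) * (?a + 1)" using 3 by (cases p) (auto simp: algebra_simps)
        also have "\<dots> \<le> (?a + 1) ^ (p - 1) * (?a + 1)" by (intro mult_right_mono power_mono) auto
        also have "\<dots> = (?a + 1) ^ p" using 3 by (cases p) auto
        finally have "?a ^ p + ?a ^ (p - 1) \<le> (card A + 1) ^ p" using cA1 by simp
        then show "N * ?a ^ p + N * ?a ^ (p - 1) \<le> N * (card A + 1) ^ p"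
          by (metis add_mult_distrib2 mult_le_mono2)
        show "{I. I \<subseteq> X \<and> I \<inter> (X - A) \<subseteq> T \<and> weight_indep \<mu> I \<and> weight_indep \<nu> I} \<subseteq>
          ({I. I \<subseteq> X \<and> I \<inter> (X - (A - {v})) \<subseteq> T \<and> weight_indep \<mu> I \<and> weight_indep \<nu> I} \<union>
         {I. I \<subseteq> X \<and> I \<inter> (X - (A - {v})) \<subseteq> insert v T \<and> weight_indep \<mu> I \<and> weight_indep \<nu>' I})"
        proof
          fix I assume I: "I \<in> {I. I \<subseteq> X \<and> I \<inter> (X - A) \<subseteq> T \<and> weight_indep \<mu> I \<and> weight_indep \<nu> I}"
          show "I \<in> {I. I \<subseteq> X \<and> I \<inter> (X - (A - {v})) \<subseteq> T \<and> weight_indep \<mu> I \<and> weight_indep \<nu> I} \<union>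
         {I. I \<subseteq> X \<and> I \<inter> (X - (A - {v})) \<subseteq> insert v T \<and> weight_indep \<mu> I \<and> weight_indep \<nu>' I}"
          proof (cases "v \<in> I")
            case True
            have "weight_indep \<nu>' I" using I True lamle unfolding weight_indep_def \<nu>'_def wlink_def
              by (auto simp: lam_def)
            then show ?thesis using I by auto
          qed (use I in auto)
        qed
      qed simp
    qed
  qed
  have "covered_by X ((1 - \<delta>) * ?M) (N * (card X + 1) ^ b)
      {I. I \<subseteq> X \<and> I \<inter> (X - X) \<subseteq> {} \<and> weight_indep \<mu> I \<and> weight_indep (\<lambda>_. 0) I}"
    by (rule key) (use Cs0 m M \<tau> in \<open>auto simp: uniform_weight_def wdeg_def cap_def\<close>)
  then show ?thesis by (rule covered_by_mono) (auto simp: weight_indep_def)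
qed

text \<open>Induction on the uniformity. A stage hands on total weight
  \<open>\<tau> * m / 2\<close>; relative to this total, its degree caps have the constant
  \<open>2 * Cs\<close>.\<close>

theorem weighted_containers:
  fixes C :: real
  assumes "i \<ge> 1" "C \<ge> 1"
  shows "\<exists>\<delta>::real. \<delta> > 0 \<and> \<delta> < 1 \<and> (\<forall>(X::'a set) \<mu> (\<tau>::real) (b::nat) (m::real). finite X \<longrightarrow> X \<noteq> {} \<longrightarrow> \<tau> > 0 \<longrightarrow> \<tau> * card X \<le> b \<longrightarrow>
     b \<le> 2 * \<tau> * card X \<longrightarrow> b \<le> \<delta> * card X \<longrightarrow> m > 0 \<longrightarrow> uniform_weight X i \<mu> \<longrightarrow> wdeg X \<mu> {} \<ge> m \<longrightarrow>
     (\<forall>\<sigma>. 1 \<le> card \<sigma> \<longrightarrow> card \<sigma> \<le> i \<longrightarrow> wdeg X \<mu> \<sigma> \<le> C * (m / card X) * \<tau> ^ (card \<sigma> - 1)) \<longrightarrow>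
     covered_by X ((1 - \<delta>) * card X) ((card X + 1) ^ (b * i)) {I. I \<subseteq> X \<and> weight_indep \<mu> I})"
  using assms
proof (induction i arbitrary: C rule: nat_induct_at_least)
  case base
  show ?case
  proof (intro exI[of _ "1 / (2 * C)"] conjI allI impI)
    fix X :: "'a set" and \<mu> and \<tau> m :: real and b :: nat
    assume X: "finite X" "X \<noteq> {}" and m: "m > 0" and u: "uniform_weight X 1 \<mu>" and tot: "wdeg X \<mu> {} \<ge> m"
      and deg: "\<forall>\<sigma>. 1 \<le> card \<sigma> \<longrightarrow> card \<sigma> \<le> 1 \<longrightarrow> wdeg X \<mu> \<sigma> \<le> C * (m / card X) * \<tau> ^ (card \<sigma> - 1)"
    have M: "real (card X) > 0" using X by (simp add: card_gt_0_iff)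
    \<comment> \<open>In uniformity one the elements of positive weight are forbidden, and the
      degree bound forces at least \<open>card X / C\<close> of them.\<close>
    define Y where "Y = {v\<in>X. \<mu> {v} \<noteq> 0}"
    have finY: "finite Y" using X Y_def by auto
    have "wdeg X \<mu> {} = (\<Sum>\<tau>\<in>(\<lambda>v. {v}) ` Y. \<mu> \<tau>)"
      unfolding wdeg_empty
    proof (rule sum.mono_neutral_right)
      show "\<forall>i\<in>Pow X - (\<lambda>v. {v}) ` Y. \<mu> i = 0"
      proof
        fix i assume i: "i \<in> Pow X - (\<lambda>v. {v}) ` Y"
        show "\<mu> i = 0"
        proof (rule ccontr)
          assume nz: "\<mu> i \<noteq> 0"
          then have "card i = 1" "i \<subseteq> X" using u unfolding uniform_weight_def by auto
          then obtain v where "i = {v}" by (metis card_1_singletonE)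
          then show False using i nz Y_def by auto
        qed
      qed
    qed (use X Y_def in auto)
    also have "\<dots> = (\<Sum>v\<in>Y. \<mu> {v})" by (subst sum.reindex) (auto simp: inj_on_def)
    also have "\<dots> \<le> (\<Sum>v\<in>Y. C * (m / card X))"
    proof (intro sum_mono)
      fix v assume "v \<in> Y"
      then have "{v} \<in> {\<tau>. \<tau> \<subseteq> X \<and> {v} \<subseteq> \<tau>}" using Y_def by auto
      then have "\<mu> {v} \<le> wdeg X \<mu> {v}" unfolding wdeg_def using X u
        by (intro member_le_sum) (auto simp: uniform_weight_def)
      then show "\<mu> {v} \<le> C * (m / card X)" using deg[rule_format, of "{v}"] by simp
    qed
    also have "\<dots> = real (card Y) * (C * (m / card X))" by simp
    finally have "m \<le> real (card Y) * (C * (m / card X))" using tot by simp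
    then have cY: "real (card Y) \<ge> card X / C" using m M base by (simp add: field_simps)
    show "covered_by X ((1 - 1 / (2*C)) * card X) ((card X + 1) ^ (b * 1)) {I. I \<subseteq> X \<and> weight_indep \<mu> I}"
    proof (rule covered_by_single[of "X - Y"])
      have "real (card (X - Y)) = real (card X) - real (card Y)"
        using X finY Y_def by (subst card_Diff_subset) (auto simp: card_mono of_nat_diff)
      also have "\<dots> \<le> (1 - 1 / C) * card X" using cY by (simp add: algebra_simps)
      also have "\<dots> \<le> (1 - 1 / (2*C)) * card X" using base by (intro mult_right_mono) (auto simp: field_simps)
      finally show "real (card (X - Y)) \<le> (1 - 1 / (2*C)) * card X" .
      fix I assume "I \<in> {I. I \<subseteq> X \<and> weight_indep \<mu> I}"
      then show "I \<subseteq> X - Y" unfolding weight_indep_def Y_def by auto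
    qed auto
  qed (use base in \<open>auto simp: field_simps\<close>)
next
  case (Suc i)
  define Cs where "Cs = real i * 2 ^ (i + 6) * C^2"
  have "1 \<le> real i * 2 ^ (i+6)" using Suc.hyps by (metis mult_mono' of_nat_0_le_iff of_nat_1 of_nat_mono one_le_power one_le_numeral mult_1 zero_le_one)
  then have "1 * 1 \<le> Cs" unfolding Cs_def using Suc.prems by (intro mult_mono) auto
  then have Cs1: "2 * Cs \<ge> 1" by simp
  from Suc.IH[OF Cs1] obtain \<delta>' :: real where d': "\<delta>' > 0" "\<delta>' < 1" and IH: "\<And>(X::'a set) \<mu> (\<tau>::real) (b::nat) (m::real). finite X \<Longrightarrow> X \<noteq> {} \<Longrightarrow> \<tau> > 0 \<Longrightarrow> \<tau> * card X \<le> b \<Longrightarrow>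
     b \<le> 2 * \<tau> * card X \<Longrightarrow> b \<le> \<delta>' * card X \<Longrightarrow> m > 0 \<Longrightarrow> uniform_weight X i \<mu> \<Longrightarrow> wdeg X \<mu> {} \<ge> m \<Longrightarrow>
     (\<forall>\<sigma>. 1 \<le> card \<sigma> \<longrightarrow> card \<sigma> \<le> i \<longrightarrow> wdeg X \<mu> \<sigma> \<le> 2 * Cs * (m / card X) * \<tau> ^ (card \<sigma> - 1)) \<Longrightarrow>
     covered_by X ((1 - \<delta>') * card X) ((card X + 1) ^ (b * i)) {I. I \<subseteq> X \<and> weight_indep \<mu> I}" by blast
  define \<delta> where "\<delta> = min \<delta>' (1 / (8 * C))"
  have d: "\<delta> > 0" "\<delta> < 1" "\<delta> \<le> \<delta>'" "\<delta> \<le> 1 / (8*C)" using d' Suc.prems unfolding \<delta>_def by auto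
  show ?case
  proof (intro exI[of _ \<delta>] conjI allI impI)
    fix X :: "'a set" and \<mu> and \<tau> m :: real and b :: nat
    assume X: "finite X" "X \<noteq> {}" and t: "\<tau> > 0" "\<tau> * card X \<le> b" "b \<le> 2 * \<tau> * card X" "b \<le> \<delta> * card X"
      and m: "m > 0" and u: "uniform_weight X (Suc i) \<mu>" and tot: "wdeg X \<mu> {} \<ge> m"
      and deg: "\<forall>\<sigma>. 1 \<le> card \<sigma> \<longrightarrow> card \<sigma> \<le> Suc i \<longrightarrow> wdeg X \<mu> \<sigma> \<le> C * (m / card X) * \<tau> ^ (card \<sigma> - 1)"
    have "covered_by X ((1 - \<delta>) * card X) ((card X + 1) ^ (b * i) * (card X + 1) ^ b) {I. I \<subseteq> X \<and> weight_indep \<mu> I}"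
    proof (rule container_stage[where C = C and i = i and m = m and \<tau> = \<tau> and Cs = Cs])
      fix \<nu> :: "'a set \<Rightarrow> real" assume n: "uniform_weight X i \<nu>" "wdeg X \<nu> {} \<ge> \<tau> * m / 2"
       "\<And>\<sigma>. 1 \<le> card \<sigma> \<Longrightarrow> card \<sigma> \<le> i \<Longrightarrow> wdeg X \<nu> \<sigma> \<le> Cs * (m / card X) * \<tau> ^ card \<sigma>"
      have "covered_by X ((1 - \<delta>') * card X) ((card X + 1) ^ (b * i)) {I. I \<subseteq> X \<and> weight_indep \<nu> I}"
      proof (rule IH[where \<tau> = \<tau> and m = "\<tau> * m / 2"])
        show "b \<le> \<delta>' * card X" using t d by (meson mult_right_mono of_nat_0_le_iff order_trans)
        show "\<forall>\<sigma>. 1 \<le> card \<sigma> \<longrightarrow> card \<sigma> \<le> i \<longrightarrow> wdeg X \<nu> \<sigma> \<le> 2 * Cs * (\<tau> * m / 2 / card X) * \<tau> ^ (card \<sigma> - 1)"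
        proof (intro allI impI)
          fix \<sigma> :: "'a set" assume c: "1 \<le> card \<sigma>" "card \<sigma> \<le> i"
          have "\<tau> ^ card \<sigma> = \<tau> * \<tau> ^ (card \<sigma> - 1)" using c by (cases "card \<sigma>") auto
          then show "wdeg X \<nu> \<sigma> \<le> 2 * Cs * (\<tau> * m / 2 / card X) * \<tau> ^ (card \<sigma> - 1)"
            using n(3)[OF c] by (simp add: algebra_simps)
        qed
      qed (use X t m n in auto)
      then show "covered_by X ((1 - \<delta>) * card X) ((card X + 1) ^ (b * i)) {I. I \<subseteq> X \<and> weight_indep \<nu> I}"
        by (rule covered_by_mono) (use d in \<open>auto intro: mult_right_mono\<close>)
    qed (use X t m u tot deg d Suc in \<open>auto simp: Cs_def\<close>)
    then show "covered_by X ((1 - \<delta>) * card X) ((card X + 1) ^ (b * Suc i)) {I. I \<subseteq> X \<and> weight_indep \<mu> I}"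
      by (simp add: power_add mult.commute)
  qed (use d in auto)
qed

section \<open>Spread kernels\<close>

context rev_kernel begin

abbreviation pm :: "nat \<Rightarrow> 'v \<Rightarrow> 'v \<Rightarrow> real" where "pm \<equiv> PM (\<lambda>_ _ _. 1) 0"

lemma PM_const: "PM (\<lambda>_ _ _. 1) a g u v = pm g u v"
  by (induction g arbitrary: v) auto

lemma pm_nonneg: "0 \<le> pm g u v" by (rule PM_nonneg) simp

lemma pm_add: "pm (g + h) u v = (\<Sum>w\<in>V. pm g u w * pm h w v / pp w)"
  using PM_add[of "\<lambda>_ _ _. 1" 0 g h u v] PM_const[of g] by (simp only: add_0)

lemma pm_one: "pm (Suc 0) u v = \<rho> u v" by (simp only: PM_one mult_1_right)

lemma pm_zero: "pp v = 0 \<Longrightarrow> pm g u v = 0" by (rule PM_zero)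

lemma pm_sym: "pm g u v = pm g v u"
proof (induction g arbitrary: u v)
  case (Suc g)
  have "pm (Suc g) u v = (\<Sum>w\<in>V. pm g u w * pm (Suc 0) w v / pp w)"
    using pm_add[of g "Suc 0"] by (simp only: add_Suc_right add_0_right)
  also have "\<dots> = (\<Sum>w\<in>V. pm (Suc 0) v w * pm g w u / pp w)"
    unfolding pm_one using Suc[of u] rho_sym[of _ v] by (simp add: mult.commute)
  also have "\<dots> = pm (Suc g) v u" using pm_add[of "Suc 0" g] by simp
  finally show ?case .
qed auto

lemma pm_zero': "pp u = 0 \<Longrightarrow> pm g u v = 0" using pm_zero pm_sym by metis

lemma pm_row: "(\<Sum>v\<in>V. pm g u v) = pp u"
proof (induction g)
  case 0
  show ?case using finV pp_supp[of u] by (auto simp: sum.delta)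
next
  case (Suc g)
  have "(\<Sum>v\<in>V. pm (Suc g) u v) = (\<Sum>w\<in>V. pm g u w * (\<Sum>v\<in>V. R w v))"
    by (simp add: sum_distrib_left) (rule sum.swap)
  also have "\<dots> = (\<Sum>w\<in>V. pm g u w)"
  proof (rule sum.cong[OF refl])
    fix w show "pm g u w * (\<Sum>v\<in>V. R w v) = pm g u w"
      by (cases "pp w = 0") (auto simp: pm_zero R_sum_eq)
  qed
  finally show ?case using Suc by simp
qed

lemma pm_col: "(\<Sum>u\<in>V. pm g u v) = pp v" using pm_row[of g v] pm_sym by simp

text \<open>Reversibility lets a walk be extended at its beginning by a transition, so leading
  coordinates can be summed out as well as trailing ones.\<close>

lemma pr_left: "a < b \<Longrightarrow> pr c a b = R (c (Suc a)) (c a) * pr c (Suc a) b"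
proof -
  assume "a < b"
  then have "{a..<b} = insert a {Suc a..<b}" by auto
  then have "pr c a b = (pp (c a) * R (c a) (c (Suc a))) * (\<Prod>i\<in>{Suc a..<b}. R (c i) (c (Suc i)))"
    unfolding pr_def by simp
  also have "\<dots> = (pp (c (Suc a)) * R (c (Suc a)) (c a)) * (\<Prod>i\<in>{Suc a..<b}. R (c i) (c (Suc i)))"
    by (simp only: pp_R_sym)
  finally show ?thesis unfolding pr_def by simp
qed

lemma isums_pr_one: "a < b \<Longrightarrow> isums V [Suc a..<b] (\<lambda>c. pr c a b) c = pm (b - a) (c a) (c b)"
  using isums_pr[of a b "\<lambda>_ _ _. 1" c] PM_const[of a "b - a" "c a" "c b"] by simp

lemma isums_pr_right:
  assumes h: "\<And>c. 0 \<le> h c" "depends_on {..b} h" and ab: "a \<le> b" "b \<le> t"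
  shows "isums V [Suc b..<Suc t] (\<lambda>c. pr c a t * h c) c \<le> pr c a b * h c"
proof -
  have "isums V [Suc b..<Suc t] ((\<lambda>k c. pr c a k * h c) t) c \<le> (\<Prod>k\<in>{b..<t}. 1) * (\<lambda>k c. pr c a k * h c) b c"
  proof (rule isums_peel)
    fix k c assume k: "b \<le> k" "k < t"
    have "(\<lambda>c. pr c a (Suc k) * h c) = (\<lambda>c. (pr c a k * h c) * R (c k) (c (Suc k)))"
      using k ab by (simp add: pr_Suc mult_ac)
    moreover have "isum V (Suc k) (\<lambda>c. (pr c a k * h c) * R (c k) (c (Suc k))) c
      = (pr c a k * h c) * isum V (Suc k) (\<lambda>c. R (c k) (c (Suc k))) c"
    proof (rule isum_factor[where A = "{..k}"])
      show "depends_on {..k} (\<lambda>c. pr c a k * h c)"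
        using depends_on_mono[OF h(2), of "{..k}"] depends_on_mono[OF depends_on_pr[of a k], of "{..k}"] k ab
        unfolding depends_on_def by (auto simp: max_def intro!: arg_cong2[where f = times])
    qed simp
    moreover have "isum V (Suc k) (\<lambda>c. R (c k) (c (Suc k))) c \<le> 1"
      unfolding isum_def using R_sum by simp
    moreover have "0 \<le> pr c a k * h c" using h pr_nonneg by simp
    ultimately show "isum V (Suc k) (\<lambda>c. pr c a (Suc k) * h c) c \<le> 1 * (pr c a k * h c)"
      using mult_left_mono[of "isum V (Suc k) (\<lambda>c. R (c k) (c (Suc k))) c" 1 "pr c a k * h c"] by simp
  qed (use ab in auto)
  then show ?thesis by simp
qed

lemma isums_pr_left:
  assumes h: "\<And>c. 0 \<le> h c" "depends_on {a..} h" and ab: "a \<le> b"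
  shows "isums V [0..<a] (\<lambda>c. pr c 0 b * h c) c \<le> pr c a b * h c"
proof -
  have "isums V [j..<a] (\<lambda>c. pr c j b * h c) c \<le> pr c a b * h c" if "j \<le> a" for j c
    using that
  proof (induction "a - j" arbitrary: j c)
    case (Suc d)
    then have j: "j < a" by simp
    have "isums V [j..<a] (\<lambda>c. pr c j b * h c) c = isums V [Suc j..<a] (isum V j (\<lambda>c. pr c j b * h c)) c"
    proof -
      have "isums V [j..<a] (\<lambda>c. pr c j b * h c) = isum V j (isums V [Suc j..<a] (\<lambda>c. pr c j b * h c))"
        using j by (simp add: upt_conv_Cons)
      then show ?thesis by (simp only: isum_isums)
    qed
    also have "\<dots> \<le> isums V [Suc j..<a] (\<lambda>c. pr c (Suc j) b * h c) c"
    proof (rule isums_mono)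
      fix c
      have "isum V j (\<lambda>c. pr c j b * h c) c = isum V j (\<lambda>c. (pr c (Suc j) b * h c) * R (c (Suc j)) (c j)) c"
        using j ab by (simp add: pr_left mult_ac)
      also have "\<dots> = (pr c (Suc j) b * h c) * isum V j (\<lambda>c. R (c (Suc j)) (c j)) c"
      proof (rule isum_factor[where A = "{Suc j..}"])
        show "depends_on {Suc j..} (\<lambda>c. pr c (Suc j) b * h c)"
          using depends_on_mono[OF h(2), of "{Suc j..}"] depends_on_mono[OF depends_on_pr[of "Suc j" b], of "{Suc j..}"] j
          unfolding depends_on_def by (auto intro!: arg_cong2[where f = times])
      qed simp
      also have "\<dots> \<le> (pr c (Suc j) b * h c) * 1"
        using h pr_nonneg R_sum by (intro mult_left_mono) (auto simp: isum_def)
      finally show "isum V j (\<lambda>c. pr c j b * h c) c \<le> pr c (Suc j) b * h c" by simp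
    qed
    also have "\<dots> \<le> pr c a b * h c" using Suc j by (intro Suc.hyps) auto
    finally show ?case .
  qed simp
  then show ?thesis by simp
qed

text \<open>The parts of the walk before \<open>a\<close> and after \<open>b\<close> are transition
  probabilities and sum to at most one.\<close>

lemma isums_pr_marginal:
  assumes h: "\<And>u v. 0 \<le> h u v" and ab: "a < b" "b \<le> t"
  shows "isums V [0..<Suc t] (\<lambda>c. pr c 0 t * h (c a) (c b)) c \<le> (\<Sum>u\<in>V. \<Sum>v\<in>V. pm (b - a) u v * h u v)"
proof -
  have l: "[0..<Suc t] = [0..<Suc b] @ [Suc b..<Suc t]"
    using upt_add_eq_append[of 0 "Suc b" "t - b"] ab by (simp del: upt_Suc)
  have "isums V [0..<Suc t] (\<lambda>c. pr c 0 t * h (c a) (c b)) c \<le> isums V [0..<Suc b] (\<lambda>c. pr c 0 b * h (c a) (c b)) c"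
    unfolding l isums_append using ab h
    by (intro isums_mono isums_pr_right[where h = "\<lambda>c. h (c a) (c b)"]) (auto simp: depends_on_def)
  also have "\<dots> = isums V ([a, b] @ [Suc a..<b] @ [0..<a]) (\<lambda>c. pr c 0 b * h (c a) (c b)) c"
    by (rule fun_cong[OF isums_set]) (use ab in auto)
  also have "\<dots> \<le> isums V ([a, b] @ [Suc a..<b]) (\<lambda>c. pr c a b * h (c a) (c b)) c"
    unfolding append_assoc[symmetric] isums_append[of _ _ "[0..<a]"] using ab h
    by (intro isums_mono isums_pr_left[where h = "\<lambda>c. h (c a) (c b)"]) (auto simp: depends_on_def)
  also have "\<dots> = isums V [a, b] (\<lambda>c. pm (b - a) (c a) (c b) * h (c a) (c b)) c"
  proof -
    have "isums V [Suc a..<b] (\<lambda>c. h (c a) (c b) * pr c a b) = (\<lambda>c. h (c a) (c b) * isums V [Suc a..<b] (\<lambda>c. pr c a b) c)"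
      by (rule ext, rule isums_factor[where A = "{a, b}"]) (auto simp: depends_on_def)
    then show ?thesis unfolding isums_append using isums_pr_one[OF ab(1)] by (simp add: mult.commute)
  qed
  also have "\<dots> = (\<Sum>u\<in>V. \<Sum>v\<in>V. pm (b - a) u v * h u v)"
    using ab by (simp add: isum_def)
  finally show ?thesis .
qed

lemma isums_pr_ends:
  assumes "t > 0"
  shows "isums V [0..<Suc t] (\<lambda>c. pr c 0 t * h (c 0) (c t)) c = (\<Sum>u\<in>V. \<Sum>v\<in>V. pm t u v * h u v)"
proof -
  have "isums V [0..<Suc t] (\<lambda>c. pr c 0 t * h (c 0) (c t)) c = isums V ([0, t] @ [Suc 0..<t]) (\<lambda>c. pr c 0 t * h (c 0) (c t)) c"
    by (rule fun_cong[OF isums_set]) (use assms in auto)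
  also have "\<dots> = isums V [0, t] (\<lambda>c. pm t (c 0) (c t) * h (c 0) (c t)) c"
  proof -
    have "isums V [Suc 0..<t] (\<lambda>c. h (c 0) (c t) * pr c 0 t) = (\<lambda>c. h (c 0) (c t) * isums V [Suc 0..<t] (\<lambda>c. pr c 0 t) c)"
      by (rule ext, rule isums_factor[where A = "{0, t}"]) (auto simp: depends_on_def)
    then show ?thesis unfolding isums_append using isums_pr_one[OF assms] by (simp add: mult.commute)
  qed
  also have "\<dots> = (\<Sum>u\<in>V. \<Sum>v\<in>V. pm t u v * h u v)"
    using assms by (simp add: isum_def)
  finally show ?thesis .
qed

end

text \<open>\<open>n\<close> will be the number of vertices and \<open>\<kappa>\<close> will be
  \<open>n powr (-2/3)\<close>. The root \<open>D\<close> is fixed by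
  \<open>n * D = n powr (2 * l / (2 * l - 1))\<close>, the exponent of the theorem, and the bound on
  \<open>\<kappa> * n\<close> brings single steps down to \<open>lev 1\<close>.\<close>

locale spread_kernel = rev_kernel V \<rho> for V :: "'v set" and \<rho> +
  fixes n D \<kappa> C :: real and l :: nat
  assumes total: "(\<Sum>u\<in>V. pp u) = 1" and C1: "C \<ge> 1" and n1: "n \<ge> 1" and D1: "D \<ge> 1" and Dn: "D ^ (2*l - 1) = n"
    and l2: "l \<ge> 2" and pp_low: "pp u \<noteq> 0 \<Longrightarrow> 1 / pp u \<le> C * n" and k0: "\<kappa> \<ge> 0"
    and rho_up: "\<rho> u v \<le> C * \<kappa> * sqrt (pp u) * sqrt (pp v)" and kn: "\<kappa> * n \<le> D ^ (l - 1)"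
begin

text \<open>The density relative to \<open>pp u * pp v\<close> tolerated for walks of length
  \<open>i\<close>; each further step divides it by \<open>D\<close>, until at length
  \<open>l\<close> it is that of independent ends.\<close>

definition lev :: "nat \<Rightarrow> real" where "lev i = D ^ (l - i)"

lemma lev_ge1: "1 \<le> lev i" unfolding lev_def using D1 by simp

lemma pp_le1: "pp u \<le> 1"
proof (cases "u \<in> V")
  case True
  then have "pp u \<le> (\<Sum>u\<in>V. pp u)" using finV pp_nonneg by (intro member_le_sum) auto
  then show ?thesis using total by simp
qed (simp add: pp_supp)

lemma sqrt_pp: "sqrt (pp u) \<le> sqrt (C * n) * pp u"
proof (cases "pp u = 0")
  case False
  then have p: "pp u > 0" using pp_nonneg[of u] by linarith
  have "1 \<le> C * n * pp u" using pp_low[OF False] p by (simp add: field_simps)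
  then have "1 * pp u \<le> C * n * pp u * pp u" using p by (intro mult_right_mono) auto
  then have "sqrt (pp u) \<le> sqrt (C * n * (pp u)^2)" by (simp add: power2_eq_square mult_ac)
  also have "\<dots> = sqrt (C * n) * pp u" using p by (simp add: real_sqrt_mult)
  finally show ?thesis .
qed simp

text \<open>\<open>sqrt (pp u)\<close> exceeds \<open>pp u\<close> by at most a factor
  \<open>sqrt (C * n)\<close>. Two such factors turn \<open>\<kappa>\<close> into
  \<open>\<kappa> * n\<close>.\<close>

lemma rho_lev: "\<rho> u v \<le> C^2 * lev 1 * pp u * pp v"
proof -
  have "\<rho> u v \<le> C * \<kappa> * sqrt (pp u) * sqrt (pp v)" by (rule rho_up)
  also have "\<dots> \<le> C * \<kappa> * (sqrt (C * n) * pp u) * (sqrt (C * n) * pp v)"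
    using C1 k0 sqrt_pp pp_nonneg n1 by (intro mult_mono) auto
  also have "\<dots> = C^2 * (\<kappa> * n) * (pp u * pp v)"
  proof -
    have "sqrt (C * n) * sqrt (C * n) = C * n" using C1 n1 by simp
    moreover have "C * \<kappa> * (s * pp u) * (s * pp v) = C * \<kappa> * (s * s) * (pp u * pp v)" for s by (simp add: mult_ac)
    ultimately show ?thesis by (simp add: power2_eq_square mult_ac)
  qed
  also have "\<dots> \<le> C^2 * lev 1 * (pp u * pp v)"
    unfolding lev_def using kn pp_nonneg by (intro mult_right_mono mult_left_mono) auto
  finally show ?thesis by (simp add: mult.assoc)
qed

text \<open>Bounds all transition probabilities. For \<open>\<kappa> = n powr (-2/3)\<close> it is
  of order \<open>n powr (-1/6)\<close>, which is why repeated vertices are rare.\<close>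

definition err :: real where "err = C * \<kappa> * sqrt (C * n)"

lemma err_nonneg: "0 \<le> err" unfolding err_def using C1 k0 n1 by simp

lemma R_err: "R u v \<le> err * sqrt (pp v)"
proof (cases "pp u = 0")
  case False
  then have p: "pp u > 0" using pp_nonneg[of u] by linarith
  have "\<rho> u v \<le> C * \<kappa> * (sqrt (C * n) * pp u) * sqrt (pp v)"
    by (rule order_trans[OF rho_up mult_right_mono[OF mult_left_mono[OF sqrt_pp]]]) (use C1 k0 pp_nonneg in auto)
  then show ?thesis unfolding R_def err_def using p by (simp add: field_simps)
qed (use err_nonneg pp_nonneg in \<open>simp add: R_zero\<close>)

lemma R_le_err: "R u v \<le> err"
proof -
  have "err * sqrt (pp v) \<le> err * 1" using err_nonneg pp_le1 by (intro mult_left_mono) auto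
  then show ?thesis using R_err[of u v] by simp
qed

lemma pm_err: assumes "g > 0" shows "pm g u v \<le> err * pp u * sqrt (pp v)"
proof -
  obtain h where h: "g = Suc h" using assms gr0_conv_Suc by blast
  have "pm g u v = (\<Sum>w\<in>V. pm h u w * R w v)" unfolding h by simp
  also have "\<dots> \<le> (\<Sum>w\<in>V. pm h u w * (err * sqrt (pp v)))"
    using R_err pm_nonneg by (intro sum_mono mult_left_mono) auto
  also have "\<dots> = pp u * (err * sqrt (pp v))" by (simp add: sum_distrib_right[symmetric] pm_row)
  finally show ?thesis by (simp add: mult_ac)
qed

lemma pm_err': "g > 0 \<Longrightarrow> pm g u v \<le> err * pp v * sqrt (pp u)"
  using pm_err[of g v u] pm_sym[of g u v] by simp

lemma R_le_rho: "R u v \<le> C * n * \<rho> u v"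
proof (cases "pp u = 0")
  case False
  have "R u v = (1 / pp u) * \<rho> u v" unfolding R_def by simp
  also have "\<dots> \<le> C * n * \<rho> u v" using pp_low[OF False] rho_nonneg by (intro mult_right_mono) auto
  finally show ?thesis .
qed (use C1 n1 rho_nonneg in \<open>simp add: R_zero\<close>)

text \<open>The mass of the pairs joined by walks of length \<open>i\<close> with density above \<open>lev i / 2\<close>. The thresholds \<open>thr i\<close>
  grow so fast that the walks of the first length \<open>t\<close> passing its threshold mostly have no dense
  proper subwalk.\<close>

definition high :: "nat \<Rightarrow> real" where
  "high i = (\<Sum>u\<in>V. \<Sum>v\<in>V. pm i u v * of_bool (pm i u v > lev i / 2 * pp u * pp v))"

definition thr :: "nat \<Rightarrow> real" where "thr i = 1/2 * (1 / (2 * real l ^ 2)) ^ (l - i)"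

lemma pm_total: "(\<Sum>u\<in>V. \<Sum>v\<in>V. pm i u v) = 1" using pm_row total by simp

text \<open>As \<open>lev l = 1\<close>, the pairs below the threshold carry at most
  \<open>pp u * pp v / 2\<close> each, hence at most half of the mass together.\<close>

lemma high_l: "high l \<ge> 1/2"
proof -
  have "1 = (\<Sum>u\<in>V. \<Sum>v\<in>V. pm l u v)" by (simp add: pm_total)
  also have "\<dots> \<le> (\<Sum>u\<in>V. \<Sum>v\<in>V. pm l u v * of_bool (pm l u v > lev l / 2 * pp u * pp v) + 1/2 * (pp u * pp v))"
  proof (intro sum_mono)
    fix u v show "pm l u v \<le> pm l u v * of_bool (pm l u v > lev l / 2 * pp u * pp v) + 1/2 * (pp u * pp v)"
      using pp_nonneg[of u] pp_nonneg[of v] by (cases "pm l u v > lev l / 2 * pp u * pp v") (auto simp: lev_def)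
  qed
  also have "\<dots> = high l + 1/2 * (\<Sum>u\<in>V. \<Sum>v\<in>V. pp u * pp v)"
    unfolding high_def by (simp only: sum.distrib sum_distrib_left)
  also have "(\<Sum>u\<in>V. \<Sum>v\<in>V. pp u * pp v) = 1"
    by (simp add: sum_distrib_left[symmetric] total)
  finally show ?thesis by simp
qed

lemma choose_level:
  obtains t where "2 \<le> t" "t \<le> l" "high t \<ge> thr t" "\<And>i. 2 \<le> i \<Longrightarrow> i < t \<Longrightarrow> high i < thr i"
proof -
  let ?P = "\<lambda>i. 2 \<le> i \<and> high i \<ge> thr i"
  have "?P l" using high_l l2 by (simp add: thr_def)
  then have "?P (LEAST i. ?P i)" "(LEAST i. ?P i) \<le> l" by (rule LeastI, rule Least_le)
  moreover have "high i < thr i" if "2 \<le> i" "i < (LEAST i. ?P i)" for i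
    using not_less_Least[OF that(2)] that(1) by auto
  ultimately show ?thesis using that by blast
qed

text \<open>A level passing its threshold has mass at least \<open>8 * \<delta>\<close>. Half of
  this may be lost to walks with a dense subwalk, and \<open>2 * \<delta>\<close> more to the
  cleaning of conditional weights.\<close>

definition \<delta> :: real where "\<delta> = 1/16 * (1 / (2 * real l ^ 2)) ^ l"

lemma delta_pos: "\<delta> > 0" unfolding \<delta>_def using l2 by simp

lemma sq_l: "1 \<le> 2 * real l ^ 2"
proof -
  have "1 \<le> real l ^ 2" using l2 by (intro one_le_power) simp
  then show ?thesis by linarith
qed

lemma thr_delta: "thr i \<ge> 8 * \<delta>"
proof -
  have "(1 / (2 * real l ^ 2)) ^ l \<le> (1 / (2 * real l ^ 2)) ^ (l - i)"
  proof (rule power_decreasing)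
    show "1 / (2 * real l ^ 2) \<le> 1"
    proof -
      have "0 < 2 * real l ^ 2" using sq_l by linarith
      then show ?thesis using sq_l by (simp only: divide_le_eq_1_pos)
    qed
  qed auto
  then show ?thesis unfolding thr_def \<delta>_def by simp
qed

text \<open>There are at most \<open>l ^ 2\<close> subwalks to exclude, and together they may cost
  half of \<open>thr t\<close>.\<close>

lemma thr_step: assumes "i < t" "t \<le> l" shows "real l ^ 2 * thr i \<le> thr t / 2"
proof -
  let ?x = "1 / (2 * real l ^ 2)"
  have x: "0 < ?x" "?x \<le> 1" using l2 sq_l by auto
  have "?x ^ (l - i) \<le> ?x ^ Suc (l - t)" using x assms by (intro power_decreasing) auto
  then have "real l ^ 2 * ?x ^ (l - i) \<le> real l ^ 2 * (?x * ?x ^ (l - t))" by (intro mult_left_mono) auto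
  also have "\<dots> = ?x ^ (l - t) / 2" using l2 by simp
  finally show ?thesis unfolding thr_def by simp
qed

text \<open>Subwalks of length one are exempt because \<open>rho_lev\<close> already bounds their
  density.\<close>

definition good :: "nat \<Rightarrow> (nat \<Rightarrow> 'v) \<Rightarrow> bool" where
  "good t c \<longleftrightarrow> pm t (c 0) (c t) > lev t / 2 * pp (c 0) * pp (c t) \<and>
     (\<forall>a b. a < b \<and> b \<le> t \<and> 2 \<le> b - a \<and> b - a < t \<longrightarrow> pm (b - a) (c a) (c b) \<le> lev (b - a) / 2 * pp (c a) * pp (c b))"

lemma depends_on_good: "depends_on {..t} (good t)"
  unfolding depends_on_def
proof (intro allI impI)
  fix c c' :: "nat \<Rightarrow> 'v" assume e: "\<forall>j\<in>{..t}. c j = c' j"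
  then have e': "j \<le> t \<Longrightarrow> c j = c' j" for j by simp
  have "(\<forall>a b. a < b \<and> b \<le> t \<and> 2 \<le> b - a \<and> b - a < t \<longrightarrow> pm (b - a) (c a) (c b) \<le> lev (b - a) / 2 * pp (c a) * pp (c b)) \<longleftrightarrow>
    (\<forall>a b. a < b \<and> b \<le> t \<and> 2 \<le> b - a \<and> b - a < t \<longrightarrow> pm (b - a) (c' a) (c' b) \<le> lev (b - a) / 2 * pp (c' a) * pp (c' b))"
    using e' by (smt (verit, best) less_imp_le_nat order_trans)
  then show "good t c = good t c'" unfolding good_def using e'[of 0] e'[of t] by simp
qed

lemma good_mass:
  assumes t: "2 \<le> t" "t \<le> l" "high t \<ge> thr t" "\<And>i. 2 \<le> i \<Longrightarrow> i < t \<Longrightarrow> high i < thr i"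
  shows "isums V [0..<Suc t] (\<lambda>c. pr c 0 t * of_bool (good t c)) c \<ge> 4 * \<delta>"
proof -
  define P where "P = {(a, b). a < b \<and> b \<le> t \<and> 2 \<le> b - a \<and> b - a < t}"
  have Psub: "P \<subseteq> {..<t} \<times> {1..t}" unfolding P_def by auto
  then have finP: "finite P" by (rule finite_subset) simp
  have "card P \<le> card ({..<t} \<times> {1..t})" using Psub by (intro card_mono) auto
  then have cP: "card P \<le> t * t" by (simp add: card_cartesian_product)
  let ?hi = "\<lambda>i u v. of_bool (pm i u v > lev i / 2 * pp u * pp v) :: real"
  let ?I = "\<lambda>f. isums V [0..<Suc t] f c"
  have pw: "pr c 0 t * ?hi t (c 0) (c t) \<le> pr c 0 t * of_bool (good t c) + (\<Sum>(a,b)\<in>P. pr c 0 t * ?hi (b - a) (c a) (c b))" for c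
  proof -
    have s: "0 \<le> (\<Sum>(a,b)\<in>P. pr c 0 t * ?hi (b - a) (c a) (c b))"
      by (intro sum_nonneg) (auto simp: pr_nonneg)
    show ?thesis
    proof (cases "good t c \<or> \<not> (pm t (c 0) (c t) > lev t / 2 * pp (c 0) * pp (c t))")
      case True
      then show ?thesis using s pr_nonneg[of c 0 t] by (auto simp: good_def)
    next
      case False
      then obtain a b where ab: "(a, b) \<in> P" "pm (b - a) (c a) (c b) > lev (b - a) / 2 * pp (c a) * pp (c b)"
        unfolding good_def P_def by force
      have "(\<lambda>(a,b). pr c 0 t * ?hi (b - a) (c a) (c b)) (a,b) \<le> (\<Sum>(a,b)\<in>P. pr c 0 t * ?hi (b - a) (c a) (c b))"
        by (rule member_le_sum[OF ab(1)]) (auto simp: finP pr_nonneg)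
      then show ?thesis using ab False pr_nonneg[of c 0 t] by auto
    qed
  qed
  have "thr t \<le> high t" by (rule t)
  also have "\<dots> = ?I (\<lambda>c. pr c 0 t * ?hi t (c 0) (c t))"
    unfolding high_def by (rule isums_pr_ends[symmetric]) (use t in simp)
  also have "\<dots> \<le> ?I (\<lambda>c. (\<Sum>x\<in>{True, False}. (if x then pr c 0 t * of_bool (good t c) else (\<Sum>(a,b)\<in>P. pr c 0 t * ?hi (b - a) (c a) (c b)))))"
    using pw by (intro isums_mono) simp
  also have "\<dots> = ?I (\<lambda>c. pr c 0 t * of_bool (good t c)) + ?I (\<lambda>c. \<Sum>p\<in>P. pr c 0 t * ?hi (snd p - fst p) (c (fst p)) (c (snd p)))"
    by (subst isums_sum) (simp add: case_prod_beta)
  also have "?I (\<lambda>c. \<Sum>p\<in>P. pr c 0 t * ?hi (snd p - fst p) (c (fst p)) (c (snd p))) = (\<Sum>p\<in>P. ?I (\<lambda>c. pr c 0 t * ?hi (snd p - fst p) (c (fst p)) (c (snd p))))"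
    by (rule isums_sum)
  also have "\<dots> \<le> (\<Sum>p\<in>P. thr t / (2 * real l ^ 2))"
  proof (intro sum_mono)
    fix p assume p: "p \<in> P"
    then have p': "fst p < snd p" "snd p \<le> t" "2 \<le> snd p - fst p" "snd p - fst p < t" unfolding P_def by auto
    have "?I (\<lambda>c. pr c 0 t * ?hi (snd p - fst p) (c (fst p)) (c (snd p))) \<le> high (snd p - fst p)"
      unfolding high_def using p' by (intro isums_pr_marginal) auto
    also have "\<dots> \<le> thr (snd p - fst p)" using t(4) p' by (meson less_imp_le)
    also have "\<dots> \<le> thr t / (2 * real l ^ 2)" using thr_step[OF p'(4) t(2)] l2 by (simp add: field_simps)
    finally show "?I (\<lambda>c. pr c 0 t * ?hi (snd p - fst p) (c (fst p)) (c (snd p))) \<le> thr t / (2 * real l ^ 2)" .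
  qed
  also have "\<dots> = real (card P) * (thr t / (2 * real l ^ 2))" by simp
  also have "\<dots> \<le> real l ^ 2 * (thr t / (2 * real l ^ 2))"
  proof (rule mult_right_mono)
    have "card P \<le> l * l" using cP t(2) by (meson mult_le_mono order_trans)
    then show "real (card P) \<le> real l ^ 2" unfolding power2_eq_square of_nat_mult[symmetric] by (rule of_nat_mono)
    show "0 \<le> thr t / (2 * real l ^ 2)" unfolding thr_def by simp
  qed
  also have "\<dots> = thr t / 2" using l2 by simp
  finally have "?I (\<lambda>c. pr c 0 t * of_bool (good t c)) \<ge> thr t / 2" by simp
  then show ?thesis using thr_delta[of t] by simp
qed

text \<open>A base point for sums over the positions \<open>1\<close> to \<open>t - 2\<close>: the
  default \<open>y\<close> there is overwritten, and nothing beyond \<open>t\<close> is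
  read.\<close>

definition tri :: "nat \<Rightarrow> 'v \<Rightarrow> 'v \<Rightarrow> 'v \<Rightarrow> nat \<Rightarrow> 'v" where
  "tri t x z y = (\<lambda>i. if i = 0 then x else if i = t - 1 then z else y)"

text \<open>Weight of the walks from \<open>x\<close> whose last step goes from \<open>z\<close> to
  \<open>y\<close>. That step is singled out because the zigzag runs back and forth between these
  two layers.\<close>

definition trisum :: "nat \<Rightarrow> ((nat \<Rightarrow> 'v) \<Rightarrow> real) \<Rightarrow> 'v \<Rightarrow> 'v \<Rightarrow> 'v \<Rightarrow> real" where
  "trisum t W x z y = isums V [1..<t - 1] (\<lambda>c. pr c 0 t * W c) (tri t x z y)"

lemma trisum_eval:
  assumes "2 \<le> t" "depends_on {..t} W"
  shows "isums V [1..<t - 1] (\<lambda>c. pr c 0 t * W c) c = trisum t W (c 0) (c (t - 1)) (c t)"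
  unfolding trisum_def
proof (rule depends_onD[OF depends_on_isums])
  show "depends_on {..t} (\<lambda>c. pr c 0 t * W c)"
    using assms(2) depends_on_pr[of 0 t] unfolding depends_on_def by (auto intro!: arg_cong2[where f = times])
  fix j assume "j \<in> {..t} - set [1..<t - 1]"
  then have "j = 0 \<or> j = t - 1 \<or> j = t" by auto
  then show "c j = tri t (c 0) (c (t - 1)) (c t) j" unfolding tri_def using assms(1) by auto
qed

lemma isums_trisum:
  assumes "2 \<le> t" "depends_on {..t} W"
  shows "isums V [0..<Suc t] (\<lambda>c. pr c 0 t * W c) c = (\<Sum>x\<in>V. \<Sum>z\<in>V. \<Sum>y\<in>V. trisum t W x z y)"
proof -
  have "isums V [0..<Suc t] (\<lambda>c. pr c 0 t * W c) c = isums V ([0, t - 1, t] @ [1..<t - 1]) (\<lambda>c. pr c 0 t * W c) c"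
    by (rule fun_cong[OF isums_set]) (use assms in auto)
  also have "\<dots> = isums V [0, t - 1, t] (\<lambda>c. trisum t W (c 0) (c (t - 1)) (c t)) c"
    unfolding isums_append using trisum_eval[OF assms] by presburger
  also have "\<dots> = (\<Sum>x\<in>V. \<Sum>z\<in>V. \<Sum>y\<in>V. trisum t W x z y)"
  proof -
    have "t - 1 \<noteq> t" "t - 1 \<noteq> 0" "t \<noteq> 0" using assms(1) by auto
    then show ?thesis by (simp add: isum_def)
  qed
  finally show ?thesis .
qed

lemma trisum_nonneg: "(\<And>c. 0 \<le> W c) \<Longrightarrow> 0 \<le> trisum t W x z y"
  unfolding trisum_def by (intro isums_nonneg mult_nonneg_nonneg pr_nonneg) auto

lemma trisum_le:
  assumes "2 \<le> t" "\<And>c. 0 \<le> W c \<and> W c \<le> 1"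
  shows "trisum t W x z y \<le> pm (t - 1) x z * R z y"
proof -
  obtain k where k: "t = Suc (Suc k)" using assms(1) by (metis Suc_le_D numeral_2_eq_2 Suc_le_mono)
  have "trisum t W x z y \<le> isums V [1..<t - 1] (\<lambda>c. R (c (t - 1)) (c t) * pr c 0 (t - 1)) (tri t x z y)"
    unfolding trisum_def
  proof (rule isums_mono)
    fix c
    have "pr c 0 t * W c \<le> pr c 0 t * 1" using assms(2) pr_nonneg by (intro mult_left_mono) auto
    then show "pr c 0 t * W c \<le> R (c (t - 1)) (c t) * pr c 0 (t - 1)" unfolding k by (simp add: pr_Suc mult.commute)
  qed
  also have "\<dots> = R z y * isums V [1..<t - 1] (\<lambda>c. pr c 0 (t - 1)) (tri t x z y)"
    by (subst isums_factor[where A = "{t - 1, t}"]) (auto simp: depends_on_def tri_def k)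
  also have "\<dots> = R z y * pm (t - 1) x z"
    using isums_pr_one[of 0 "t - 1" "tri t x z y"] k by (simp add: tri_def)
  finally show ?thesis by (simp add: mult.commute)
qed

text \<open>Among good walks, pairs \<open>(x, y)\<close> and \<open>(x, z)\<close> that keep less
  than a fraction \<open>\<delta>\<close> of their mass are removed; afterwards, conditioning on
  such a pair costs only a constant compared with \<open>pm\<close>. The removal depends only on the
  triple \<open>(x, z, y)\<close>, so it is a restriction of the walks and spoils no upper
  bound.\<close>

lemma zigzag_weight:
  obtains t W where "2 \<le> t" "t \<le> l" "depends_on {..t} W" "\<And>c. 0 \<le> W c \<and> W c \<le> 1"
    "\<And>c. W c \<noteq> 0 \<Longrightarrow> pm t (c 0) (c t) \<ge> lev t / 2 * pp (c 0) * pp (c t)"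
    "\<And>c a b. W c \<noteq> 0 \<Longrightarrow> a < b \<Longrightarrow> b \<le> t \<Longrightarrow> b - a < t \<Longrightarrow> pm (b - a) (c a) (c b) \<le> C^2 * lev (b - a) * pp (c a) * pp (c b)"
    "\<And>x y. (\<Sum>z\<in>V. trisum t W x z y) = 0 \<or> (\<Sum>z\<in>V. trisum t W x z y) \<ge> \<delta> * pm t x y"
    "\<And>x z. (\<Sum>y\<in>V. trisum t W x z y) = 0 \<or> (\<Sum>y\<in>V. trisum t W x z y) \<ge> \<delta> * pm (t - 1) x z"
    "(\<Sum>x\<in>V. \<Sum>z\<in>V. \<Sum>y\<in>V. trisum t W x z y) \<ge> \<delta>"
proof -
  obtain t where t: "2 \<le> t" "t \<le> l" "high t \<ge> thr t" "\<And>i. 2 \<le> i \<Longrightarrow> i < t \<Longrightarrow> high i < thr i"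
    using choose_level by blast
  let ?W0 = "\<lambda>c. of_bool (good t c) :: real"
  have dW0: "depends_on {..t} ?W0"
    unfolding depends_on_def
  proof (intro allI impI)
    fix c c' :: "nat \<Rightarrow> 'v" assume e: "\<forall>j\<in>{..t}. c j = c' j"
    have "good t c = good t c'" by (rule depends_onD[OF depends_on_good]) (use e in auto)
    then show "?W0 c = ?W0 c'" by simp
  qed
  define q0 where "q0 = trisum t ?W0"
  have q0n: "0 \<le> q0 x z y" for x z y unfolding q0_def by (rule trisum_nonneg) simp
  \<comment> \<open>\<open>Inl (x, y)\<close> and \<open>Inr (x, z)\<close> index the two families
    of classes. Each family has thresholds summing to \<open>\<delta>\<close>.\<close>
  define I where "I = (Inl ` (V \<times> V) \<union> Inr ` (V \<times> V) :: ('v \<times> 'v + 'v \<times> 'v) set)"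
  define S where "S = (\<lambda>i::'v \<times> 'v + 'v \<times> 'v. case i of Inl p \<Rightarrow> {(x,z,y). x = fst p \<and> y = snd p} | Inr p \<Rightarrow> {(x,z,y). x = fst p \<and> z = snd p})"
  define th where "th = (\<lambda>i::'v \<times> 'v + 'v \<times> 'v. case i of Inl p \<Rightarrow> \<delta> * pm t (fst p) (snd p) | Inr p \<Rightarrow> \<delta> * pm (t - 1) (fst p) (snd p))"
  define E where "E = V \<times> V \<times> V"
  let ?w = "\<lambda>(x,z,y). q0 x z y"
  have "\<exists>E'\<subseteq>E. sum ?w E' \<ge> sum ?w E - sum th I \<and> (\<forall>i\<in>I. S i \<inter> E' = {} \<or> sum ?w (S i \<inter> E') \<ge> th i)"
    by (rule remove_light_classes) (use finV q0n delta_pos pm_nonneg in \<open>auto simp: I_def E_def th_def split: sum.split\<close>)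
  then obtain E' where E': "E' \<subseteq> E" "sum ?w E' \<ge> sum ?w E - sum th I" and E'i: "\<And>i. i \<in> I \<Longrightarrow> S i \<inter> E' = {} \<or> sum ?w (S i \<inter> E') \<ge> th i"
    by blast
  have finE: "finite E" unfolding E_def using finV by simp
  have thI: "sum th I = 2 * \<delta>"
  proof -
    have "sum th I = sum th (Inl ` (V \<times> V)) + sum th (Inr ` (V \<times> V))"
      unfolding I_def using finV by (intro sum.union_disjoint) auto
    also have "sum th (Inl ` (V \<times> V)) = (\<Sum>p\<in>V\<times>V. \<delta> * pm t (fst p) (snd p))"
      by (subst sum.reindex) (auto simp: th_def)
    also have "sum th (Inr ` (V \<times> V)) = (\<Sum>p\<in>V\<times>V. \<delta> * pm (t - 1) (fst p) (snd p))"
      by (subst sum.reindex) (auto simp: th_def)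
    moreover have "(\<Sum>p\<in>V\<times>V. \<delta> * pm g (fst p) (snd p)) = \<delta>" for g
    proof -
      have "(\<Sum>p\<in>V\<times>V. pm g (fst p) (snd p)) = 1" using pm_total[of g] by (simp add: sum.cartesian_product split_def)
      then show ?thesis by (simp add: sum_distrib_left[symmetric])
    qed
    ultimately show ?thesis by simp
  qed
  have sumE: "sum ?w E = (\<Sum>x\<in>V. \<Sum>z\<in>V. \<Sum>y\<in>V. q0 x z y)"
    unfolding E_def by (simp add: sum.cartesian_product split_def)
  have "4 * \<delta> \<le> (\<Sum>x\<in>V. \<Sum>z\<in>V. \<Sum>y\<in>V. q0 x z y)"
    using good_mass[OF t] unfolding isums_trisum[OF t(1) dW0] q0_def .
  then have "sum ?w E \<ge> 4 * \<delta>" using sumE by simp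
  then have E'mass: "sum ?w E' \<ge> 2 * \<delta>" using E'(2) thI by simp
  \<comment> \<open>The second condition concerns exactly the coordinates that \<open>trisum\<close>
    fixes, so a triple keeps its whole weight or loses all of it.\<close>
  define W where "W = (\<lambda>c. of_bool (good t c \<and> (c 0, c (t - 1), c t) \<in> E') :: real)"
  have dW: "depends_on {..t} W"
    unfolding depends_on_def
  proof (intro allI impI)
    fix c c' :: "nat \<Rightarrow> 'v" assume e: "\<forall>j\<in>{..t}. c j = c' j"
    have "good t c = good t c'" by (rule depends_onD[OF depends_on_good]) (use e in auto)
    then show "W c = W c'" unfolding W_def using e by simp
  qed
  have q: "trisum t W x z y = (if (x, z, y) \<in> E' then q0 x z y else 0)" for x z y
  proof -
    have "trisum t W x z y = isums V [1..<t - 1] (\<lambda>c. of_bool ((c 0, c (t - 1), c t) \<in> E') * (pr c 0 t * ?W0 c)) (tri t x z y)"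
      unfolding trisum_def W_def by (simp add: of_bool_conj mult_ac)
    also have "\<dots> = of_bool ((x, z, y) \<in> E') * q0 x z y"
      unfolding q0_def trisum_def
      by (subst isums_factor[where A = "{0, t - 1, t}"]) (use t in \<open>auto simp: depends_on_def tri_def\<close>)
    finally show ?thesis by simp
  qed
  have EV: "(x, z, y) \<in> E' \<Longrightarrow> x \<in> V \<and> z \<in> V \<and> y \<in> V" for x z y using E'(1) unfolding E_def by auto
  have q1: "(\<Sum>z\<in>V. trisum t W x z y) = sum ?w (S (Inl (x, y)) \<inter> E')" for x y
  proof -
    have "(\<Sum>z\<in>V. trisum t W x z y) = (\<Sum>z\<in>{z\<in>V. (x,z,y) \<in> E'}. q0 x z y)"
      unfolding q using finV by (simp add: sum.inter_filter)
    also have "\<dots> = sum ?w (S (Inl (x, y)) \<inter> E')"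
      by (rule sum.reindex_bij_witness[where i = "\<lambda>(x,z,y). z" and j = "\<lambda>z. (x,z,y)"]) (auto simp: S_def dest: EV)
    finally show ?thesis .
  qed
  have q2: "(\<Sum>y\<in>V. trisum t W x z y) = sum ?w (S (Inr (x, z)) \<inter> E')" for x z
  proof -
    have "(\<Sum>y\<in>V. trisum t W x z y) = (\<Sum>y\<in>{y\<in>V. (x,z,y) \<in> E'}. q0 x z y)"
      unfolding q using finV by (simp add: sum.inter_filter)
    also have "\<dots> = sum ?w (S (Inr (x, z)) \<inter> E')"
      by (rule sum.reindex_bij_witness[where i = "\<lambda>(x,z,y). y" and j = "\<lambda>y. (x,z,y)"]) (auto simp: S_def dest: EV)
    finally show ?thesis .
  qed
  show ?thesis
  proof (rule that[OF t(1,2) dW])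
    show "0 \<le> W c \<and> W c \<le> 1" for c unfolding W_def by simp
    show "pm t (c 0) (c t) \<ge> lev t / 2 * pp (c 0) * pp (c t)" if "W c \<noteq> 0" for c
      using that unfolding W_def good_def by auto
    show "pm (b - a) (c a) (c b) \<le> C^2 * lev (b - a) * pp (c a) * pp (c b)"
      if w: "W c \<noteq> 0" and ab: "a < b" "b \<le> t" "b - a < t" for c a b
    proof (cases "b - a = 1")
      case True
      then show ?thesis using rho_lev[of "c a" "c b"] pm_one by simp
    next
      case False
      then have "2 \<le> b - a" using ab by simp
      then have "pm (b - a) (c a) (c b) \<le> lev (b - a) / 2 * pp (c a) * pp (c b)"
        using w ab unfolding W_def good_def by auto
      also have "\<dots> = 1/2 * (lev (b - a) * (pp (c a) * pp (c b)))" by simp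
      also have "\<dots> \<le> C^2 * (lev (b - a) * (pp (c a) * pp (c b)))"
      proof (rule mult_right_mono)
        have "1 \<le> C^2" using C1 by simp
        then show "1/2 \<le> C^2" by linarith
        show "0 \<le> lev (b - a) * (pp (c a) * pp (c b))" using lev_ge1[of "b - a"] pp_nonneg by simp
      qed
      finally show ?thesis by (simp add: mult_ac)
    qed
    show "(\<Sum>z\<in>V. trisum t W x z y) = 0 \<or> (\<Sum>z\<in>V. trisum t W x z y) \<ge> \<delta> * pm t x y" for x y
    proof (cases "x \<in> V \<and> y \<in> V")
      case True
      then show ?thesis using E'i[of "Inl (x,y)"] unfolding q1 by (auto simp: I_def th_def)
    next
      case False
      then have "S (Inl (x, y)) \<inter> E' = {}" using EV by (auto simp: S_def)
      then show ?thesis unfolding q1 by simp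
    qed
    show "(\<Sum>y\<in>V. trisum t W x z y) = 0 \<or> (\<Sum>y\<in>V. trisum t W x z y) \<ge> \<delta> * pm (t - 1) x z" for x z
    proof (cases "x \<in> V \<and> z \<in> V")
      case True
      then show ?thesis using E'i[of "Inr (x,z)"] unfolding q2 by (auto simp: I_def th_def)
    next
      case False
      then have "S (Inr (x, z)) \<inter> E' = {}" using EV by (auto simp: S_def)
      then show ?thesis unfolding q2 by simp
    qed
    have "(\<Sum>x\<in>V. \<Sum>z\<in>V. \<Sum>y\<in>V. trisum t W x z y) = sum ?w E'"
    proof -
      have "(\<Sum>x\<in>V. \<Sum>z\<in>V. \<Sum>y\<in>V. trisum t W x z y) = (\<Sum>p\<in>E. if p \<in> E' then ?w p else 0)"
        unfolding q E_def sum.cartesian_product by (intro sum.cong) (auto simp: split_def)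
      also have "\<dots> = sum ?w {p\<in>E. p \<in> E'}" using finE by (simp add: sum.inter_filter)
      also have "{p\<in>E. p \<in> E'} = E'" using E' by auto
      finally show ?thesis .
    qed
    then show "(\<Sum>x\<in>V. \<Sum>z\<in>V. \<Sum>y\<in>V. trisum t W x z y) \<ge> \<delta>" using E'mass delta_pos by simp
  qed
qed

end

section \<open>The random closed walk\<close>

lemma isums_nonzero:
  "isums V is F c \<noteq> 0 \<Longrightarrow> \<exists>c'. F c' \<noteq> 0 \<and> (\<forall>j. j \<notin> set is \<longrightarrow> c' j = c j)"
proof (induction "is" arbitrary: c)
  case (Cons i "is")
  then obtain v where "isums V is F (c(i := v)) \<noteq> 0"
    by (metis (no_types, lifting) isum_def isums.simps(2) sum.neutral)
  then obtain c' where "F c' \<noteq> 0" "\<forall>j. j \<notin> set is \<longrightarrow> c' j = (c(i := v)) j" using Cons.IH by blast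
  then show ?case by (intro exI[of _ c']) auto
qed auto

locale zigzag = spread_kernel V \<rho> n D \<kappa> C l for V :: "'v set" and \<rho> n D \<kappa> C l +
  fixes t :: nat and W :: "(nat \<Rightarrow> 'v) \<Rightarrow> real"
  assumes t2: "2 \<le> t" and tl: "t \<le> l" and dW: "depends_on {..t} W" and W01: "0 \<le> W c \<and> W c \<le> 1"
    and W_high: "W c \<noteq> 0 \<Longrightarrow> pm t (c 0) (c t) \<ge> lev t / 2 * pp (c 0) * pp (c t)"
    and W_low: "W c \<noteq> 0 \<Longrightarrow> a < b \<Longrightarrow> b \<le> t \<Longrightarrow> b - a < t \<Longrightarrow> pm (b - a) (c a) (c b) \<le> C^2 * lev (b - a) * pp (c a) * pp (c b)"
    and q1_low: "(\<Sum>z\<in>V. trisum t W x z y) = 0 \<or> (\<Sum>z\<in>V. trisum t W x z y) \<ge> \<delta> * pm t x y"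
    and q2_low: "(\<Sum>y\<in>V. trisum t W x z y) = 0 \<or> (\<Sum>y\<in>V. trisum t W x z y) \<ge> \<delta> * pm (t - 1) x z"
    and q_mass: "(\<Sum>x\<in>V. \<Sum>z\<in>V. \<Sum>y\<in>V. trisum t W x z y) \<ge> \<delta>"
begin

abbreviation q where "q \<equiv> trisum t W"
definition q1 where "q1 x y = (\<Sum>z\<in>V. q x z y)"
definition q2 where "q2 x z = (\<Sum>y\<in>V. q x z y)"
text \<open>Positions \<open>0..t\<close> carry the first walk, \<open>t..e\<close> the zigzag and
  \<open>e..2 * l\<close> the walk back, position \<open>2 * l\<close> being position
  \<open>0\<close>. As \<open>e - t\<close> is even, the zigzag ends in the layer where it
  began.\<close>

definition e :: nat where "e = 2 * l - t"
definition WW where "WW c = pr c 0 t * W c"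

lemma te: "t \<le> e" "e < 2 * l" "even (e - t)" using t2 tl l2 unfolding e_def by auto

lemma dWW: "depends_on {..t} WW"
  unfolding WW_def using dW depends_on_pr[of 0 t] unfolding depends_on_def by (auto intro!: arg_cong2[where f = times])

lemma WW_nonneg: "0 \<le> WW c" unfolding WW_def using pr_nonneg W01 by simp

lemma q_nonneg: "0 \<le> q x z y" using W01 by (intro trisum_nonneg) auto

lemma q_le: "q x z y \<le> pm (t - 1) x z * R z y" using W01 t2 by (intro trisum_le) auto

lemma q1_nonneg: "0 \<le> q1 x y" unfolding q1_def by (intro sum_nonneg q_nonneg)
lemma q2_nonneg: "0 \<le> q2 x y" unfolding q2_def by (intro sum_nonneg q_nonneg)

lemma q_supp: assumes "q x z y \<noteq> 0"
  shows "z \<in> V" "y \<in> V" "x \<in> V" "pp x > 0" "pp y > 0" "pp z > 0" "\<rho> z y \<noteq> 0"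
    "pm t x y \<ge> lev t / 2 * pp x * pp y" "pm (t - 1) x z \<le> C^2 * lev (t - 1) * pp x * pp z"
proof -
  have "pm (t - 1) x z * R z y \<noteq> 0" using assms q_le[of x z y] q_nonneg[of x z y] by auto
  then have nz: "pm (t - 1) x z \<noteq> 0" "R z y \<noteq> 0" by auto
  then have "pp x \<noteq> 0" "pp z \<noteq> 0" "pp y \<noteq> 0" using pm_zero'[of x] R_zero[of z y] R_zero[where v = y] by blast+
  then show "z \<in> V" "y \<in> V" "x \<in> V" "pp x > 0" "pp y > 0" "pp z > 0"
    using pp_supp pp_nonneg by (auto simp: order_less_le)
  show "\<rho> z y \<noteq> 0" using nz unfolding R_def by auto
  obtain c where c: "pr c 0 t * W c \<noteq> 0" "\<forall>j. j \<notin> set [1..<t - 1] \<longrightarrow> c j = tri t x z y j"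
    using assms isums_nonzero unfolding trisum_def by blast
  have "c 0 = x" "c (t - 1) = z" "c t = y" using c(2) t2 unfolding tri_def by auto
  moreover have "W c \<noteq> 0" using c by auto
  ultimately show "pm t x y \<ge> lev t / 2 * pp x * pp y" "pm (t - 1) x z \<le> C^2 * lev (t - 1) * pp x * pp z"
    using W_high[of c] W_low[of c 0 "t - 1"] t2 by auto
qed

lemma q1_pos: assumes "q1 x y \<noteq> 0" shows "q1 x y \<ge> \<delta> / 2 * lev t * pp x * pp y" "pp x > 0" "pp y > 0"
proof -
  obtain z where z: "q x z y \<noteq> 0" using assms unfolding q1_def by (meson sum.neutral)
  have "\<delta> / 2 * lev t * pp x * pp y = \<delta> * (lev t / 2 * pp x * pp y)" by simp
  also have "\<dots> \<le> \<delta> * pm t x y" using q_supp(8)[OF z] delta_pos by (intro mult_left_mono) auto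
  also have "\<dots> \<le> q1 x y" using q1_low[of x y] assms unfolding q1_def by auto
  finally show "q1 x y \<ge> \<delta> / 2 * lev t * pp x * pp y" .
  show "pp x > 0" "pp y > 0" using q_supp[OF z] by auto
qed

lemma q2_pos: "q2 x z \<noteq> 0 \<Longrightarrow> q2 x z \<ge> \<delta> * pm (t - 1) x z"
  using q2_low[of x z] unfolding q2_def by auto

lemma q_le_q1: "q x z y \<le> q1 x y"
proof (cases "z \<in> V")
  case True
  then show ?thesis unfolding q1_def using finV q_nonneg by (intro member_le_sum) auto
next
  case False
  then show ?thesis using q_supp(1)[of x z y] q1_nonneg[of x y] by fastforce
qed

lemma q_le_q2: "q x z y \<le> q2 x z"
proof (cases "y \<in> V")
  case True
  then show ?thesis unfolding q2_def using finV q_nonneg by (intro member_le_sum) auto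
next
  case False
  then show ?thesis using q_supp(2)[of x z y] q2_nonneg[of x z] by fastforce
qed

lemma lev_step: "lev (t - 1) = D * lev t"
proof -
  have "l - (t - 1) = Suc (l - t)" using t2 tl by auto
  then show ?thesis unfolding lev_def by simp
qed

text \<open>The first bound compares density at most \<open>lev (t - 1)\<close> above with at least
  \<open>lev t\<close> below; their quotient \<open>D\<close> is the price for stepping from an end
  \<open>y\<close> back to a penultimate vertex \<open>z\<close>. The second bound forgets the
  levels and serves the collision estimates.\<close>

lemma step_z: "q x z y / q1 x y \<le> 2 * C^2 / \<delta> * D * R y z" "q x z y / q1 x y \<le> 2 * err^2 / \<delta>"
proof -
  have "q x z y / q1 x y \<le> 2 * C^2 / \<delta> * D * R y z \<and> q x z y / q1 x y \<le> 2 * err^2 / \<delta>"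
  proof (cases "q x z y = 0")
    case True
    then show ?thesis using R_nonneg delta_pos D1 C1 by simp
  next
    case False
    note s = q_supp[OF False]
    have q1: "q1 x y \<ge> \<delta> / 2 * lev t * pp x * pp y" using False q_le_q1[of x z y] q_nonneg[of x z y] by (intro q1_pos) auto
    have den: "0 < \<delta> / 2 * lev t * pp x * pp y" using s delta_pos lev_ge1[of t] by simp
    have "q x z y / q1 x y \<le> q x z y / (\<delta> / 2 * lev t * pp x * pp y)"
      using q1 den q_nonneg by (intro divide_left_mono) auto
    also have "\<dots> \<le> (pm (t - 1) x z * R z y) / (\<delta> / 2 * lev t * pp x * pp y)"
      using q_le den by (intro divide_right_mono) auto
    finally have 1: "q x z y / q1 x y \<le> (pm (t - 1) x z * R z y) / (\<delta> / 2 * lev t * pp x * pp y)" .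
    have "(pm (t - 1) x z * R z y) / (\<delta> / 2 * lev t * pp x * pp y) \<le> (C^2 * lev (t - 1) * pp x * pp z * R z y) / (\<delta> / 2 * lev t * pp x * pp y)"
      using s(9) den R_nonneg by (intro divide_right_mono mult_right_mono) auto
    also have "\<dots> = 2 * C^2 / \<delta> * D * ((pp z * R z y) / pp y)"
      unfolding lev_step using s delta_pos lev_ge1[of t] by (simp add: field_simps)
    also have "(pp z * R z y) / pp y = R y z" using s by (simp add: pp_R_sym[of z y])
    finally have a: "q x z y / q1 x y \<le> 2 * C^2 / \<delta> * D * R y z" using 1 by linarith
    have R1: "R z y \<le> err * pp y * sqrt (pp z) / pp z"
      using pm_err'[of "Suc 0" z y] s unfolding R_def pm_one by (intro divide_right_mono) auto
    have "pm (t - 1) x z * R z y \<le> (err * pp x * sqrt (pp z)) * (err * pp y * sqrt (pp z) / pp z)"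
      using pm_err[of "t - 1" x z] R1 t2 R_nonneg err_nonneg pp_nonneg by (intro mult_mono) auto
    also have "\<dots> = err^2 * pp x * pp y"
    proof -
      have "sqrt (pp z) * sqrt (pp z) = pp z" using s by simp
      then have "(err * pp x * sqrt (pp z)) * (err * pp y * sqrt (pp z) / pp z) = err^2 * pp x * pp y * (pp z / pp z)"
        by (metis (no_types, opaque_lifting) mult.assoc mult.commute mult.left_commute power2_eq_square times_divide_eq_right)
      then show ?thesis using s by simp
    qed
    finally have "(pm (t - 1) x z * R z y) / (\<delta> / 2 * lev t * pp x * pp y) \<le> (err^2 * pp x * pp y) / (\<delta> / 2 * lev t * pp x * pp y)"
      using den by (intro divide_right_mono) auto
    also have "\<dots> = (2 * err^2 / \<delta>) / lev t" using s delta_pos lev_ge1[of t] by (simp add: field_simps)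
    also have "\<dots> \<le> (2 * err^2 / \<delta>) / 1" using lev_ge1[of t] delta_pos by (intro divide_left_mono) auto
    finally have b: "q x z y / q1 x y \<le> 2 * err^2 / \<delta>" using 1 by simp
    from a b show ?thesis by simp
  qed
  then show "q x z y / q1 x y \<le> 2 * C^2 / \<delta> * D * R y z" "q x z y / q1 x y \<le> 2 * err^2 / \<delta>" by auto
qed

text \<open>Here numerator and denominator share the walk of length \<open>t - 1\<close> from
  \<open>x\<close> to \<open>z\<close>, so no factor \<open>D\<close> appears.\<close>

lemma step_y: "q x z y / q2 x z \<le> R z y / \<delta>"
proof (cases "q x z y = 0")
  case True
  then show ?thesis using R_nonneg delta_pos by simp
next
  case False
  then have q2: "q2 x z \<ge> \<delta> * pm (t - 1) x z" using q_le_q2[of x z y] q_nonneg[of x z y] by (intro q2_pos) auto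
  have "pm (t - 1) x z * R z y \<noteq> 0" using False q_le[of x z y] q_nonneg[of x z y] by auto
  then have p: "pm (t - 1) x z > 0" using pm_nonneg[of "t - 1" x z] by (auto simp: order_less_le)
  have "q x z y / q2 x z \<le> (pm (t - 1) x z * R z y) / (\<delta> * pm (t - 1) x z)"
    using q_le q2 p delta_pos R_nonneg by (intro frac_le) auto
  then show ?thesis using p by simp
qed

text \<open>At even distance from \<open>t\<close> the zigzag sits at ends \<open>y\<close>, at odd
  distance at penultimate vertices \<open>z\<close>. Given \<open>c 0\<close>, \<open>Q\<close>
  weighs two successive positions and \<open>N\<close> is its marginal, so \<open>Q / N\<close> is a
  transition kernel whose stationary laws are \<open>q1\<close> and \<open>q2\<close>.\<close>

definition Q :: "nat \<Rightarrow> (nat \<Rightarrow> 'v) \<Rightarrow> real" where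
  "Q i c = (if even (i - t) then q (c 0) (c (Suc i)) (c i) else q (c 0) (c i) (c (Suc i)))"
definition N :: "nat \<Rightarrow> (nat \<Rightarrow> 'v) \<Rightarrow> real" where
  "N i c = (if even (i - t) then q1 (c 0) (c i) else q2 (c 0) (c i))"
definition c0 :: real where "c0 = 2 * C^4 / \<delta>"
definition zc :: "nat \<Rightarrow> real" where "zc i = c0 * n * (if even (i - t) then D else 1)"

lemma delta_le: "\<delta> \<le> 1"
proof -
  have "(1 / (2 * real l ^ 2)) ^ l \<le> 1" using sq_l by (intro power_le_one) (auto simp: divide_le_eq_1)
  then show ?thesis unfolding \<delta>_def by simp
qed

lemma c0_facts: "c0 \<ge> 1" "2 * C^3 / \<delta> \<le> c0" "C / \<delta> \<le> c0" "C \<le> c0" "2 * C^2 / \<delta> \<le> c0" "2 / \<delta> \<le> c0"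
proof -
  have p: "C ^ i \<le> C ^ j" if "i \<le> j" for i j using C1 that by (rule power_increasing[rotated])
  have p1: "1 \<le> C ^ 4" "C \<le> C ^ 4" "C^2 \<le> C^4" "C^3 \<le> C^4" using p[of 0 4] p[of 1 4] p[of 2 4] p[of 3 4] by auto
  show "2 * C^3 / \<delta> \<le> c0" "2 * C^2 / \<delta> \<le> c0" "2 / \<delta> \<le> c0" "C / \<delta> \<le> c0"
    unfolding c0_def using p1 delta_pos C1 by (auto intro!: divide_right_mono)
  have "C * \<delta> \<le> C * 1" using delta_le C1 by (intro mult_left_mono) auto
  then have "C * \<delta> \<le> 2 * C^4" using p1 by linarith
  then show "C \<le> c0" unfolding c0_def using delta_pos by (simp add: field_simps)
  then show "c0 \<ge> 1" using C1 by linarith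
qed

lemma zc_pos: "0 \<le> zc i" unfolding zc_def using c0_facts n1 D1 by simp

lemma Q_nonneg: "0 \<le> Q i c" unfolding Q_def using q_nonneg by simp
lemma N_nonneg: "0 \<le> N i c" unfolding N_def using q1_nonneg q2_nonneg by simp

lemma Q_N: "N i c = 0 \<Longrightarrow> Q i c = 0"
  unfolding N_def Q_def using q_le_q1 q_le_q2 q_nonneg by (smt (verit))

lemma step_rho: "Q i c / N i c \<le> zc i * \<rho> (c i) (c (Suc i))"
proof (cases "even (i - t)")
  case True
  have "Q i c / N i c \<le> 2 * C^2 / \<delta> * D * R (c i) (c (Suc i))" using step_z(1) True unfolding Q_def N_def by simp
  also have "\<dots> \<le> 2 * C^2 / \<delta> * D * (C * n * \<rho> (c i) (c (Suc i)))"
    using R_le_rho D1 delta_pos by (intro mult_left_mono) auto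
  also have "\<dots> = (2 * C^3 / \<delta>) * (n * D * \<rho> (c i) (c (Suc i)))" by (simp add: power3_eq_cube power2_eq_square)
  also have "\<dots> \<le> c0 * (n * D * \<rho> (c i) (c (Suc i)))"
    using c0_facts n1 D1 rho_nonneg by (intro mult_right_mono) auto
  finally show ?thesis unfolding zc_def using True by (simp add: mult_ac)
next
  case False
  have "Q i c / N i c \<le> R (c i) (c (Suc i)) / \<delta>" using step_y False unfolding Q_def N_def by simp
  also have "\<dots> \<le> C * n * \<rho> (c i) (c (Suc i)) / \<delta>"
    using R_le_rho delta_pos by (intro divide_right_mono) auto
  also have "\<dots> = (C / \<delta>) * (n * \<rho> (c i) (c (Suc i)))" by simp
  also have "\<dots> \<le> c0 * (n * \<rho> (c i) (c (Suc i)))"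
    using c0_facts n1 rho_nonneg by (intro mult_right_mono) auto
  finally show ?thesis unfolding zc_def using False by (simp add: mult_ac)
qed

lemma step_err: "err \<le> 1 \<Longrightarrow> Q i c / N i c \<le> 2 * err / \<delta>"
proof (cases "even (i - t)")
  assume "err \<le> 1"
  then have "err^2 \<le> err" using err_nonneg by (simp add: power2_eq_square mult_left_le)
  then have "2 * err^2 / \<delta> \<le> 2 * err / \<delta>" using delta_pos by (intro divide_right_mono) auto
  moreover assume "even (i - t)"
  ultimately show ?thesis using step_z(2) unfolding Q_def N_def by (smt (verit))
next
  assume "odd (i - t)"
  then have "Q i c / N i c \<le> R (c i) (c (Suc i)) / \<delta>" using step_y unfolding Q_def N_def by simp
  also have "\<dots> \<le> 2 * err / \<delta>" using R_le_err[of "c i" "c (Suc i)"] err_nonneg delta_pos by (intro divide_right_mono) auto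
  finally show ?thesis .
qed

lemma Q_sum: "i \<ge> t \<Longrightarrow> isum V i (Q i) c = N (Suc i) c"
  unfolding isum_def Q_def N_def q1_def q2_def using t2 by auto

lemma Q_sum': "i \<ge> t \<Longrightarrow> isum V (Suc i) (Q i) c = N i c"
  unfolding isum_def Q_def N_def q1_def q2_def using t2 by auto

lemma step_sum: "i \<ge> t \<Longrightarrow> isum V (Suc i) (\<lambda>c. Q i c / N i c) c \<le> 1"
proof -
  assume i: "i \<ge> t"
  have "isum V (Suc i) (\<lambda>c. inverse (N i c) * Q i c) c = inverse (N i c) * isum V (Suc i) (Q i) c"
    by (rule isum_factor[where A = "{0, i}"]) (auto simp: depends_on_def N_def)
  also have "\<dots> \<le> 1" unfolding Q_sum'[OF i] by (cases "N i c = 0") auto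
  finally show ?thesis by (simp add: divide_inverse mult.commute)
qed

definition WT where "WT T c = WW c * (\<Prod>i\<in>{0..<t}. T i (c i) (c (Suc i)))"
text \<open>The prefix of the random cycle up to position \<open>k\<close>, with its tests. From
  \<open>t\<close> on every factor is conditional on the earlier positions, so the last coordinate
  can always be summed out.\<close>

definition Fw where "Fw T k c = WT T c * (\<Prod>i\<in>{t..<k}. Q i c / N i c * T i (c i) (c (Suc i)))"

lemma WT_nonneg: "(\<And>i u v. 0 \<le> T i u v) \<Longrightarrow> 0 \<le> WT T c"
  unfolding WT_def by (intro mult_nonneg_nonneg WW_nonneg prod_nonneg) auto

lemma dWT: "depends_on {..t} (WT T)"
  unfolding depends_on_def WT_def
proof (intro allI impI)
  fix c c' :: "nat \<Rightarrow> 'v" assume h: "\<forall>j\<in>{..t}. c j = c' j"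
  have "WW c = WW c'" by (rule depends_onD[OF dWW]) (use h in auto)
  moreover have "(\<Prod>i\<in>{0..<t}. T i (c i) (c (Suc i))) = (\<Prod>i\<in>{0..<t}. T i (c' i) (c' (Suc i)))"
    using h by (intro prod.cong) auto
  ultimately show "WW c * (\<Prod>i\<in>{0..<t}. T i (c i) (c (Suc i))) = WW c' * (\<Prod>i\<in>{0..<t}. T i (c' i) (c' (Suc i)))" by simp
qed

lemma Fw_nonneg: "(\<And>i u v. 0 \<le> T i u v) \<Longrightarrow> 0 \<le> Fw T k c"
  unfolding Fw_def by (intro mult_nonneg_nonneg WT_nonneg prod_nonneg divide_nonneg_nonneg ballI Q_nonneg N_nonneg) auto

lemma dFw: "t \<le> k \<Longrightarrow> depends_on {..k} (Fw T k)"
  unfolding depends_on_def Fw_def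
proof (intro allI impI)
  fix c c' :: "nat \<Rightarrow> 'v" assume k: "t \<le> k" and h: "\<forall>j\<in>{..k}. c j = c' j"
  have "WT T c = WT T c'" by (rule depends_onD[OF dWT]) (use h k in auto)
  moreover have "(\<Prod>i\<in>{t..<k}. Q i c / N i c * T i (c i) (c (Suc i))) = (\<Prod>i\<in>{t..<k}. Q i c' / N i c' * T i (c' i) (c' (Suc i)))"
  proof (intro prod.cong refl)
    fix i assume "i \<in> {t..<k}"
    then have "c 0 = c' 0" "c i = c' i" "c (Suc i) = c' (Suc i)" using h by auto
    then show "Q i c / N i c * T i (c i) (c (Suc i)) = Q i c' / N i c' * T i (c' i) (c' (Suc i))" unfolding Q_def N_def by simp
  qed
  ultimately show "WT T c * (\<Prod>i\<in>{t..<k}. Q i c / N i c * T i (c i) (c (Suc i))) = WT T c' * (\<Prod>i\<in>{t..<k}. Q i c' / N i c' * T i (c' i) (c' (Suc i)))" by simp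
qed

lemma Fw_Suc: "t \<le> k \<Longrightarrow> Fw T (Suc k) c = Fw T k c * (Q k c / N k c * T k (c k) (c (Suc k)))"
  unfolding Fw_def by (simp add: prod.atLeastLessThan_Suc)

lemma Fw_t: "Fw T t = WT T" unfolding Fw_def by simp

section \<open>Tests of single steps and their price\<close>

lemma sum_rho_T_le: "(\<And>u v. 0 \<le> T u v) \<Longrightarrow> (\<Sum>v\<in>V. \<rho> u v * T u v) \<le> ang T" "(\<And>u v. 0 \<le> T u v) \<Longrightarrow> (\<Sum>u\<in>V. \<rho> v u * T u v) \<le> ang T"
proof -
  assume T: "\<And>u v. 0 \<le> T u v"
  show "(\<Sum>v\<in>V. \<rho> u v * T u v) \<le> ang T"
  proof (cases "u \<in> V")
    case True
    then show ?thesis unfolding ang_def using finV T rho_nonneg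
      by (intro member_le_sum[where f = "\<lambda>u. \<Sum>v\<in>V. \<rho> u v * T u v"]) (auto intro: sum_nonneg)
  next
    case False
    then have "\<rho> u v = 0" for v using rho_supp by blast
    then show ?thesis using ang_nonneg[of T] T by simp
  qed
  show "(\<Sum>u\<in>V. \<rho> v u * T u v) \<le> ang T"
  proof (cases "v \<in> V")
    case True
    have "(\<Sum>u\<in>V. \<rho> v u * T u v) = (\<Sum>u\<in>V. \<rho> u v * T u v)" using rho_sym by simp
    also have "\<dots> \<le> ang T" unfolding ang_def using True finV T rho_nonneg by (intro sum_mono member_le_sum) auto
    finally show ?thesis .
  next
    case False
    then have "\<rho> v u = 0" for u using rho_supp by blast
    then show ?thesis using ang_nonneg[of T] T by simp
  qed
qed

text \<open>The tests needed later are weighted indicators of the pairs inside a prescribed edge; a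
  constant test marks an untested position.\<close>

definition tests :: "nat set \<Rightarrow> (nat \<Rightarrow> 'v \<Rightarrow> 'v \<Rightarrow> real) \<Rightarrow> bool" where
  "tests J T \<longleftrightarrow> (\<forall>i u v. 0 \<le> T i u v) \<and> (\<forall>i. i \<notin> J \<longrightarrow> T i = (\<lambda>_ _. 1))"

lemma testsD: "tests J T \<Longrightarrow> 0 \<le> T i u v" "tests J T \<Longrightarrow> i \<notin> J \<Longrightarrow> T i = (\<lambda>_ _. 1)"
  unfolding tests_def by auto

lemma ang_pos: "tests J T \<Longrightarrow> 0 \<le> ang (T i)" by (intro ang_nonneg) (auto simp: tests_def)

lemma tests_cost: "tests J T \<Longrightarrow> cost T (\<lambda>i. if i \<in> J then C * n * ang (T i) else 1)"
  unfolding cost_def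
proof (intro conjI allI)
  assume T: "tests J T"
  show "0 \<le> T i u v" for i u v by (rule testsD[OF T])
  show "0 \<le> (if i \<in> J then C * n * ang (T i) else 1)" for i using ang_pos[OF T] C1 n1 by simp
  have R1: "(\<Sum>v\<in>V. R u v * h v) \<le> C * n * (\<Sum>v\<in>V. \<rho> u v * h v)" if "\<And>v. 0 \<le> h v" for u h
  proof -
    have "(\<Sum>v\<in>V. R u v * h v) \<le> (\<Sum>v\<in>V. (C * n * \<rho> u v) * h v)" using R_le_rho that by (intro sum_mono mult_right_mono) auto
    then show ?thesis by (simp add: sum_distrib_left mult.assoc)
  qed
  have Cn: "0 \<le> C * n" using C1 n1 by simp
  show "(\<Sum>v\<in>V. R u v * T i u v) \<le> (if i \<in> J then C * n * ang (T i) else 1)" for i u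
  proof (cases "i \<in> J")
    case True
    then show ?thesis using R1[of "\<lambda>v. T i u v" u] mult_left_mono[OF sum_rho_T_le(1)[of "T i" u] Cn] testsD[OF T] by fastforce
  next
    case False
    then show ?thesis using R_sum testsD(2)[OF T False] by simp
  qed
  show "(\<Sum>u\<in>V. R v u * T i u v) \<le> (if i \<in> J then C * n * ang (T i) else 1)" for i v
  proof (cases "i \<in> J")
    case True
    then show ?thesis using R1[of "\<lambda>u. T i u v" v] mult_left_mono[OF sum_rho_T_le(2)[of "T i" v] Cn] testsD[OF T] by fastforce
  next
    case False
    then show ?thesis using R_sum testsD(2)[OF T False] by simp
  qed
qed

lemma prod_if_J: "finite A \<Longrightarrow> (\<Prod>i\<in>A. if i \<in> J then x * g i else 1) = x ^ card (J \<inter> A) * (\<Prod>i\<in>J \<inter> A. g i :: real)"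
proof -
  assume A: "finite A"
  have "(\<Prod>i\<in>A. if i \<in> J then x * g i else 1) = (\<Prod>i\<in>{i\<in>A. i \<in> J}. x * g i)"
    using A by (rule prod.inter_filter[symmetric])
  also have "{i\<in>A. i \<in> J} = J \<inter> A" by auto
  finally show ?thesis by (simp add: prod.distrib)
qed

lemma zig_step:
  assumes T: "tests J T" and k: "t \<le> k"
  shows "isum V (Suc k) (Fw T (Suc k)) c \<le> (if k \<in> J then zc k * ang (T k) else 1) * Fw T k c"
proof -
  let ?b = "if k \<in> J then zc k * ang (T k) else 1"
  have "isum V (Suc k) (Fw T (Suc k)) c = isum V (Suc k) (\<lambda>c. Fw T k c * (Q k c / N k c * T k (c k) (c (Suc k)))) c"
    unfolding isum_def Fw_Suc[OF k] ..
  also have "\<dots> = Fw T k c * isum V (Suc k) (\<lambda>c. Q k c / N k c * T k (c k) (c (Suc k))) c"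
    by (rule isum_factor[OF dFw[OF k]]) simp
  also have "\<dots> \<le> Fw T k c * ?b"
  proof (rule mult_left_mono)
    show "isum V (Suc k) (\<lambda>c. Q k c / N k c * T k (c k) (c (Suc k))) c \<le> ?b"
    proof (cases "k \<in> J")
      case True
      have "isum V (Suc k) (\<lambda>c. Q k c / N k c * T k (c k) (c (Suc k))) c \<le> isum V (Suc k) (\<lambda>c. zc k * \<rho> (c k) (c (Suc k)) * T k (c k) (c (Suc k))) c"
        using testsD[OF T] step_rho by (intro isum_mono mult_right_mono) auto
      also have "\<dots> = zc k * (\<Sum>v\<in>V. \<rho> (c k) v * T k (c k) v)"
        unfolding isum_def by (simp add: sum_distrib_left mult.assoc)
      also have "\<dots> \<le> zc k * ang (T k)" using testsD[OF T] by (intro mult_left_mono zc_pos sum_rho_T_le) auto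
      finally show ?thesis using True by simp
    next
      case False
      then show ?thesis using testsD(2)[OF T False] step_sum[OF k] by simp
    qed
    show "0 \<le> Fw T k c" by (rule Fw_nonneg) (rule testsD[OF T])
  qed
  finally show ?thesis by (simp add: mult.commute)
qed

lemma zig_peel:
  assumes T: "tests J T" and k: "t \<le> k" "k \<le> k'"
  shows "isums V [Suc k..<Suc k'] (Fw T k') c \<le> (\<Prod>i\<in>{k..<k'}. if i \<in> J then zc i * ang (T i) else 1) * Fw T k c"
  by (rule isums_peel) (use k zig_step[OF T] zc_pos ang_pos[OF T] in auto)

lemma WW_q1: "isums V [1..<t] WW c = q1 (c 0) (c t)"
proof -
  have "isums V [1..<t] WW c = isums V ((t - 1) # [1..<t - 1]) WW c"
    by (rule fun_cong[OF isums_set]) (use t2 in auto)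
  also have "\<dots> = isum V (t - 1) (\<lambda>c. q (c 0) (c (t - 1)) (c t)) c"
  proof -
    have "isums V [1..<t - 1] WW = (\<lambda>c. q (c 0) (c (t - 1)) (c t))"
      using trisum_eval[OF t2 dW] unfolding WW_def[abs_def] by (rule ext)
    then show ?thesis by (simp only: isums.simps)
  qed
  also have "\<dots> = q1 (c 0) (c t)"
  proof -
    have "t \<noteq> t - 1" "t - 1 \<noteq> 0" using t2 by auto
    then show ?thesis unfolding isum_def q1_def by simp
  qed
  finally show ?thesis .
qed

text \<open>Stationarity of the zigzag for fixed \<open>c 0\<close>: summing \<open>Q\<close> over
  the old position gives the marginal \<open>N\<close> of the new one.\<close>

lemma Fw_stationary:
  assumes "t \<le> k" shows "isums V [1..<k] (Fw (\<lambda>_ _ _. 1) k) c = N k c"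
  using assms
proof (induction k arbitrary: c rule: dec_induct)
  case base
  have "Fw (\<lambda>_ _ _. 1) t = WW" by (rule ext) (simp add: Fw_def WT_def)
  then show ?case using WW_q1 unfolding N_def by simp
next
  case (step k)
  let ?F = "Fw (\<lambda>_ _ _. 1)"
  have "isums V [1..<Suc k] (?F (Suc k)) c = isums V (k # [1..<k]) (?F (Suc k)) c"
    by (rule fun_cong[OF isums_set]) (use step t2 in auto)
  also have "\<dots> = isum V k (isums V [1..<k] (\<lambda>c. (Q k c / N k c) * ?F k c)) c"
  proof -
    have "?F (Suc k) = (\<lambda>c. (Q k c / N k c) * ?F k c)" by (rule ext) (simp add: Fw_Suc[OF step(1)])
    then show ?thesis by (simp only: isums.simps)
  qed
  also have "isums V [1..<k] (\<lambda>c. (Q k c / N k c) * ?F k c) = (\<lambda>c. (Q k c / N k c) * isums V [1..<k] (?F k) c)"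
    by (rule ext, rule isums_factor[where A = "{0, k, Suc k}"]) (auto simp: depends_on_def Q_def N_def)
  also have "\<dots> = Q k" using step.IH Q_N by (auto simp: fun_eq_iff)
  also have "isum V k (Q k) c = N (Suc k) c" using step by (intro Q_sum)
  finally show ?case .
qed

lemma lev_nonneg: "0 \<le> lev i" using lev_ge1[of i] by simp

section \<open>Tests on the first walk\<close>

lemma WT_le: "tests J T \<Longrightarrow> WT T c \<le> pr c 0 t * (\<Prod>i\<in>{0..<t}. T i (c i) (c (Suc i)))"
proof -
  assume T: "tests J T"
  have "WW c \<le> pr c 0 t * 1" unfolding WW_def using pr_nonneg W01 by (intro mult_left_mono) auto
  then show ?thesis unfolding WT_def using testsD[OF T] by (intro mult_right_mono prod_nonneg) auto
qed

lemma WT_PM: assumes T: "tests J T" shows "isums V [1..<t] (WT T) c \<le> PM T 0 t (c 0) (c t)"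
proof -
  have "isums V [1..<t] (WT T) c \<le> isums V [Suc 0..<t] (\<lambda>c. pr c 0 t * (\<Prod>i\<in>{0..<t}. T i (c i) (c (Suc i)))) c"
    using WT_le[OF T] by (simp add: isums_mono)
  also have "\<dots> = PM T 0 t (c 0) (c t)" using isums_pr[of 0 t T c] t2 by simp
  finally show ?thesis .
qed

lemma WT_row: assumes T: "tests J T" shows "isums V [1..<Suc t] (WT T) c \<le> (\<Sum>v\<in>V. PM T 0 t (c 0) v)"
proof -
  have "isums V [1..<Suc t] (WT T) c = isums V (t # [1..<t]) (WT T) c"
    by (rule fun_cong[OF isums_set]) (use t2 in auto)
  also have "\<dots> \<le> isum V t (\<lambda>c. PM T 0 t (c 0) (c t)) c"
    unfolding isums.simps by (rule isum_mono) (rule WT_PM[OF T])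
  also have "\<dots> = (\<Sum>v\<in>V. PM T 0 t (c 0) v)" unfolding isum_def using t2 by simp
  finally show ?thesis .
qed

lemma WT_total: assumes T: "tests J T" shows "isums V [0..<Suc t] (WT T) c \<le> (\<Sum>u\<in>V. \<Sum>v\<in>V. PM T 0 t u v)"
proof -
  have "isums V [0..<Suc t] (WT T) c = isums V (0 # [1..<Suc t]) (WT T) c"
    by (rule fun_cong[OF isums_set]) auto
  also have "\<dots> \<le> isum V 0 (\<lambda>c. \<Sum>v\<in>V. PM T 0 t (c 0) v) c"
    unfolding isums.simps(2) by (rule isum_mono) (rule WT_row[OF T])
  also have "\<dots> = (\<Sum>u\<in>V. \<Sum>v\<in>V. PM T 0 t u v)" unfolding isum_def by simp
  finally show ?thesis .
qed

definition AJ :: "nat set \<Rightarrow> (nat \<Rightarrow> 'v \<Rightarrow> 'v \<Rightarrow> real) \<Rightarrow> nat set \<Rightarrow> real" where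
  "AJ J T A = (\<Prod>i\<in>J \<inter> A. ang (T i))"

lemma AJ_nonneg: "tests J T \<Longrightarrow> 0 \<le> AJ J T A"
  unfolding AJ_def by (intro prod_nonneg ballI ang_pos)

lemma cost_prod: "finite A \<Longrightarrow> (\<Prod>i\<in>A. if i \<in> J then x * ang (T i) else 1) = x ^ card (J \<inter> A) * AJ J T A"
  unfolding AJ_def by (rule prod_if_J)

lemma cost_prod_minus:
  assumes "finite A" "i0 \<in> J \<inter> A"
  shows "(\<Prod>i\<in>A - {i0}. if i \<in> J then x * ang (T i) else 1) * ang (T i0) = x ^ (card (J \<inter> A) - 1) * AJ J T A"
proof -
  have e1: "J \<inter> (A - {i0}) = J \<inter> A - {i0}" by auto
  have "AJ J T A = ang (T i0) * AJ J T (A - {i0})"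
    unfolding AJ_def e1 using assms by (intro prod.remove) auto
  then show ?thesis using cost_prod[of "A - {i0}" J x T] assms unfolding e1 by (simp add: card_Diff_singleton mult_ac)
qed

text \<open>Any tested step can serve as the distinguished one in \<open>PM_mid\<close>; all others
  cost \<open>C * n\<close>.\<close>

lemma sum_PM_tests_le: assumes T: "tests J T" and J: "J \<inter> {0..<t} \<noteq> {}"
  shows "(\<Sum>u\<in>V. \<Sum>v\<in>V. PM T 0 t u v) \<le> (C * n) ^ (card (J \<inter> {0..<t}) - 1) * AJ J T {0..<t}"
proof -
  obtain i0 where i0: "i0 \<in> J \<inter> {0..<t}" using J by blast
  have "(\<Sum>u\<in>V. \<Sum>v\<in>V. PM T 0 t u v) \<le> (\<Prod>i\<in>{0..<0 + t} - {i0}. if i \<in> J then C * n * ang (T i) else 1) * ang (T i0)"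
    using i0 by (intro PM_mid[OF tests_cost[OF T]]) auto
  also have "\<dots> = (C * n) ^ (card (J \<inter> {0..<t}) - 1) * AJ J T {0..<t}"
    using cost_prod_minus[of "{0..<t}" i0 J "C * n" T] i0 by simp
  finally show ?thesis .
qed

lemma WT_tests_le: assumes T: "tests J T" and J: "J \<inter> {0..<t} \<noteq> {}"
  shows "isums V [0..<Suc t] (WT T) c \<le> (C * n) ^ (card (J \<inter> {0..<t}) - 1) * AJ J T {0..<t}"
  using WT_total[OF T, of c] sum_PM_tests_le[OF T J] by linarith

text \<open>Fixing the start only drops nonnegative terms. This crude form is enough for the second
  half of the cycle in \<open>case_split\<close>, where \<open>c 0\<close> is already taken.\<close>

lemma WT_row_tests_le: assumes T: "tests J T" and J: "J \<inter> {0..<t} \<noteq> {}"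
  shows "isums V [1..<Suc t] (WT T) c \<le> (C * n) ^ (card (J \<inter> {0..<t}) - 1) * AJ J T {0..<t}"
proof -
  have "(\<Sum>v\<in>V. PM T 0 t (c 0) v) \<le> (\<Sum>u\<in>V. \<Sum>v\<in>V. PM T 0 t u v)"
  proof (cases "c 0 \<in> V")
    case True
    then show ?thesis using finV testsD[OF T]
      by (intro member_le_sum[where f = "\<lambda>u. \<Sum>v\<in>V. PM T 0 t u v"]) (auto intro!: sum_nonneg PM_nonneg)
  next
    case False
    have "(\<Sum>v\<in>V. PM T 0 t (c 0) v) \<le> pp (c 0) * (\<Prod>i\<in>{0..<0 + t}. if i \<in> J then C * n * ang (T i) else 1)"
      by (rule PM_row[OF tests_cost[OF T]])
    moreover have "0 \<le> (\<Sum>u\<in>V. \<Sum>v\<in>V. PM T 0 t u v)" using testsD[OF T] by (intro sum_nonneg PM_nonneg) auto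
    ultimately show ?thesis using pp_supp[OF False] by simp
  qed
  then show ?thesis using WT_row[OF T, of c] sum_PM_tests_le[OF T J] by linarith
qed

lemma WW_total: "isums V [0..<Suc t] WW c \<le> 1"
proof -
  have "isums V [0..<Suc t] WW c \<le> isums V [0..<Suc t] (\<lambda>c. pr c 0 t * 1) c"
    unfolding WW_def using W01 pr_nonneg by (intro isums_mono mult_left_mono) auto
  also have "\<dots> = 1" using isums_pr_ends[of t "\<lambda>_ _. 1" c] t2 pm_total by simp
  finally show ?thesis .
qed

lemma initial_block_all_tested: assumes T: "tests J T" and J: "{0..<t} \<subseteq> J"
  shows "isums V [1..<t] (WT T) c \<le> (C * n) ^ (t - 1) * AJ J T {0..<t}"
proof -
  obtain g where g: "t = Suc g" using t2 by (cases t) auto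
  have "PM T 0 (Suc g) (c 0) (c t) \<le> (C * n) ^ g * (\<Prod>i\<in>{0..<0 + Suc g}. ang (T i))"
    using testsD[OF T] pp_low C1 n1 by (intro PM_full) auto
  moreover have "J \<inter> {0..<t} = {0..<t}" using J by auto
  ultimately show ?thesis using WT_PM[OF T, of c] unfolding AJ_def g by simp
qed

text \<open>An untested first step may be replaced by independent ends at the price
  \<open>lev 1\<close>, which decouples the rest of the walk from its start.\<close>

lemma PM_edge_le:
  assumes T: "tests J T" and a: "a \<notin> J"
  shows "PM T a (Suc g) u v \<le> C^2 * lev 1 * pp u * (\<Sum>w\<in>V. PM T (Suc a) g w v)"
proof -
  have "PM T a (Suc g) u v = (\<Sum>w\<in>V. \<rho> u w / pp w * PM T (Suc a) g w v)"
    using PM_add[of T a "Suc 0" g u v] testsD(2)[OF T a] unfolding PM_one by simp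
  also have "\<dots> \<le> (\<Sum>w\<in>V. C^2 * lev 1 * pp u * PM T (Suc a) g w v)"
  proof (intro sum_mono mult_right_mono PM_nonneg testsD[OF T])
    fix w
    show "\<rho> u w / pp w \<le> C^2 * lev 1 * pp u"
    proof (cases "pp w = 0")
      case True
      then show ?thesis using lev_ge1[of 1] pp_nonneg by simp
    next
      case False
      then have "pp w > 0" using pp_nonneg[of w] by linarith
      then show ?thesis using rho_lev[of u w] by (simp add: field_simps)
    qed
  qed
  finally show ?thesis by (simp add: sum_distrib_left)
qed

lemma PM_gap_left:
  assumes T: "tests J T" and i1: "i1 \<notin> J"
  shows "PM T 0 (i1 + Suc g) x y \<le> C^2 * lev 1 * pp x * (\<Prod>i\<in>{0..<i1}. if i \<in> J then C * n * ang (T i) else 1) * (\<Sum>w\<in>V. PM T (Suc i1) g w y)"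
proof -
  let ?S = "\<Sum>w\<in>V. PM T (Suc i1) g w y" and ?P = "\<Prod>i\<in>{0..<i1}. if i \<in> J then C * n * ang (T i) else 1"
  have S0: "0 \<le> ?S" using testsD[OF T] by (intro sum_nonneg PM_nonneg) auto
  have L0: "0 \<le> C^2 * lev 1" using lev_ge1[of 1] by simp
  have "PM T 0 (i1 + Suc g) x y = (\<Sum>u\<in>V. PM T 0 i1 x u * (PM T i1 (Suc g) u y / pp u))"
    using PM_add[of T 0 i1 "Suc g" x y] by (simp del: PM.simps)
  also have "\<dots> \<le> (\<Sum>u\<in>V. PM T 0 i1 x u * (C^2 * lev 1 * ?S))"
  proof (intro sum_mono mult_left_mono PM_nonneg testsD[OF T])
    fix u
    show "PM T i1 (Suc g) u y / pp u \<le> C^2 * lev 1 * ?S"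
    proof (cases "pp u = 0")
      case True
      then show ?thesis using L0 S0 by simp
    next
      case False
      then have "pp u > 0" using pp_nonneg[of u] by linarith
      then show ?thesis using PM_edge_le[OF T i1, of g u y] by (simp add: field_simps del: PM.simps)
    qed
  qed
  also have "\<dots> = (\<Sum>u\<in>V. PM T 0 i1 x u) * (C^2 * lev 1 * ?S)" by (simp add: sum_distrib_right)
  also have "\<dots> \<le> (pp x * ?P) * (C^2 * lev 1 * ?S)"
    using PM_row[OF tests_cost[OF T], of 0 i1 x] L0 S0 by (intro mult_right_mono) auto
  finally show ?thesis by (simp add: mult_ac)
qed

text \<open>The untested steps \<open>i1\<close> and \<open>i3\<close> cut the walk into three
  independent parts, each cut at the price \<open>lev 1\<close>. The middle part then has both ends
  free, so \<open>PM_mid\<close> at the tested step \<open>i2\<close> saves a factor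
  \<open>C * n\<close>.\<close>

lemma initial_block_two_gaps:
  assumes T: "tests J T" and i: "i1 < i2" "i2 < i3" "i3 < t" "i1 \<notin> J" "i2 \<in> J" "i3 \<notin> J"
  shows "isums V [1..<t] (WT T) c \<le> (C^2 * lev 1)^2 * pp (c 0) * pp (c t) * ((C * n) ^ (card (J \<inter> {0..<t}) - 1) * AJ J T {0..<t})"
proof -
  let ?b = "\<lambda>i. if i \<in> J then C * n * ang (T i) else 1"
  let ?x = "c 0" and ?y = "c t"
  define g1 where "g1 = i3 - Suc i1"
  define h where "h = t - Suc i3"
  have tt: "t = i1 + Suc (g1 + Suc h)" "i3 = Suc i1 + g1" using i unfolding g1_def h_def by auto
  have L0: "0 \<le> C^2 * lev 1" using lev_ge1[of 1] by simp
  have bn: "0 \<le> ?b i" for i using ang_pos[OF T] C1 n1 by simp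
  have Ppos: "0 \<le> (\<Prod>i\<in>A. ?b i)" for A using bn by (intro prod_nonneg) auto
  let ?S3 = "\<Sum>v\<in>V. PM T (Suc i3) h v ?y"
  have S30: "0 \<le> ?S3" using testsD[OF T] by (intro sum_nonneg PM_nonneg) auto
  have S3: "?S3 \<le> pp ?y * (\<Prod>i\<in>{Suc i3..<t}. ?b i)"
    using PM_col[OF tests_cost[OF T], of "Suc i3" h ?y] i unfolding h_def by simp
  have mid: "(\<Sum>w\<in>V. \<Sum>v\<in>V. PM T (Suc i1) g1 w v) \<le> (\<Prod>i\<in>{Suc i1..<i3} - {i2}. ?b i) * ang (T i2)"
    using PM_mid[OF tests_cost[OF T], of "Suc i1" i2 g1] i tt(2) by simp
  have "(\<Sum>w\<in>V. PM T (Suc i1) (g1 + Suc h) w ?y) = (\<Sum>w\<in>V. \<Sum>v\<in>V. PM T (Suc i1) g1 w v * (PM T i3 (Suc h) v ?y / pp v))"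
    unfolding PM_add[of T "Suc i1" g1 "Suc h"] tt(2) by (simp del: PM.simps)
  also have "\<dots> \<le> (\<Sum>w\<in>V. \<Sum>v\<in>V. PM T (Suc i1) g1 w v * (C^2 * lev 1 * ?S3))"
  proof (intro sum_mono mult_left_mono PM_nonneg testsD[OF T])
    fix v
    show "PM T i3 (Suc h) v ?y / pp v \<le> C^2 * lev 1 * ?S3"
    proof (cases "pp v = 0")
      case True
      then show ?thesis using L0 S30 by simp
    next
      case False
      then have "pp v > 0" using pp_nonneg[of v] by linarith
      then show ?thesis using PM_edge_le[OF T i(6), of h v ?y] by (simp add: field_simps del: PM.simps)
    qed
  qed
  also have "\<dots> = (\<Sum>w\<in>V. \<Sum>v\<in>V. PM T (Suc i1) g1 w v) * (C^2 * lev 1 * ?S3)" by (simp add: sum_distrib_right)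
  also have "\<dots> \<le> ((\<Prod>i\<in>{Suc i1..<i3} - {i2}. ?b i) * ang (T i2)) * (C^2 * lev 1 * (pp ?y * (\<Prod>i\<in>{Suc i3..<t}. ?b i)))"
    using mid S3 L0 S30 Ppos ang_pos[OF T] lev_nonneg by (intro mult_mono mult_left_mono mult_nonneg_nonneg) auto
  finally have S1: "(\<Sum>w\<in>V. PM T (Suc i1) (g1 + Suc h) w ?y) \<le> ((\<Prod>i\<in>{Suc i1..<i3} - {i2}. ?b i) * ang (T i2)) * (C^2 * lev 1 * (pp ?y * (\<Prod>i\<in>{Suc i3..<t}. ?b i)))" .
  have "isums V [1..<t] (WT T) c \<le> PM T 0 (i1 + Suc (g1 + Suc h)) ?x ?y" using WT_PM[OF T, of c] unfolding tt(1)[symmetric] .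
  also have "\<dots> \<le> C^2 * lev 1 * pp ?x * (\<Prod>i\<in>{0..<i1}. ?b i) * (\<Sum>w\<in>V. PM T (Suc i1) (g1 + Suc h) w ?y)"
    by (rule PM_gap_left[OF T i(4)])
  also have "\<dots> \<le> C^2 * lev 1 * pp ?x * (\<Prod>i\<in>{0..<i1}. ?b i) * (((\<Prod>i\<in>{Suc i1..<i3} - {i2}. ?b i) * ang (T i2)) * (C^2 * lev 1 * (pp ?y * (\<Prod>i\<in>{Suc i3..<t}. ?b i))))"
    using L0 pp_nonneg Ppos lev_nonneg by (intro mult_left_mono[OF S1] mult_nonneg_nonneg) auto
  also have "\<dots> = (C^2 * lev 1)^2 * pp ?x * pp ?y * (((\<Prod>i\<in>{0..<i1}. ?b i) * (\<Prod>i\<in>{Suc i1..<i3} - {i2}. ?b i) * (\<Prod>i\<in>{Suc i3..<t}. ?b i)) * ang (T i2))"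
    by (simp only: power2_eq_square mult_ac)
  also have "(\<Prod>i\<in>{0..<i1}. ?b i) * (\<Prod>i\<in>{Suc i1..<i3} - {i2}. ?b i) * (\<Prod>i\<in>{Suc i3..<t}. ?b i) = (\<Prod>i\<in>{0..<t} - {i2}. ?b i)"
  proof -
    have "{0..<t} - {i2} = ({0..<i1} \<union> ({Suc i1..<i3} - {i2}) \<union> {Suc i3..<t}) \<union> {i1, i3}" using i by auto
    then have "(\<Prod>i\<in>{0..<t} - {i2}. ?b i) = (\<Prod>i\<in>({0..<i1} \<union> ({Suc i1..<i3} - {i2}) \<union> {Suc i3..<t}) \<union> {i1, i3}. ?b i)" by simp
    also have "\<dots> = (\<Prod>i\<in>{0..<i1} \<union> ({Suc i1..<i3} - {i2}) \<union> {Suc i3..<t}. ?b i) * (\<Prod>i\<in>{i1, i3}. ?b i)"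
      using i by (intro prod.union_disjoint) auto
    also have "(\<Prod>i\<in>{i1, i3}. ?b i) = 1" using i by simp
    also have "(\<Prod>i\<in>{0..<i1} \<union> ({Suc i1..<i3} - {i2}) \<union> {Suc i3..<t}. ?b i) = (\<Prod>i\<in>{0..<i1} \<union> ({Suc i1..<i3} - {i2}). ?b i) * (\<Prod>i\<in>{Suc i3..<t}. ?b i)"
      using i by (intro prod.union_disjoint) auto
    also have "(\<Prod>i\<in>{0..<i1} \<union> ({Suc i1..<i3} - {i2}). ?b i) = (\<Prod>i\<in>{0..<i1}. ?b i) * (\<Prod>i\<in>{Suc i1..<i3} - {i2}. ?b i)"
      using i by (intro prod.union_disjoint) auto
    finally show ?thesis by simp
  qed
  also have "(\<Prod>i\<in>{0..<t} - {i2}. ?b i) * ang (T i2) = (C * n) ^ (card (J \<inter> {0..<t}) - 1) * AJ J T {0..<t}"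
    using i by (intro cost_prod_minus) auto
  finally show ?thesis .
qed

lemma pr_row_sum:
  assumes "cost T b"
  shows "isums V [Suc a..<Suc m] (\<lambda>c. pr c a (max a m) * (\<Prod>i\<in>{a..<m}. T i (c i) (c (Suc i)))) c \<le> pp (c a) * (\<Prod>i\<in>{a..<m}. b i)"
proof (cases "a \<le> m")
  case True
  let ?F = "\<lambda>k c. pr c a k * (\<Prod>i\<in>{a..<k}. T i (c i) (c (Suc i)))"
  have "isums V [Suc a..<Suc m] (?F m) c \<le> (\<Prod>k\<in>{a..<m}. b k) * ?F a c"
  proof (rule isums_peel)
    fix k c assume k: "a \<le> k" "k < m"
    have "isum V (Suc k) (?F (Suc k)) c = isum V (Suc k) (\<lambda>c. ?F k c * (R (c k) (c (Suc k)) * T k (c k) (c (Suc k)))) c"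
      unfolding isum_def using k by (simp add: pr_Suc prod.atLeastLessThan_Suc mult_ac)
    also have "\<dots> = ?F k c * isum V (Suc k) (\<lambda>c. R (c k) (c (Suc k)) * T k (c k) (c (Suc k))) c"
    proof (rule isum_factor[where A = "{..k}"])
      have "depends_on {..k} (\<lambda>c. \<Prod>i\<in>{a..<k}. T i (c i) (c (Suc i)))"
        unfolding depends_on_def by (auto intro!: prod.cong)
      moreover have "depends_on {..k} (\<lambda>c. pr c a k)" by (rule depends_on_mono[OF depends_on_pr]) (use k in auto)
      ultimately show "depends_on {..k} (?F k)" unfolding depends_on_def by (auto intro!: arg_cong2[where f = times])
    qed simp
    also have "\<dots> \<le> ?F k c * b k"
      using costD[OF assms] by (intro mult_left_mono mult_nonneg_nonneg pr_nonneg prod_nonneg) (auto simp: isum_def)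
    finally show "isum V (Suc k) (?F (Suc k)) c \<le> b k * ?F k c" by (simp add: mult.commute)
  qed (use True costD[OF assms] in auto)
  then show ?thesis using True by (simp add: pr_def mult.commute max_def del: upt_Suc)
next
  case False
  then show ?thesis by (simp add: pr_def max_def)
qed

lemma pr_col_sum:
  assumes "cost T b" "a \<le> m"
  shows "isums V [a..<m] (\<lambda>c. pr c a m * (\<Prod>i\<in>{a..<m}. T i (c i) (c (Suc i)))) c \<le> pp (c m) * (\<Prod>i\<in>{a..<m}. b i)"
  using assms(2)
proof (induction "m - a" arbitrary: a c)
  case 0
  then show ?case by (simp add: pr_def)
next
  case (Suc d)
  then have am: "a < m" by simp
  let ?F = "\<lambda>a c. pr c a m * (\<Prod>i\<in>{a..<m}. T i (c i) (c (Suc i)))"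
  have Fa: "?F a = (\<lambda>c. ?F (Suc a) c * (R (c (Suc a)) (c a) * T a (c a) (c (Suc a))))"
  proof
    fix c
    have "{a..<m} = insert a {Suc a..<m}" using am by auto
    then show "?F a c = ?F (Suc a) c * (R (c (Suc a)) (c a) * T a (c a) (c (Suc a)))" using pr_left[OF am, of c] by simp
  qed
  have "isums V [a..<m] (?F a) c = isums V [Suc a..<m] (isum V a (?F a)) c"
  proof -
    have "isums V [a..<m] (?F a) = isum V a (isums V [Suc a..<m] (?F a))" using am by (simp add: upt_conv_Cons)
    then show ?thesis by (simp only: isum_isums)
  qed
  also have "\<dots> \<le> isums V [Suc a..<m] (\<lambda>c. b a * ?F (Suc a) c) c"
  proof (rule isums_mono)
    fix c
    have "isum V a (?F a) c = ?F (Suc a) c * isum V a (\<lambda>c. R (c (Suc a)) (c a) * T a (c a) (c (Suc a))) c"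
      unfolding Fa
    proof (rule isum_factor[where A = "{Suc a..}"])
      have "depends_on {Suc a..} (\<lambda>c. \<Prod>i\<in>{Suc a..<m}. T i (c i) (c (Suc i)))"
        unfolding depends_on_def by (auto intro!: prod.cong)
      moreover have "depends_on {Suc a..} (\<lambda>c. pr c (Suc a) m)" by (rule depends_on_mono[OF depends_on_pr]) auto
      ultimately show "depends_on {Suc a..} (?F (Suc a))" unfolding depends_on_def by (auto intro!: arg_cong2[where f = times])
    qed simp
    also have "\<dots> \<le> ?F (Suc a) c * b a"
      using costD[OF assms(1)] by (intro mult_left_mono mult_nonneg_nonneg pr_nonneg prod_nonneg) (auto simp: isum_def)
    finally show "isum V a (?F a) c \<le> b a * ?F (Suc a) c" by (simp add: mult.commute)
  qed
  also have "\<dots> = b a * isums V [Suc a..<m] (?F (Suc a)) c" by (rule isums_cmult)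
  also have "\<dots> \<le> b a * (pp (c m) * (\<Prod>i\<in>{Suc a..<m}. b i))"
    using Suc am costD[OF assms(1)] by (intro mult_left_mono) auto
  also have "\<dots> = pp (c m) * (\<Prod>i\<in>{a..<m}. b i)"
  proof -
    have "{a..<m} = insert a {Suc a..<m}" using am by auto
    then show ?thesis by simp
  qed
  finally show ?case .
qed

text \<open>The untested interval is a subwalk shorter than \<open>t\<close>, so
  \<open>W_low\<close> replaces it by independent ends at density \<open>lev (b - a)\<close>. Two
  separate walks remain, one hanging at each fixed end, and every tested step costs
  \<open>C * n\<close>.\<close>

lemma initial_block_one_gap:
  assumes T: "tests J T" and ab: "a < b" "b \<le> t" "b - a < t" and gap: "\<And>i. a \<le> i \<Longrightarrow> i < b \<Longrightarrow> i \<notin> J"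
  shows "isums V [1..<t] (WT T) c \<le> C^2 * lev (b - a) * pp (c 0) * pp (c t) * ((C * n) ^ card (J \<inter> {0..<t}) * AJ J T {0..<t})"
proof -
  let ?b = "\<lambda>i. if i \<in> J then C * n * ang (T i) else 1"
  let ?K = "C^2 * lev (b - a)"
  let ?G1 = "\<lambda>c. pr c 0 a * (\<Prod>i\<in>{0..<a}. T i (c i) (c (Suc i)))"
  let ?G2 = "\<lambda>c. pr c b t * (\<Prod>i\<in>{b..<t}. T i (c i) (c (Suc i)))"
  \<comment> \<open>\<open>W\<close> is dropped so that the gap can be summed freely; the indicator
    preserves the one consequence of \<open>W_low\<close> that is needed once the gap has been
    summed.\<close>
  let ?h = "\<lambda>c. of_bool (pm (b - a) (c a) (c b) \<le> ?K * pp (c a) * pp (c b)) / (pp (c a) * pp (c b)) :: real"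
  have K0: "0 \<le> ?K" using lev_ge1[of "b - a"] by simp
  have Tn: "0 \<le> T i u v" for i u v using testsD(1)[OF T] .
  have G0: "0 \<le> ?G1 c" "0 \<le> ?G2 c" for c using Tn by (auto intro!: mult_nonneg_nonneg pr_nonneg prod_nonneg)
  have dG1: "depends_on {..a} ?G1" and dG2: "depends_on {b..t} ?G2"
  proof -
    have "depends_on {..a} (\<lambda>c. \<Prod>i\<in>{0..<a}. T i (c i) (c (Suc i)))" "depends_on {b..t} (\<lambda>c. \<Prod>i\<in>{b..<t}. T i (c i) (c (Suc i)))"
      unfolding depends_on_def by (auto intro!: prod.cong)
    moreover have "depends_on {..a} (\<lambda>c. pr c 0 a)" "depends_on {b..t} (\<lambda>c. pr c b t)"
      using ab by (auto intro!: depends_on_mono[OF depends_on_pr])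
    ultimately show "depends_on {..a} ?G1" "depends_on {b..t} ?G2" unfolding depends_on_def by (auto intro!: arg_cong2[where f = times])
  qed
  have pw: "WT T c \<le> (?G1 c * ?G2 c * ?h c) * pr c a b" for c
  proof (cases "W c = 0 \<or> pr c 0 t = 0")
    case True
    then have "WT T c = 0" unfolding WT_def WW_def by auto
    moreover have "0 \<le> (?G1 c * ?G2 c * ?h c) * pr c a b"
      by (rule mult_nonneg_nonneg[OF mult_nonneg_nonneg[OF mult_nonneg_nonneg[OF G0] divide_nonneg_nonneg] pr_nonneg]) (auto simp: pp_nonneg)
    ultimately show ?thesis by simp
  next
    case False
    have cut: "pr c i k = pr c i j * pr c j k / pp (c j)" if "pp (c j) \<noteq> 0" "i \<le> j" "j \<le> k" for i j k
    proof -
      have "{i..<k} = {i..<j} \<union> {j..<k}" using that by auto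
      then have "(\<Prod>i\<in>{i..<k}. R (c i) (c (Suc i))) = (\<Prod>i\<in>{i..<j}. R (c i) (c (Suc i))) * (\<Prod>i\<in>{j..<k}. R (c i) (c (Suc i)))"
        by (simp add: prod.union_disjoint)
      then show ?thesis unfolding pr_def using that by simp
    qed
    have ppnz: "pp (c j) \<noteq> 0" if "j \<le> t" for j
    proof (cases "j = 0")
      case True
      then show ?thesis using False unfolding pr_def by auto
    next
      case j0: False
      then obtain i where "j = Suc i" by (cases j) auto
      moreover have "R (c i) (c (Suc i)) \<noteq> 0" if "i < t" for i using False that unfolding pr_def by (auto simp: prod_zero_iff)
      ultimately show ?thesis using R_zero(2) that by (metis Suc_le_lessD)
    qed
    have e1: "pr c 0 t = pr c 0 a * pr c a b * pr c b t / (pp (c a) * pp (c b))"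
      using cut[of a 0 t] cut[of b a t] ab ppnz by (simp add: mult_ac)
    have e2: "?h c = 1 / (pp (c a) * pp (c b))" using W_low[of c a b] False ab by simp
    have e3: "(\<Prod>i\<in>{0..<t}. T i (c i) (c (Suc i))) = (\<Prod>i\<in>{0..<a}. T i (c i) (c (Suc i))) * (\<Prod>i\<in>{b..<t}. T i (c i) (c (Suc i)))"
    proof -
      have "{0..<t} = ({0..<a} \<union> {b..<t}) \<union> {a..<b}" using ab by auto
      then have "(\<Prod>i\<in>{0..<t}. T i (c i) (c (Suc i))) = (\<Prod>i\<in>({0..<a} \<union> {b..<t}) \<union> {a..<b}. T i (c i) (c (Suc i)))" by simp
      also have "\<dots> = (\<Prod>i\<in>{0..<a} \<union> {b..<t}. T i (c i) (c (Suc i))) * (\<Prod>i\<in>{a..<b}. T i (c i) (c (Suc i)))"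
        using ab by (intro prod.union_disjoint) auto
      finally have "(\<Prod>i\<in>{0..<t}. T i (c i) (c (Suc i))) = (\<Prod>i\<in>{0..<a} \<union> {b..<t}. T i (c i) (c (Suc i))) * (\<Prod>i\<in>{a..<b}. T i (c i) (c (Suc i)))" .
      moreover have "(\<Prod>i\<in>{a..<b}. T i (c i) (c (Suc i))) = 1" using testsD(2)[OF T gap] by (intro prod.neutral) auto
      moreover have "(\<Prod>i\<in>{0..<a} \<union> {b..<t}. T i (c i) (c (Suc i))) = (\<Prod>i\<in>{0..<a}. T i (c i) (c (Suc i))) * (\<Prod>i\<in>{b..<t}. T i (c i) (c (Suc i)))"
        using ab by (intro prod.union_disjoint) auto
      ultimately show ?thesis by simp
    qed
    have "pr c 0 t * (\<Prod>i\<in>{0..<t}. T i (c i) (c (Suc i))) = (?G1 c * ?G2 c * ?h c) * pr c a b"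
      unfolding e1 e2 e3 by (simp add: mult_ac)
    then show ?thesis using WT_le[OF T, of c] by simp
  qed
  have "isums V [1..<t] (WT T) c = isums V (([1..<Suc a] @ [b..<t]) @ [Suc a..<b]) (WT T) c"
    if a0: True
    by (rule fun_cong[OF isums_set]) (use ab in auto)
  then have "isums V [1..<t] (WT T) c \<le> isums V (([1..<Suc a] @ [b..<t]) @ [Suc a..<b]) (\<lambda>c. (?G1 c * ?G2 c * ?h c) * pr c a b) c"
    using pw by (simp only: isums_mono)
  also have "\<dots> = isums V ([1..<Suc a] @ [b..<t]) (\<lambda>c. (?G1 c * ?G2 c * ?h c) * pm (b - a) (c a) (c b)) c"
  proof -
    have "isums V [Suc a..<b] (\<lambda>c. (?G1 c * ?G2 c * ?h c) * pr c a b) = (\<lambda>c. (?G1 c * ?G2 c * ?h c) * isums V [Suc a..<b] (\<lambda>c. pr c a b) c)"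
    proof (rule ext, rule isums_factor[where A = "{..a} \<union> {b..}"])
      show "depends_on ({..a} \<union> {b..}) (\<lambda>c. ?G1 c * ?G2 c * ?h c)"
        unfolding depends_on_def
      proof (intro allI impI)
        fix c c' :: "nat \<Rightarrow> 'v" assume h: "\<forall>j\<in>{..a} \<union> {b..}. c j = c' j"
        have "?G1 c = ?G1 c'" by (rule depends_onD[OF dG1]) (use h in auto)
        moreover have "?G2 c = ?G2 c'" by (rule depends_onD[OF dG2]) (use h in auto)
        moreover have "?h c = ?h c'" using h by simp
        ultimately show "?G1 c * ?G2 c * ?h c = ?G1 c' * ?G2 c' * ?h c'" by simp
      qed
    qed auto
    then show ?thesis unfolding isums_append[of V _ "[Suc a..<b]"] isums_pr_one[OF ab(1)] by simp
  qed
  also have "\<dots> \<le> isums V ([1..<Suc a] @ [b..<t]) (\<lambda>c. ?K * (?G1 c * ?G2 c)) c"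
  proof (rule isums_mono)
    fix c
    have "?h c * pm (b - a) (c a) (c b) \<le> ?K"
    proof (cases "pp (c a) * pp (c b) = 0")
      case True
      show ?thesis unfolding True using K0 by simp
    next
      case False
      then have pos: "pp (c a) * pp (c b) > 0" using pp_nonneg[of "c a"] pp_nonneg[of "c b"] by (auto simp: order_less_le)
      show ?thesis
      proof (cases "pm (b - a) (c a) (c b) \<le> ?K * pp (c a) * pp (c b)")
        case le: True
        then have "pm (b - a) (c a) (c b) \<le> ?K * (pp (c a) * pp (c b))" by (simp only: mult.assoc)
        then have "pm (b - a) (c a) (c b) / (pp (c a) * pp (c b)) \<le> ?K" using pos by (simp only: pos_divide_le_eq)
        then show ?thesis using le by simp
      next
        case nle: False
        then show ?thesis using K0 by simp
      qed
    qed
    then have "(?G1 c * ?G2 c) * (?h c * pm (b - a) (c a) (c b)) \<le> (?G1 c * ?G2 c) * ?K" using G0 by (intro mult_left_mono) auto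
    then show "(?G1 c * ?G2 c * ?h c) * pm (b - a) (c a) (c b) \<le> ?K * (?G1 c * ?G2 c)" by (simp only: mult_ac)
  qed
  also have "\<dots> = ?K * isums V [1..<Suc a] (\<lambda>c. ?G1 c * isums V [b..<t] ?G2 c) c"
  proof -
    have "isums V [b..<t] (\<lambda>c. ?G1 c * ?G2 c) = (\<lambda>c. ?G1 c * isums V [b..<t] ?G2 c)"
      by (rule ext, rule isums_factor[OF dG1]) (use ab in auto)
    then show ?thesis unfolding isums_cmult isums_append by simp
  qed
  also have "\<dots> \<le> ?K * isums V [1..<Suc a] (\<lambda>c. (pp (c t) * (\<Prod>i\<in>{b..<t}. ?b i)) * ?G1 c) c"
  proof (intro mult_left_mono isums_mono K0)
    fix c
    show "?G1 c * isums V [b..<t] ?G2 c \<le> (pp (c t) * (\<Prod>i\<in>{b..<t}. ?b i)) * ?G1 c"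
      using mult_left_mono[OF pr_col_sum[OF tests_cost[OF T] ab(2), of c] G0(1)[of c]] by (simp add: mult.commute)
  qed
  also have "\<dots> = ?K * ((pp (c t) * (\<Prod>i\<in>{b..<t}. ?b i)) * isums V [1..<Suc a] ?G1 c)"
    by (subst isums_factor[where A = "{t}"]) (use ab in \<open>auto simp: depends_on_def\<close>)
  also have "\<dots> \<le> ?K * ((pp (c t) * (\<Prod>i\<in>{b..<t}. ?b i)) * (pp (c 0) * (\<Prod>i\<in>{0..<a}. ?b i)))"
  proof (intro mult_left_mono K0)
    show "isums V [1..<Suc a] ?G1 c \<le> pp (c 0) * (\<Prod>i\<in>{0..<a}. ?b i)"
      using pr_row_sum[OF tests_cost[OF T], of 0 a c] by (simp del: upt_Suc)
    show "0 \<le> pp (c t) * (\<Prod>i\<in>{b..<t}. ?b i)" using pp_nonneg ang_pos[OF T] C1 n1 by (intro mult_nonneg_nonneg prod_nonneg) auto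
  qed
  also have "\<dots> = ?K * pp (c 0) * pp (c t) * ((\<Prod>i\<in>{0..<a}. ?b i) * (\<Prod>i\<in>{b..<t}. ?b i))" by (simp only: mult_ac)
  also have "(\<Prod>i\<in>{0..<a}. ?b i) * (\<Prod>i\<in>{b..<t}. ?b i) = (\<Prod>i\<in>{0..<t}. ?b i)"
  proof -
    have "{0..<t} = ({0..<a} \<union> {b..<t}) \<union> {a..<b}" using ab by auto
    then have "(\<Prod>i\<in>{0..<t}. ?b i) = (\<Prod>i\<in>({0..<a} \<union> {b..<t}) \<union> {a..<b}. ?b i)" by simp
    also have "\<dots> = (\<Prod>i\<in>{0..<a} \<union> {b..<t}. ?b i) * (\<Prod>i\<in>{a..<b}. ?b i)"
      using ab by (intro prod.union_disjoint) auto
    finally have "(\<Prod>i\<in>{0..<t}. ?b i) = (\<Prod>i\<in>{0..<a} \<union> {b..<t}. ?b i) * (\<Prod>i\<in>{a..<b}. ?b i)" .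
    moreover have "(\<Prod>i\<in>{a..<b}. ?b i) = 1" using gap by (intro prod.neutral) auto
    moreover have "(\<Prod>i\<in>{0..<a} \<union> {b..<t}. ?b i) = (\<Prod>i\<in>{0..<a}. ?b i) * (\<Prod>i\<in>{b..<t}. ?b i)"
      using ab by (intro prod.union_disjoint) auto
    ultimately show ?thesis by simp
  qed
  also have "\<dots> = (C * n) ^ card (J \<inter> {0..<t}) * AJ J T {0..<t}" by (rule cost_prod) simp
  finally show ?thesis .
qed

text \<open>Division by \<open>q1\<close> conditions the walk on its ends. With a single gap of
  length \<open>g\<close> there are \<open>j = t - g\<close> tests, and
  \<open>lev g / lev t = D ^ j\<close> gives each of them a factor \<open>D\<close>. With two gaps,
  the factor saved between them pays for both cuts.\<close>

lemma initial_block_partly_tested: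
  assumes T: "tests J T" and J: "J \<inter> {0..<t} \<noteq> {}" "\<not> {0..<t} \<subseteq> J"
  shows "isums V [1..<t] (WT T) c / q1 (c 0) (c t) \<le> c0 * ((c0 * (n * D)) ^ card (J \<inter> {0..<t}) * AJ J T {0..<t})"
proof (cases "q1 (c 0) (c t) = 0")
  case True
  then show ?thesis using AJ_nonneg[OF T] c0_facts n1 D1 by simp
next
  case False
  let ?j = "card (J \<inter> {0..<t})" and ?x = "c 0" and ?y = "c t" and ?A = "AJ J T {0..<t}"
  note p = q1_pos[OF False]
  have A0: "0 \<le> ?A" by (rule AJ_nonneg[OF T])
  have den: "0 < \<delta> / 2 * lev t * pp ?x * pp ?y" using p delta_pos lev_ge1[of t] by simp
  have X0: "0 \<le> isums V [1..<t] (WT T) c" using testsD[OF T] by (intro isums_nonneg WT_nonneg) auto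
  have div: "isums V [1..<t] (WT T) c / q1 ?x ?y \<le> 2 * K / (\<delta> * lev t)" if "isums V [1..<t] (WT T) c \<le> K * (pp ?x * pp ?y)" for K
  proof -
    have "isums V [1..<t] (WT T) c / q1 ?x ?y \<le> K * (pp ?x * pp ?y) / (\<delta> / 2 * lev t * pp ?x * pp ?y)"
      using that p den X0 by (intro frac_le) auto
    also have "\<dots> = 2 * K / (\<delta> * lev t)" using p delta_pos lev_ge1[of t] by (simp add: field_simps)
    finally show ?thesis .
  qed
  have Cn: "0 \<le> C * n" "C * n \<le> c0 * n" using C1 n1 c0_facts by auto
  \<comment> \<open>The untested positions either fill the interval from \<open>i1\<close> to
    \<open>i3\<close> or have a tested position strictly between these two.\<close>
  define M where "M = {0..<t} - J"
  have M: "finite M" "M \<noteq> {}" using J unfolding M_def by auto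
  define i1 where "i1 = Min M"
  define i3 where "i3 = Max M"
  have i13: "i1 \<in> M" "i3 \<in> M" "i1 \<le> i3" and bd: "\<And>i. i \<in> M \<Longrightarrow> i1 \<le> i \<and> i \<le> i3"
    using M unfolding i1_def i3_def by auto
  show ?thesis
  proof (cases "\<exists>i2. i1 < i2 \<and> i2 < i3 \<and> i2 \<in> J")
    case True
    then obtain i2 where i2: "i1 < i2" "i2 < i3" "i2 \<in> J" by blast
    have j1: "?j \<ge> 1" using J by (simp add: Suc_le_eq card_gt_0_iff)
    have "isums V [1..<t] (WT T) c \<le> ((C^2 * lev 1)^2 * ((C * n) ^ (?j - 1) * ?A)) * (pp ?x * pp ?y)"
      using initial_block_two_gaps[OF T i2(1,2), of c] i13 i2 unfolding M_def by (simp add: mult_ac)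
    then have "isums V [1..<t] (WT T) c / q1 ?x ?y \<le> 2 * ((C^2 * lev 1)^2 * ((C * n) ^ (?j - 1) * ?A)) / (\<delta> * lev t)" by (rule div)
    also have "\<dots> \<le> 2 * ((C^2 * lev 1)^2 * ((C * n) ^ (?j - 1) * ?A)) / (\<delta> * 1)"
      using lev_ge1[of t] delta_pos A0 Cn by (intro divide_left_mono mult_left_mono mult_pos_pos mult_nonneg_nonneg) auto
    also have "\<dots> = c0 * ((lev 1)^2 * ((C * n) ^ (?j - 1) * ?A))"
      unfolding c0_def by (simp add: power_mult_distrib)
    also have "\<dots> \<le> c0 * ((c0 * (n * D)) ^ ?j * ?A)"
    proof (rule mult_left_mono)
      \<comment> \<open>\<open>2 * (l - 1) \<le> 2 * l - 1\<close>, so two cuts cost at most one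
        factor \<open>n\<close>.\<close>
      have "(lev 1)^2 = D ^ (2 * l - 2)" unfolding lev_def using l2 by (simp add: power_mult[symmetric] mult.commute right_diff_distrib')
      also have "\<dots> \<le> D ^ (2 * l - 1)" using D1 by (intro power_increasing) auto
      finally have l1: "(lev 1)^2 \<le> n" using Dn by simp
      have "n * 1 * 1 \<le> n * D * c0" using n1 D1 c0_facts by (intro mult_mono) auto
      then have nn: "n \<le> c0 * (n * D)" by (simp add: mult_ac)
      have "C * n * 1 \<le> c0 * n * D" using C1 n1 D1 c0_facts by (intro mult_mono) auto
      then have "(C * n) ^ (?j - 1) \<le> (c0 * (n * D)) ^ (?j - 1)" using Cn by (intro power_mono) (auto simp: mult_ac)
      then have "(lev 1)^2 * (C * n) ^ (?j - 1) \<le> (c0 * (n * D)) * (c0 * (n * D)) ^ (?j - 1)"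
        by (rule mult_mono[OF order_trans[OF l1 nn]]) (use Cn n1 D1 c0_facts in auto)
      also have "\<dots> = (c0 * (n * D)) ^ ?j" using j1 by (metis power_eq_if not_one_le_zero)
      finally have "(lev 1)^2 * (C * n) ^ (?j - 1) * ?A \<le> (c0 * (n * D)) ^ ?j * ?A" using A0 by (rule mult_right_mono)
      then show "(lev 1)^2 * ((C * n) ^ (?j - 1) * ?A) \<le> (c0 * (n * D)) ^ ?j * ?A" by (simp add: mult.assoc)
      show "0 \<le> c0" using c0_facts by simp
    qed
    finally show ?thesis .
  next
    case False
    let ?g = "Suc i3 - i1"
    have gap: "i \<notin> J" if "i1 \<le> i" "i < Suc i3" for i
      using that False i13 unfolding M_def by (metis DiffD2 le_neq_implies_less less_SucE)
    have JM: "J \<inter> {0..<t} = {0..<t} - {i1..<Suc i3}"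
      using gap bd unfolding M_def by fastforce
    have sub: "{i1..<Suc i3} \<subseteq> {0..<t}" using i13 unfolding M_def by auto
    have jg: "?j = t - ?g" "?g \<le> t" unfolding JM using sub card_mono[OF _ sub] by (auto simp: card_Diff_subset)
    have gt: "?g < t" using J(1) jg by (metis card_gt_0_iff finite_Int finite_atLeastLessThan zero_less_diff)
    have "isums V [1..<t] (WT T) c \<le> C^2 * lev ?g * pp ?x * pp ?y * ((C * n) ^ ?j * ?A)"
      using i13 gt gap unfolding M_def by (intro initial_block_one_gap[OF T]) auto
    then have "isums V [1..<t] (WT T) c \<le> (C^2 * lev ?g * ((C * n) ^ ?j * ?A)) * (pp ?x * pp ?y)" by (simp only: mult_ac)
    then have "isums V [1..<t] (WT T) c / q1 ?x ?y \<le> 2 * (C^2 * lev ?g * ((C * n) ^ ?j * ?A)) / (\<delta> * lev t)" by (rule div)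
    also have "\<dots> = (2 * C^2 / \<delta>) * (D ^ ?j * ((C * n) ^ ?j * ?A))"
    proof -
      have "l - ?g = ?j + (l - t)" using jg tl gt by simp
      then have "lev ?g = D ^ ?j * lev t" unfolding lev_def by (simp only: power_add)
      moreover have "lev t \<noteq> 0" using lev_ge1[of t] by simp
      ultimately show ?thesis using delta_pos by (simp add: field_simps)
    qed
    also have "\<dots> \<le> c0 * ((c0 * (n * D)) ^ ?j * ?A)"
    proof (rule mult_mono[OF c0_facts(5)])
      have "D ^ ?j * (C * n) ^ ?j = (C * n * D) ^ ?j" by (simp add: power_mult_distrib mult_ac)
      also have "\<dots> \<le> (c0 * n * D) ^ ?j" by (rule power_mono[OF mult_right_mono[OF Cn(2)]]) (use Cn D1 in auto)
      finally have "D ^ ?j * (C * n) ^ ?j * ?A \<le> (c0 * n * D) ^ ?j * ?A" using A0 by (rule mult_right_mono)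
      then show "D ^ ?j * ((C * n) ^ ?j * ?A) \<le> (c0 * (n * D)) ^ ?j * ?A" by (simp add: mult.assoc)
    qed (use c0_facts A0 Cn D1 in auto)
    finally show ?thesis .
  qed
qed

text \<open>\<open>fz\<close> is the distribution of the random cycle; it is invariant under the reflection \<open>rv\<close> of the positions,
  which exchanges the initial and the final walk.\<close>

definition rv :: "nat \<Rightarrow> nat" where "rv i = (if i = 0 \<or> 2 * l \<le> i then i else 2 * l - i)"
definition nx :: "nat \<Rightarrow> nat" where "nx i = (if Suc i = 2 * l then 0 else Suc i)"
definition TP where "TP T c = (\<Prod>i\<in>{0..<2 * l}. T i (c i) (c (nx i)) :: real)"
text \<open>The reflection sends step \<open>i\<close> to step \<open>2 * l - 1 - i\<close>
  traversed backwards, hence the exchanged arguments.\<close>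

definition Tr :: "(nat \<Rightarrow> 'v \<Rightarrow> 'v \<Rightarrow> real) \<Rightarrow> nat \<Rightarrow> 'v \<Rightarrow> 'v \<Rightarrow> real" where
  "Tr T i = (if i < 2 * l then (\<lambda>u v. T (2 * l - 1 - i) v u) else T i)"
definition rJ :: "nat set \<Rightarrow> nat set" where "rJ J = {i. i < 2 * l \<and> 2 * l - 1 - i \<in> J}"
definition fz where "fz c = WW c * (\<Prod>i\<in>{t..<e}. Q i c) * inverse (\<Prod>i\<in>{t..e}. N i c) * WW (c \<circ> rv)"

lemma rv_rv: "rv (rv i) = i" unfolding rv_def by auto

lemma rv_0: "rv 0 = 0" unfolding rv_def by simp

lemma rv_t: "rv t = e" "rv e = t" using t2 tl unfolding rv_def e_def by auto

lemma fz_nonneg: "0 \<le> fz c"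
  unfolding fz_def by (intro mult_nonneg_nonneg WW_nonneg prod_nonneg Q_nonneg ballI) (auto intro!: prod_nonneg N_nonneg)

text \<open>Rests on \<open>e - t\<close> being even: a zigzag step read backwards joins the same
  two layers, with the parity of its starting position exchanged.\<close>

lemma Q_rv: "t \<le> i \<Longrightarrow> i < e \<Longrightarrow> Q i (c \<circ> rv) = Q (2 * l - 1 - i) c"
proof -
  assume i: "t \<le> i" "i < e"
  obtain a where a: "i = t + a" using i(1) le_Suc_ex by blast
  obtain m where m: "l = t + m" using tl le_Suc_ex by blast
  have "e = t + 2 * m" unfolding e_def by (simp add: m)
  then have am: "a < 2 * m" "i - t = a" "2 * l - 1 - i - t = 2 * m - 1 - a" using i(2) a m by auto
  have "even (i - t) \<longleftrightarrow> odd (2 * l - 1 - i - t)" unfolding am(2,3) using am(1) by presburger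
  moreover have "rv i = Suc (2 * l - 1 - i)" "rv (Suc i) = 2 * l - 1 - i" using i t2 tl unfolding e_def rv_def by auto
  ultimately show ?thesis unfolding Q_def by (simp add: rv_0)
qed

lemma N_rv: "t \<le> i \<Longrightarrow> i \<le> e \<Longrightarrow> N i (c \<circ> rv) = N (2 * l - i) c"
proof -
  assume i: "t \<le> i" "i \<le> e"
  obtain a where a: "i = t + a" using i(1) le_Suc_ex by blast
  obtain m where m: "l = t + m" using tl le_Suc_ex by blast
  have "e = t + 2 * m" unfolding e_def by (simp add: m)
  then have am: "a \<le> 2 * m" "i - t = a" "2 * l - i - t = 2 * m - a" using i(2) a m by auto
  have "even (i - t) \<longleftrightarrow> even (2 * l - i - t)" unfolding am(2,3) using am(1) by presburger
  moreover have "rv i = 2 * l - i" using i t2 tl unfolding e_def rv_def by auto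
  ultimately show ?thesis unfolding N_def by (simp add: rv_0)
qed

lemma fz_rv: "fz (c \<circ> rv) = fz c"
proof -
  have "(c \<circ> rv) \<circ> rv = c" using rv_rv by (auto simp: fun_eq_iff)
  moreover have "(\<Prod>i\<in>{t..<e}. Q i (c \<circ> rv)) = (\<Prod>i\<in>{t..<e}. Q i c)"
    by (rule prod.reindex_bij_witness[where i = "\<lambda>i. 2 * l - 1 - i" and j = "\<lambda>i. 2 * l - 1 - i"])
       (use t2 tl in \<open>auto simp: Q_rv e_def\<close>)
  moreover have "(\<Prod>i\<in>{t..e}. N i (c \<circ> rv)) = (\<Prod>i\<in>{t..e}. N i c)"
    by (rule prod.reindex_bij_witness[where i = "\<lambda>i. 2 * l - i" and j = "\<lambda>i. 2 * l - i"])
       (use t2 tl in \<open>auto simp: N_rv e_def\<close>)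
  ultimately show ?thesis unfolding fz_def by simp
qed

lemma TP_rv: "TP (Tr T) (c \<circ> rv) = TP T c"
  unfolding TP_def
proof (rule prod.reindex_bij_witness[where i = "\<lambda>i. 2 * l - 1 - i" and j = "\<lambda>i. 2 * l - 1 - i"])
  fix i assume i: "i \<in> {0..<2 * l}"
  have "rv (nx i) = 2 * l - 1 - i" "rv i = nx (2 * l - 1 - i)" using i l2 unfolding rv_def nx_def by auto
  then show "T (2 * l - 1 - i) (c (2 * l - 1 - i)) (c (nx (2 * l - 1 - i))) = Tr T i ((c \<circ> rv) i) ((c \<circ> rv) (nx i))"
    using i unfolding Tr_def by simp
qed auto

lemma tests_rv: "tests J T \<Longrightarrow> J \<subseteq> {..<2 * l} \<Longrightarrow> tests (rJ J) (Tr T)"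
  unfolding tests_def Tr_def rJ_def by (auto simp: fun_eq_iff)

lemma rJ_sub: "rJ J \<subseteq> {..<2 * l}" unfolding rJ_def by auto

lemma ang_flip: "ang (\<lambda>u v. T v u) = ang T"
  unfolding ang_def by (subst sum.swap) (simp add: rho_sym)

lemma rJ_image: "A \<subseteq> {0..<2 * l} \<Longrightarrow> bij_betw (\<lambda>i. 2 * l - 1 - i) (rJ J \<inter> A) (J \<inter> (\<lambda>i. 2 * l - 1 - i) ` A)"
proof -
  assume A: "A \<subseteq> {0..<2 * l}"
  have inv: "2 * l - 1 - (2 * l - 1 - x) = x" "x < 2 * l" if "x \<in> A" for x using A that by auto
  show ?thesis
    by (rule bij_betw_byWitness[where f' = "\<lambda>i. 2 * l - 1 - i"]) (use inv in \<open>auto simp: rJ_def\<close>)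
qed

lemma rJ_card: "A \<subseteq> {0..<2 * l} \<Longrightarrow> card (rJ J \<inter> A) = card (J \<inter> (\<lambda>i. 2 * l - 1 - i) ` A)"
  by (rule bij_betw_same_card[OF rJ_image])

lemma rJ_AJ: "A \<subseteq> {0..<2 * l} \<Longrightarrow> AJ (rJ J) (Tr T) A = AJ J T ((\<lambda>i. 2 * l - 1 - i) ` A)"
proof -
  assume A: "A \<subseteq> {0..<2 * l}"
  have "AJ (rJ J) (Tr T) A = (\<Prod>i\<in>rJ J \<inter> A. ang (T (2 * l - 1 - i)))"
    unfolding AJ_def
  proof (rule prod.cong[OF refl])
    fix i assume "i \<in> rJ J \<inter> A"
    then have "i < 2 * l" unfolding rJ_def by auto
    then show "ang (Tr T i) = ang (T (2 * l - 1 - i))" using ang_flip[of "T (2 * l - 1 - i)"] by (simp add: Tr_def)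
  qed
  also have "\<dots> = AJ J T ((\<lambda>i. 2 * l - 1 - i) ` A)"
    unfolding AJ_def by (rule prod.reindex_bij_betw[OF rJ_image[OF A]])
  finally show ?thesis .
qed

lemma refl_init: "(\<lambda>i. 2 * l - 1 - i) ` {0..<t} = {e..<2 * l}"
proof
  show "{e..<2 * l} \<subseteq> (\<lambda>i. 2 * l - 1 - i) ` {0..<t}"
  proof
    fix i assume "i \<in> {e..<2 * l}"
    then have "i = 2 * l - 1 - (2 * l - 1 - i)" "2 * l - 1 - i \<in> {0..<t}" using tl unfolding e_def by auto
    then show "i \<in> (\<lambda>i. 2 * l - 1 - i) ` {0..<t}" by blast
  qed
qed (use tl in \<open>auto simp: e_def\<close>)

lemma refl_fin: "(\<lambda>i. 2 * l - 1 - i) ` {e..<2 * l} = {0..<t}"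
proof
  show "{0..<t} \<subseteq> (\<lambda>i. 2 * l - 1 - i) ` {e..<2 * l}"
  proof
    fix i assume "i \<in> {0..<t}"
    then have "i = 2 * l - 1 - (2 * l - 1 - i)" "2 * l - 1 - i \<in> {e..<2 * l}" using tl t2 unfolding e_def by auto
    then show "i \<in> (\<lambda>i. 2 * l - 1 - i) ` {e..<2 * l}" by blast
  qed
qed (use tl t2 in \<open>auto simp: e_def\<close>)

lemma TP_split: "TP T c = (\<Prod>i\<in>{0..<t}. T i (c i) (c (Suc i))) * (\<Prod>i\<in>{t..<e}. T i (c i) (c (Suc i))) *
   (\<Prod>i\<in>{0..<t}. Tr T i ((c \<circ> rv) i) ((c \<circ> rv) (Suc i)))"
proof -
  let ?g = "\<lambda>i. T i (c i) (c (nx i))"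
  have "{0..<2 * l} = ({0..<t} \<union> {t..<e}) \<union> {e..<2 * l}" using t2 tl unfolding e_def by auto
  then have "TP T c = prod ?g (({0..<t} \<union> {t..<e}) \<union> {e..<2 * l})" unfolding TP_def by simp
  also have "\<dots> = prod ?g ({0..<t} \<union> {t..<e}) * prod ?g {e..<2 * l}" using te by (intro prod.union_disjoint) auto
  also have "prod ?g ({0..<t} \<union> {t..<e}) = prod ?g {0..<t} * prod ?g {t..<e}" by (intro prod.union_disjoint) auto
  also have "prod ?g {0..<t} = (\<Prod>i\<in>{0..<t}. T i (c i) (c (Suc i)))" using tl t2 by (intro prod.cong) (auto simp: nx_def)
  also have "prod ?g {t..<e} = (\<Prod>i\<in>{t..<e}. T i (c i) (c (Suc i)))" using tl t2 by (intro prod.cong) (auto simp: nx_def e_def)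
  also have "prod ?g {e..<2 * l} = (\<Prod>i\<in>{0..<t}. Tr T i ((c \<circ> rv) i) ((c \<circ> rv) (Suc i)))"
  proof (rule prod.reindex_bij_witness[where i = "\<lambda>i. 2 * l - 1 - i" and j = "\<lambda>i. 2 * l - 1 - i"])
    fix i assume i: "i \<in> {e..<2 * l}"
    have "rv (2 * l - 1 - i) = nx i" "rv (Suc (2 * l - 1 - i)) = i" "2 * l - 1 - (2 * l - 1 - i) = i" "2 * l - 1 - i < 2 * l"
      using i tl t2 unfolding rv_def nx_def e_def by auto
    then show "Tr T (2 * l - 1 - i) ((c \<circ> rv) (2 * l - 1 - i)) ((c \<circ> rv) (Suc (2 * l - 1 - i))) = ?g i"
      unfolding Tr_def by simp
  qed (use tl t2 in \<open>auto simp: e_def\<close>)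
  finally show ?thesis .
qed

text \<open>The cycle is a forward prefix up to \<open>e\<close> followed by a reversed walk; the
  spare factor \<open>inverse (N e c)\<close> conditions that walk on its ends.\<close>

lemma fz_TP: "fz c * TP T c = Fw T e c * (inverse (N e c) * WT (Tr T) (c \<circ> rv))"
proof -
  have "{t..e} = insert e {t..<e}" using te by auto
  then have 1: "(\<Prod>i\<in>{t..e}. N i c) = N e c * (\<Prod>i\<in>{t..<e}. N i c)" by simp
  have 2: "(\<Prod>i\<in>{t..<e}. Q i c / N i c * T i (c i) (c (Suc i))) = (\<Prod>i\<in>{t..<e}. Q i c) * inverse (\<Prod>i\<in>{t..<e}. N i c) * (\<Prod>i\<in>{t..<e}. T i (c i) (c (Suc i)))"
    by (simp only: prod.distrib prod_dividef) (simp only: divide_inverse)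
  show ?thesis unfolding fz_def TP_split Fw_def WT_def 1 2 by (simp add: mult_ac)
qed

text \<open>After reflection the closing walk is an opening walk, so all bounds for the initial
  block apply to it.\<close>

lemma last_sum:
  "isums V [Suc e..<2 * l] (\<lambda>c. inverse (N e c) * WT T (c \<circ> rv)) c = isums V [1..<t] (WT T) (c \<circ> rv) / q1 ((c \<circ> rv) 0) ((c \<circ> rv) t)"
proof -
  have "isums V [Suc e..<2 * l] (\<lambda>c. inverse (N e c) * WT T (c \<circ> rv)) c = inverse (N e c) * isums V [Suc e..<2 * l] (\<lambda>c. WT T (c \<circ> rv)) c"
    by (rule isums_factor[where A = "{0, e}"]) (auto simp: depends_on_def N_def)
  also have "isums V [Suc e..<2 * l] (\<lambda>c. WT T (c \<circ> rv)) c = isums V (map rv [Suc e..<2 * l]) (WT T) (c \<circ> rv)"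
    by (rule isums_involution) (rule rv_rv)
  also have "\<dots> = isums V [1..<t] (WT T) (c \<circ> rv)"
  proof (rule fun_cong[OF isums_set])
    have "rv ` {Suc e..<2 * l} = {1..<t}"
    proof (intro equalityI subsetI)
      fix x assume "x \<in> {1..<t}"
      then have "x = rv (2 * l - x)" "2 * l - x \<in> {Suc e..<2 * l}" using tl unfolding rv_def e_def by auto
      then show "x \<in> rv ` {Suc e..<2 * l}" by blast
    qed (use tl in \<open>auto simp: rv_def e_def\<close>)
    then show "set (map rv [Suc e..<2 * l]) = set [1..<t]" by simp
    show "distinct (map rv [Suc e..<2 * l])" by (auto simp: distinct_map inj_on_def rv_def)
  qed simp
  also have "N e c = q1 ((c \<circ> rv) 0) ((c \<circ> rv) t)" unfolding N_def using te rv_t by (simp add: rv_0)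
  finally show ?thesis by (simp only: divide_inverse mult.commute)
qed

lemma upt_mid: "k \<le> e \<Longrightarrow> t \<le> k \<Longrightarrow> [0..<Suc e] = [0..<Suc k] @ [Suc k..<Suc e]"
  using upt_add_eq_append[of 0 "Suc k" "e - k"] by (simp del: upt_Suc)

lemma peel_last:
  assumes T: "\<And>i u v. 0 \<le> T i u v" and b: "\<And>d. isums V [1..<t] (WT (Tr T)) d / q1 (d 0) (d t) \<le> \<phi>"
  shows "isums V [0..<2 * l] (\<lambda>c. fz c * TP T c) c \<le> \<phi> * isums V [0..<Suc e] (Fw T e) c"
proof -
  have u: "[0..<2 * l] = [0..<Suc e] @ [Suc e..<2 * l]"
    using upt_add_eq_append[of 0 "Suc e" "2 * l - Suc e"] te by (simp del: upt_Suc)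
  have "isums V [0..<2 * l] (\<lambda>c. fz c * TP T c) c = isums V [0..<Suc e] (isums V [Suc e..<2 * l] (\<lambda>c. Fw T e c * (inverse (N e c) * WT (Tr T) (c \<circ> rv)))) c"
    unfolding u isums_append fz_TP ..
  also have "\<dots> \<le> isums V [0..<Suc e] (\<lambda>c. \<phi> * Fw T e c) c"
  proof (rule isums_mono)
    fix c
    have "isums V [Suc e..<2 * l] (\<lambda>c. Fw T e c * (inverse (N e c) * WT (Tr T) (c \<circ> rv))) c = Fw T e c * isums V [Suc e..<2 * l] (\<lambda>c. inverse (N e c) * WT (Tr T) (c \<circ> rv)) c"
      by (rule isums_factor[OF dFw[OF te(1)]]) auto
    also have "\<dots> \<le> Fw T e c * \<phi>" unfolding last_sum by (rule mult_left_mono[OF b Fw_nonneg]) (rule T)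
    finally show "isums V [Suc e..<2 * l] (\<lambda>c. Fw T e c * (inverse (N e c) * WT (Tr T) (c \<circ> rv))) c \<le> \<phi> * Fw T e c" by (simp add: mult.commute)
  qed
  also have "\<dots> = \<phi> * isums V [0..<Suc e] (Fw T e) c" by (rule isums_cmult)
  finally show ?thesis .
qed

lemma peel_zig:
  assumes T: "tests J T" and k: "t \<le> k" "k \<le> e"
  shows "isums V [0..<Suc e] (Fw T e) c \<le> (\<Prod>i\<in>{k..<e}. if i \<in> J then zc i * ang (T i) else 1) * isums V [0..<Suc k] (Fw T k) c"
proof -
  have "isums V [0..<Suc e] (Fw T e) c \<le> isums V [0..<Suc k] (\<lambda>c. (\<Prod>i\<in>{k..<e}. if i \<in> J then zc i * ang (T i) else 1) * Fw T k c) c"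
    unfolding upt_mid[OF k(2,1)] isums_append by (rule isums_mono) (rule zig_peel[OF T k])
  then show ?thesis unfolding isums_cmult .
qed

definition s :: real where "s = n * D"

lemma s_facts: "1 \<le> n * D" "n \<le> n * D" "0 < n * D" "1 \<le> s" "n \<le> s" "0 < s"
proof -
  have "1 * 1 \<le> n * D" "n * 1 \<le> n * D" using n1 D1 by (intro mult_mono; simp)+
  then show "1 \<le> n * D" "n \<le> n * D" "0 < n * D" "1 \<le> s" "n \<le> s" "0 < s" unfolding s_def by auto
qed

lemma zc_le: "zc i \<le> c0 * s"
proof -
  have "c0 * n * (if even (i - t) then D else 1) \<le> c0 * n * D" using c0_facts n1 D1 by (intro mult_left_mono) auto
  then show ?thesis unfolding zc_def s_def by (simp add: mult.assoc)
qed

lemma zig_cost: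
  assumes T: "tests J T" and "finite A"
  shows "(\<Prod>i\<in>A. if i \<in> J then zc i * ang (T i) else 1) \<le> (c0 * s) ^ card (J \<inter> A) * AJ J T A"
proof -
  have "(\<Prod>i\<in>A. if i \<in> J then zc i * ang (T i) else 1) \<le> (\<Prod>i\<in>A. if i \<in> J then (c0 * s) * ang (T i) else 1)"
    using zc_le zc_pos ang_pos[OF T] by (intro prod_mono) (auto intro: mult_right_mono)
  then show ?thesis using cost_prod[OF assms(2), of J "c0 * s" T] by simp
qed

lemma AJ_un: "finite J \<Longrightarrow> A \<inter> B = {} \<Longrightarrow> AJ J T (A \<union> B) = AJ J T A * AJ J T B"
  unfolding AJ_def Int_Un_distrib by (intro prod.union_disjoint) auto

lemma card_un: "finite J \<Longrightarrow> A \<inter> B = {} \<Longrightarrow> card (J \<inter> (A \<union> B)) = card (J \<inter> A) + card (J \<inter> B)"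
  unfolding Int_Un_distrib by (intro card_Un_disjoint) auto

lemma J_split:
  assumes "J \<subseteq> {..<2 * l}"
  shows "card J = card (J \<inter> {0..<t}) + card (J \<inter> {t..<e}) + card (J \<inter> {e..<2 * l})"
    "AJ J T UNIV = AJ J T {0..<t} * AJ J T {t..<e} * AJ J T {e..<2 * l}"
proof -
  have fJ: "finite J" using assms finite_subset by blast
  have J: "J = J \<inter> (({0..<t} \<union> {t..<e}) \<union> {e..<2 * l})" using assms te by auto
  have d: "({0..<t} \<union> {t..<e}) \<inter> {e..<2 * l} = {}" "{0..<t} \<inter> {t..<e} = {}" using te by auto
  show "card J = card (J \<inter> {0..<t}) + card (J \<inter> {t..<e}) + card (J \<inter> {e..<2 * l})"
    using arg_cong[OF J, of card] unfolding card_un[OF fJ d(1)] card_un[OF fJ d(2)] .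
  have "AJ J T UNIV = AJ J T (({0..<t} \<union> {t..<e}) \<union> {e..<2 * l})" unfolding AJ_def using J by simp
  then show "AJ J T UNIV = AJ J T {0..<t} * AJ J T {t..<e} * AJ J T {e..<2 * l}"
    unfolding AJ_un[OF fJ d(1)] AJ_un[OF fJ d(2)] .
qed

section \<open>Case analysis over the positions of the tested steps\<close>

definition Z where "Z T c = isums V [0..<2 * l] (\<lambda>c. fz c * TP T c) c"

lemma cn_le: "C * n \<le> c0 * s" "0 \<le> C * n" "1 \<le> c0 * s"
proof -
  show "C * n \<le> c0 * s" using C1 n1 c0_facts s_facts by (intro mult_mono) auto
  show "0 \<le> C * n" using C1 n1 by simp
  have "1 * 1 \<le> c0 * s" using c0_facts s_facts by (intro mult_mono) auto
  then show "1 \<le> c0 * s" by simp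
qed

lemma initial_block_untested:
  assumes T: "tests J T" and J: "J \<inter> {0..<t} = {}"
  shows "isums V [1..<t] (WT T) c / q1 (c 0) (c t) \<le> 1"
proof -
  have "(\<Prod>i\<in>{0..<t}. T i (c i) (c (Suc i))) = 1" for c
  proof (rule prod.neutral, rule ballI)
    fix i assume "i \<in> {0..<t}"
    then have "i \<notin> J" using J by auto
    then show "T i (c i) (c (Suc i)) = 1" using testsD(2)[OF T] by simp
  qed
  then have "WT T = WW" unfolding WT_def by (intro ext) simp
  then show ?thesis using WW_q1[of c] by (cases "q1 (c 0) (c t) = 0") auto
qed

lemma initial_block_not_all_tested:
  assumes T: "tests J T" and J: "\<not> {0..<t} \<subseteq> J"
  shows "isums V [1..<t] (WT T) c / q1 (c 0) (c t) \<le> c0 * ((c0 * s) ^ card (J \<inter> {0..<t}) * AJ J T {0..<t})"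
proof (cases "J \<inter> {0..<t} = {}")
  case True
  then show ?thesis using initial_block_untested[OF T True, of c] c0_facts by (simp add: AJ_def)
next
  case False
  then show ?thesis using initial_block_partly_tested[OF T False J, of c] unfolding s_def by simp
qed

text \<open>The closing walk is summed out first; it is conditioned on its ends and therefore needs
  an untested step. Then the zigzag goes, each test at price at most \<open>c0 * s\<close>. The
  opening walk comes last with free ends, so its tests save one factor.\<close>

lemma case_forward:
  assumes T: "tests J T" and J: "J \<subseteq> {..<2 * l}" "J \<inter> {0..<t} \<noteq> {}" "\<not> {e..<2 * l} \<subseteq> J"
  shows "Z T c \<le> c0 * ((c0 * s) ^ (card J - 1) * AJ J T UNIV)"
proof -
  note T' = tests_rv[OF T J(1)]
  let ?k0 = "card (J \<inter> {0..<t})" and ?kz = "card (J \<inter> {t..<e})" and ?kf = "card (J \<inter> {e..<2 * l})"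
  have sub: "{0..<t} \<subseteq> {0..<2 * l}" using tl t2 by auto
  have nf: "\<not> {0..<t} \<subseteq> rJ J"
  proof
    assume h: "{0..<t} \<subseteq> rJ J"
    have "{e..<2 * l} \<subseteq> J"
    proof
      fix i assume "i \<in> {e..<2 * l}"
      then obtain j where "j \<in> {0..<t}" "i = 2 * l - 1 - j" unfolding refl_init[symmetric] by blast
      then show "i \<in> J" using h unfolding rJ_def by blast
    qed
    then show False using J(3) by blast
  qed
  have kf: "card (rJ J \<inter> {0..<t}) = ?kf" "AJ (rJ J) (Tr T) {0..<t} = AJ J T {e..<2 * l}"
    using rJ_card[OF sub] rJ_AJ[OF sub] unfolding refl_init by auto
  let ?\<phi> = "c0 * ((c0 * s) ^ ?kf * AJ J T {e..<2 * l})"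
  have p0: "0 \<le> ?\<phi>" using c0_facts s_facts AJ_nonneg[OF T] by (intro mult_nonneg_nonneg) auto
  have "Z T c \<le> ?\<phi> * isums V [0..<Suc e] (Fw T e) c"
    unfolding Z_def using initial_block_not_all_tested[OF T' nf] unfolding kf by (intro peel_last testsD(1)[OF T]) blast
  also have "\<dots> \<le> ?\<phi> * (((c0 * s) ^ ?kz * AJ J T {t..<e}) * ((c0 * s) ^ (?k0 - 1) * AJ J T {0..<t}))"
  proof (rule mult_left_mono[OF _ p0])
    have "isums V [0..<Suc e] (Fw T e) c \<le> (\<Prod>i\<in>{t..<e}. if i \<in> J then zc i * ang (T i) else 1) * isums V [0..<Suc t] (WT T) c"
      using peel_zig[OF T order_refl te(1), of c] unfolding Fw_t .
    also have "\<dots> \<le> ((c0 * s) ^ ?kz * AJ J T {t..<e}) * ((C * n) ^ (?k0 - 1) * AJ J T {0..<t})"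
    proof (rule mult_mono)
      show "0 \<le> isums V [0..<Suc t] (WT T) c" by (intro isums_nonneg WT_nonneg testsD[OF T])
      show "0 \<le> (c0 * s) ^ ?kz * AJ J T {t..<e}" using c0_facts s_facts AJ_nonneg[OF T] by (intro mult_nonneg_nonneg) auto
      show "isums V [0..<Suc t] (WT T) c \<le> (C * n) ^ (?k0 - 1) * AJ J T {0..<t}" by (rule WT_tests_le[OF T J(2)])
      show "(\<Prod>i\<in>{t..<e}. if i \<in> J then zc i * ang (T i) else 1) \<le> (c0 * s) ^ ?kz * AJ J T {t..<e}"
        by (rule zig_cost[OF T]) simp
    qed
    also have "\<dots> \<le> ((c0 * s) ^ ?kz * AJ J T {t..<e}) * ((c0 * s) ^ (?k0 - 1) * AJ J T {0..<t})"
      using c0_facts s_facts AJ_nonneg[OF T] cn_le C1 n1 by (intro mult_left_mono mult_right_mono power_mono mult_nonneg_nonneg) auto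
    finally show "isums V [0..<Suc e] (Fw T e) c \<le> ((c0 * s) ^ ?kz * AJ J T {t..<e}) * ((c0 * s) ^ (?k0 - 1) * AJ J T {0..<t})" .
  qed
  also have "\<dots> = c0 * ((c0 * s) ^ (?kf + ?kz + (?k0 - 1)) * AJ J T UNIV)"
    unfolding J_split(2)[OF J(1)] by (simp only: power_add mult_ac)
  also have "?kf + ?kz + (?k0 - 1) = card J - 1"
  proof -
    have "?k0 \<ge> 1" using J(2) by (simp add: Suc_le_eq card_gt_0_iff)
    then show ?thesis using J_split(1)[OF J(1)] by simp
  qed
  finally show ?thesis .
qed

lemma Z_mirror: "Z T c = Z (Tr T) (c \<circ> rv)"
proof -
  have "Z T c = isums V [0..<2 * l] (\<lambda>c. (\<lambda>c. fz c * TP (Tr T) c) (c \<circ> rv)) c"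
    unfolding Z_def fz_rv TP_rv ..
  also have "\<dots> = isums V (map rv [0..<2 * l]) (\<lambda>c. fz c * TP (Tr T) c) (c \<circ> rv)"
    by (rule isums_involution) (rule rv_rv)
  also have "\<dots> = Z (Tr T) (c \<circ> rv)" unfolding Z_def
  proof (rule fun_cong[OF isums_set])
    show "set (map rv [0..<2 * l]) = set [0..<2 * l]"
    proof -
      have "rv i < 2 * l" if "i < 2 * l" for i using that unfolding rv_def by auto
      then have "rv ` {0..<2 * l} \<subseteq> {0..<2 * l}" by auto
      moreover have "{0..<2 * l} \<subseteq> rv ` {0..<2 * l}"
        using calculation rv_rv by (metis image_eqI subsetI image_subset_iff)
      ultimately show ?thesis by auto
    qed
    show "distinct (map rv [0..<2 * l])" by (simp add: distinct_map) (metis inj_onI rv_rv)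
  qed simp
  finally show ?thesis .
qed

lemma AJ_UNIV_rv: "J \<subseteq> {..<2 * l} \<Longrightarrow> AJ (rJ J) (Tr T) UNIV = AJ J T UNIV" "J \<subseteq> {..<2 * l} \<Longrightarrow> card (rJ J) = card J"
proof -
  assume J: "J \<subseteq> {..<2 * l}"
  have im: "(\<lambda>i. 2 * l - 1 - i) ` {0..<2 * l} = {0..<2 * l}"
  proof
    show "{0..<2 * l} \<subseteq> (\<lambda>i. 2 * l - 1 - i) ` {0..<2 * l}"
    proof
      fix i assume "i \<in> {0..<2 * l}"
      then have "i = 2 * l - 1 - (2 * l - 1 - i)" "2 * l - 1 - i \<in> {0..<2 * l}" by auto
      then show "i \<in> (\<lambda>i. 2 * l - 1 - i) ` {0..<2 * l}" by blast
    qed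
  qed auto
  have "rJ J \<inter> {0..<2 * l} = rJ J" "J \<inter> {0..<2 * l} = J" using J rJ_sub[of J] by auto
  then show "AJ (rJ J) (Tr T) UNIV = AJ J T UNIV" "card (rJ J) = card J"
    using rJ_AJ[of "{0..<2 * l}" J T] rJ_card[of "{0..<2 * l}" J] unfolding im AJ_def by auto
qed

lemma case_backward:
  assumes T: "tests J T" and J: "J \<subseteq> {..<2 * l}" "J \<inter> {e..<2 * l} \<noteq> {}" "\<not> {0..<t} \<subseteq> J"
  shows "Z T c \<le> c0 * ((c0 * s) ^ (card J - 1) * AJ J T UNIV)"
proof -
  have "Z (Tr T) (c \<circ> rv) \<le> c0 * ((c0 * s) ^ (card (rJ J) - 1) * AJ (rJ J) (Tr T) UNIV)"
  proof (rule case_forward[OF tests_rv[OF T J(1)] rJ_sub])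
    obtain i where i: "i \<in> J" "i \<in> {e..<2 * l}" using J(2) by blast
    then obtain j where "j \<in> {0..<t}" "i = 2 * l - 1 - j" unfolding refl_init[symmetric] by blast
    then have "j \<in> rJ J \<inter> {0..<t}" using i tl unfolding rJ_def by auto
    then show "rJ J \<inter> {0..<t} \<noteq> {}" by blast
    obtain i where i: "i \<notin> J" "i \<in> {0..<t}" using J(3) by blast
    then obtain j where "j \<in> {e..<2 * l}" "i = 2 * l - 1 - j" unfolding refl_fin[symmetric] by blast
    then show "\<not> {e..<2 * l} \<subseteq> rJ J" using i unfolding rJ_def by auto
  qed
  then show ?thesis unfolding Z_mirror[of T c] AJ_UNIV_rv[OF J(1)] .
qed

text \<open>Everything before the first tested step \<open>i0\<close> is summed out by stationarity.
  Summed over \<open>c 0\<close>, the law of step \<open>i0\<close> itself is at most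
  \<open>\<rho>\<close>, so the first test costs only its \<open>ang\<close>.\<close>

lemma case_zig:
  assumes T: "tests J T" and J: "J \<subseteq> {t..<e}" "J \<noteq> {}"
  shows "Z T c \<le> c0 * ((c0 * s) ^ (card J - 1) * AJ J T UNIV)"
proof -
  have J2: "J \<subseteq> {..<2 * l}" using J(1) te by auto
  have fJ: "finite J" using J(1) finite_subset by blast
  note T' = tests_rv[OF T J2]
  define i0 where "i0 = Min J"
  have i0: "i0 \<in> J" "\<And>i. i \<in> J \<Longrightarrow> i0 \<le> i" using fJ J(2) unfolding i0_def by auto
  have i0t: "t \<le> i0" "i0 < e" using i0(1) J(1) by auto
  have emp: "rJ J \<inter> {0..<t} = {}"
  proof (rule ccontr)
    assume "rJ J \<inter> {0..<t} \<noteq> {}"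
    then obtain x where "x \<in> rJ J" "x \<in> {0..<t}" by blast
    then have x: "x < t" "2 * l - 1 - x \<in> J" unfolding rJ_def by auto
    then have "2 * l - 1 - x < 2 * l - t" using J(1) unfolding e_def by auto
    then show False using x(1) tl by linarith
  qed
  have "Z T c \<le> 1 * isums V [0..<Suc e] (Fw T e) c"
    unfolding Z_def using initial_block_untested[OF T' emp] by (intro peel_last testsD(1)[OF T]) blast
  also have "\<dots> \<le> (\<Prod>i\<in>{Suc i0..<e}. if i \<in> J then zc i * ang (T i) else 1) * isums V [0..<Suc (Suc i0)] (Fw T (Suc i0)) c"
    using peel_zig[OF T, of "Suc i0" c] i0t by simp
  also have "\<dots> \<le> ((c0 * s) ^ card (J \<inter> {Suc i0..<e}) * AJ J T {Suc i0..<e}) * ang (T i0)"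
  proof (rule mult_mono)
    show "0 \<le> isums V [0..<Suc (Suc i0)] (Fw T (Suc i0)) c" by (intro isums_nonneg Fw_nonneg testsD[OF T])
    show "0 \<le> (c0 * s) ^ card (J \<inter> {Suc i0..<e}) * AJ J T {Suc i0..<e}" using c0_facts s_facts AJ_nonneg[OF T] by (intro mult_nonneg_nonneg) auto
    show "(\<Prod>i\<in>{Suc i0..<e}. if i \<in> J then zc i * ang (T i) else 1) \<le> (c0 * s) ^ card (J \<inter> {Suc i0..<e}) * AJ J T {Suc i0..<e}"
      by (rule zig_cost[OF T]) simp
    show "isums V [0..<Suc (Suc i0)] (Fw T (Suc i0)) c \<le> ang (T i0)"
    proof -
      let ?T = "T i0" and ?F = "Fw (\<lambda>_ _ _. 1)"
      have Ti: "T i = (\<lambda>_ _. 1)" if "i < i0" for i using testsD(2)[OF T] i0(2)[of i] that by force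
      have F0: "Fw T i0 c = ?F i0 c" for c unfolding Fw_def WT_def using Ti i0t by simp
      have FS: "Fw T (Suc i0) = (\<lambda>c. (Q i0 c / N i0 c * ?T (c i0) (c (Suc i0))) * ?F i0 c)"
        by (rule ext) (simp add: Fw_Suc[OF i0t(1)] F0 mult.commute)
      have "isums V [0..<Suc (Suc i0)] (Fw T (Suc i0)) c = isums V ([0, i0, Suc i0] @ [1..<i0]) (Fw T (Suc i0)) c"
        by (rule fun_cong[OF isums_set]) (use i0t t2 in auto)
      also have "\<dots> = isums V [0, i0, Suc i0] (\<lambda>c. Q i0 c * ?T (c i0) (c (Suc i0))) c"
      proof -
        have "isums V [1..<i0] (Fw T (Suc i0)) = (\<lambda>c. (Q i0 c / N i0 c * ?T (c i0) (c (Suc i0))) * isums V [1..<i0] (?F i0) c)"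
          unfolding FS by (rule ext, rule isums_factor[where A = "{0, i0, Suc i0}"]) (auto simp: depends_on_def Q_def N_def)
        also have "\<dots> = (\<lambda>c. Q i0 c * ?T (c i0) (c (Suc i0)))"
          unfolding Fw_stationary[OF i0t(1)] using Q_N[of i0] by (auto simp: fun_eq_iff)
        finally show ?thesis unfolding isums_append by simp
      qed
      also have "\<dots> = (\<Sum>x\<in>V. \<Sum>u\<in>V. \<Sum>v\<in>V. (if even (i0 - t) then q x v u else q x u v) * ?T u v)"
      proof -
        have "i0 \<noteq> 0" using i0t t2 by auto
        then show ?thesis by (simp add: isum_def Q_def cong: if_cong)
      qed
      also have "\<dots> = (\<Sum>u\<in>V. \<Sum>v\<in>V. \<Sum>x\<in>V. (if even (i0 - t) then q x v u else q x u v) * ?T u v)"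
        by (subst sum.swap, rule sum.cong[OF refl], rule sum.swap)
      also have "\<dots> = (\<Sum>u\<in>V. \<Sum>v\<in>V. (\<Sum>x\<in>V. (if even (i0 - t) then q x v u else q x u v)) * ?T u v)"
        by (simp only: sum_distrib_right)
      also have "\<dots> \<le> (\<Sum>u\<in>V. \<Sum>v\<in>V. \<rho> u v * ?T u v)"
      proof (intro sum_mono mult_right_mono testsD[OF T])
        fix u v
        have qs: "(\<Sum>x\<in>V. q x z y) \<le> \<rho> z y" for z y
        proof -
          have "(\<Sum>x\<in>V. q x z y) \<le> (\<Sum>x\<in>V. pm (t - 1) x z * R z y)" by (intro sum_mono q_le)
          also have "\<dots> = pp z * R z y" by (simp only: sum_distrib_right[symmetric] pm_col)
          finally show ?thesis by (simp only: pp_R)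
        qed
        show "(\<Sum>x\<in>V. (if even (i0 - t) then q x v u else q x u v)) \<le> \<rho> u v"
          using qs[of v u] qs[of u v] rho_sym[of u v] by (cases "even (i0 - t)") simp_all
      qed
      finally show ?thesis unfolding ang_def .
    qed
  qed
  also have "\<dots> \<le> c0 * ((c0 * s) ^ (card J - 1) * AJ J T UNIV)"
  proof -
    have JJ: "J \<inter> {Suc i0..<e} = J - {i0}" using i0 J(1) by (auto simp: Suc_le_eq order_less_le)
    have "AJ J T UNIV = ang (T i0) * AJ J T {Suc i0..<e}"
      unfolding AJ_def JJ Int_UNIV_right by (rule prod.remove[OF fJ i0(1)])
    moreover have "card (J \<inter> {Suc i0..<e}) = card J - 1" unfolding JJ using i0 fJ by (simp add: card_Diff_singleton)
    ultimately have "((c0 * s) ^ card (J \<inter> {Suc i0..<e}) * AJ J T {Suc i0..<e}) * ang (T i0) = (c0 * s) ^ (card J - 1) * AJ J T UNIV"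
      by (simp only: mult_ac)
    moreover have "0 \<le> (c0 * s) ^ (card J - 1) * AJ J T UNIV" using c0_facts s_facts AJ_nonneg[OF T] by (intro mult_nonneg_nonneg) auto
    moreover have "x \<le> c0 * x" if "0 \<le> x" for x using mult_right_mono[OF c0_facts(1) that] by simp
    ultimately show ?thesis by metis
  qed
  finally show ?thesis .
qed

end

lemma isums_mono_on:
  assumes "\<And>c'. (\<And>j. j \<notin> set is \<Longrightarrow> c' j = c j) \<Longrightarrow> f c' \<le> g c'"
  shows "isums V is f c \<le> isums V is g c"
  using assms
proof (induction "is" arbitrary: c)
  case (Cons i "is")
  show ?case unfolding isums.simps isum_def
  proof (rule sum_mono, rule Cons.IH)
    fix v c' assume h: "\<And>j. j \<notin> set is \<Longrightarrow> c' j = (c(i := v)) j"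
    show "f c' \<le> g c'" by (rule Cons.prems) (use h in auto)
  qed
qed auto

context zigzag begin

text \<open>Without a gap no density bound helps: each fixed end costs
  \<open>1 / pp \<le> C * n\<close>. The factor \<open>1 / lev t\<close> is kept because it is
  needed in \<open>case_all\<close>.\<close>

lemma initial_block_all_tested_div:
  assumes T: "tests J T" and J: "{0..<t} \<subseteq> J"
  shows "isums V [1..<t] (WT T) c / q1 (c 0) (c t) \<le> c0 * (C * n) ^ (t + 1) / lev t * AJ J T {0..<t}"
proof (cases "q1 (c 0) (c t) = 0")
  case True
  have "0 \<le> c0 * (C * n) ^ (t + 1) / lev t * AJ J T {0..<t}"
    using c0_facts cn_le AJ_nonneg[OF T] lev_nonneg by (intro mult_nonneg_nonneg divide_nonneg_nonneg) auto
  then show ?thesis using True by simp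
next
  case False
  let ?x = "c 0" and ?y = "c t" and ?A = "AJ J T {0..<t}"
  note p = q1_pos[OF False]
  have A0: "0 \<le> ?A" by (rule AJ_nonneg[OF T])
  have L: "lev t > 0" using lev_ge1[of t] by simp
  have den: "0 < \<delta> / 2 * lev t * pp ?x * pp ?y" using p delta_pos L by simp
  have X0: "0 \<le> isums V [1..<t] (WT T) c" by (intro isums_nonneg WT_nonneg testsD[OF T])
  have "isums V [1..<t] (WT T) c / q1 ?x ?y \<le> ((C * n) ^ (t - 1) * ?A) / (\<delta> / 2 * lev t * pp ?x * pp ?y)"
    using initial_block_all_tested[OF T J, of c] p den X0 by (intro frac_le) auto
  also have "\<dots> = (2 / \<delta>) * ((C * n) ^ (t - 1) / lev t * ?A) * ((1 / pp ?x) * (1 / pp ?y))"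
    using p delta_pos L by (simp add: field_simps)
  also have "\<dots> \<le> c0 * ((C * n) ^ (t - 1) / lev t * ?A) * ((C * n) * (C * n))"
    using c0_facts p pp_low[of ?x] pp_low[of ?y] cn_le A0 L delta_pos C1 n1
    by (intro mult_mono mult_right_mono mult_nonneg_nonneg divide_nonneg_nonneg) auto
  also have "\<dots> = c0 * ((C * n) ^ (t - 1) * (C * n) * (C * n)) / lev t * ?A" by (simp add: field_simps)
  also have "(C * n) ^ (t - 1) * (C * n) * (C * n) = (C * n) ^ (t + 1)"
  proof -
    have "t + 1 = Suc (Suc (t - 1))" using t2 by simp
    then show ?thesis by (simp only: power_Suc2)
  qed
  finally show ?thesis .
qed

text \<open>Only the steps from \<open>y\<close> to \<open>z\<close>, every second one, cost a
  factor \<open>D\<close>.\<close>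

lemma zc_prod: "(\<Prod>i\<in>{t..<t + 2 * m}. zc i) = (c0 * n) ^ (2 * m) * D ^ m"
proof (induction m)
  case (Suc m)
  have "{t..<t + 2 * Suc m} = insert (t + 2 * m) (insert (Suc (t + 2 * m)) {t..<t + 2 * m})" by auto
  then have "(\<Prod>i\<in>{t..<t + 2 * Suc m}. zc i) = zc (t + 2 * m) * (zc (Suc (t + 2 * m)) * (\<Prod>i\<in>{t..<t + 2 * m}. zc i))" by simp
  also have "\<dots> = (c0 * n * D) * ((c0 * n) * ((c0 * n) ^ (2 * m) * D ^ m))" unfolding Suc unfolding zc_def by simp
  also have "\<dots> = (c0 * n) ^ (2 * Suc m) * D ^ Suc m" by simp
  finally show ?case .
qed simp

lemma s_pow: "s ^ (2 * l - 1) = n ^ (2 * l)"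
proof -
  have "s ^ (2 * l - 1) = n ^ (2 * l - 1) * n" unfolding s_def power_mult_distrib Dn ..
  also have "\<dots> = n ^ (2 * l)" using l2 by (metis One_nat_def Suc_pred mult_pos_pos power_Suc2 zero_less_numeral less_le_trans)
  finally show ?thesis .
qed

text \<open>The \<open>l - t\<close> factors \<open>D\<close> of the zigzag cancel exactly against
  \<open>lev t\<close>, and \<open>n ^ (2 * l) = s ^ (2 * l - 1)\<close>. The uniform bound
  \<open>zc i \<le> c0 * s\<close> would be too weak here when \<open>t < l\<close>.\<close>

lemma case_all:
  assumes T: "tests {..<2 * l} T"
  shows "Z T c \<le> c0 ^ (2 * l + 1) * (s ^ (2 * l - 1) * AJ {..<2 * l} T UNIV)"
proof -
  let ?J = "{..<2 * l}"
  note T' = tests_rv[OF T order_refl]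
  have sub: "{0..<t} \<subseteq> {0..<2 * l}" using tl t2 by auto
  have full: "{0..<t} \<subseteq> rJ ?J" using sub unfolding rJ_def by auto
  have kf: "AJ (rJ ?J) (Tr T) {0..<t} = AJ ?J T {e..<2 * l}" using rJ_AJ[OF sub] unfolding refl_init by auto
  let ?\<phi> = "c0 * (C * n) ^ (t + 1) / lev t * AJ ?J T {e..<2 * l}"
  have L: "lev t > 0" using lev_ge1[of t] by simp
  have p0: "0 \<le> ?\<phi>" using c0_facts cn_le AJ_nonneg[OF T] L by (intro mult_nonneg_nonneg divide_nonneg_nonneg) auto
  have em: "e = t + 2 * (l - t)" using tl unfolding e_def by simp
  have "Z T c \<le> ?\<phi> * isums V [0..<Suc e] (Fw T e) c"
    unfolding Z_def using initial_block_all_tested_div[OF T' full] unfolding kf by (intro peel_last testsD(1)[OF T]) blast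
  also have "\<dots> \<le> ?\<phi> * (((c0 * n) ^ (2 * (l - t)) * D ^ (l - t) * AJ ?J T {t..<e}) * ((C * n) ^ (t - 1) * AJ ?J T {0..<t}))"
  proof (rule mult_left_mono[OF _ p0])
    have "isums V [0..<Suc e] (Fw T e) c \<le> (\<Prod>i\<in>{t..<e}. if i \<in> ?J then zc i * ang (T i) else 1) * isums V [0..<Suc t] (WT T) c"
      using peel_zig[OF T order_refl te(1), of c] unfolding Fw_t .
    also have "(\<Prod>i\<in>{t..<e}. if i \<in> ?J then zc i * ang (T i) else 1) = (\<Prod>i\<in>{t..<e}. zc i * ang (T i))"
      using te by (intro prod.cong) auto
    also have "\<dots> = (\<Prod>i\<in>{t..<e}. zc i) * AJ ?J T {t..<e}"
    proof -
      have "?J \<inter> {t..<e} = {t..<e}" using te by auto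
      then show ?thesis unfolding AJ_def by (simp add: prod.distrib)
    qed
    also have "(\<Prod>i\<in>{t..<e}. zc i) = (c0 * n) ^ (2 * (l - t)) * D ^ (l - t)" using zc_prod[of "l - t"] em by simp
    also have "(c0 * n) ^ (2 * (l - t)) * D ^ (l - t) * AJ ?J T {t..<e} * isums V [0..<Suc t] (WT T) c \<le>
       (c0 * n) ^ (2 * (l - t)) * D ^ (l - t) * AJ ?J T {t..<e} * ((C * n) ^ (t - 1) * AJ ?J T {0..<t})"
    proof (rule mult_left_mono)
      have "?J \<inter> {0..<t} = {0..<t}" using sub by auto
      then have "card (?J \<inter> {0..<t}) = t" "?J \<inter> {0..<t} \<noteq> {}" using t2 by auto
      then show "isums V [0..<Suc t] (WT T) c \<le> (C * n) ^ (t - 1) * AJ ?J T {0..<t}" using WT_tests_le[OF T, of c] by simp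
      show "0 \<le> (c0 * n) ^ (2 * (l - t)) * D ^ (l - t) * AJ ?J T {t..<e}"
        using c0_facts n1 D1 AJ_nonneg[OF T] by (intro mult_nonneg_nonneg) auto
    qed
    finally show "isums V [0..<Suc e] (Fw T e) c \<le> ((c0 * n) ^ (2 * (l - t)) * D ^ (l - t) * AJ ?J T {t..<e}) * ((C * n) ^ (t - 1) * AJ ?J T {0..<t})" .
  qed
  also have "\<dots> = c0 * ((C * n) ^ (t + 1) * (C * n) ^ (t - 1) * (c0 * n) ^ (2 * (l - t))) * AJ ?J T UNIV"
  proof -
    have "lev t = D ^ (l - t)" unfolding lev_def ..
    then show ?thesis unfolding J_split(2)[OF order_refl] using L D1 by (simp add: field_simps)
  qed
  also have "\<dots> \<le> c0 * (c0 * n) ^ (2 * l) * AJ ?J T UNIV"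
  proof (intro mult_right_mono mult_left_mono AJ_nonneg[OF T])
    have cn: "C * n \<le> c0 * n" "0 \<le> c0 * n" using c0_facts n1 by auto
    have "(C * n) ^ (t + 1) * (C * n) ^ (t - 1) * (c0 * n) ^ (2 * (l - t)) \<le> (c0 * n) ^ (t + 1) * (c0 * n) ^ (t - 1) * (c0 * n) ^ (2 * (l - t))"
      using cn cn_le C1 n1 by (intro mult_mono mult_right_mono power_mono mult_nonneg_nonneg) auto
    also have "\<dots> = (c0 * n) ^ (2 * l)"
    proof -
      have "2 * l = (t + 1) + (t - 1) + 2 * (l - t)" using t2 tl by simp
      then show ?thesis by (metis power_add)
    qed
    finally show "(C * n) ^ (t + 1) * (C * n) ^ (t - 1) * (c0 * n) ^ (2 * (l - t)) \<le> (c0 * n) ^ (2 * l)" .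
  qed (use c0_facts in auto)
  also have "\<dots> = c0 ^ (2 * l + 1) * (s ^ (2 * l - 1) * AJ ?J T UNIV)"
    unfolding s_pow by (simp add: power_mult_distrib)
  finally show ?thesis .
qed

text \<open>Cuts the cycle at a zigzag step into a forward prefix and a reflected one. Apart from
  the link between them they share only the position \<open>0\<close>.\<close>

lemma fz_split:
  assumes i0: "t \<le> i0" "i0 < e"
  shows "fz c * TP T c = Fw T i0 c * (Q i0 c * inverse (N i0 c * N (Suc i0) c) * T i0 (c i0) (c (Suc i0))) * Fw (Tr T) (2 * l - 1 - i0) (c \<circ> rv)"
proof -
  let ?k = "2 * l - 1 - i0"
  have F2: "Fw (Tr T) ?k (c \<circ> rv) = WT (Tr T) (c \<circ> rv) * ((\<Prod>i\<in>{Suc i0..<e}. Q i c) * inverse (\<Prod>i\<in>{Suc (Suc i0)..e}. N i c) * (\<Prod>i\<in>{Suc i0..<e}. T i (c i) (c (Suc i))))"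
  proof -
    have "(\<Prod>j\<in>{t..<?k}. Q j (c \<circ> rv) / N j (c \<circ> rv) * Tr T j ((c \<circ> rv) j) ((c \<circ> rv) (Suc j))) = (\<Prod>i\<in>{Suc i0..<e}. Q i c / N (Suc i) c * T i (c i) (c (Suc i)))"
    proof (rule prod.reindex_bij_witness[where i = "\<lambda>i. 2 * l - 1 - i" and j = "\<lambda>i. 2 * l - 1 - i"])
      fix j assume j: "j \<in> {t..<?k}"
      have jr: "t \<le> j" "j < e" using j i0 tl unfolding e_def by auto
      have "2 * l - j = Suc (2 * l - 1 - j)" "rv j = Suc (2 * l - 1 - j)" "rv (Suc j) = 2 * l - 1 - j" "j < 2 * l"
        using j t2 tl i0 unfolding rv_def e_def by auto
      then show "Q (2 * l - 1 - j) c / N (Suc (2 * l - 1 - j)) c * T (2 * l - 1 - j) (c (2 * l - 1 - j)) (c (Suc (2 * l - 1 - j))) = Q j (c \<circ> rv) / N j (c \<circ> rv) * Tr T j ((c \<circ> rv) j) ((c \<circ> rv) (Suc j))"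
        using Q_rv[OF jr] N_rv[of j c] jr unfolding Tr_def by simp
    qed (use i0 tl t2 in \<open>auto simp: e_def\<close>)
    also have "\<dots> = (\<Prod>i\<in>{Suc i0..<e}. Q i c) * inverse (\<Prod>i\<in>{Suc i0..<e}. N (Suc i) c) * (\<Prod>i\<in>{Suc i0..<e}. T i (c i) (c (Suc i)))"
      by (simp only: prod.distrib prod_dividef) (simp only: divide_inverse)
    also have "(\<Prod>i\<in>{Suc i0..<e}. N (Suc i) c) = (\<Prod>i\<in>{Suc (Suc i0)..e}. N i c)"
      by (rule prod.reindex_bij_witness[where i = "\<lambda>i. i - 1" and j = Suc]) auto
    finally show ?thesis unfolding Fw_def by (simp only:)
  qed
  have sp: "prod g {t..<e} = prod g {t..<i0} * g i0 * prod g {Suc i0..<e}" for g :: "nat \<Rightarrow> real"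
  proof -
    have "{t..<e} = insert i0 ({t..<i0} \<union> {Suc i0..<e})" using i0 by auto
    then have "prod g {t..<e} = g i0 * prod g ({t..<i0} \<union> {Suc i0..<e})" by simp
    also have "prod g ({t..<i0} \<union> {Suc i0..<e}) = prod g {t..<i0} * prod g {Suc i0..<e}" by (rule prod.union_disjoint) auto
    finally show ?thesis by (simp add: mult_ac)
  qed
  have spN: "(\<Prod>i\<in>{t..e}. N i c) = (\<Prod>i\<in>{t..<i0}. N i c) * (N i0 c * N (Suc i0) c) * (\<Prod>i\<in>{Suc (Suc i0)..e}. N i c)"
  proof -
    have "{t..e} = insert i0 (insert (Suc i0) ({t..<i0} \<union> {Suc (Suc i0)..e}))" using i0 by auto
    then have "(\<Prod>i\<in>{t..e}. N i c) = N i0 c * (N (Suc i0) c * (\<Prod>i\<in>{t..<i0} \<union> {Suc (Suc i0)..e}. N i c))" by simp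
    also have "(\<Prod>i\<in>{t..<i0} \<union> {Suc (Suc i0)..e}. N i c) = (\<Prod>i\<in>{t..<i0}. N i c) * (\<Prod>i\<in>{Suc (Suc i0)..e}. N i c)" by (rule prod.union_disjoint) auto
    finally show ?thesis by (simp add: mult_ac)
  qed
  have F1: "Fw T i0 c = WT T c * ((\<Prod>i\<in>{t..<i0}. Q i c) * inverse (\<Prod>i\<in>{t..<i0}. N i c) * (\<Prod>i\<in>{t..<i0}. T i (c i) (c (Suc i))))"
    unfolding Fw_def by (simp only: prod.distrib prod_dividef) (simp only: divide_inverse)
  show ?thesis unfolding F1 F2 fz_def TP_split WT_def spN sp[of "\<lambda>i. Q i c"] sp[of "\<lambda>i. T i (c i) (c (Suc i))"]
    by (simp add: mult_ac)
qed

text \<open>Density of a zigzag step relative to independent ends for fixed \<open>c 0\<close>: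
  \<open>\<rho>\<close> contributes \<open>lev 1\<close>, the mass of \<open>c 0\<close> a factor
  \<open>C * n\<close>, and conditioning divides by \<open>lev t\<close>; finally
  \<open>lev 1 / lev t = D ^ (t - 1)\<close>.\<close>

lemma link_le: assumes "t \<le> i" shows "Q i c * inverse (N i c * N (Suc i) c) \<le> c0^2 * (n * D ^ (t - 1))"
proof -
  have core: "q x z y * inverse (q1 x y * q2 x z) \<le> c0^2 * (n * D ^ (t - 1))" for x z y
  proof (cases "q x z y = 0")
    case True
    then show ?thesis using c0_facts n1 D1 by simp
  next
    case False
    note s = q_supp[OF False]
    have q1: "q1 x y \<ge> \<delta> / 2 * lev t * pp x * pp y" using False q_le_q1[of x z y] q_nonneg[of x z y] by (intro q1_pos) auto
    have L: "lev t > 0" using lev_ge1[of t] by simp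
    have den: "0 < \<delta> / 2 * lev t * pp x * pp y" using s delta_pos L by simp
    have "q x z y * inverse (q1 x y * q2 x z) = (q x z y / q2 x z) / q1 x y" by (simp add: divide_inverse)
    also have "\<dots> \<le> (R z y / \<delta>) / (\<delta> / 2 * lev t * pp x * pp y)"
      by (rule frac_le[OF _ step_y den q1]) (use R_nonneg delta_pos in auto)
    also have "\<dots> = (2 / \<delta>^2) / lev t * ((\<rho> z y / (pp z * pp y)) * (1 / pp x))"
      unfolding R_def using s delta_pos L by (simp add: field_simps power2_eq_square)
    also have "\<dots> \<le> (2 / \<delta>^2) / lev t * ((C^2 * lev 1) * (C * n))"
    proof (intro mult_left_mono mult_mono)
      show "\<rho> z y / (pp z * pp y) \<le> C^2 * lev 1" using rho_lev[of z y] s by (simp add: field_simps)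
      show "1 / pp x \<le> C * n" using pp_low[of x] s by auto
    qed (use s L lev_nonneg in auto)
    also have "\<dots> = (2 * C^3 / \<delta>^2) * (n * (lev 1 / lev t))" by (simp add: power2_eq_square power3_eq_cube)
    also have "lev 1 / lev t = D ^ (t - 1)"
    proof -
      have "l - 1 = (t - 1) + (l - t)" using tl t2 by simp
      then have "lev 1 = D ^ (t - 1) * lev t" unfolding lev_def by (metis power_add)
      then show ?thesis using L by simp
    qed
    also have "(2 * C^3 / \<delta>^2) * (n * D ^ (t - 1)) \<le> c0^2 * (n * D ^ (t - 1))"
    proof (rule mult_right_mono)
      have "C^3 \<le> C^8" using C1 by (intro power_increasing) auto
      moreover have "0 \<le> C^8" using C1 by simp
      ultimately have "2 * C^3 \<le> 4 * C^8" by linarith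
      then have "2 * C^3 / \<delta>^2 \<le> 4 * C^8 / \<delta>^2" by (intro divide_right_mono) auto
      also have "\<dots> = c0^2" unfolding c0_def by (simp add: power_divide power_mult_distrib power_mult[symmetric])
      finally show "2 * C^3 / \<delta>^2 \<le> c0^2" .
    qed (use n1 D1 in auto)
    finally show ?thesis .
  qed
  show ?thesis
  proof (cases "even (i - t)")
    case True
    then show ?thesis using core[of "c 0" "c (Suc i)" "c i"] assms unfolding Q_def N_def by simp
  next
    case False
    then show ?thesis using core[of "c 0" "c i" "c (Suc i)"] assms unfolding Q_def N_def by (simp add: mult.commute)
  qed
qed

text \<open>Both end walks are fully tested, so neither can be conditioned on its ends at the right
  price. Cutting at the untested zigzag step frees one end of each, and each saves a factor
  \<open>n\<close>. One of these pays the \<open>n\<close> of the link, and the tested steps absorb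
  its \<open>D ^ (t - 1)\<close>.\<close>

lemma case_split:
  assumes T: "tests J T" and J: "J \<subseteq> {..<2 * l}" "{0..<t} \<subseteq> J" "{e..<2 * l} \<subseteq> J" and i0: "t \<le> i0" "i0 < e" "i0 \<notin> J"
  shows "Z T c \<le> c0^2 * ((c0 * s) ^ (card J - 1) * AJ J T UNIV)"
proof -
  let ?k = "2 * l - 1 - i0"
  note T' = tests_rv[OF T J(1)]
  have fJ: "finite J" using J(1) finite_subset by blast
  have k: "t \<le> ?k" "?k < e" using i0 tl unfolding e_def by auto
  have sub: "{0..<t} \<subseteq> {0..<2 * l}" "{t..<?k} \<subseteq> {0..<2 * l}" using tl t2 by auto
  have rim: "(\<lambda>i. 2 * l - 1 - i) ` {t..<?k} = {Suc i0..<e}"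
  proof (intro equalityI subsetI)
    fix x assume "x \<in> {Suc i0..<e}"
    then have "x = 2 * l - 1 - (2 * l - 1 - x)" "2 * l - 1 - x \<in> {t..<?k}" using i0 tl unfolding e_def by auto
    then show "x \<in> (\<lambda>i. 2 * l - 1 - i) ` {t..<?k}" by blast
  qed (use i0 tl in \<open>auto simp: e_def\<close>)
  have rf: "card (rJ J \<inter> {0..<t}) = card (J \<inter> {e..<2 * l})" "AJ (rJ J) (Tr T) {0..<t} = AJ J T {e..<2 * l}"
    "card (rJ J \<inter> {t..<?k}) = card (J \<inter> {Suc i0..<e})" "AJ (rJ J) (Tr T) {t..<?k} = AJ J T {Suc i0..<e}"
    using rJ_card[OF sub(1)] rJ_AJ[OF sub(1)] rJ_card[OF sub(2)] rJ_AJ[OF sub(2)] unfolding refl_init rim by auto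
  have cF: "card (J \<inter> {e..<2 * l}) = t"
  proof -
    have "J \<inter> {e..<2 * l} = {e..<2 * l}" using J(3) by auto
    then show ?thesis using tl unfolding e_def by simp
  qed
  have cI: "card (J \<inter> {0..<t}) = t" "J \<inter> {0..<t} \<noteq> {}"
  proof -
    have "J \<inter> {0..<t} = {0..<t}" using J(2) by auto
    then show "card (J \<inter> {0..<t}) = t" "J \<inter> {0..<t} \<noteq> {}" using t2 by auto
  qed
  have ne: "rJ J \<inter> {0..<t} \<noteq> {}" using rf(1) cF t2 by (metis card.empty not_numeral_le_zero)
  have Fwsum: "isums V [Suc t..<Suc k'] (Fw T2 k') d \<le> ((c0 * s) ^ card (J2 \<inter> {t..<k'}) * AJ J2 T2 {t..<k'}) * WT T2 d"
    if T2: "tests J2 T2" and "t \<le> k'" for T2 J2 k' d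
  proof -
    have "isums V [Suc t..<Suc k'] (Fw T2 k') d \<le> (\<Prod>i\<in>{t..<k'}. if i \<in> J2 then zc i * ang (T2 i) else 1) * WT T2 d"
      using zig_peel[OF T2 order_refl that(2), of d] unfolding Fw_t .
    also have "\<dots> \<le> ((c0 * s) ^ card (J2 \<inter> {t..<k'}) * AJ J2 T2 {t..<k'}) * WT T2 d"
      by (intro mult_right_mono zig_cost[OF T2] WT_nonneg testsD(1)[OF T2]) simp
    finally show ?thesis .
  qed
  define B1 where "B1 = ((c0 * s) ^ card (J \<inter> {t..<i0}) * AJ J T {t..<i0}) * ((C * n) ^ (t - 1) * AJ J T {0..<t})"
  define B2 where "B2 = ((c0 * s) ^ card (J \<inter> {Suc i0..<e}) * AJ J T {Suc i0..<e}) * ((C * n) ^ (t - 1) * AJ J T {e..<2 * l})"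
  have P0: "0 \<le> (c0 * s) ^ x * AJ J T A" for x A using c0_facts s_facts AJ_nonneg[OF T] by (intro mult_nonneg_nonneg) auto
  have B0: "0 \<le> B1" "0 \<le> B2" unfolding B1_def B2_def using P0 cn_le AJ_nonneg[OF T] by (auto intro!: mult_nonneg_nonneg)
  have S1: "isums V [0..<Suc i0] (Fw T i0) c \<le> B1" for c
  proof -
    have u: "[0..<Suc i0] = [0..<Suc t] @ [Suc t..<Suc i0]"
      using upt_add_eq_append[of 0 "Suc t" "i0 - t"] i0 by (simp del: upt_Suc)
    have "isums V [0..<Suc i0] (Fw T i0) c \<le> isums V [0..<Suc t] (\<lambda>c. ((c0 * s) ^ card (J \<inter> {t..<i0}) * AJ J T {t..<i0}) * WT T c) c"
      unfolding u isums_append by (intro isums_mono Fwsum[OF T i0(1)])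
    also have "\<dots> = ((c0 * s) ^ card (J \<inter> {t..<i0}) * AJ J T {t..<i0}) * isums V [0..<Suc t] (WT T) c" by (rule isums_cmult)
    also have "\<dots> \<le> B1" unfolding B1_def using WT_tests_le[OF T cI(2), of c] unfolding cI(1) by (intro mult_left_mono P0)
    finally show ?thesis .
  qed
  \<comment> \<open>Position \<open>0\<close> is summed together with the left half, so it is fixed
    here and the row bound has to be used.\<close>
  have S2: "isums V [Suc i0..<2 * l] (\<lambda>c. Fw (Tr T) ?k (c \<circ> rv)) c \<le> B2" for c
  proof -
    have "isums V [Suc i0..<2 * l] (\<lambda>c. Fw (Tr T) ?k (c \<circ> rv)) c = isums V (map rv [Suc i0..<2 * l]) (Fw (Tr T) ?k) (c \<circ> rv)"
      by (rule isums_involution) (rule rv_rv)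
    also have "\<dots> = isums V ([1..<Suc t] @ [Suc t..<Suc ?k]) (Fw (Tr T) ?k) (c \<circ> rv)"
    proof (rule fun_cong[OF isums_set])
      have "rv ` {Suc i0..<2 * l} = {1..<Suc ?k}"
      proof (intro equalityI subsetI)
        fix x assume "x \<in> {1..<Suc ?k}"
        then have "x = rv (2 * l - x)" "2 * l - x \<in> {Suc i0..<2 * l}" using i0 te unfolding rv_def by auto
        then show "x \<in> rv ` {Suc i0..<2 * l}" by blast
      qed (auto simp: rv_def)
      then show "set (map rv [Suc i0..<2 * l]) = set ([1..<Suc t] @ [Suc t..<Suc ?k])" using k by auto
      show "distinct (map rv [Suc i0..<2 * l])" by (auto simp: distinct_map inj_on_def rv_def)
    qed auto
    also have "\<dots> \<le> isums V [1..<Suc t] (\<lambda>d. ((c0 * s) ^ card (rJ J \<inter> {t..<?k}) * AJ (rJ J) (Tr T) {t..<?k}) * WT (Tr T) d) (c \<circ> rv)"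
      unfolding isums_append by (intro isums_mono Fwsum[OF T' k(1)])
    also have "\<dots> = ((c0 * s) ^ card (J \<inter> {Suc i0..<e}) * AJ J T {Suc i0..<e}) * isums V [1..<Suc t] (WT (Tr T)) (c \<circ> rv)"
      unfolding rf by (rule isums_cmult)
    also have "\<dots> \<le> B2" unfolding B2_def using WT_row_tests_le[OF T' ne, of "c \<circ> rv"] unfolding rf cF by (intro mult_left_mono P0)
    finally show ?thesis .
  qed
  let ?Lk = "c0^2 * (n * D ^ (t - 1))"
  have Lk0: "0 \<le> ?Lk" using c0_facts n1 D1 by simp
  have u: "[0..<2 * l] = [0..<Suc i0] @ [Suc i0..<2 * l]"
    using upt_add_eq_append[of 0 "Suc i0" "2 * l - Suc i0"] i0 te by (simp del: upt_Suc)
  have "Z T c \<le> isums V [0..<2 * l] (\<lambda>c. (?Lk * Fw T i0 c) * Fw (Tr T) ?k (c \<circ> rv)) c"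
    unfolding Z_def
  proof (rule isums_mono)
    fix c
    have Ti: "T i0 (c i0) (c (Suc i0)) = 1" using testsD(2)[OF T i0(3)] by simp
    have F0: "0 \<le> Fw T i0 c" "0 \<le> Fw (Tr T) ?k (c \<circ> rv)" using testsD(1)[OF T] testsD(1)[OF T'] by (auto intro!: Fw_nonneg)
    have "fz c * TP T c = (Q i0 c * inverse (N i0 c * N (Suc i0) c)) * (Fw T i0 c * Fw (Tr T) ?k (c \<circ> rv))"
      unfolding fz_split[OF i0(1,2)] Ti by simp
    also have "\<dots> \<le> ?Lk * (Fw T i0 c * Fw (Tr T) ?k (c \<circ> rv))" using F0 by (intro mult_right_mono link_le i0) auto
    finally show "fz c * TP T c \<le> (?Lk * Fw T i0 c) * Fw (Tr T) ?k (c \<circ> rv)" by (simp only: mult.assoc)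
  qed
  also have "\<dots> \<le> isums V [0..<Suc i0] (\<lambda>c. (?Lk * B2) * Fw T i0 c) c"
    unfolding u isums_append
  proof (rule isums_mono)
    fix c
    have "isums V [Suc i0..<2 * l] (\<lambda>c. (?Lk * Fw T i0 c) * Fw (Tr T) ?k (c \<circ> rv)) c = (?Lk * Fw T i0 c) * isums V [Suc i0..<2 * l] (\<lambda>c. Fw (Tr T) ?k (c \<circ> rv)) c"
    proof (rule isums_factor[where A = "{..i0}"])
      show "depends_on {..i0} (\<lambda>c. ?Lk * Fw T i0 c)" using dFw[OF i0(1), of T] unfolding depends_on_def by metis
    qed auto
    also have "\<dots> \<le> (?Lk * Fw T i0 c) * B2" by (rule mult_left_mono[OF S2 mult_nonneg_nonneg[OF Lk0 Fw_nonneg]]) (rule testsD(1)[OF T])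
    finally show "isums V [Suc i0..<2 * l] (\<lambda>c. (?Lk * Fw T i0 c) * Fw (Tr T) ?k (c \<circ> rv)) c \<le> (?Lk * B2) * Fw T i0 c" by (simp only: mult_ac)
  qed
  also have "\<dots> = (?Lk * B2) * isums V [0..<Suc i0] (Fw T i0) c" by (rule isums_cmult)
  also have "\<dots> \<le> (?Lk * B2) * B1" by (rule mult_left_mono[OF S1 mult_nonneg_nonneg[OF Lk0 B0(2)]])
  also have "\<dots> = c0^2 * ((n * D ^ (t - 1) * (C * n) ^ (t - 1) * (C * n) ^ (t - 1)) * (c0 * s) ^ card (J \<inter> {t..<e}) * AJ J T UNIV)"
  proof -
    have JJ: "J \<inter> {t..<e} = (J \<inter> {t..<i0}) \<union> (J \<inter> {Suc i0..<e})"
    proof -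
      have "{t..<e} = insert i0 ({t..<i0} \<union> {Suc i0..<e})" using i0 by auto
      then show ?thesis using i0(3) by auto
    qed
    have dj: "(J \<inter> {t..<i0}) \<inter> (J \<inter> {Suc i0..<e}) = {}" by auto
    have "card (J \<inter> {t..<e}) = card (J \<inter> {t..<i0}) + card (J \<inter> {Suc i0..<e})" unfolding JJ using fJ dj by (intro card_Un_disjoint) auto
    moreover have "AJ J T {t..<e} = AJ J T {t..<i0} * AJ J T {Suc i0..<e}" unfolding AJ_def JJ using fJ dj by (intro prod.union_disjoint) auto
    ultimately show ?thesis unfolding B1_def B2_def J_split(2)[OF J(1)] by (simp only: power_add mult_ac)
  qed
  also have "\<dots> \<le> c0^2 * ((c0 * s) ^ (2 * t - 1) * (c0 * s) ^ card (J \<inter> {t..<e}) * AJ J T UNIV)"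
  proof (intro mult_left_mono mult_right_mono AJ_nonneg[OF T])
    have "D ^ (t - 1) \<le> D ^ (2 * (t - 1))" using D1 by (intro power_increasing) auto
    then have "n * D ^ (t - 1) * (C * n) ^ (t - 1) * (C * n) ^ (t - 1) \<le> n * D ^ (2 * (t - 1)) * (C * n) ^ (t - 1) * (C * n) ^ (t - 1)"
      using n1 C1 by (intro mult_right_mono mult_left_mono) auto
    also have "\<dots> = n * (C * s) ^ (2 * (t - 1))" unfolding s_def mult_2 by (simp add: power_mult_distrib power_add mult_ac)
    also have "\<dots> \<le> (c0 * s) * (c0 * s) ^ (2 * (t - 1))"
    proof (rule mult_mono)
      have "1 * n \<le> c0 * s" using c0_facts s_facts n1 by (intro mult_mono) auto
      then show "n \<le> c0 * s" by simp
      show "(C * s) ^ (2 * (t - 1)) \<le> (c0 * s) ^ (2 * (t - 1))" using c0_facts s_facts C1 by (intro power_mono mult_right_mono) auto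
    qed (use cn_le C1 s_facts in auto)
    also have "\<dots> = (c0 * s) ^ Suc (2 * (t - 1))" by simp
    also have "Suc (2 * (t - 1)) = 2 * t - 1" using t2 by simp
    finally show "n * D ^ (t - 1) * (C * n) ^ (t - 1) * (C * n) ^ (t - 1) \<le> (c0 * s) ^ (2 * t - 1)" .
  qed (use c0_facts s_facts in auto)
  also have "\<dots> = c0^2 * ((c0 * s) ^ (card J - 1) * AJ J T UNIV)"
  proof -
    have "card J - 1 = (2 * t - 1) + card (J \<inter> {t..<e})" using J_split(1)[OF J(1)] cI(1) cF t2 by simp
    then show ?thesis by (simp only: power_add)
  qed
  finally show ?thesis .
qed

lemma cycle_tests_bound:
  assumes T: "tests J T" and J: "J \<subseteq> {..<2 * l}" "J \<noteq> {}"
  shows "Z T c \<le> c0 ^ (2 * l + 2) * (s ^ (card J - 1) * AJ J T UNIV)"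
proof -
  have fJ: "finite J" using J(1) finite_subset by blast
  have cJ: "1 \<le> card J" "card J \<le> 2 * l" using fJ J card_mono[OF _ J(1)] by (auto simp: Suc_le_eq card_gt_0_iff)
  have P0: "0 \<le> s ^ (card J - 1) * AJ J T UNIV" using s_facts AJ_nonneg[OF T] by (intro mult_nonneg_nonneg) auto
  have fin: "c0 ^ a * ((c0 * s) ^ (card J - 1) * AJ J T UNIV) \<le> c0 ^ (2 * l + 2) * (s ^ (card J - 1) * AJ J T UNIV)" if "a \<le> 2" for a
  proof -
    have "c0 ^ a * ((c0 * s) ^ (card J - 1) * AJ J T UNIV) = c0 ^ (a + (card J - 1)) * (s ^ (card J - 1) * AJ J T UNIV)"
      by (simp only: power_mult_distrib power_add mult_ac)
    also have "\<dots> \<le> c0 ^ (2 * l + 2) * (s ^ (card J - 1) * AJ J T UNIV)"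
      using c0_facts cJ that by (intro mult_right_mono[OF _ P0] power_increasing) auto
    finally show ?thesis .
  qed
  have ne1: "\<not> {0..<t} \<subseteq> J" if "J \<inter> {0..<t} = {}"
  proof -
    have "0 \<in> {0..<t}" using t2 by simp
    then show ?thesis using that by blast
  qed
  have ne2: "J \<inter> {e..<2 * l} \<noteq> {}" if "{e..<2 * l} \<subseteq> J"
  proof -
    have "e \<in> {e..<2 * l}" using te by simp
    then show ?thesis using that by blast
  qed
  \<comment> \<open>If neither of the first two cases holds, the end walks are both free of tests or
    both completely tested.\<close>
  consider "J \<inter> {0..<t} \<noteq> {}" "\<not> {e..<2 * l} \<subseteq> J" | "J \<inter> {e..<2 * l} \<noteq> {}" "\<not> {0..<t} \<subseteq> J"
    | "J \<inter> {0..<t} = {}" "J \<inter> {e..<2 * l} = {}" | "{0..<t} \<subseteq> J" "{e..<2 * l} \<subseteq> J"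
    using ne1 ne2 by metis
  then show ?thesis
  proof cases
    case 1
    then show ?thesis using case_forward[OF T J(1) 1, of c] fin[of 1] by simp
  next
    case 2
    then show ?thesis using case_backward[OF T J(1) 2, of c] fin[of 1] by simp
  next
    case 3
    have "J \<subseteq> {t..<e}"
    proof
      fix i assume i: "i \<in> J"
      then have "i < 2 * l" using J(1) by auto
      moreover have "i \<notin> {0..<t}" "i \<notin> {e..<2 * l}" using 3 i by blast+
      ultimately show "i \<in> {t..<e}" by auto
    qed
    then show ?thesis using case_zig[OF T _ J(2), of c] fin[of 1] by simp
  next
    case 4
    show ?thesis
    proof (cases "{t..<e} \<subseteq> J")
      case True
      have JJ: "J = {..<2 * l}"
      proof
        show "{..<2 * l} \<subseteq> J"
        proof
          fix i assume "i \<in> {..<2 * l}"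
          then have "i \<in> {0..<t} \<or> i \<in> {t..<e} \<or> i \<in> {e..<2 * l}" by auto
          then show "i \<in> J" using True 4 by blast
        qed
      qed (rule J(1))
      have "Z T c \<le> c0 ^ (2 * l + 1) * (s ^ (2 * l - 1) * AJ J T UNIV)" using T unfolding JJ by (rule case_all)
      also have "\<dots> \<le> c0 ^ (2 * l + 2) * (s ^ (2 * l - 1) * AJ J T UNIV)"
        using c0_facts s_facts AJ_nonneg[OF T] by (intro mult_right_mono power_increasing mult_nonneg_nonneg) auto
      finally show ?thesis unfolding JJ by simp
    next
      case False
      then obtain i0 where "i0 \<in> {t..<e}" and nJ: "i0 \<notin> J" by blast
      then have "t \<le> i0" "i0 < e" "i0 \<notin> J" by auto
      then show ?thesis using case_split[OF T J(1) 4, of i0 c] fin[of 2] by simp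
    qed
  qed
qed

section \<open>Total mass, support and repeated vertices\<close>

abbreviation T1 :: "nat \<Rightarrow> 'v \<Rightarrow> 'v \<Rightarrow> real" where "T1 \<equiv> \<lambda>_ _ _. 1"

lemma tests1: "tests {} T1" unfolding tests_def by simp

lemma Tr1: "Tr T1 = T1" unfolding Tr_def by (auto simp: fun_eq_iff)

lemma WT1: "WT T1 = WW" unfolding WT_def by (intro ext) simp

lemma fz_1: "fz c = Fw T1 e c * (inverse (N e c) * WW (c \<circ> rv))"
  using fz_TP[of c T1] unfolding Tr1 WT1 TP_def by simp

lemma upt_split_e: "[0..<2 * l] = [0..<Suc e] @ [Suc e..<2 * l]"
  using upt_add_eq_append[of 0 "Suc e" "2 * l - Suc e"] te by (simp del: upt_Suc)

lemma last_sum1: "isums V [Suc e..<2 * l] (\<lambda>c. inverse (N e c) * WW (c \<circ> rv)) c = of_bool (q1 (c 0) (c e) \<noteq> 0)"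
proof -
  have "isums V [Suc e..<2 * l] (\<lambda>c. inverse (N e c) * WW (c \<circ> rv)) c = isums V [1..<t] WW (c \<circ> rv) / q1 ((c \<circ> rv) 0) ((c \<circ> rv) t)"
    using last_sum[of T1 c] unfolding WT1 .
  also have "\<dots> = q1 (c 0) (c e) / q1 (c 0) (c e)" unfolding WW_q1 using rv_t by (simp add: rv_0)
  finally show ?thesis by simp
qed

text \<open>The closing walk, conditioned on its ends, sums to one wherever the prefix has mass; by
  stationarity of the zigzag the total is that of the first walk.\<close>

lemma fz_mass: "isums V [0..<2 * l] fz c \<ge> \<delta>"
proof -
  have e0: "e \<noteq> 0" using te t2 by auto
  have "isums V [0..<2 * l] fz c = isums V [0..<Suc e] (isums V [Suc e..<2 * l] (\<lambda>c. Fw T1 e c * (inverse (N e c) * WW (c \<circ> rv)))) c"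
    unfolding upt_split_e isums_append using fz_1 by presburger
  also have "isums V [Suc e..<2 * l] (\<lambda>c. Fw T1 e c * (inverse (N e c) * WW (c \<circ> rv))) = (\<lambda>c. Fw T1 e c * of_bool (q1 (c 0) (c e) \<noteq> 0))"
  proof
    fix c
    have "isums V [Suc e..<2 * l] (\<lambda>c. Fw T1 e c * (inverse (N e c) * WW (c \<circ> rv))) c = Fw T1 e c * isums V [Suc e..<2 * l] (\<lambda>c. inverse (N e c) * WW (c \<circ> rv)) c"
      by (rule isums_factor[OF dFw[OF te(1)]]) auto
    then show "isums V [Suc e..<2 * l] (\<lambda>c. Fw T1 e c * (inverse (N e c) * WW (c \<circ> rv))) c = Fw T1 e c * of_bool (q1 (c 0) (c e) \<noteq> 0)"
      unfolding last_sum1 .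
  qed
  also have "isums V [0..<Suc e] (\<lambda>c. Fw T1 e c * of_bool (q1 (c 0) (c e) \<noteq> 0)) c = isums V ([0, e] @ [1..<e]) (\<lambda>c. of_bool (q1 (c 0) (c e) \<noteq> 0) * Fw T1 e c) c"
    unfolding mult.commute[of "Fw T1 e _"] by (rule fun_cong[OF isums_set]) (use e0 in auto)
  also have "\<dots> = isums V [0, e] (\<lambda>c. q1 (c 0) (c e)) c"
  proof -
    have "isums V [1..<e] (\<lambda>c. of_bool (q1 (c 0) (c e) \<noteq> 0) * Fw T1 e c) = (\<lambda>c. of_bool (q1 (c 0) (c e) \<noteq> 0) * isums V [1..<e] (Fw T1 e) c)"
      by (rule ext, rule isums_factor[where A = "{0, e}"]) (auto simp: depends_on_def)
    also have "\<dots> = (\<lambda>c. q1 (c 0) (c e))" unfolding Fw_stationary[OF te(1)] N_def using te by (auto simp: fun_eq_iff)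
    finally show ?thesis unfolding isums_append by simp
  qed
  also have "\<dots> = (\<Sum>x\<in>V. \<Sum>y\<in>V. q1 x y)" using e0 by (simp add: isum_def)
  also have "\<dots> = (\<Sum>x\<in>V. \<Sum>z\<in>V. \<Sum>y\<in>V. q x z y)" unfolding q1_def by (rule sum.cong[OF refl], rule sum.swap)
  finally show ?thesis using q_mass by simp
qed

lemma fz_support:
  assumes "fz c \<noteq> 0" "i < 2 * l" shows "\<rho> (c i) (c (nx i)) \<noteq> 0"
proof -
  have nz: "WW c \<noteq> 0" "(\<Prod>i\<in>{t..<e}. Q i c) \<noteq> 0" "WW (c \<circ> rv) \<noteq> 0" using assms(1) unfolding fz_def by auto
  have pr0: "\<rho> (d i) (d (Suc i)) \<noteq> 0" if "WW d \<noteq> 0" "i < t" for d i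
  proof -
    have "(\<Prod>i\<in>{0..<t}. R (d i) (d (Suc i))) \<noteq> 0" using that(1) unfolding WW_def pr_def by auto
    then have "R (d i) (d (Suc i)) \<noteq> 0" using that(2) by (auto simp: prod_zero_iff)
    then show ?thesis unfolding R_def by auto
  qed
  consider "i < t" | "t \<le> i" "i < e" | "e \<le> i" by linarith
  then show ?thesis
  proof cases
    case 1
    then show ?thesis using pr0[OF nz(1) 1] tl t2 unfolding nx_def by simp
  next
    case 2
    then have "Q i c \<noteq> 0" using nz(2) by (auto simp: prod_zero_iff)
    then have "\<rho> (c i) (c (Suc i)) \<noteq> 0" unfolding Q_def using q_supp(7) rho_sym by (metis (full_types))
    then show ?thesis using 2 te unfolding nx_def by simp
  next
    case 3
    let ?j = "2 * l - 1 - i"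
    have j: "?j < t" "rv ?j = nx i" "rv (Suc ?j) = i" using 3 assms(2) tl t2 unfolding e_def rv_def nx_def by auto
    then show ?thesis using pr0[OF nz(3) j(1)] rho_sym by simp
  qed
qed

lemma Fw1_total: "t \<le> k \<Longrightarrow> isums V [0..<Suc k] (Fw T1 k) c \<le> 1"
proof -
  assume k: "t \<le> k"
  have u: "[0..<Suc k] = [0..<Suc t] @ [Suc t..<Suc k]"
    using upt_add_eq_append[of 0 "Suc t" "k - t"] k by (simp del: upt_Suc)
  have "isums V [0..<Suc k] (Fw T1 k) c \<le> isums V [0..<Suc t] WW c"
    unfolding u isums_append using zig_peel[OF tests1 order_refl k] by (intro isums_mono) (simp add: Fw_t WT1 del: upt_Suc)
  then show ?thesis using WW_total[of c] by linarith
qed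

lemma single_hit:
  fixes f :: "'v \<Rightarrow> real"
  assumes "\<And>v. f v \<le> E" "0 \<le> E" shows "(\<Sum>v\<in>V. f v * of_bool (w = v)) \<le> E"
proof -
  have "(\<Sum>v\<in>V. f v * of_bool (w = v)) = (\<Sum>v\<in>V. if w = v then f w else 0)" by (intro sum.cong refl) auto
  also have "\<dots> \<le> E" using finV assms by (simp add: sum.delta)
  finally show ?thesis .
qed

text \<open>Drop everything after position \<open>j\<close>. The last draw then hits the given
  vertex \<open>c i\<close> with probability at most \<open>2 * err / \<delta>\<close>; inside the
  first walk, \<open>W\<close> is bounded by one and the draw is a plain transition.\<close>

lemma collision_mass_forward:
  assumes ij: "i < j" "j \<le> e" and er: "err \<le> 1"
  shows "isums V [0..<2 * l] (\<lambda>c. fz c * of_bool (c i = c j)) c \<le> 2 * err / \<delta>"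
proof -
  let ?ob = "\<lambda>c::nat \<Rightarrow> 'v. of_bool (c i = c j) :: real"
  let ?E = "2 * err / \<delta>"
  have E0: "0 \<le> ?E" using err_nonneg delta_pos by simp
  have dob: "depends_on {..k} ?ob" if "j \<le> k" for k using ij that unfolding depends_on_def by auto
  have dprod: "depends_on {..k} (\<lambda>c. Fw T1 k c * ?ob c)" if "t \<le> k" "j \<le> k" for k
    unfolding depends_on_def
  proof (intro allI impI)
    fix c c' :: "nat \<Rightarrow> 'v" assume h: "\<forall>j\<in>{..k}. c j = c' j"
    have "Fw T1 k c = Fw T1 k c'" by (rule depends_onD[OF dFw[OF that(1)]]) (use h in auto)
    moreover have "?ob c = ?ob c'" by (rule depends_onD[OF dob[OF that(2)]]) (use h in auto)
    ultimately show "Fw T1 k c * ?ob c = Fw T1 k c' * ?ob c'" by simp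
  qed
  have F0: "0 \<le> Fw T1 k c * ?ob c" for k c by (intro mult_nonneg_nonneg Fw_nonneg) auto
  have "isums V [0..<2 * l] (\<lambda>c. fz c * ?ob c) c = isums V [0..<Suc e] (isums V [Suc e..<2 * l] (\<lambda>c. (Fw T1 e c * ?ob c) * (inverse (N e c) * WW (c \<circ> rv)))) c"
    unfolding upt_split_e isums_append fz_1 by (simp only: mult_ac)
  also have "\<dots> \<le> isums V [0..<Suc e] (\<lambda>c. Fw T1 e c * ?ob c) c"
  proof (rule isums_mono)
    fix c
    have "isums V [Suc e..<2 * l] (\<lambda>c. (Fw T1 e c * ?ob c) * (inverse (N e c) * WW (c \<circ> rv))) c = (Fw T1 e c * ?ob c) * of_bool (q1 (c 0) (c e) \<noteq> 0)"
      unfolding last_sum1[symmetric] by (rule isums_factor[OF dprod[OF te(1) ij(2)]]) auto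
    then show "isums V [Suc e..<2 * l] (\<lambda>c. (Fw T1 e c * ?ob c) * (inverse (N e c) * WW (c \<circ> rv))) c \<le> Fw T1 e c * ?ob c"
      using mult_left_le[of "of_bool (q1 (c 0) (c e) \<noteq> 0)" "Fw T1 e c * ?ob c"] F0[of e c] by (simp only: of_bool_less_eq_one)
  qed
  also have "\<dots> \<le> ?E"
  proof -
    have peel: "isums V [0..<Suc e] (\<lambda>c. Fw T1 e c * ?ob c) c \<le> isums V [0..<Suc k] (\<lambda>c. Fw T1 k c * ?ob c) c"
      if k: "t \<le> k" "j \<le> k" "k \<le> e" for k c
    proof -
      have "isums V [Suc k..<Suc e] ((\<lambda>k c. Fw T1 k c * ?ob c) e) c \<le> (\<Prod>i\<in>{k..<e}. 1) * (\<lambda>k c. Fw T1 k c * ?ob c) k c" for c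
      proof (rule isums_peel)
        fix k' c assume k': "k \<le> k'" "k' < e"
        have "isum V (Suc k') (\<lambda>c. Fw T1 (Suc k') c * ?ob c) c = isum V (Suc k') (\<lambda>c. ?ob c * Fw T1 (Suc k') c) c" by (simp only: mult.commute)
        also have "\<dots> = ?ob c * isum V (Suc k') (Fw T1 (Suc k')) c"
          by (rule isum_factor[OF dob[of k']]) (use k k' in auto)
        also have "\<dots> \<le> ?ob c * Fw T1 k' c"
          using zig_step[OF tests1, of k' c] k k' by (intro mult_left_mono) auto
        finally show "isum V (Suc k') (\<lambda>c. Fw T1 (Suc k') c * ?ob c) c \<le> 1 * (Fw T1 k' c * ?ob c)" by (simp add: mult.commute)
      qed (use k in auto)
      then show ?thesis unfolding upt_mid[OF k(3,1)] isums_append by (intro isums_mono) simp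
    qed
    show ?thesis
    proof (cases "j > t")
      case True
      then obtain k where k: "j = Suc k" "t \<le> k" by (cases j) auto
      have "isums V [0..<Suc e] (\<lambda>c. Fw T1 e c * ?ob c) c \<le> isums V [0..<Suc j] (\<lambda>c. Fw T1 j c * ?ob c) c"
        using True ij by (intro peel) auto
      also have "\<dots> = isums V [0..<j] (isum V j (\<lambda>c. Fw T1 j c * ?ob c)) c" by (simp add: isums_append)
      also have "\<dots> \<le> isums V [0..<j] (\<lambda>c. ?E * Fw T1 k c) c"
      proof (rule isums_mono)
        fix c
        have "isum V j (\<lambda>c. Fw T1 j c * ?ob c) c = isum V j (\<lambda>c. Fw T1 k c * (Q k c / N k c * ?ob c)) c"
          unfolding k(1) Fw_Suc[OF k(2)] by (simp only: mult.assoc mult_1_right)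
        also have "\<dots> = Fw T1 k c * isum V j (\<lambda>c. Q k c / N k c * ?ob c) c"
          by (rule isum_factor[OF dFw[OF k(2)]]) (use k in auto)
        also have "\<dots> \<le> Fw T1 k c * ?E"
        proof (rule mult_left_mono)
          have "isum V j (\<lambda>c. Q k c / N k c * ?ob c) c = (\<Sum>v\<in>V. (Q k (c(j := v)) / N k (c(j := v))) * of_bool (c i = v))"
            unfolding isum_def using ij by simp
          also have "\<dots> \<le> ?E" by (intro single_hit step_err[OF er] E0)
          finally show "isum V j (\<lambda>c. Q k c / N k c * ?ob c) c \<le> ?E" .
          show "0 \<le> Fw T1 k c" by (rule Fw_nonneg) simp
        qed
        finally show "isum V j (\<lambda>c. Fw T1 j c * ?ob c) c \<le> ?E * Fw T1 k c" by (simp add: mult.commute)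
      qed
      also have "\<dots> = ?E * isums V [0..<Suc k] (Fw T1 k) c" unfolding k(1) by (rule isums_cmult)
      also have "\<dots> \<le> ?E * 1" by (intro mult_left_mono Fw1_total k E0)
      finally show ?thesis by simp
    next
      case False
      then have jt: "j \<le> t" by simp
      obtain k where k: "j = Suc k" using ij by (cases j) auto
      have "isums V [0..<Suc e] (\<lambda>c. Fw T1 e c * ?ob c) c \<le> isums V [0..<Suc t] (\<lambda>c. Fw T1 t c * ?ob c) c"
        using jt te by (intro peel) auto
      also have "\<dots> \<le> isums V [0..<Suc t] (\<lambda>c. pr c 0 t * ?ob c) c"
      proof (rule isums_mono, rule mult_right_mono)
        fix c show "Fw T1 t c \<le> pr c 0 t" unfolding Fw_t WT1 WW_def using W01 pr_nonneg by (simp add: mult_left_le)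
      qed simp
      also have "\<dots> \<le> isums V [0..<Suc j] (\<lambda>c. pr c 0 j * ?ob c) c"
      proof -
        have u: "[0..<Suc t] = [0..<Suc j] @ [Suc j..<Suc t]"
          using upt_add_eq_append[of 0 "Suc j" "t - j"] jt by (simp del: upt_Suc)
        show ?thesis unfolding u isums_append
          by (intro isums_mono isums_pr_right dob jt) auto
      qed
      also have "\<dots> = isums V [0..<j] (isum V j (\<lambda>c. pr c 0 j * ?ob c)) c" by (simp add: isums_append)
      also have "\<dots> \<le> isums V [0..<j] (\<lambda>c. ?E * pr c 0 k) c"
      proof (rule isums_mono)
        fix c
        have "isum V j (\<lambda>c. pr c 0 j * ?ob c) c = isum V j (\<lambda>c. pr c 0 k * (R (c k) (c j) * ?ob c)) c"
          unfolding k by (simp only: pr_Suc[of 0 k] mult.assoc le0)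
        also have "\<dots> = pr c 0 k * isum V j (\<lambda>c. R (c k) (c j) * ?ob c) c"
          by (rule isum_factor[OF depends_on_pr]) (use k in auto)
        also have "\<dots> \<le> pr c 0 k * ?E"
        proof (rule mult_left_mono[OF _ pr_nonneg])
          have "isum V j (\<lambda>c. R (c k) (c j) * ?ob c) c = (\<Sum>v\<in>V. R (c k) v * of_bool (c i = v))"
            unfolding isum_def using ij k by simp
          also have "\<dots> \<le> ?E"
          proof (rule single_hit[OF _ E0])
            fix v
            have "err * \<delta> \<le> err * 1" using delta_le err_nonneg by (intro mult_left_mono) auto
            then have "err * \<delta> \<le> 2 * err" using err_nonneg by linarith
            then have "err \<le> ?E" using delta_pos by (simp add: field_simps)
            then show "R (c k) v \<le> ?E" using R_le_err[of "c k" v] by linarith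
          qed
          finally show "isum V j (\<lambda>c. R (c k) (c j) * ?ob c) c \<le> ?E" .
        qed
        finally show "isum V j (\<lambda>c. pr c 0 j * ?ob c) c \<le> ?E * pr c 0 k" by (simp add: mult.commute)
      qed
      also have "\<dots> = ?E * isums V [0..<j] (\<lambda>c. pr c 0 k) c" by (rule isums_cmult)
      also have "\<dots> \<le> ?E * 1"
      proof (rule mult_left_mono[OF _ E0])
        have u: "[0..<j] = [0] @ [Suc 0..<Suc k]" unfolding k by (simp add: upt_conv_Cons del: upt_Suc)
        have "isums V [0..<j] (\<lambda>c. pr c 0 k) c \<le> isums V [0] (\<lambda>c. pr c 0 0) c"
          unfolding u isums_append using isums_pr_right[of "\<lambda>_. 1" 0 0 k] by (intro isums_mono) (simp add: depends_on_def del: upt_Suc)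
        also have "\<dots> = 1" using total by (simp add: isum_def pr_def)
        finally show "isums V [0..<j] (\<lambda>c. pr c 0 k) c \<le> 1" .
      qed
      finally show ?thesis by simp
    qed
  qed
  finally show ?thesis .
qed

text \<open>A walk with fixed ends through \<open>v\<close> is cut at \<open>v\<close>. Each part
  gives a factor \<open>sqrt (pp v)\<close> by \<open>pm_err\<close>, which cancels the division by
  \<open>pp v\<close>.\<close>

lemma PM_hit:
  assumes "0 < b" "b < t"
  shows "isums V [1..<t] (\<lambda>c. WW c * of_bool (v = c b)) c \<le> err^2 * pp (c 0) * pp (c t)"
proof -
  define T :: "nat \<Rightarrow> 'v \<Rightarrow> 'v \<Rightarrow> real" where "T = (\<lambda>i u u'. if i = b then of_bool (v = u) else 1)"
  have Tn: "0 \<le> T i u w" for i u w unfolding T_def by simp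
  have prodT: "(\<Prod>i\<in>{0..<t}. T i (c i) (c (Suc i))) = of_bool (v = c b)" for c
  proof -
    have "(\<Prod>i\<in>{0..<t}. T i (c i) (c (Suc i))) = (\<Prod>i\<in>{0..<t}. if i = b then of_bool (v = c b) else 1)"
      unfolding T_def by (intro prod.cong) auto
    then show ?thesis using assms by (simp add: prod.delta)
  qed
  have "isums V [1..<t] (\<lambda>c. WW c * of_bool (v = c b)) c \<le> isums V [Suc 0..<t] (\<lambda>c. pr c 0 t * (\<Prod>i\<in>{0..<t}. T i (c i) (c (Suc i)))) c"
    unfolding prodT One_nat_def
  proof (rule isums_mono, rule mult_right_mono)
    fix c show "WW c \<le> pr c 0 t" unfolding WW_def using W01 pr_nonneg by (simp add: mult_left_le)
  qed simp
  also have "\<dots> = PM T 0 (b + Suc (t - Suc b)) (c 0) (c t)" using isums_pr[of 0 t T c] assms by simp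
  also have "\<dots> = (\<Sum>w\<in>V. pm b (c 0) w * PM T b (Suc (t - Suc b)) w (c t) / pp w)"
  proof -
    have "PM T 0 b (c 0) w = pm b (c 0) w" for w by (rule PM_cong) (auto simp: T_def fun_eq_iff)
    then show ?thesis using PM_add[of T 0 b "Suc (t - Suc b)" "c 0" "c t"] by (simp only: add_0)
  qed
  also have "\<dots> = (\<Sum>w\<in>V. (pm b (c 0) w * pm (Suc (t - Suc b)) w (c t) / pp w) * of_bool (v = w))"
  proof (rule sum.cong[OF refl])
    fix w
    have "PM T b (Suc (t - Suc b)) w (c t) = (\<Sum>x\<in>V. \<rho> w x * T b w x * PM T (Suc b) (t - Suc b) x (c t) / pp x)"
      using PM_add[of T b "Suc 0" "t - Suc b" w "c t"] unfolding PM_one by simp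
    also have "\<dots> = (\<Sum>x\<in>V. \<rho> w x * pm (t - Suc b) x (c t) / pp x) * of_bool (v = w)"
    proof -
      have "PM T (Suc b) (t - Suc b) x (c t) = pm (t - Suc b) x (c t)" for x
      proof -
        have "PM T (Suc b) (t - Suc b) x (c t) = PM (\<lambda>_ _ _. 1) (Suc b) (t - Suc b) x (c t)"
          by (rule PM_cong) (auto simp: T_def fun_eq_iff)
        then show ?thesis using PM_const[of "Suc b" "t - Suc b" x "c t"] by simp
      qed
      then show ?thesis by (simp add: T_def)
    qed
    also have "(\<Sum>x\<in>V. \<rho> w x * pm (t - Suc b) x (c t) / pp x) = pm (Suc (t - Suc b)) w (c t)"
      using pm_add[of "Suc 0" "t - Suc b" w "c t"] unfolding pm_one by simp
    finally show "pm b (c 0) w * PM T b (Suc (t - Suc b)) w (c t) / pp w = (pm b (c 0) w * pm (Suc (t - Suc b)) w (c t) / pp w) * of_bool (v = w)" by (simp del: PM.simps)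
  qed
  also have "\<dots> \<le> err^2 * pp (c 0) * pp (c t)"
  proof (rule single_hit)
    fix w
    show "pm b (c 0) w * pm (Suc (t - Suc b)) w (c t) / pp w \<le> err^2 * pp (c 0) * pp (c t)"
    proof (cases "pp w = 0")
      case True
      then show ?thesis using pp_nonneg by simp
    next
      case False
      then have p: "pp w > 0" using pp_nonneg[of w] by linarith
      have "pm b (c 0) w * pm (Suc (t - Suc b)) w (c t) \<le> (err * pp (c 0) * sqrt (pp w)) * (err * pp (c t) * sqrt (pp w))"
        by (rule mult_mono[OF pm_err[OF assms(1)] pm_err']) (use pm_nonneg[of "Suc (t - Suc b)"] err_nonneg pp_nonneg in \<open>auto simp del: PM.simps\<close>)
      also have "\<dots> = err^2 * pp (c 0) * pp (c t) * (sqrt (pp w) * sqrt (pp w))" by (simp only: power2_eq_square mult_ac)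
      also have "sqrt (pp w) * sqrt (pp w) = pp w" using p by simp
      finally show ?thesis using p by (simp add: pos_divide_le_eq)
    qed
  qed (use pp_nonneg in auto)
  finally show ?thesis .
qed

text \<open>Inside the closing walk a vertex is conditioned from both sides, so a bound on one
  transition does not suffice. \<open>PM_hit\<close> divided by the lower bound for
  \<open>q1\<close> leaves \<open>2 * err ^ 2 / \<delta>\<close>.\<close>

lemma collision_mass_last:
  assumes ij: "i \<le> e" "e < j" "j < 2 * l" and er: "err \<le> 1"
  shows "isums V [0..<2 * l] (\<lambda>c. fz c * of_bool (c i = c j)) c \<le> 2 * err / \<delta>"
proof -
  let ?ob = "\<lambda>c::nat \<Rightarrow> 'v. of_bool (c i = c j) :: real"
  let ?E = "2 * err / \<delta>" and ?b = "2 * l - j"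
  have E0: "0 \<le> ?E" using err_nonneg delta_pos by simp
  have b: "0 < ?b" "?b < t" "rv ?b = j" using ij tl unfolding e_def rv_def by auto
  \<comment> \<open>The reflected position \<open>rv i\<close> is not summed in this block, so
    \<open>c i\<close> is a constant vertex there, as \<open>PM_hit\<close> requires.\<close>
  have ri: "rv i = 0 \<or> t \<le> rv i" using ij(1) tl unfolding rv_def e_def by auto
  have "isums V [0..<2 * l] (\<lambda>c. fz c * ?ob c) c = isums V [0..<Suc e] (isums V [Suc e..<2 * l] (\<lambda>c. Fw T1 e c * (inverse (N e c) * (WW (c \<circ> rv) * ?ob c)))) c"
    unfolding upt_split_e isums_append fz_1 by (simp only: mult.assoc)
  also have "\<dots> \<le> isums V [0..<Suc e] (\<lambda>c. ?E * Fw T1 e c) c"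
  proof (rule isums_mono)
    fix c
    have Fn: "0 \<le> Fw T1 e c" by (rule Fw_nonneg) simp
    have "isums V [Suc e..<2 * l] (\<lambda>c. Fw T1 e c * (inverse (N e c) * (WW (c \<circ> rv) * ?ob c))) c = Fw T1 e c * isums V [Suc e..<2 * l] (\<lambda>c. inverse (N e c) * (WW (c \<circ> rv) * ?ob c)) c"
      by (rule isums_factor[OF dFw[OF te(1)]]) auto
    also have "isums V [Suc e..<2 * l] (\<lambda>c. inverse (N e c) * (WW (c \<circ> rv) * ?ob c)) c = inverse (N e c) * isums V [Suc e..<2 * l] (\<lambda>c. WW (c \<circ> rv) * ?ob c) c"
      by (rule isums_factor[where A = "{0, e}"]) (auto simp: depends_on_def N_def)
    finally have split: "isums V [Suc e..<2 * l] (\<lambda>c. Fw T1 e c * (inverse (N e c) * (WW (c \<circ> rv) * ?ob c))) c = Fw T1 e c * (inverse (N e c) * isums V [Suc e..<2 * l] (\<lambda>c. WW (c \<circ> rv) * ?ob c) c)" .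
    have "isums V [Suc e..<2 * l] (\<lambda>c. WW (c \<circ> rv) * ?ob c) c = isums V [Suc e..<2 * l] (\<lambda>c. (\<lambda>d. WW d * of_bool (d (rv i) = d ?b)) (c \<circ> rv)) c"
      using b rv_rv by simp
    also have "\<dots> = isums V (map rv [Suc e..<2 * l]) (\<lambda>d. WW d * of_bool (d (rv i) = d ?b)) (c \<circ> rv)"
      by (rule isums_involution) (rule rv_rv)
    also have "\<dots> = isums V [1..<t] (\<lambda>d. WW d * of_bool (d (rv i) = d ?b)) (c \<circ> rv)"
    proof (rule fun_cong[OF isums_set])
      have "rv ` {Suc e..<2 * l} = {1..<t}"
      proof (intro equalityI subsetI)
        fix x assume "x \<in> {1..<t}"
        then have "x = rv (2 * l - x)" "2 * l - x \<in> {Suc e..<2 * l}" using tl unfolding rv_def e_def by auto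
        then show "x \<in> rv ` {Suc e..<2 * l}" by blast
      qed (use tl in \<open>auto simp: rv_def e_def\<close>)
      then show "set (map rv [Suc e..<2 * l]) = set [1..<t]" by simp
      show "distinct (map rv [Suc e..<2 * l])" by (auto simp: distinct_map inj_on_def rv_def)
    qed simp
    also have "\<dots> \<le> isums V [1..<t] (\<lambda>d. WW d * of_bool (c i = d ?b)) (c \<circ> rv)"
    proof (rule isums_mono_on)
      fix d assume h: "\<And>j. j \<notin> set [1..<t] \<Longrightarrow> d j = (c \<circ> rv) j"
      have "d (rv i) = (c \<circ> rv) (rv i)" using ri by (intro h) auto
      then have "d (rv i) = c i" by (simp add: rv_rv)
      then show "WW d * of_bool (d (rv i) = d ?b) \<le> WW d * of_bool (c i = d ?b)" by simp
    qed
    also have "\<dots> \<le> err^2 * pp (c 0) * pp (c e)"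
      using PM_hit[OF b(1,2), of "c i" "c \<circ> rv"] rv_t by (simp add: rv_0)
    finally have hit: "isums V [Suc e..<2 * l] (\<lambda>c. WW (c \<circ> rv) * ?ob c) c \<le> err^2 * pp (c 0) * pp (c e)" .
    have le: "isums V [Suc e..<2 * l] (\<lambda>c. Fw T1 e c * (inverse (N e c) * (WW (c \<circ> rv) * ?ob c))) c \<le> Fw T1 e c * (inverse (N e c) * (err^2 * pp (c 0) * pp (c e)))"
      unfolding split by (rule mult_left_mono[OF mult_left_mono[OF hit] Fn]) (use N_nonneg[of e c] in simp)
    have "inverse (N e c) * (err^2 * pp (c 0) * pp (c e)) \<le> ?E"
    proof (cases "q1 (c 0) (c e) = 0")
      case True
      then show ?thesis using E0 te unfolding N_def by simp
    next
      case False
      note p = q1_pos[OF False]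
      have L: "lev t \<ge> 1" by (rule lev_ge1)
      have "\<delta> / 2 * pp (c 0) * pp (c e) * 1 \<le> \<delta> / 2 * pp (c 0) * pp (c e) * lev t" using L p delta_pos by (intro mult_left_mono) auto
      then have q: "\<delta> / 2 * pp (c 0) * pp (c e) \<le> q1 (c 0) (c e)" using p(1) by (simp add: mult_ac)
      have "inverse (N e c) * (err^2 * pp (c 0) * pp (c e)) = (err^2 * pp (c 0) * pp (c e)) / q1 (c 0) (c e)"
        unfolding N_def using te by (simp add: divide_inverse mult.commute)
      also have "\<dots> \<le> (err^2 * pp (c 0) * pp (c e)) / (\<delta> / 2 * pp (c 0) * pp (c e))"
      proof (rule divide_left_mono[OF q])
        have "0 < \<delta> / 2 * pp (c 0) * pp (c e)" using p delta_pos by simp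
        then show "0 < q1 (c 0) (c e) * (\<delta> / 2 * pp (c 0) * pp (c e))" using q by (metis mult_pos_pos order_less_le_trans)
      qed (use p in auto)
      also have "\<dots> = 2 * err^2 / \<delta>" using p delta_pos by (simp add: field_simps)
      also have "\<dots> \<le> ?E"
      proof -
        have "err^2 \<le> err" using er err_nonneg by (simp add: power2_eq_square mult_left_le)
        then show ?thesis using delta_pos by (intro divide_right_mono) auto
      qed
      finally show ?thesis .
    qed
    then have "Fw T1 e c * (inverse (N e c) * (err^2 * pp (c 0) * pp (c e))) \<le> Fw T1 e c * ?E" using Fn by (rule mult_left_mono)
    then show "isums V [Suc e..<2 * l] (\<lambda>c. Fw T1 e c * (inverse (N e c) * (WW (c \<circ> rv) * ?ob c))) c \<le> ?E * Fw T1 e c"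
      using le by (simp add: mult.commute)
  qed
  also have "\<dots> = ?E * isums V [0..<Suc e] (Fw T1 e) c" by (rule isums_cmult)
  also have "\<dots> \<le> ?E * 1" by (intro mult_left_mono Fw1_total te E0)
  finally show ?thesis by simp
qed

lemma collision_mass:
  assumes ij: "i < j" "j < 2 * l" and er: "err \<le> 1"
  shows "isums V [0..<2 * l] (\<lambda>c. fz c * of_bool (c i = c j)) c \<le> 2 * err / \<delta>"
proof -
  consider "j \<le> e" | "i \<le> e" "e < j" | "e < i" by linarith
  then show ?thesis
  proof cases
    case 1
    then show ?thesis using collision_mass_forward[OF ij(1) 1 er] by simp
  next
    case 2
    then show ?thesis using collision_mass_last[OF 2 ij(2) er] by simp
  next
    case 3
    \<comment> \<open>Two positions inside the closing walk are reflected into the opening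
      walk.\<close>
    have r: "rv j < rv i" "rv i \<le> e" using 3 ij tl unfolding rv_def e_def by auto
    have ob: "(of_bool ((c \<circ> rv) (rv j) = (c \<circ> rv) (rv i)) :: real) = of_bool (c i = c j)" for c :: "nat \<Rightarrow> 'v"
      by (auto simp: rv_rv)
    have "isums V [0..<2 * l] (\<lambda>c. fz c * of_bool (c i = c j)) c = isums V [0..<2 * l] (\<lambda>c. (\<lambda>d. fz d * of_bool (d (rv j) = d (rv i))) (c \<circ> rv)) c"
      by (simp only: fz_rv ob)
    also have "\<dots> = isums V (map rv [0..<2 * l]) (\<lambda>d. fz d * of_bool (d (rv j) = d (rv i))) (c \<circ> rv)"
      by (rule isums_involution) (rule rv_rv)
    also have "\<dots> = isums V [0..<2 * l] (\<lambda>d. fz d * of_bool (d (rv j) = d (rv i))) (c \<circ> rv)"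
    proof (rule fun_cong[OF isums_set])
      show "set (map rv [0..<2 * l]) = set [0..<2 * l]"
      proof -
        have "rv i < 2 * l" if "i < 2 * l" for i using that unfolding rv_def by auto
        then have "rv ` {0..<2 * l} \<subseteq> {0..<2 * l}" by auto
        moreover have "{0..<2 * l} \<subseteq> rv ` {0..<2 * l}"
          using calculation rv_rv by (metis image_eqI subsetI image_subset_iff)
        ultimately show ?thesis by auto
      qed
      show "distinct (map rv [0..<2 * l])" by (simp add: distinct_map) (metis inj_onI rv_rv)
    qed simp
    also have "\<dots> \<le> 2 * err / \<delta>" by (rule collision_mass_forward[OF r er])
    finally show ?thesis .
  qed
qed

end

text \<open>Tests on the edges \<open>J\<close> of the cycle cost at most \<open>(n D) ^ (card J - 1)\<close>; the cycles with a repeated vertex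
  are discarded, since a small \<open>err\<close> makes their mass negligible.\<close>

theorem (in spread_kernel) cycle_measure:
  assumes small: "err \<le> \<delta>^2 / (16 * real l ^ 2)"
  shows "\<exists>f :: (nat \<Rightarrow> 'v) \<Rightarrow> real. (\<forall>c. 0 \<le> f c) \<and>
    (\<forall>c. f c \<noteq> 0 \<longrightarrow> inj_on c {..<2 * l} \<and> (\<forall>i<2 * l. \<rho> (c i) (c (if Suc i = 2 * l then 0 else Suc i)) \<noteq> 0)) \<and>
    (\<forall>c. isums V [0..<2 * l] f c \<ge> \<delta> / 2) \<and>
    (\<forall>J T c. J \<subseteq> {..<2 * l} \<longrightarrow> J \<noteq> {} \<longrightarrow> (\<forall>i u v. 0 \<le> T i u v) \<longrightarrow>
      isums V [0..<2 * l] (\<lambda>c. f c * (\<Prod>i\<in>J. T i (c i) (c (if Suc i = 2 * l then 0 else Suc i)))) c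
        \<le> (2 * C^4 / \<delta>) ^ (2 * l + 2) * ((n * D) ^ (card J - 1) * (\<Prod>i\<in>J. ang (T i))))"
proof -
  obtain t W where zz: "2 \<le> t" "t \<le> l" "depends_on {..t} W" "\<And>c. 0 \<le> W c \<and> W c \<le> 1"
    "\<And>c. W c \<noteq> 0 \<Longrightarrow> pm t (c 0) (c t) \<ge> lev t / 2 * pp (c 0) * pp (c t)"
    "\<And>c a b. W c \<noteq> 0 \<Longrightarrow> a < b \<Longrightarrow> b \<le> t \<Longrightarrow> b - a < t \<Longrightarrow> pm (b - a) (c a) (c b) \<le> C^2 * lev (b - a) * pp (c a) * pp (c b)"
    "\<And>x y. (\<Sum>z\<in>V. trisum t W x z y) = 0 \<or> (\<Sum>z\<in>V. trisum t W x z y) \<ge> \<delta> * pm t x y"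
    "\<And>x z. (\<Sum>y\<in>V. trisum t W x z y) = 0 \<or> (\<Sum>y\<in>V. trisum t W x z y) \<ge> \<delta> * pm (t - 1) x z"
    "(\<Sum>x\<in>V. \<Sum>z\<in>V. \<Sum>y\<in>V. trisum t W x z y) \<ge> \<delta>"
    by (rule zigzag_weight) (rule that; assumption)
  interpret z: zigzag V \<rho> n D \<kappa> C l t W by unfold_locales (fact zz)+
  have l1: "1 \<le> real l" using l2 by simp
  have er1: "err \<le> 1"
  proof -
    have "\<delta>^2 \<le> 1" using z.delta_le delta_pos by (simp add: power_le_one)
    moreover have "1 \<le> 16 * real l ^ 2" using one_le_power[OF l1, of 2] by linarith
    ultimately have "\<delta>^2 \<le> 16 * real l ^ 2" "0 < 16 * real l ^ 2" by linarith+
    then have "\<delta>^2 / (16 * real l ^ 2) \<le> 1" by (simp only: divide_le_eq_1_pos)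
    then show ?thesis using small by linarith
  qed
  let ?ob = "\<lambda>c. of_bool (inj_on c {..<2 * l}) :: real"
  define f where "f = (\<lambda>c. z.fz c * ?ob c)"
  have nx: "(if Suc i = 2 * l then 0 else Suc i) = z.nx i" for i unfolding z.nx_def by simp
  have fle: "f c \<le> z.fz c" "0 \<le> f c" for c unfolding f_def using z.fz_nonneg by auto
  have 1: "f c \<noteq> 0 \<longrightarrow> inj_on c {..<2 * l} \<and> (\<forall>i<2 * l. \<rho> (c i) (c (z.nx i)) \<noteq> 0)" for c
    unfolding f_def using z.fz_support[of c] by auto
  have 2: "isums V [0..<2 * l] f c \<ge> \<delta> / 2" for c
  proof -
    let ?P = "{(i, j). i < j \<and> j < 2 * l}"
    have Psub: "?P \<subseteq> {..<2 * l} \<times> {..<2 * l}" by auto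
    then have finP: "finite ?P" by (rule finite_subset) simp
    have "card ?P \<le> card ({..<2 * l} \<times> {..<2 * l})" using Psub by (intro card_mono) auto
    then have cP: "card ?P \<le> (2 * l) * (2 * l)" by (simp add: card_cartesian_product)
    have pw: "z.fz c \<le> f c + (\<Sum>p\<in>?P. z.fz c * of_bool (c (fst p) = c (snd p)))" for c
    proof (cases "inj_on c {..<2 * l}")
      case True
      have "0 \<le> (\<Sum>p\<in>?P. z.fz c * of_bool (c (fst p) = c (snd p)))" using z.fz_nonneg by (intro sum_nonneg) auto
      then show ?thesis unfolding f_def using True by simp
    next
      case False
      then obtain i j where ij: "i < 2 * l" "j < 2 * l" "c i = c j" "i < j"
        unfolding inj_on_def by (metis lessThan_iff linorder_neqE_nat)
      then have "(i, j) \<in> ?P" by auto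
      then have "(\<lambda>p. z.fz c * of_bool (c (fst p) = c (snd p))) (i, j) \<le> (\<Sum>p\<in>?P. z.fz c * of_bool (c (fst p) = c (snd p)))"
        using z.fz_nonneg finP by (intro member_le_sum) auto
      then show ?thesis unfolding f_def using ij False by simp
    qed
    have "\<delta> \<le> isums V [0..<2 * l] z.fz c" by (rule z.fz_mass)
    also have "\<dots> \<le> isums V [0..<2 * l] (\<lambda>c. (\<Sum>x\<in>{True, False}. (if x then f c else (\<Sum>p\<in>?P. z.fz c * of_bool (c (fst p) = c (snd p)))))) c"
      using pw by (intro isums_mono) simp
    also have "\<dots> = isums V [0..<2 * l] f c + isums V [0..<2 * l] (\<lambda>c. \<Sum>p\<in>?P. z.fz c * of_bool (c (fst p) = c (snd p))) c"
      by (subst isums_sum) simp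
    also have "isums V [0..<2 * l] (\<lambda>c. \<Sum>p\<in>?P. z.fz c * of_bool (c (fst p) = c (snd p))) c = (\<Sum>p\<in>?P. isums V [0..<2 * l] (\<lambda>c. z.fz c * of_bool (c (fst p) = c (snd p))) c)"
      by (rule isums_sum)
    \<comment> \<open>There are at most \<open>4 * l ^ 2\<close> pairs of positions; the hypothesis
      on \<open>err\<close> is exactly what bounds their total loss by
      \<open>\<delta> / 2\<close>.\<close>
    also have "\<dots> \<le> (\<Sum>p\<in>?P. 2 * err / \<delta>)" using z.collision_mass[OF _ _ er1] by (intro sum_mono) auto
    also have "\<dots> = real (card ?P) * (2 * err / \<delta>)" by simp
    also have "\<dots> \<le> (4 * real l ^ 2) * (2 * err / \<delta>)"
    proof (rule mult_right_mono)
      have "real (card ?P) \<le> real ((2 * l) * (2 * l))" using cP by (rule of_nat_mono)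
      then show "real (card ?P) \<le> 4 * real l ^ 2" by (simp add: power2_eq_square)
      show "0 \<le> 2 * err / \<delta>" using err_nonneg delta_pos by simp
    qed
    also have "\<dots> \<le> (4 * real l ^ 2) * (2 * (\<delta>^2 / (16 * real l ^ 2)) / \<delta>)"
      using small delta_pos by (intro mult_left_mono divide_right_mono) auto
    also have "\<dots> = \<delta> / 2" using l1 delta_pos by (simp add: field_simps power2_eq_square)
    finally show ?thesis by simp
  qed
  have 3: "isums V [0..<2 * l] (\<lambda>c. f c * (\<Prod>i\<in>J. T i (c i) (c (z.nx i)))) c
        \<le> (2 * C^4 / \<delta>) ^ (2 * l + 2) * ((n * D) ^ (card J - 1) * (\<Prod>i\<in>J. ang (T i)))"
    if J: "J \<subseteq> {..<2 * l}" "J \<noteq> {}" and T: "\<forall>i u v. 0 \<le> T i u v" for J T c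
  proof -
    define T' where "T' = (\<lambda>i. if i \<in> J then T i else (\<lambda>_ _. 1))"
    have tT: "z.tests J T'" unfolding z.tests_def T'_def using T by auto
    have TP: "z.TP T' c = (\<Prod>i\<in>J. T i (c i) (c (z.nx i)))" for c
    proof -
      have "z.TP T' c = (\<Prod>i\<in>J. T' i (c i) (c (z.nx i)))" unfolding z.TP_def
        by (rule prod.mono_neutral_right) (use J in \<open>auto simp: T'_def\<close>)
      also have "\<dots> = (\<Prod>i\<in>J. T i (c i) (c (z.nx i)))" by (intro prod.cong) (auto simp: T'_def)
      finally show ?thesis .
    qed
    have "isums V [0..<2 * l] (\<lambda>c. f c * (\<Prod>i\<in>J. T i (c i) (c (z.nx i)))) c \<le> z.Z T' c"
      unfolding z.Z_def TP using fle T by (intro isums_mono mult_right_mono prod_nonneg) auto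
    also have "\<dots> \<le> z.c0 ^ (2 * l + 2) * (z.s ^ (card J - 1) * z.AJ J T' UNIV)" by (rule z.cycle_tests_bound[OF tT J])
    also have "z.AJ J T' UNIV = (\<Prod>i\<in>J. ang (T i))" unfolding z.AJ_def T'_def by (intro prod.cong) auto
    finally show ?thesis unfolding z.c0_def z.s_def .
  qed
  show ?thesis unfolding nx using 1 2 3 fle(2) by (intro exI[of _ f]) blast
qed

section \<open>From dense hypergraphs to spread kernels\<close>

text \<open>There are at most \<open>card V ^ (r - 1)\<close> sets to clean, each at a loss of at
  most \<open>K\<close> edges. This is where the threshold of order \<open>n ^ (r - 1)\<close> on
  the number of edges comes from.\<close>

lemma full_subgraph:
  fixes K :: nat
  assumes V: "finite V" and G: "r_graph_on r V G"
  shows "\<exists>G1\<subseteq>G. real (card G1) \<ge> real (card G) - real K * real (card V) ^ (r - 1) \<and>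
    (\<forall>A. A \<subseteq> V \<longrightarrow> card A = r - 1 \<longrightarrow> {e\<in>G1. A \<subseteq> e} = {} \<or> K \<le> card {e\<in>G1. A \<subseteq> e})"
proof -
  define I where "I = {A. A \<subseteq> V \<and> card A = r - 1}"
  have finG: "finite G" using V G unfolding r_graph_on_def by (intro finite_subset[of G "Pow V"]) auto
  have finI: "finite I" unfolding I_def using V by auto
  have cI: "card I \<le> card V ^ (r - 1)"
  proof (cases "r - 1 \<le> card V")
    case True
    then show ?thesis unfolding I_def using n_subsets[OF V, of "r - 1"] binomial_le_pow[OF True] by simp
  next
    case False
    then have "I = {}" unfolding I_def using V by (auto dest: card_mono)
    then show ?thesis by simp
  qed
  have "\<exists>E'\<subseteq>G. sum (\<lambda>_. 1::real) E' \<ge> sum (\<lambda>_. 1) G - sum (\<lambda>_. real K) I \<and>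
    (\<forall>A\<in>I. {e. A \<subseteq> e} \<inter> E' = {} \<or> sum (\<lambda>_. 1::real) ({e. A \<subseteq> e} \<inter> E') \<ge> real K)"
    by (rule remove_light_classes) (use finI finG in auto)
  then obtain E' where E': "E' \<subseteq> G" "sum (\<lambda>_. 1::real) E' \<ge> sum (\<lambda>_. 1) G - sum (\<lambda>_. real K) I"
    "\<forall>A\<in>I. {e. A \<subseteq> e} \<inter> E' = {} \<or> sum (\<lambda>_. 1::real) ({e. A \<subseteq> e} \<inter> E') \<ge> real K" by blast
  have eq: "{e\<in>E'. A \<subseteq> e} = {e. A \<subseteq> e} \<inter> E'" for A by auto
  have "real (card I) * real K \<le> real (card V) ^ (r - 1) * real K"
    using cI by (intro mult_right_mono) (auto simp: of_nat_power[symmetric] simp del: of_nat_power)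
  then have "real (card E') \<ge> real (card G) - real K * real (card V) ^ (r - 1)" using E'(2) by (simp add: mult.commute)
  moreover have "{e\<in>E'. A \<subseteq> e} = {} \<or> K \<le> card {e\<in>E'. A \<subseteq> e}" if "A \<subseteq> V" "card A = r - 1" for A
  proof -
    have "A \<in> I" using that unfolding I_def by blast
    then show ?thesis unfolding eq using E'(3)[rule_format, of A] by simp
  qed
  ultimately show ?thesis using E'(1) by blast
qed

lemma double_count:
  fixes P :: "'a \<Rightarrow> 'b \<Rightarrow> bool"
  assumes "finite A" "finite B" "\<And>a. a \<in> A \<Longrightarrow> x \<le> card {b\<in>B. P a b}" "\<And>b. b \<in> B \<Longrightarrow> card {a\<in>A. P a b} \<le> y"
  shows "x * card A \<le> y * card B"
proof -
  have "x * card A = (\<Sum>a\<in>A. x)" by simp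
  also have "\<dots> \<le> (\<Sum>a\<in>A. card {b\<in>B. P a b})" using assms by (intro sum_mono) auto
  also have "\<dots> = (\<Sum>b\<in>B. card {a\<in>A. P a b})" by (rule sum_multicount_gen) (use assms in auto)
  also have "\<dots> \<le> (\<Sum>b\<in>B. y)" using assms by (intro sum_mono) auto
  finally show ?thesis by (simp add: mult.commute)
qed

text \<open>Switching: in an edge that meets \<open>X\<close> outside \<open>u\<close> and
  \<open>v\<close>, exchange a vertex of \<open>X\<close> for one outside \<open>X\<close>. Fullness
  offers at least \<open>K - x0 \<ge> r * x0\<close> exchanges, and an edge results from at most
  \<open>r * x0\<close> of them. So edges with \<open>k + 1\<close> hits are no more numerous than
  those with \<open>k\<close>, and the number of hits takes fewer than \<open>r + 1\<close>
  values.\<close>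

lemma edges_avoiding_set:
  fixes K x0 :: nat
  assumes V: "finite V" and G: "r_graph_on r V G" and r: "r \<ge> 2" and uv: "u \<noteq> v"
    and full: "\<And>A. A \<subseteq> V \<Longrightarrow> card A = r - 1 \<Longrightarrow> {e\<in>G. A \<subseteq> e} = {} \<or> K \<le> card {e\<in>G. A \<subseteq> e}"
    and X: "finite X" "card X \<le> x0" "x0 \<ge> 1" and K: "K \<ge> (r + 1) * x0"
  shows "card {e\<in>G. u \<in> e \<and> v \<in> e} \<le> r * card {e\<in>G. u \<in> e \<and> v \<in> e \<and> (e - {u, v}) \<inter> X = {}}"
proof -
  have finG: "finite G" using V G unfolding r_graph_on_def by (intro finite_subset[of G "Pow V"]) auto
  define E where "E = (\<lambda>k. {e\<in>G. u \<in> e \<and> v \<in> e \<and> card ((e - {u, v}) \<inter> X) = k})"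
  have finE: "finite (E k)" for k unfolding E_def using finG by auto
  have step: "card (E (Suc k)) \<le> card (E k)" for k
  proof -
    define P where "P = (\<lambda>e e'. \<exists>x y. x \<in> X \<and> x \<notin> e' \<and> y \<in> e' \<and> e = insert x (e' - {y}))"
    have "(r * x0) * card (E (Suc k)) \<le> (r * x0) * card (E k)"
    proof (rule double_count[OF finE finE, where P = P])
      fix e assume e: "e \<in> E (Suc k)"
      then have eG: "e \<in> G" "u \<in> e" "v \<in> e" "card ((e - {u, v}) \<inter> X) = Suc k" unfolding E_def by auto
      then have er: "finite e" "card e = r" "e \<subseteq> V" using G unfolding r_graph_on_def by auto
      have "(e - {u, v}) \<inter> X \<noteq> {}" using eG(4) by (metis card.empty nat.distinct(1))
      then obtain x where x: "x \<in> e" "x \<noteq> u" "x \<noteq> v" "x \<in> X" by blast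
      define A where "A = e - {x}"
      have A: "A \<subseteq> V" "card A = r - 1" "finite A" using er x unfolding A_def by auto
      have "e \<in> {e\<in>G. A \<subseteq> e}" using eG unfolding A_def by auto
      then have KA: "K \<le> card {e\<in>G. A \<subseteq> e}" using full[OF A(1,2)] by auto
      have ext: "\<exists>y. y \<notin> A \<and> e' = insert y A" if "e' \<in> G" "A \<subseteq> e'" for e'
      proof -
        have "card e' = r" "finite e'" using that G unfolding r_graph_on_def by auto
        then have "card (e' - A) = 1" using A that r by (simp add: card_Diff_subset)
        then obtain y where "e' - A = {y}" by (metis card_1_singletonE)
        then show ?thesis using that by (intro exI[of _ y]) auto
      qed
      have sub: "{e'\<in>G. A \<subseteq> e'} \<subseteq> {b\<in>E k. P e b} \<union> (\<lambda>y. insert y A) ` X"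
      proof
        fix e' assume "e' \<in> {e'\<in>G. A \<subseteq> e'}"
        then obtain y where e': "e' \<in> G" "A \<subseteq> e'" "y \<notin> A" "e' = insert y A" using ext by blast
        show "e' \<in> {b\<in>E k. P e b} \<union> (\<lambda>y. insert y A) ` X"
        proof (cases "y \<in> X")
          case True
          then show ?thesis using e' by blast
        next
          case False
          have xy: "x \<noteq> y" using False x by auto
          have "(e' - {u, v}) \<inter> X = ((e - {u, v}) \<inter> X) - {x}" using e'(4) False unfolding A_def by auto
          then have "card ((e' - {u, v}) \<inter> X) = k" using eG(4) x X by (simp add: card_Diff_singleton_if)
          then have "e' \<in> E k" using e' eG x unfolding E_def A_def by auto
          moreover have "P e e'" unfolding P_def using x xy e' by (intro exI[of _ x] exI[of _ y]) (auto simp: A_def)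
          ultimately show ?thesis by blast
        qed
      qed
      have "K \<le> card ({b\<in>E k. P e b} \<union> (\<lambda>y. insert y A) ` X)"
      proof -
        have "finite ({b\<in>E k. P e b} \<union> (\<lambda>y. insert y A) ` X)" using finE[of k] X(1) by simp
        from card_mono[OF this sub] show ?thesis using KA by linarith
      qed
      also have "\<dots> \<le> card {b\<in>E k. P e b} + card ((\<lambda>y. insert y A) ` X)" by (rule card_Un_le)
      also have "\<dots> \<le> card {b\<in>E k. P e b} + x0" using card_image_le[OF X(1), of "\<lambda>y. insert y A"] X(2) by linarith
      finally show "r * x0 \<le> card {b\<in>E k. P e b}" using K by simp
    next
      fix e' assume e': "e' \<in> E k"
      then have er: "finite e'" "card e' = r" using G unfolding r_graph_on_def E_def by auto
      have "{a\<in>E (Suc k). P a e'} \<subseteq> (\<lambda>(x, y). insert x (e' - {y})) ` (X \<times> e')" unfolding P_def by auto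
      then have "card {a\<in>E (Suc k). P a e'} \<le> card ((\<lambda>(x, y). insert x (e' - {y})) ` (X \<times> e'))" using X er by (intro card_mono) auto
      also have "\<dots> \<le> card (X \<times> e')" using X er by (intro card_image_le) auto
      also have "\<dots> \<le> x0 * r" using X er by (simp add: card_cartesian_product)
      finally show "card {a\<in>E (Suc k). P a e'} \<le> r * x0" by (simp add: mult.commute)
    qed
    then show ?thesis using r X by simp
  qed
  have le0: "card (E k) \<le> card (E 0)" for k
  proof (induction k)
    case (Suc k)
    then show ?case using step[of k] by linarith
  qed simp
  have "{e\<in>G. u \<in> e \<and> v \<in> e} \<subseteq> (\<Union>k\<in>{..<r}. E k)"
  proof
    fix e assume e: "e \<in> {e\<in>G. u \<in> e \<and> v \<in> e}"
    then have er: "finite e" "card e = r" using G unfolding r_graph_on_def by auto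
    have "card ((e - {u, v}) \<inter> X) < card e" by (rule psubset_card_mono) (use e er in auto)
    then show "e \<in> (\<Union>k\<in>{..<r}. E k)" using e er unfolding E_def by auto
  qed
  then have "card {e\<in>G. u \<in> e \<and> v \<in> e} \<le> card (\<Union>k\<in>{..<r}. E k)" using finE by (intro card_mono) auto
  also have "\<dots> \<le> (\<Sum>k\<in>{..<r}. card (E k))" by (rule card_UN_le) simp
  also have "\<dots> \<le> (\<Sum>k\<in>{..<r}. card (E 0))" using le0 by (intro sum_mono) auto
  also have "\<dots> = r * card (E 0)" by simp
  also have "E 0 = {e\<in>G. u \<in> e \<and> v \<in> e \<and> (e - {u, v}) \<inter> X = {}}" unfolding E_def using X by auto
  finally show ?thesis .
qed

text \<open>Disjointness is asked only against all junctions and the earlier edges, which is what a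
  greedy choice provides; for two interior vertices the edge of larger index decides.\<close>

lemma lin_cycle_copy:
  fixes c :: "nat \<Rightarrow> 'a" and E :: "nat \<Rightarrow> 'a set"
  assumes r: "r \<ge> 3" and k: "k \<ge> 2" and inj: "inj_on c {..<k}"
    and E: "\<And>i. i < k \<Longrightarrow> E i \<in> H" "\<And>i. i < k \<Longrightarrow> finite (E i)" "\<And>i. i < k \<Longrightarrow> card (E i) = r" "\<And>i. i < k \<Longrightarrow> E i \<subseteq> V"
    and cE: "\<And>i. i < k \<Longrightarrow> c i \<in> E i" "\<And>i. i < k \<Longrightarrow> c (if Suc i = k then 0 else Suc i) \<in> E i"
    and disj: "\<And>i. i < k \<Longrightarrow> (E i - {c i, c (if Suc i = k then 0 else Suc i)}) \<inter> (c ` {..<k} \<union> (\<Union>j<i. E j)) = {}"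
  shows "\<not> lin_cycle_free r k V H"
proof -
  define nx where "nx = (\<lambda>i. if Suc i = k then 0 else Suc i)"
  define Fl where "Fl = (\<lambda>i. E i - {c i, c (nx i)})"
  have nxk: "nx i < k" "nx i \<noteq> i" if "i < k" for i using that k unfolding nx_def by auto
  have cc: "c i \<noteq> c (nx i)" if "i < k" for i using inj nxk[OF that] that unfolding inj_on_def by (metis lessThan_iff)
  have Flc: "card (Fl i) = r - 2" "finite (Fl i)" if "i < k" for i
    using E[OF that] cE[OF that] cc[OF that] r unfolding Fl_def nx_def by (auto simp: card_Diff_subset)
  have "\<exists>b. bij_betw b {1..r - 2} (Fl i)" if "i < k" for i
    using Flc[OF that] by (metis card_atLeastAtMost diff_Suc_1 finite_atLeastAtMost finite_same_card_bij)
  then obtain fl where fl: "\<And>i. i < k \<Longrightarrow> bij_betw (fl i) {1..r - 2} (Fl i)" by metis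
  define q where "q = r - 1"
  have q: "q \<ge> 2" using r unfolding q_def by simp
  \<comment> \<open>Multiples of \<open>q\<close> are junctions. The reduction \<open>mod k\<close>
    sends the number \<open>k * q\<close>, which stands for index \<open>0\<close> of the cycle, to
    \<open>c 0\<close>.\<close>
  define f where "f = (\<lambda>p. if p mod q = 0 then c ((p div q) mod k) else fl (p div q) (p mod q))"
  have fj: "f (i * q) = c (i mod k)" for i unfolding f_def using q by simp
  have ff: "f (i * q + a) = fl i a" if "1 \<le> a" "a < q" for i a
    unfolding f_def using that by simp
  have flF: "fl i a \<in> Fl i" if "i < k" "1 \<le> a" "a < q" for i a
    using bij_betwE[OF fl[OF that(1)]] that unfolding q_def by auto
  have edge: "f ` lin_cycle_edge r k (Suc i) = E i" if i: "i < k" for i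
  proof -
    have "lin_cycle_edge r k (Suc i) = lin_cycle_vertex r k ` {i * q..Suc i * q}" unfolding lin_cycle_edge_def q_def by simp
    also have "{i * q..Suc i * q} = {i * q, Suc i * q} \<union> (\<lambda>a. i * q + a) ` {1..r - 2}"
    proof -
      have "x \<in> {i * q, Suc i * q} \<union> (\<lambda>a. i * q + a) ` {1..r - 2}" if "x \<in> {i * q..Suc i * q}" for x
      proof (cases "x = i * q \<or> x = Suc i * q")
        case False
        then have "x = i * q + (x - i * q)" "x - i * q \<in> {1..r - 2}" using that unfolding q_def by auto
        then show ?thesis by blast
      qed auto
      moreover have "{i * q, Suc i * q} \<union> (\<lambda>a. i * q + a) ` {1..r - 2} \<subseteq> {i * q..Suc i * q}" using r unfolding q_def by auto
      ultimately show ?thesis by blast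
    qed
    finally have le: "lin_cycle_edge r k (Suc i) = lin_cycle_vertex r k ` ({i * q, Suc i * q} \<union> (\<lambda>a. i * q + a) ` {1..r - 2})" .
    have v1: "f (lin_cycle_vertex r k (i * q)) = c i"
    proof (cases "i = 0")
      case True
      then have "lin_cycle_vertex r k (i * q) = k * q" unfolding lin_cycle_vertex_def q_def by simp
      then show ?thesis using fj[of k] True by simp
    next
      case False
      then have "lin_cycle_vertex r k (i * q) = i * q" unfolding lin_cycle_vertex_def using q by simp
      then show ?thesis using fj[of i] i by simp
    qed
    have "lin_cycle_vertex r k (Suc i * q) = Suc i * q" unfolding lin_cycle_vertex_def using q by simp
    then have v2: "f (lin_cycle_vertex r k (Suc i * q)) = c (nx i)" using fj[of "Suc i"] i unfolding nx_def by auto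
    have v3: "f (lin_cycle_vertex r k (i * q + a)) = fl i a" if "a \<in> {1..r - 2}" for a
    proof -
      have "lin_cycle_vertex r k (i * q + a) = i * q + a" unfolding lin_cycle_vertex_def using that by simp
      then show ?thesis using ff[of a i] that unfolding q_def by auto
    qed
    have "f ` lin_cycle_edge r k (Suc i) = {c i, c (nx i)} \<union> fl i ` {1..r - 2}"
      unfolding le image_Un image_image using v1 v2 v3 by (auto simp: image_def)
    also have "fl i ` {1..r - 2} = Fl i" using fl[OF i] by (simp add: bij_betw_def)
    also have "{c i, c (nx i)} \<union> Fl i = E i" using cE[OF i] unfolding Fl_def nx_def by auto
    finally show ?thesis .
  qed
  have Fld: "Fl i \<inter> c ` {..<k} = {}" "\<And>j. j < i \<Longrightarrow> Fl i \<inter> Fl j = {}" if "i < k" for i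
    using disj[OF that] unfolding Fl_def nx_def by auto
  have inj_f: "inj_on f (lin_cycle_verts r k)"
  proof (rule inj_onI)
    \<comment> \<open>Junction numbers are \<open>i * q\<close> with
      \<open>1 \<le> i \<le> k\<close>; the value \<open>0\<close> does not occur, so reducing
      \<open>i\<close> modulo \<open>k\<close> identifies no two of them.\<close>
    have form: "(\<exists>i. 1 \<le> i \<and> i \<le> k \<and> p = i * q) \<or> (\<exists>i a. i < k \<and> 1 \<le> a \<and> a < q \<and> p = i * q + a)"
      if "p \<in> lin_cycle_verts r k" for p
    proof (cases "p mod q = 0")
      case True
      then have p: "p = (p div q) * q" by auto
      have "1 \<le> p" "p \<le> k * q" using that unfolding lin_cycle_verts_def q_def by auto
      then have "1 \<le> p div q" "p div q \<le> k" using p q by (metis Suc_leI One_nat_def mult_is_0 neq0_conv not_one_le_zero, metis div_le_mono div_mult_self_is_m q_def less_le_trans zero_less_numeral)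
      then show ?thesis using p by blast
    next
      case False
      have "p \<le> k * q" using that unfolding lin_cycle_verts_def q_def by auto
      moreover have "p \<noteq> k * q" using False by auto
      ultimately have "p div q < k" using q by (simp add: less_mult_imp_div_less)
      moreover have "1 \<le> p mod q" "p mod q < q" "p = (p div q) * q + p mod q" using False q by auto
      ultimately show ?thesis by blast
    qed
    have jf: "c j \<noteq> fl i a" if "j < k" "i < k" "1 \<le> a" "a < q" for i j a
      using flF[OF that(2-4)] Fld(1)[OF that(2)] that(1) by (metis IntI empty_iff imageI lessThan_iff)
    fix p p' assume p: "p \<in> lin_cycle_verts r k" and p': "p' \<in> lin_cycle_verts r k" and eq: "f p = f p'"
    from form[OF p] show "p = p'"
    proof (elim disjE exE conjE)
      fix i assume i: "1 \<le> i" "i \<le> k" "p = i * q"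
      then have fp: "f p = c (i mod k)" using fj by simp
      from form[OF p'] show ?thesis
      proof (elim disjE exE conjE)
        fix i' assume i': "1 \<le> i'" "i' \<le> k" "p' = i' * q"
        then have "c (i mod k) = c (i' mod k)" using fp fj eq by simp
        moreover have "i mod k < k" "i' mod k < k" using k by auto
        ultimately have "i mod k = i' mod k" using inj unfolding inj_on_def by blast
        then have "i = i'" using i i' k by (metis le_neq_implies_less mod_less mod_self not_one_le_zero)
        then show ?thesis using i i' by simp
      next
        fix i' a assume i': "i' < k" "1 \<le> a" "a < q" "p' = i' * q + a"
        then show ?thesis using fp eq ff[of a i'] jf[of "i mod k" i' a] k by simp
      qed
    next
      fix i a assume i: "i < k" "1 \<le> a" "a < q" "p = i * q + a"
      then have fp: "f p = fl i a" using ff by simp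
      from form[OF p'] show ?thesis
      proof (elim disjE exE conjE)
        fix i' assume i': "1 \<le> i'" "i' \<le> k" "p' = i' * q"
        then show ?thesis using fp eq fj[of i'] jf[of "i' mod k" i a] i k by simp
      next
        fix i' a' assume i': "i' < k" "1 \<le> a'" "a' < q" "p' = i' * q + a'"
        then have e2: "fl i a = fl i' a'" using fp eq ff by simp
        have m: "fl i a \<in> Fl i" "fl i' a' \<in> Fl i'" using flF i i' by auto
        have "i = i'"
        proof (rule ccontr)
          assume "i \<noteq> i'"
          then have "i < i' \<or> i' < i" by auto
          then show False using Fld(2)[OF i(1)] Fld(2)[OF i'(1)] m e2 by (metis disjoint_iff)
        qed
        moreover have "a = a'" using e2 bij_betw_imp_inj_on[OF fl[OF i(1)]] i i' calculation unfolding q_def inj_on_def by auto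
        ultimately show ?thesis using i i' by simp
      qed
    qed
  qed
  have "f ` lin_cycle_verts r k \<subseteq> V"
  proof
    fix y assume "y \<in> f ` lin_cycle_verts r k"
    then obtain p where p: "p \<in> lin_cycle_verts r k" "y = f p" by blast
    have "1 \<le> p" "p \<le> k * q" using p unfolding lin_cycle_verts_def q_def by auto
    \<comment> \<open>With \<open>p - 1\<close> instead of \<open>p\<close>, the final vertex
      \<open>k * q\<close> is assigned to the last edge.\<close>
    define i where "i = (p - 1) div q"
    have i: "i < k" unfolding i_def using \<open>1 \<le> p\<close> \<open>p \<le> k * q\<close> q by (intro less_mult_imp_div_less) linarith
    have b1: "i * q \<le> p - 1" unfolding i_def by simp
    have b2: "p - 1 < Suc i * q" unfolding i_def using q by (metis dividend_less_div_times less_le_trans zero_less_numeral mult_Suc add.commute)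
    have b: "i * q \<le> p" "p \<le> Suc i * q" using b1 b2 \<open>1 \<le> p\<close> by linarith+
    have "lin_cycle_vertex r k p = p" unfolding lin_cycle_vertex_def using \<open>1 \<le> p\<close> by simp
    then have "p \<in> lin_cycle_edge r k (Suc i)" unfolding lin_cycle_edge_def using b unfolding q_def by force
    then have "y \<in> E i" using edge[OF i] p by blast
    then show "y \<in> V" using E(4)[OF i] by blast
  qed
  moreover have "\<forall>e\<in>lin_cycle_edges r k. f ` e \<in> H"
  proof
    fix e assume "e \<in> lin_cycle_edges r k"
    then obtain j where "j \<in> {1..k}" "e = lin_cycle_edge r k j" unfolding lin_cycle_edges_def by blast
    then have "j - 1 < k" "e = lin_cycle_edge r k (Suc (j - 1))" by auto
    then show "f ` e \<in> H" using edge[of "j - 1"] E(1)[of "j - 1"] by simp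
  qed
  ultimately show ?thesis unfolding lin_cycle_free_def contains_copy_def using inj_f by blast
qed

definition vdeg :: "'a set set \<Rightarrow> 'a \<Rightarrow> nat" where "vdeg G v = card {e\<in>G. v \<in> e}"
definition codeg :: "'a set set \<Rightarrow> 'a \<Rightarrow> 'a \<Rightarrow> nat" where "codeg G u v = card {e\<in>G. u \<in> e \<and> v \<in> e}"

lemma r_graph_finite: "finite V \<Longrightarrow> r_graph_on r V G \<Longrightarrow> finite G"
  unfolding r_graph_on_def by (intro finite_subset[of G "Pow V"]) auto

lemma sum_vdeg:
  assumes "finite V" "r_graph_on r V G" shows "(\<Sum>v\<in>V. vdeg G v) = r * card G"
proof -
  have "(\<Sum>v\<in>V. card {e\<in>G. v \<in> e}) = (\<Sum>e\<in>G. card {v\<in>V. v \<in> e})"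
    by (rule sum_multicount_gen) (use assms r_graph_finite in auto)
  also have "\<dots> = (\<Sum>e\<in>G. r)"
  proof (rule sum.cong[OF refl])
    fix e assume "e \<in> G"
    then have "e \<subseteq> V" "card e = r" using assms unfolding r_graph_on_def by auto
    then show "card {v\<in>V. v \<in> e} = r" by (metis Collect_mem_eq Int_absorb1 Collect_conj_eq)
  qed
  finally show ?thesis unfolding vdeg_def by simp
qed

lemma sum_codeg:
  assumes "finite V" "r_graph_on r V G" shows "(\<Sum>v\<in>V. codeg G v u) = r * vdeg G u"
proof -
  have "r_graph_on r V {e\<in>G. u \<in> e}" using assms unfolding r_graph_on_def by auto
  moreover have "{e \<in> {e\<in>G. u \<in> e}. v \<in> e} = {e\<in>G. v \<in> e \<and> u \<in> e}" for v by auto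
  ultimately show ?thesis using sum_vdeg[OF assms(1), of r "{e\<in>G. u \<in> e}"] unfolding vdeg_def codeg_def by simp
qed

lemma codeg_sym: "codeg G u v = codeg G v u" unfolding codeg_def by (simp add: conj_commute)

lemma card_supersets:
  assumes "finite V" "card S = j" "j \<le> r" "finite S"
  shows "card {e. e \<subseteq> V \<and> card e = r \<and> S \<subseteq> e} \<le> card V ^ (r - j)"
proof -
  have "inj_on (\<lambda>e. e - S) {e. e \<subseteq> V \<and> card e = r \<and> S \<subseteq> e}" by (rule inj_onI) (metis (no_types, lifting) Un_Diff_cancel2 mem_Collect_eq sup.absorb1)
  moreover have "(\<lambda>e. e - S) ` {e. e \<subseteq> V \<and> card e = r \<and> S \<subseteq> e} \<subseteq> {A. A \<subseteq> V \<and> card A = r - j}"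
    using assms by (auto simp: card_Diff_subset)
  moreover have "finite {A. A \<subseteq> V \<and> card A = r - j}" using assms by auto
  ultimately have "card {e. e \<subseteq> V \<and> card e = r \<and> S \<subseteq> e} \<le> card {A. A \<subseteq> V \<and> card A = r - j}" by (rule card_inj_on_le)
  also have "\<dots> \<le> card V ^ (r - j)"
  proof (cases "r - j \<le> card V")
    case True
    then show ?thesis using n_subsets[OF assms(1), of "r - j"] binomial_le_pow[OF True] by simp
  next
    case False
    then have "{A. A \<subseteq> V \<and> card A = r - j} = {}" using assms by (auto dest: card_mono)
    then show ?thesis by (metis card.empty le0)
  qed
  finally show ?thesis .
qed

text \<open>Weigh a quadruple \<open>(a, b, c, f)\<close> by
  \<open>codeg a b * codeg b c * codeg c f / (vdeg b * vdeg c)\<close>, as for a random walk of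
  three steps; all quadruples together weigh at most \<open>r ^ 4 * card G\<close>. A quadruple of
  heavy pairs weighs at least \<open>C ^ 3 * \<kappa> ^ 3 * card G / (4 * n)\<close>, so there are
  \<open>O(n ^ 3 / C ^ 3)\<close> of them, each contained in at most \<open>n ^ (r - 4)\<close>
  edges. The same count with three vertices would only allow
  \<open>\<kappa> = n powr (-1/2)\<close>, too large for \<open>lev 1\<close>.\<close>

lemma heavy_edges:
  fixes \<kappa> :: real and V :: "'a set"
  assumes V: "finite V" "V \<noteq> {}" and G: "r_graph_on r V G" and r: "r \<ge> 4" and k: "\<kappa> > 0" "\<kappa> ^ 3 * real (card V) ^ 2 = 1"
    and C: "C \<ge> 1" and M: "card G > 0"
    and E: "E \<subseteq> G" "\<And>e v. e \<in> E \<Longrightarrow> v \<in> e \<Longrightarrow> real (vdeg G v) \<ge> card G / (4 * card V)"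
      "\<And>e u v. e \<in> E \<Longrightarrow> u \<in> e \<Longrightarrow> v \<in> e \<Longrightarrow> u \<noteq> v \<Longrightarrow> real (codeg G u v) > C * \<kappa> * sqrt (vdeg G u) * sqrt (vdeg G v)"
  shows "real (card E) \<le> 4 * real r ^ 4 / C ^ 3 * real (card V) ^ (r - 1)"
proof -
  let ?n = "real (card V)" and ?M = "real (card G)"
  have n0: "?n > 0" using V by (simp add: card_gt_0_iff)
  have finG: "finite G" using V G r_graph_finite by blast
  have finE: "finite E" using E finG finite_subset by blast
  define d where "d = (\<lambda>v. real (vdeg G v))"
  define cd where "cd = (\<lambda>u v. real (codeg G u v))"
  have "\<exists>x. case x of (a, b, c, f) \<Rightarrow> {a, b, c, f} \<subseteq> e \<and> distinct [a, b, c, f]" if "e \<in> E" for e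
  proof -
    have "card e = r" "finite e" using that E G unfolding r_graph_on_def by auto
    then obtain S where S: "S \<subseteq> e" "card S = 4" using obtain_subset_with_card_n[of 4 e] r by metis
    then obtain xs where xs: "set xs = S" "distinct xs" using finite_distinct_list[of S] by (metis card.infinite zero_neq_numeral)
    then have "length xs = 4" using S distinct_card by fastforce
    then obtain a b c f where "xs = [a, b, c, f]" by (auto simp: numeral_eq_Suc length_Suc_conv)
    then show ?thesis using xs S by (intro exI[of _ "(a, b, c, f)"]) auto
  qed
  then have "\<exists>g. \<forall>e\<in>E. case g e of (a, b, c, f) \<Rightarrow> {a, b, c, f} \<subseteq> e \<and> distinct [a, b, c, f]" by (intro bchoice) blast
  then obtain g where g0: "\<forall>e\<in>E. case g e of (a, b, c, f) \<Rightarrow> {a, b, c, f} \<subseteq> e \<and> distinct [a, b, c, f]" ..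
  note g = bspec[OF g0]
  define Q where "Q = g ` E"
  have finQ: "finite Q" unfolding Q_def using finE by simp
  define F where "F = (\<lambda>(a, b, c, f). cd a b * cd b c * cd c f / (d b * d c))"
  define L where "L = C ^ 3 * \<kappa> ^ 3 * (?M / (4 * ?n))"
  have M0: "?M > 0" using M by simp
  have L0: "L > 0" unfolding L_def using C k M0 n0 by simp
  have QV: "Q \<subseteq> V \<times> V \<times> V \<times> V"
  proof
    fix x assume "x \<in> Q"
    then obtain e where e: "e \<in> E" "x = g e" unfolding Q_def by blast
    then have "e \<subseteq> V" using E G unfolding r_graph_on_def by auto
    then show "x \<in> V \<times> V \<times> V \<times> V" using g[OF e(1)] e(2) by (cases x) auto
  qed
  have F1: "L \<le> F x" if xQ: "x \<in> Q" for x
  proof -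
    obtain e where e: "e \<in> E" "x = g e" using xQ unfolding Q_def by blast
    obtain a b c f where x: "x = (a, b, c, f)" by (cases x) auto
    have abcf: "a \<in> e" "b \<in> e" "c \<in> e" "f \<in> e" "a \<noteq> b" "b \<noteq> c" "c \<noteq> f" using g[OF e(1)] e(2) x by auto
    let ?s = "\<lambda>v. sqrt (d v)"
    have dl: "d v \<ge> ?M / (4 * ?n)" if "v \<in> e" for v unfolding d_def using E(2)[OF e(1) that] by simp
    have dp: "d v > 0" if "v \<in> e" for v using dl[OF that] M0 n0 by (smt (verit) divide_pos_pos mult_pos_pos)
    have h: "C * \<kappa> * ?s u * ?s v \<le> cd u v" if "u \<in> e" "v \<in> e" "u \<noteq> v" for u v
      unfolding d_def cd_def using E(3)[OF e(1) that] by simp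
    have nn: "0 \<le> C * \<kappa> * ?s u * ?s v" for u v unfolding d_def using C k by simp
    \<comment> \<open>The degrees of the inner vertices cancel against the denominator of
      \<open>F\<close>; the square roots at the two outer vertices are bounded below by the minimum
      degree.\<close>
    have "L * (d b * d c) \<le> C ^ 3 * \<kappa> ^ 3 * (?s a * ?s f) * (d b * d c)"
    proof -
      have "?M / (4 * ?n) = sqrt (?M / (4 * ?n)) * sqrt (?M / (4 * ?n))" using M0 n0 by simp
      also have "\<dots> \<le> ?s a * ?s f" using dl abcf M0 n0 dp[OF abcf(1)] by (intro mult_mono real_sqrt_le_mono) auto
      finally show ?thesis unfolding L_def using C k dp[OF abcf(2)] dp[OF abcf(3)] by (intro mult_right_mono mult_left_mono) auto
    qed
    also have "\<dots> = (C * \<kappa> * ?s a * ?s b) * (C * \<kappa> * ?s b * ?s c) * (C * \<kappa> * ?s c * ?s f)"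
    proof -
      have "?s b * ?s b = d b" "?s c * ?s c = d c" using dp abcf by (auto simp: less_imp_le)
      moreover have "(C * \<kappa> * ?s a * ?s b) * (C * \<kappa> * ?s b * ?s c) * (C * \<kappa> * ?s c * ?s f) = C ^ 3 * \<kappa> ^ 3 * (?s a * ?s f) * ((?s b * ?s b) * (?s c * ?s c))"
        by (simp only: power3_eq_cube mult_ac)
      ultimately show ?thesis by (simp only:)
    qed
    also have "\<dots> \<le> cd a b * cd b c * cd c f"
      by (intro mult_mono h abcf nn mult_nonneg_nonneg) (auto simp: cd_def)
    finally have "L * (d b * d c) \<le> cd a b * cd b c * cd c f" .
    moreover have "d b * d c > 0" using dp abcf by simp
    ultimately show ?thesis unfolding F_def x by (simp add: pos_le_divide_eq)
  qed
  have F0: "0 \<le> F x" for x unfolding F_def cd_def d_def by (cases x) auto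
  have cds: "(\<Sum>v\<in>V. cd v u) = real r * d u" "(\<Sum>v\<in>V. cd u v) = real r * d u" for u
  proof -
    show "(\<Sum>v\<in>V. cd v u) = real r * d u"
      unfolding cd_def d_def using sum_codeg[OF V(1) G, of u] by (metis of_nat_mult of_nat_sum)
    then show "(\<Sum>v\<in>V. cd u v) = real r * d u" unfolding cd_def using codeg_sym[of G u] by simp
  qed
  have "L * real (card Q) \<le> (\<Sum>x\<in>Q. F x)" using sum_mono[of Q "\<lambda>_. L" F] F1 by (simp add: mult.commute)
  also have "\<dots> \<le> (\<Sum>x\<in>V \<times> V \<times> V \<times> V. F x)" using QV V F0 by (intro sum_mono2) auto
  also have "\<dots> = (\<Sum>a\<in>V. \<Sum>b\<in>V. \<Sum>c\<in>V. \<Sum>f\<in>V. cd a b * (cd b c / (d b * d c)) * cd c f)"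
    unfolding F_def by (simp add: sum.cartesian_product split_def)
  also have "\<dots> = (\<Sum>b\<in>V. \<Sum>c\<in>V. (real r * d b) * (cd b c / (d b * d c)) * (real r * d c))"
  proof -
    have "(\<Sum>a\<in>V. \<Sum>b\<in>V. \<Sum>c\<in>V. \<Sum>f\<in>V. cd a b * (cd b c / (d b * d c)) * cd c f) = (\<Sum>a\<in>V. \<Sum>b\<in>V. cd a b * (\<Sum>c\<in>V. (cd b c / (d b * d c)) * (real r * d c)))"
      by (simp only: sum_distrib_left[symmetric] cds(2) mult.assoc)
    also have "\<dots> = (\<Sum>b\<in>V. \<Sum>a\<in>V. cd a b * (\<Sum>c\<in>V. (cd b c / (d b * d c)) * (real r * d c)))" by (rule sum.swap)
    also have "\<dots> = (\<Sum>b\<in>V. (real r * d b) * (\<Sum>c\<in>V. (cd b c / (d b * d c)) * (real r * d c)))"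
      by (simp only: sum_distrib_right[symmetric] cds(1))
    also have "\<dots> = (\<Sum>b\<in>V. \<Sum>c\<in>V. (real r * d b) * (cd b c / (d b * d c)) * (real r * d c))"
      by (simp only: sum_distrib_left mult.assoc)
    finally show ?thesis .
  qed
  also have "\<dots> \<le> (\<Sum>b\<in>V. \<Sum>c\<in>V. real r ^ 2 * cd b c)"
  proof (intro sum_mono)
    fix b c
    have "(real r * d b) * (cd b c / (d b * d c)) * (real r * d c) = real r ^ 2 * cd b c * ((d b * d c) / (d b * d c))"
      by (simp add: power2_eq_square)
    also have "\<dots> \<le> real r ^ 2 * cd b c * 1" unfolding cd_def by (intro mult_left_mono) auto
    finally show "(real r * d b) * (cd b c / (d b * d c)) * (real r * d c) \<le> real r ^ 2 * cd b c" by simp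
  qed
  also have "\<dots> = real r ^ 2 * (\<Sum>b\<in>V. real r * d b)" by (simp only: sum_distrib_left[symmetric] cds(2))
  also have "\<dots> = real r ^ 2 * (real r * (real r * ?M))"
  proof -
    have "(\<Sum>b\<in>V. d b) = real r * ?M" unfolding d_def using sum_vdeg[OF V(1) G] by (metis of_nat_mult of_nat_sum)
    then show ?thesis by (simp add: sum_distrib_left[symmetric])
  qed
  also have "\<dots> = real r ^ 4 * ?M" by (simp add: power2_eq_square power4_eq_xxxx)
  finally have "L * real (card Q) \<le> real r ^ 4 * ?M" .
  then have cQ: "real (card Q) \<le> 4 * real r ^ 4 / C ^ 3 * ?n ^ 3"
  proof -
    have "real (card Q) \<le> real r ^ 4 * ?M / L" using \<open>L * real (card Q) \<le> real r ^ 4 * ?M\<close> L0 by (simp add: pos_le_divide_eq mult.commute)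
    also have "\<dots> = 4 * real r ^ 4 / C ^ 3 * ?n / \<kappa> ^ 3" unfolding L_def using M0 n0 C k by (simp add: field_simps)
    also have "\<dots> = 4 * real r ^ 4 / C ^ 3 * ?n * ?n ^ 2"
    proof -
      have "1 / \<kappa> ^ 3 = ?n ^ 2" using k by (simp add: field_simps)
      then show ?thesis by (metis mult.right_neutral times_divide_eq_right)
    qed
    finally show ?thesis by (simp add: power2_eq_square power3_eq_cube)
  qed
  have "card E = (\<Sum>x\<in>Q. card {e\<in>E. g e = x})"
  proof -
    have "card E = (\<Sum>e\<in>E. 1)" by simp
    also have "\<dots> = (\<Sum>x\<in>Q. \<Sum>e\<in>{e\<in>E. g e = x}. 1)" by (rule sum.group[symmetric]) (auto simp: finE finQ Q_def)
    finally show ?thesis by simp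
  qed
  also have "\<dots> \<le> (\<Sum>x\<in>Q. card V ^ (r - 4))"
  proof (rule sum_mono)
    fix x assume "x \<in> Q"
    then obtain e0 where e0: "e0 \<in> E" "x = g e0" unfolding Q_def by blast
    obtain a b c f where x: "x = (a, b, c, f)" by (cases x) auto
    let ?S = "{a, b, c, f}"
    have S4: "card ?S = 4" using g[OF e0(1)] e0(2) x by auto
    have "{e\<in>E. g e = x} \<subseteq> {e. e \<subseteq> V \<and> card e = r \<and> ?S \<subseteq> e}"
    proof
      fix e assume e: "e \<in> {e\<in>E. g e = x}"
      then have "?S \<subseteq> e" using g[of e] x by auto
      moreover have "e \<subseteq> V" "card e = r" using e E G unfolding r_graph_on_def by auto
      ultimately show "e \<in> {e. e \<subseteq> V \<and> card e = r \<and> ?S \<subseteq> e}" by blast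
    qed
    then have "card {e\<in>E. g e = x} \<le> card {e. e \<subseteq> V \<and> card e = r \<and> ?S \<subseteq> e}" using V by (intro card_mono) auto
    also have "\<dots> \<le> card V ^ (r - 4)" by (rule card_supersets[OF V(1) S4 r]) simp
    finally show "card {e\<in>E. g e = x} \<le> card V ^ (r - 4)" .
  qed
  finally have "card E \<le> card Q * card V ^ (r - 4)" by simp
  then have "real (card E) \<le> real (card Q) * ?n ^ (r - 4)" by (metis of_nat_le_iff of_nat_mult of_nat_power)
  also have "\<dots> \<le> (4 * real r ^ 4 / C ^ 3 * ?n ^ 3) * ?n ^ (r - 4)" using cQ by (intro mult_right_mono) auto
  also have "\<dots> = 4 * real r ^ 4 / C ^ 3 * ?n ^ (r - 1)"
  proof -
    have "r - 1 = 3 + (r - 4)" using r by simp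
    then show ?thesis by (metis mult.assoc power_add)
  qed
  finally show ?thesis .
qed

text \<open>Every surviving edge selects one of its pairs of small codegree, and
  \<open>\<rho>\<close> is the distribution of the selected pair. Its marginals must stay comparable
  to the degrees, which is what the cleaning secures.\<close>

lemma exists_spread_kernel:
  fixes \<kappa> D :: real and V :: "'a set" and l r :: nat
  assumes V: "finite V" "V \<noteq> {}" and G: "r_graph_on r V G" and r: "r \<ge> 4" and k: "\<kappa> > 0" "\<kappa> ^ 3 * real (card V) ^ 2 = 1"
    and M: "real (card G) \<ge> real (card V) ^ (r - 1)"
    and D: "D \<ge> 1" "D ^ (2 * l - 1) = real (card V)" "\<kappa> * real (card V) \<le> D ^ (l - 1)" and l: "l \<ge> 2"
  shows "\<exists>\<rho> m. spread_kernel V \<rho> (real (card V)) D \<kappa> (64 * real r ^ 5) l \<and> real (card G) / 4 \<le> m \<and>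
     (\<forall>u v. \<rho> u v \<noteq> 0 \<longrightarrow> u \<noteq> v) \<and> (\<forall>u v. 2 * m * \<rho> u v \<le> real (codeg G u v))"
proof -
  let ?n = "real (card V)" and ?M = "real (card G)"
  have n1: "?n \<ge> 1" using V by (simp add: Suc_le_eq card_gt_0_iff)
  have M1: "?M \<ge> 1" using M n1 one_le_power[of ?n "r - 1"] by linarith
  have r1: "real r \<ge> 1" using r by simp
  have finG: "finite G" using V G r_graph_finite by blast
  \<comment> \<open>This value makes the edges with only heavy pairs at most a quarter of all edges.
    The final \<open>64 * r ^ 5\<close> is \<open>C\<close> times the factor \<open>4 * r\<close>
    that may separate a degree from the weight \<open>W\<close> of the vertex.\<close>
  define C where "C = 16 * real r ^ 4"
  have rp: "1 \<le> real r ^ i" for i using r1 by (rule one_le_power)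
  have C1: "C \<ge> 1" unfolding C_def using rp[of 4] by linarith
  define low where "low = {e\<in>G. \<exists>v\<in>e. real (vdeg G v) < ?M / (4 * ?n)}"
  define lt where "lt = (\<lambda>u v. real (codeg G u v) \<le> C * \<kappa> * sqrt (vdeg G u) * sqrt (vdeg G v))"
  define hv where "hv = {e\<in>G. (\<forall>v\<in>e. real (vdeg G v) \<ge> ?M / (4 * ?n)) \<and> (\<forall>u\<in>e. \<forall>v\<in>e. u \<noteq> v \<longrightarrow> \<not> lt u v)}"
  define G3 where "G3 = {e\<in>G. (\<forall>v\<in>e. real (vdeg G v) \<ge> ?M / (4 * ?n)) \<and> (\<exists>u\<in>e. \<exists>v\<in>e. u \<noteq> v \<and> lt u v)}"
  have c_low: "real (card low) \<le> ?M / 4"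
  proof -
    have "low \<subseteq> (\<Union>v\<in>{v\<in>V. real (vdeg G v) < ?M / (4 * ?n)}. {e\<in>G. v \<in> e})" unfolding low_def using G unfolding r_graph_on_def by auto
    then have "card low \<le> card (\<Union>v\<in>{v\<in>V. real (vdeg G v) < ?M / (4 * ?n)}. {e\<in>G. v \<in> e})" using V finG by (intro card_mono) auto
    also have "\<dots> \<le> (\<Sum>v\<in>{v\<in>V. real (vdeg G v) < ?M / (4 * ?n)}. vdeg G v)" unfolding vdeg_def using V by (intro card_UN_le) auto
    finally have "real (card low) \<le> (\<Sum>v\<in>{v\<in>V. real (vdeg G v) < ?M / (4 * ?n)}. real (vdeg G v))" by (metis of_nat_le_iff of_nat_sum)
    also have "\<dots> \<le> (\<Sum>v\<in>{v\<in>V. real (vdeg G v) < ?M / (4 * ?n)}. ?M / (4 * ?n))" by (intro sum_mono) auto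
    also have "\<dots> \<le> (\<Sum>v\<in>V. ?M / (4 * ?n))" using V by (intro sum_mono2) auto
    also have "\<dots> = ?M / 4" using n1 by simp
    finally show ?thesis .
  qed
  have c_hv: "real (card hv) \<le> ?M / 4"
  proof -
    have "real (card hv) \<le> 4 * real r ^ 4 / C ^ 3 * ?n ^ (r - 1)"
      by (rule heavy_edges[OF V G r k C1]) (use M1 in \<open>auto simp: hv_def lt_def not_le\<close>)
    also have "4 * real r ^ 4 / C ^ 3 \<le> 1 / 4"
    proof -
      have "C ^ 1 \<le> C ^ 3" using C1 by (intro power_increasing) auto
      then have "16 * real r ^ 4 \<le> C ^ 3" unfolding C_def by simp
      moreover have "C ^ 3 > 0" using C1 by simp
      ultimately show ?thesis by (simp add: pos_divide_le_eq)
    qed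
    then have "4 * real r ^ 4 / C ^ 3 * ?n ^ (r - 1) \<le> 1 / 4 * ?n ^ (r - 1)" by (intro mult_right_mono) auto
    also have "\<dots> \<le> ?M / 4" using M by simp
    finally show ?thesis .
  qed
  have G3G: "G3 \<subseteq> G" unfolding G3_def by auto
  have c_G3: "real (card G3) \<ge> ?M / 2"
  proof -
    have "G \<subseteq> G3 \<union> (low \<union> hv)" unfolding G3_def low_def hv_def by (auto simp: not_le)
    then have "card G \<le> card (G3 \<union> (low \<union> hv))" using finG by (intro card_mono) (auto simp: G3_def low_def hv_def)
    also have "\<dots> \<le> card G3 + (card low + card hv)" by (meson add_left_mono card_Un_le le_trans)
    finally have "?M \<le> real (card G3) + (real (card low) + real (card hv))" by linarith
    then show ?thesis using c_low c_hv by linarith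
  qed
  have "\<exists>p. case p of (u, v) \<Rightarrow> u \<in> e \<and> v \<in> e \<and> u \<noteq> v \<and> lt u v" if "e \<in> G3" for e using that unfolding G3_def by auto
  then have "\<exists>g. \<forall>e\<in>G3. case g e of (u, v) \<Rightarrow> u \<in> e \<and> v \<in> e \<and> u \<noteq> v \<and> lt u v" by (intro bchoice) blast
  then obtain g where g0: "\<forall>e\<in>G3. case g e of (u, v) \<Rightarrow> u \<in> e \<and> v \<in> e \<and> u \<noteq> v \<and> lt u v" ..
  note g = bspec[OF g0]
  define \<phi> where "\<phi> = (\<lambda>e. {fst (g e), snd (g e)})"
  have lt_sym: "lt u v \<longleftrightarrow> lt v u" for u v unfolding lt_def using codeg_sym[of G u v] by (simp add: mult_ac)
  have phi: "\<phi> e \<subseteq> e" "card (\<phi> e) = 2" "\<And>u v. u \<noteq> v \<Longrightarrow> \<phi> e = {u, v} \<Longrightarrow> lt u v" if "e \<in> G3" for e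
  proof -
    obtain a b where ab: "g e = (a, b)" by (cases "g e") auto
    then have p: "a \<in> e" "b \<in> e" "a \<noteq> b" "lt a b" using g[OF that] by auto
    show "\<phi> e \<subseteq> e" "card (\<phi> e) = 2" unfolding \<phi>_def ab using p by auto
    show "lt u v" if "u \<noteq> v" "\<phi> e = {u, v}" for u v
    proof -
      have "(u = a \<and> v = b) \<or> (u = b \<and> v = a)" using that p unfolding \<phi>_def ab by (auto simp: doubleton_eq_iff)
      then show ?thesis using p lt_sym by blast
    qed
  qed
  \<comment> \<open>A vertex selected by less than a fraction \<open>1 / (4 * r)\<close> of its
    edges is dropped. The degrees sum to \<open>r * card G\<close>, so at most a quarter of the
    edges is lost.\<close>
  have "\<exists>E'\<subseteq>G3. sum (\<lambda>_. 1::real) E' \<ge> sum (\<lambda>_. 1) G3 - sum (\<lambda>v. real (vdeg G v) / (4 * real r)) V \<and>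
    (\<forall>v\<in>V. {e. v \<in> \<phi> e} \<inter> E' = {} \<or> sum (\<lambda>_. 1::real) ({e. v \<in> \<phi> e} \<inter> E') \<ge> real (vdeg G v) / (4 * real r))"
    by (rule remove_light_classes) (use V finG G3G finite_subset in auto)
  then obtain G4 where G4: "G4 \<subseteq> G3" "sum (\<lambda>_. 1::real) G4 \<ge> sum (\<lambda>_. 1) G3 - sum (\<lambda>v. real (vdeg G v) / (4 * real r)) V"
    and G4v: "\<And>v. v \<in> V \<Longrightarrow> {e. v \<in> \<phi> e} \<inter> G4 = {} \<or> sum (\<lambda>_. 1::real) ({e. v \<in> \<phi> e} \<inter> G4) \<ge> real (vdeg G v) / (4 * real r)" by blast
  define m where "m = real (card G4)"
  have fin4: "finite G4" by (rule finite_subset[OF G4(1) finite_subset[OF G3G finG]])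
  have m: "m \<ge> ?M / 4"
  proof -
    have "(\<Sum>v\<in>V. real (vdeg G v)) = real r * ?M" using sum_vdeg[OF V(1) G] by (metis of_nat_mult of_nat_sum)
    then have "(\<Sum>v\<in>V. real (vdeg G v) / (4 * real r)) = ?M / 4" using r1 by (simp add: sum_divide_distrib[symmetric])
    then show ?thesis using G4(2) c_G3 unfolding m_def by simp
  qed
  have m0: "m > 0" using m M1 by linarith
  have mM: "m \<le> ?M" unfolding m_def using G4(1) G3G finG by (simp add: card_mono order_trans[OF G4(1) G3G])
  define w where "w = (\<lambda>u v. if u = v then 0 else card {e\<in>G4. \<phi> e = {u, v}})"
  define W where "W = (\<lambda>u. card {e\<in>G4. u \<in> \<phi> e})"
  \<comment> \<open>Each edge counts for both orders of its pair, hence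
    \<open>2 * m\<close>.\<close>
  define \<rho> where "\<rho> = (\<lambda>u v. real (w u v) / (2 * m))"
  have phiV: "\<phi> e \<subseteq> V" if "e \<in> G4" for e using phi(1)[of e] that G4(1) G3G G unfolding r_graph_on_def by blast
  have wsum: "(\<Sum>v\<in>V. w u v) = W u" for u
  proof -
    have "(\<Sum>v\<in>V. w u v) = (\<Sum>v\<in>V. card {e\<in>G4. \<phi> e = {u, v} \<and> u \<noteq> v})" unfolding w_def by (intro sum.cong) auto
    also have "\<dots> = (\<Sum>e\<in>G4. card {v\<in>V. \<phi> e = {u, v} \<and> u \<noteq> v})" by (rule sum_multicount_gen) (use V fin4 in auto)
    also have "\<dots> = (\<Sum>e\<in>G4. if u \<in> \<phi> e then 1 else 0)"
    proof (rule sum.cong[OF refl])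
      fix e assume e: "e \<in> G4"
      then have c2: "card (\<phi> e) = 2" using phi G4 by blast
      show "card {v\<in>V. \<phi> e = {u, v} \<and> u \<noteq> v} = (if u \<in> \<phi> e then 1 else 0)"
      proof (cases "u \<in> \<phi> e")
        case True
        obtain a b where ab: "\<phi> e = {a, b}" "a \<noteq> b" using c2 by (meson card_2_iff)
        define x where "x = (if u = a then b else a)"
        have "\<phi> e = {u, x}" "u \<noteq> x" "x \<in> V" using ab True phiV[OF e] unfolding x_def by auto
        then have "{v\<in>V. \<phi> e = {u, v} \<and> u \<noteq> v} = {x}" by (auto simp: doubleton_eq_iff)
        then show ?thesis using True by simp
      next
        case False
        then have "{v\<in>V. \<phi> e = {u, v} \<and> u \<noteq> v} = {}" by auto
        then show ?thesis using False by (metis card.empty)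
      qed
    qed
    also have "\<dots> = W u" unfolding W_def using fin4 by (simp add: sum.If_cases Int_def)
    finally show ?thesis .
  qed
  have Wsum: "(\<Sum>u\<in>V. W u) = 2 * card G4"
  proof -
    have "(\<Sum>u\<in>V. W u) = (\<Sum>e\<in>G4. card {u\<in>V. u \<in> \<phi> e})" unfolding W_def by (rule sum_multicount_gen) (use V fin4 in auto)
    also have "\<dots> = (\<Sum>e\<in>G4. 2)"
    proof (rule sum.cong[OF refl])
      fix e assume e: "e \<in> G4"
      have "{u\<in>V. u \<in> \<phi> e} = \<phi> e" using phiV[OF e] by auto
      then show "card {u\<in>V. u \<in> \<phi> e} = 2" using phi G4 e by auto
    qed
    finally show ?thesis by simp
  qed
  have wW: "w u v \<le> W u" for u v unfolding w_def W_def using fin4 by (auto intro!: card_mono)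
  have Wlow: "real (W u) \<ge> real (vdeg G u) / (4 * real r)" "real (vdeg G u) \<ge> ?M / (4 * ?n)" if W0: "W u \<noteq> 0" for u
  proof -
    have "{e\<in>G4. u \<in> \<phi> e} \<noteq> {}" using W0 unfolding W_def by (metis card.empty)
    then obtain e where e: "e \<in> G4" "u \<in> \<phi> e" by blast
    have uV: "u \<in> V" using e phiV by blast
    have eq: "{e. u \<in> \<phi> e} \<inter> G4 = {e\<in>G4. u \<in> \<phi> e}" by auto
    show "real (W u) \<ge> real (vdeg G u) / (4 * real r)" using G4v[OF uV] e unfolding eq W_def by auto
    have "e \<in> G3" "u \<in> e" using e G4(1) phi(1)[of e] by auto
    then show "real (vdeg G u) \<ge> ?M / (4 * ?n)" unfolding G3_def by auto
  qed
  have wsym: "w u v = w v u" for u v unfolding w_def by (auto simp: insert_commute)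
  interpret rk: rev_kernel V \<rho>
  proof
    show "finite V" by (rule V)
    show "0 \<le> \<rho> u v" for u v unfolding \<rho>_def using m0 by simp
    show "\<rho> u v = \<rho> v u" for u v unfolding \<rho>_def using wsym by simp
    show "u \<in> V" if "\<rho> u v \<noteq> 0" for u v
    proof -
      have "w u v \<noteq> 0" using that unfolding \<rho>_def by auto
      then have "W u \<noteq> 0" using wW[of u v] by simp
      then have "{e\<in>G4. u \<in> \<phi> e} \<noteq> {}" unfolding W_def by (metis card.empty)
      then obtain e where "e \<in> G4" "u \<in> \<phi> e" by blast
      then show ?thesis using phiV by blast
    qed
  qed
  have pp: "rk.pp u = real (W u) / (2 * m)" for u
  proof -
    have "rk.pp u = (\<Sum>v\<in>V. real (w u v)) / (2 * m)" unfolding rk.pp_def by (simp add: \<rho>_def sum_divide_distrib)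
    also have "(\<Sum>v\<in>V. real (w u v)) = real (W u)" unfolding wsum[symmetric] by simp
    finally show ?thesis .
  qed
  have "spread_kernel V \<rho> ?n D \<kappa> (64 * real r ^ 5) l"
  proof
    show "(\<Sum>u\<in>V. rk.pp u) = 1"
    proof -
      have "(\<Sum>u\<in>V. rk.pp u) = (\<Sum>u\<in>V. real (W u)) / (2 * m)" unfolding pp by (simp add: sum_divide_distrib)
      also have "(\<Sum>u\<in>V. real (W u)) = 2 * m" using Wsum unfolding m_def by (metis of_nat_sum of_nat_mult of_nat_numeral)
      finally show ?thesis using m0 by simp
    qed
    show "1 \<le> 64 * real r ^ 5" using rp[of 5] by linarith
    show "1 / rk.pp u \<le> 64 * real r ^ 5 * ?n" if "rk.pp u \<noteq> 0" for u
    proof -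
      have W0: "W u \<noteq> 0" using that unfolding pp by auto
      have "?M / (16 * real r * ?n) = ?M / (4 * ?n) / (4 * real r)" by simp
      also have "\<dots> \<le> real (vdeg G u) / (4 * real r)" using Wlow(2)[OF W0] by (intro divide_right_mono) auto
      also have "\<dots> \<le> real (W u)" by (rule Wlow(1)[OF W0])
      finally have "?M / (16 * real r * ?n) \<le> real (W u)" .
      then have "?M \<le> real (W u) * (16 * real r * ?n)" using r1 n1 by (simp add: pos_divide_le_eq)
      then have "m \<le> real (W u) * (16 * real r * ?n)" using mM by linarith
      then have "2 * m / real (W u) \<le> 32 * real r * ?n" using W0 by (simp add: field_simps)
      also have "\<dots> \<le> 64 * real r ^ 5 * ?n"
      proof (rule mult_right_mono)
        have "real r * 1 \<le> real r * real r ^ 4" using rp[of 4] r1 by (intro mult_left_mono) auto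
        also have "real r * real r ^ 4 = real r ^ 5" by (simp add: numeral_eq_Suc)
        finally have "real r \<le> real r ^ 5" by simp
        then show "32 * real r \<le> 64 * real r ^ 5" using r1 by linarith
      qed simp
      finally show ?thesis unfolding pp by simp
    qed
    show "\<rho> u v \<le> 64 * real r ^ 5 * \<kappa> * sqrt (rk.pp u) * sqrt (rk.pp v)" for u v
    proof (cases "w u v = 0")
      case True
      then have "\<rho> u v = 0" by (simp add: \<rho>_def)
      then show ?thesis using k rk.pp_nonneg by simp
    next
      case False
      then have uv: "u \<noteq> v" "{e\<in>G4. \<phi> e = {u, v}} \<noteq> {}" unfolding w_def by (metis, metis card.empty)
      then obtain e where e: "e \<in> G4" "\<phi> e = {u, v}" by blast
      have lt: "lt u v" using phi(3)[of e u v] e uv G4(1) by blast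
      have wc: "w u v \<le> codeg G u v"
      proof -
        have "{e\<in>G4. \<phi> e = {u, v}} \<subseteq> {e\<in>G. u \<in> e \<and> v \<in> e}" using phi(1) G4(1) G3G by blast
        then show ?thesis unfolding w_def codeg_def using finG uv by (simp add: card_mono)
      qed
      have W0: "W u \<noteq> 0" "W v \<noteq> 0" using False wW[of u v] wW[of v u] wsym[of u v] by auto
      have dW: "real (vdeg G x) \<le> (4 * real r) * (2 * m) * rk.pp x" if "W x \<noteq> 0" for x
        using Wlow(1)[OF that] r1 m0 unfolding pp by (simp add: field_simps)
      have "real (w u v) \<le> C * \<kappa> * sqrt (vdeg G u) * sqrt (vdeg G v)" using wc lt unfolding lt_def by linarith
      also have "\<dots> \<le> C * \<kappa> * sqrt ((4 * real r) * (2 * m) * rk.pp u) * sqrt ((4 * real r) * (2 * m) * rk.pp v)"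
        using dW W0 C1 k by (intro mult_mono mult_left_mono real_sqrt_le_mono mult_nonneg_nonneg) (auto simp: rk.pp_nonneg m0 less_imp_le)
      also have "\<dots> = C * \<kappa> * ((4 * real r) * (2 * m)) * (sqrt (rk.pp u) * sqrt (rk.pp v))"
      proof -
        have "sqrt (4 * real r * (2 * m)) * sqrt (4 * real r * (2 * m)) = 4 * real r * (2 * m)" using m0 by simp
        then show ?thesis unfolding real_sqrt_mult[of "4 * real r * (2 * m)"] by (metis (no_types, opaque_lifting) mult.assoc mult.commute mult.left_commute)
      qed
      also have "\<dots> = 2 * m * (64 * real r ^ 5 * \<kappa> * sqrt (rk.pp u) * sqrt (rk.pp v))"
        unfolding C_def by (simp add: numeral_eq_Suc)
      finally show ?thesis unfolding \<rho>_def using m0 by (simp add: pos_divide_le_eq mult.commute)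
    qed
  qed (use n1 D l k in auto)
  moreover have "\<rho> u v \<noteq> 0 \<longrightarrow> u \<noteq> v" for u v unfolding \<rho>_def w_def by auto
  moreover have "2 * m * \<rho> u v \<le> real (codeg G u v)" for u v
  proof (cases "u = v")
    case True
    then show ?thesis unfolding \<rho>_def w_def by simp
  next
    case False
    have "{e\<in>G4. \<phi> e = {u, v}} \<subseteq> {e\<in>G. u \<in> e \<and> v \<in> e}" using phi(1) G4(1) G3G by blast
    then have "w u v \<le> codeg G u v" unfolding w_def codeg_def using finG False by (simp add: card_mono)
    then show ?thesis unfolding \<rho>_def using m0 by simp
  qed
  ultimately show ?thesis using m by (intro exI[of _ \<rho>] exI[of _ m]) blast
qed

section \<open>Weights on linear cycles\<close>

text \<open>The edge through \<open>c i\<close> and the next junction vertex is drawn uniformly among the edges that avoid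
  everything chosen before; by fullness this is at least a fraction \<open>1 / r\<close> of all edges through the pair.\<close>

lemma expansion_weight:
  fixes V :: "'a set" and \<rho> :: "'a \<Rightarrow> 'a \<Rightarrow> real" and f :: "(nat \<Rightarrow> 'a) \<Rightarrow> real" and l r K :: nat
  assumes V: "finite V" and G: "r_graph_on r V G" and r: "r \<ge> 4" and l: "l \<ge> 2"
    and full: "\<And>A. A \<subseteq> V \<Longrightarrow> card A = r - 1 \<Longrightarrow> {e\<in>G. A \<subseteq> e} = {} \<or> K \<le> card {e\<in>G. A \<subseteq> e}"
    and K: "K \<ge> (r + 1) * (2 * l * (r + 1))"
    and ker: "rev_kernel V \<rho>" and m: "m > 0" and rho_ne: "\<And>u v. \<rho> u v \<noteq> 0 \<Longrightarrow> u \<noteq> v"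
    and rho_le: "\<And>u v. 2 * m * \<rho> u v \<le> real (codeg G u v)"
    and f0: "\<And>c. 0 \<le> f c"
    and fs: "\<And>c. f c \<noteq> 0 \<Longrightarrow> inj_on c {..<2 * l}" "\<And>c i. f c \<noteq> 0 \<Longrightarrow> i < 2 * l \<Longrightarrow> \<rho> (c i) (c (if Suc i = 2 * l then 0 else Suc i)) \<noteq> 0"
    and fm: "\<And>c. isums V [0..<2 * l] f c \<ge> a"
    and fb: "\<And>J T c. J \<subseteq> {..<2 * l} \<Longrightarrow> J \<noteq> {} \<Longrightarrow> (\<And>i u v. 0 \<le> T i u v) \<Longrightarrow>
      isums V [0..<2 * l] (\<lambda>c. f c * (\<Prod>i\<in>J. T i (c i) (c (if Suc i = 2 * l then 0 else Suc i)))) c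
        \<le> B * (s ^ (card J - 1) * (\<Prod>i\<in>J. rev_kernel.ang V \<rho> (T i)))"
    and B: "B \<ge> 0" and s: "s \<ge> 0"
  shows "\<exists>\<mu>. uniform_weight G (2 * l) \<mu> \<and> wdeg G \<mu> {} \<ge> a \<and>
    (\<forall>\<sigma>. 1 \<le> card \<sigma> \<longrightarrow> card \<sigma> \<le> 2 * l \<longrightarrow> wdeg G \<mu> \<sigma> \<le> real (2 * l) ^ (2 * l) * (B * (s ^ (card \<sigma> - 1) * (real r ^ 3 / (2 * m)) ^ card \<sigma>))) \<and>
    (\<forall>H. lin_cycle_free r (2 * l) V H \<longrightarrow> weight_indep \<mu> H)"
proof -
  interpret rk: rev_kernel V \<rho> by (rule ker)
  have finG: "finite G" by (rule r_graph_finite[OF V G])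
  define nx where "nx = (\<lambda>i. if Suc i = 2 * l then 0 else Suc i)"
  \<comment> \<open>All junctions are avoided but only the edges of smaller index, precisely the
    form required by \<open>lin_cycle_copy\<close>.\<close>
  define Gd where "Gd = (\<lambda>i (c :: nat \<Rightarrow> 'a) (E :: nat \<Rightarrow> 'a set). {e\<in>G. c i \<in> e \<and> c (nx i) \<in> e \<and>
     (e - {c i, c (nx i)}) \<inter> (c ` {..<2 * l} \<union> (\<Union>j<i. E j)) = {}})"
  define g where "g = (\<lambda>i c E. of_bool (E i \<in> Gd i c E) / real (card (Gd i c E)))"
  define P where "P = (\<lambda>k c E. \<Prod>i<k. g i c E)"
  have finGd: "finite (Gd i c E)" for i c E unfolding Gd_def using finG by auto
  have GdG: "Gd i c E \<subseteq> G" for i c E unfolding Gd_def by auto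
  have g0: "0 \<le> g i c E" for i c E unfolding g_def by simp
  have P0: "0 \<le> P k c E" for k c E unfolding P_def using g0 by (intro prod_nonneg) auto
  have PS: "P (Suc k) c E = P k c E * g k c E" for k c E unfolding P_def by simp
  have Pmem: "E i \<in> Gd i c E" if "P k c E \<noteq> 0" "i < k" for k c E i
  proof -
    have "g i c E \<noteq> 0" using that unfolding P_def by auto
    then show ?thesis unfolding g_def by auto
  qed
  have dGd: "Gd i c (E(i := e)) = Gd i c E" for i c E e
  proof -
    have "(\<Union>j<i. (E(i := e)) j) = (\<Union>j<i. E j)" by auto
    then show ?thesis unfolding Gd_def by simp
  qed
  have dP: "depends_on {..<k} (P k c)" for k c
    unfolding depends_on_def P_def
  proof (intro allI impI prod.cong refl)
    fix E E' :: "nat \<Rightarrow> 'a set" and i assume h: "\<forall>j\<in>{..<k}. E j = E' j" and i: "i \<in> {..<k}"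
    have "(\<Union>j<i. E j) = (\<Union>j<i. E' j)" using h i by auto
    then have "Gd i c E = Gd i c E'" unfolding Gd_def by simp
    then show "g i c E = g i c E'" unfolding g_def using h i by simp
  qed
  have Gdcard: "2 * m * \<rho> (c i) (c (nx i)) / real r \<le> real (card (Gd i c E))" "card (Gd i c E) > 0"
    if fc: "f c \<noteq> 0" and i: "i < 2 * l" and P: "P i c E \<noteq> 0" for c E i
  proof -
    let ?u = "c i" and ?v = "c (nx i)"
    \<comment> \<open>At most \<open>2 * l\<close> junctions and \<open>2 * l\<close> earlier edges
      of \<open>r\<close> vertices each: the origin of \<open>2 * l * (r + 1)\<close> in the bound
      on \<open>K\<close>.\<close>
    let ?X = "c ` {..<2 * l} \<union> (\<Union>j<i. E j)"
    have rp: "\<rho> ?u ?v > 0" using fs(2)[OF fc i] rk.rho_nonneg[of ?u ?v] unfolding nx_def by linarith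
    have Ej: "finite (E j)" "card (E j) = r" if "j < i" for j
      using Pmem[OF P that] GdG[of j c E] G unfolding r_graph_on_def by auto
    have "card (\<Union>j<i. E j) \<le> (\<Sum>j<i. card (E j))" by (rule card_UN_le) simp
    also have "\<dots> = i * r" using Ej by simp
    also have "\<dots> \<le> 2 * l * r" using i by simp
    finally have cU: "card (\<Union>j<i. E j) \<le> 2 * l * r" .
    have "card ?X \<le> card (c ` {..<2 * l}) + card (\<Union>j<i. E j)" by (rule card_Un_le)
    also have "\<dots> \<le> 2 * l + 2 * l * r" using cU card_image_le[of "{..<2 * l}" c] by simp
    finally have cX: "card ?X \<le> 2 * l * (r + 1)" by simp
    have finX: "finite ?X" using Ej by auto
    have "card {e\<in>G. ?u \<in> e \<and> ?v \<in> e} \<le> r * card {e\<in>G. ?u \<in> e \<and> ?v \<in> e \<and> (e - {?u, ?v}) \<inter> ?X = {}}"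
      by (rule edges_avoiding_set[OF V G _ _ full finX cX _ K]) (use r l rp rho_ne[of ?u ?v] in auto)
    then have "real (codeg G ?u ?v) \<le> real (r * card (Gd i c E))" unfolding codeg_def Gd_def by (rule of_nat_mono)
    then have le: "2 * m * \<rho> ?u ?v \<le> real (card (Gd i c E)) * real r" using rho_le[of ?u ?v] by (simp add: mult.commute)
    then show "2 * m * \<rho> ?u ?v / real r \<le> real (card (Gd i c E))" using r by (simp add: pos_divide_le_eq)
    have "0 < 2 * m * \<rho> ?u ?v" using m rp by simp
    then have "0 < real (card (Gd i c E)) * real r" using le by linarith
    then show "card (Gd i c E) > 0" by (metis mult_zero_left of_nat_0 less_irrefl neq0_conv)
  qed
  have P_one: "isums G [0..<k] (P k c) E = 1" if fc: "f c \<noteq> 0" and "k \<le> 2 * l" for c k E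
    using that(2)
  proof (induction k arbitrary: E)
    case 0
    then show ?case by (simp add: P_def)
  next
    case (Suc k)
    have step: "isum G k (P (Suc k) c) = P k c"
    proof
      fix E
      have "isum G k (P (Suc k) c) E = isum G k (\<lambda>E. P k c E * g k c E) E" unfolding isum_def PS ..
      also have "\<dots> = P k c E * isum G k (g k c) E" by (rule isum_factor[OF dP]) simp
      also have "\<dots> = P k c E"
      proof (cases "P k c E = 0")
        case False
        have "isum G k (g k c) E = (\<Sum>e\<in>G. if e \<in> Gd k c E then 1 / real (card (Gd k c E)) else 0)"
          unfolding isum_def g_def dGd by (intro sum.cong) auto
        also have "\<dots> = (\<Sum>e\<in>{e\<in>G. e \<in> Gd k c E}. 1 / real (card (Gd k c E)))" by (rule sum.inter_filter[OF finG, symmetric])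
        also have "{e\<in>G. e \<in> Gd k c E} = Gd k c E" using GdG[of k c E] by auto
        also have "(\<Sum>e\<in>Gd k c E. 1 / real (card (Gd k c E))) = 1" using Gdcard(2)[OF fc _ False] Suc.prems by simp
        finally show ?thesis by simp
      qed simp
      finally show "isum G k (P (Suc k) c) E = P k c E" .
    qed
    have "isums G [0..<Suc k] (P (Suc k) c) E = isums G [0..<k] (P k c) E" by (simp add: isums_append step)
    then show ?case using Suc by simp
  qed
  \<comment> \<open>Prescribing the edge \<open>S i\<close> forces the junctions into
    \<open>S i\<close> and has probability at most \<open>r / (2 * m * \<rho> u v)\<close>. In
    \<open>ang\<close> the factor \<open>\<rho>\<close> cancels, leaving \<open>r / (2 * m)\<close>
    for each of the at most \<open>r ^ 2\<close> ordered pairs in \<open>S i\<close>.\<close>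
  define T where "T = (\<lambda>(S :: nat \<Rightarrow> 'a set) i u v. of_bool (u \<in> S i \<and> v \<in> S i) * (real r / (2 * m * \<rho> u v)))"
  have T0: "0 \<le> T S i u v" for S i u v unfolding T_def using m rk.rho_nonneg by simp
  have P_test: "isums G [0..<k] (\<lambda>E. P k c E * (\<Prod>i\<in>J \<inter> {..<k}. of_bool (E i = S i))) E \<le> (\<Prod>i\<in>J \<inter> {..<k}. T S i (c i) (c (nx i)))"
    if fc: "f c \<noteq> 0" and "k \<le> 2 * l" and finJ: "finite J" for c k E J S
    using that(2)
  proof (induction k arbitrary: E)
    case 0
    then show ?case by (simp add: P_def)
  next
    case (Suc k)
    let ?b = "if k \<in> J then T S k (c k) (c (nx k)) else 1"
    let ?F = "\<lambda>k E. P k c E * (\<Prod>i\<in>J \<inter> {..<k}. of_bool (E i = S i))"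
    have Js: "J \<inter> {..<Suc k} = (if k \<in> J then insert k (J \<inter> {..<k}) else J \<inter> {..<k})" by (auto simp: less_Suc_eq)
    have F0: "0 \<le> ?F k E" for k E using P0 by (intro mult_nonneg_nonneg prod_nonneg) auto
    have b0: "0 \<le> ?b" using T0 by simp
    have st: "isum G k (?F (Suc k)) E \<le> ?b * ?F k E" for E
    proof -
      let ?h = "\<lambda>E. if k \<in> J then of_bool (E k = S k) else 1 :: real"
      have FS: "?F (Suc k) E = ?F k E * (g k c E * ?h E)" for E
        unfolding PS Js using finJ by simp
      have dF: "depends_on {..<k} (?F k)"
        unfolding depends_on_def
      proof (intro allI impI)
        fix E E' :: "nat \<Rightarrow> 'a set" assume h: "\<forall>j\<in>{..<k}. E j = E' j"
        have "P k c E = P k c E'" by (rule depends_onD[OF dP]) (use h in auto)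
        moreover have "(\<Prod>i\<in>J \<inter> {..<k}. of_bool (E i = S i) :: real) = (\<Prod>i\<in>J \<inter> {..<k}. of_bool (E' i = S i))" using h by (intro prod.cong) auto
        ultimately show "?F k E = ?F k E'" by simp
      qed
      have "isum G k (?F (Suc k)) E = isum G k (\<lambda>E. ?F k E * (g k c E * ?h E)) E" unfolding isum_def FS ..
      also have "\<dots> = ?F k E * isum G k (\<lambda>E. g k c E * ?h E) E" by (rule isum_factor[OF dF]) simp
      also have "\<dots> \<le> ?F k E * ?b"
      proof (cases "P k c E = 0")
        case False
        have k2: "k < 2 * l" using Suc.prems by simp
        note Gc = Gdcard[OF fc k2 False]
        have eq: "isum G k (\<lambda>E. g k c E * ?h E) E = (\<Sum>e\<in>G. of_bool (e \<in> Gd k c E) / real (card (Gd k c E)) * (if k \<in> J then of_bool (e = S k) else 1))"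
          unfolding isum_def g_def dGd by (simp cong: if_cong)
        have "isum G k (\<lambda>E. g k c E * ?h E) E \<le> ?b"
        proof (cases "k \<in> J")
          case True
          have "isum G k (\<lambda>E. g k c E * ?h E) E = (\<Sum>e\<in>G. if e = S k then of_bool (S k \<in> Gd k c E) / real (card (Gd k c E)) else 0)"
            unfolding eq using True by (intro sum.cong) auto
          also have "\<dots> \<le> of_bool (S k \<in> Gd k c E) / real (card (Gd k c E))" using finG by (simp add: sum.delta)
          also have "\<dots> \<le> T S k (c k) (c (nx k))"
          proof (cases "S k \<in> Gd k c E")
            case True
            then have mem: "c k \<in> S k" "c (nx k) \<in> S k" unfolding Gd_def by auto
            have rp: "\<rho> (c k) (c (nx k)) > 0" using fs(2)[OF fc k2] rk.rho_nonneg[of "c k" "c (nx k)"] unfolding nx_def by linarith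
            have pos: "0 < 2 * m * \<rho> (c k) (c (nx k)) / real r" using rp m r by simp
            have "1 / real (card (Gd k c E)) \<le> 1 / (2 * m * \<rho> (c k) (c (nx k)) / real r)"
              by (rule divide_left_mono[OF Gc(1)]) (simp, rule mult_pos_pos, use Gc(2) pos in simp_all)
            then show ?thesis unfolding T_def using True mem by simp
          next
            case False
            then show ?thesis using T0 by simp
          qed
          finally show ?thesis using True by simp
        next
          case False
          have "isum G k (\<lambda>E. g k c E * ?h E) E = (\<Sum>e\<in>G. if e \<in> Gd k c E then 1 / real (card (Gd k c E)) else 0)"
            unfolding eq using False by (intro sum.cong) auto
          also have "\<dots> = (\<Sum>e\<in>{e\<in>G. e \<in> Gd k c E}. 1 / real (card (Gd k c E)))" by (rule sum.inter_filter[OF finG, symmetric])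
          also have "{e\<in>G. e \<in> Gd k c E} = Gd k c E" using GdG[of k c E] by auto
          also have "(\<Sum>e\<in>Gd k c E. 1 / real (card (Gd k c E))) = 1" using Gc by simp
          finally show ?thesis using False by simp
        qed
        then show ?thesis by (rule mult_left_mono[OF _ F0])
      qed simp
      finally show ?thesis by (simp add: mult.commute)
    qed
    have "isums G [0..<Suc k] (?F (Suc k)) E = isums G [0..<k] (isum G k (?F (Suc k))) E" by (simp add: isums_append)
    also have "\<dots> \<le> isums G [0..<k] (\<lambda>E. ?b * ?F k E) E" using st by (rule isums_mono)
    also have "\<dots> = ?b * isums G [0..<k] (?F k) E" by (rule isums_cmult)
    also have "\<dots> \<le> ?b * (\<Prod>i\<in>J \<inter> {..<k}. T S i (c i) (c (nx i)))" using Suc b0 by (intro mult_left_mono) auto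
    also have "\<dots> = (\<Prod>i\<in>J \<inter> {..<Suc k}. T S i (c i) (c (nx i)))" unfolding Js using finJ by simp
    finally show ?case .
  qed
  \<comment> \<open>The hypotheses on \<open>f\<close> and the facts on \<open>P\<close> hold for
    every base point, so arbitrary ones will do.\<close>
  define c0 :: "nat \<Rightarrow> 'a" where "c0 = undefined"
  define E0 :: "nat \<Rightarrow> 'a set" where "E0 = undefined"
  define I where "I = (\<lambda>h :: (nat \<Rightarrow> 'a set) \<Rightarrow> real. isums V [0..<2 * l] (\<lambda>c. f c * isums G [0..<2 * l] (\<lambda>E. P (2 * l) c E * h E) E0) c0)"
  have I_mono: "I h \<le> I h'" if "\<And>c E. f c \<noteq> 0 \<Longrightarrow> P (2 * l) c E \<noteq> 0 \<Longrightarrow> h E \<le> h' E" for h h'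
    unfolding I_def
  proof (rule isums_mono)
    fix c
    show "f c * isums G [0..<2 * l] (\<lambda>E. P (2 * l) c E * h E) E0 \<le> f c * isums G [0..<2 * l] (\<lambda>E. P (2 * l) c E * h' E) E0"
    proof (cases "f c = 0")
      case False
      show ?thesis
      proof (rule mult_left_mono[OF _ f0], rule isums_mono)
        fix E show "P (2 * l) c E * h E \<le> P (2 * l) c E * h' E" using that[OF False] P0[of "2 * l" c E]
          by (cases "P (2 * l) c E = 0") (auto intro: mult_left_mono)
      qed
    qed simp
  qed
  have I_sum: "I (\<lambda>E. \<Sum>x\<in>A. h x E) = (\<Sum>x\<in>A. I (h x))" for A :: "'c set" and h
    unfolding I_def by (simp only: sum_distrib_left isums_sum)
  have I_nonneg: "0 \<le> I h" if "\<And>E. 0 \<le> h E" for h unfolding I_def using that f0 P0 by (intro isums_nonneg mult_nonneg_nonneg) auto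
  define \<mu> where "\<mu> = (\<lambda>\<tau>. I (\<lambda>E. of_bool (E ` {..<2 * l} = \<tau>)))"
  have Pprop: "E i \<in> G" "c i \<in> E i" "c (nx i) \<in> E i" "(E i - {c i, c (nx i)}) \<inter> (c ` {..<2 * l} \<union> (\<Union>j<i. E j)) = {}" "card (E i) = r" "finite (E i)" "E i \<subseteq> V"
    if "P (2 * l) c E \<noteq> 0" "i < 2 * l" for c E i
    using Pmem[OF that] G unfolding Gd_def r_graph_on_def by auto
  \<comment> \<open>Each edge has a vertex besides its two junctions, and that vertex lies in no
    earlier edge.\<close>
  have Einj: "inj_on E {..<2 * l}" if P: "P (2 * l) c E \<noteq> 0" for c E
  proof -
    have ne: "E i \<noteq> E j" if "i < j" "j < 2 * l" for i j
    proof
      assume eq: "E i = E j"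
      have "card (E j - {c j, c (nx j)}) \<ge> card (E j) - card {c j, c (nx j)}" by (rule diff_card_le_card_Diff) simp
      moreover have "card {c j, c (nx j)} \<le> 2" by (simp add: card_insert_if)
      ultimately have "card (E j - {c j, c (nx j)}) > 0" using Pprop(5)[OF P that(2)] r by linarith
      then obtain x where x: "x \<in> E j - {c j, c (nx j)}" by (metis card.empty ex_in_conv less_irrefl)
      then have "x \<in> (\<Union>k<j. E k)" using eq that(1) by auto
      then show False using Pprop(4)[OF P that(2)] x by blast
    qed
    show ?thesis
    proof (rule inj_onI)
      fix i j assume "i \<in> {..<2 * l}" "j \<in> {..<2 * l}" "E i = E j"
      then show "i = j" using ne[of i j] ne[of j i] by (metis lessThan_iff linorder_neqE_nat)
    qed
  qed
  have wit: "\<exists>c E. f c \<noteq> 0 \<and> P (2 * l) c E \<noteq> 0 \<and> E ` {..<2 * l} = \<tau>" if mt: "\<mu> \<tau> \<noteq> 0" for \<tau>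
  proof -
    obtain c where c: "f c * isums G [0..<2 * l] (\<lambda>E. P (2 * l) c E * of_bool (E ` {..<2 * l} = \<tau>)) E0 \<noteq> 0"
      using isums_nonzero[OF mt[unfolded \<mu>_def I_def]] by blast
    then have "isums G [0..<2 * l] (\<lambda>E. P (2 * l) c E * of_bool (E ` {..<2 * l} = \<tau>)) E0 \<noteq> 0" by auto
    then obtain E where "P (2 * l) c E * of_bool (E ` {..<2 * l} = \<tau>) \<noteq> 0" using isums_nonzero by blast
    then show ?thesis using c by (intro exI[of _ c] exI[of _ E]) auto
  qed
  have uw: "uniform_weight G (2 * l) \<mu>"
    unfolding uniform_weight_def
  proof (intro allI conjI impI)
    show "0 \<le> \<mu> \<tau>" for \<tau> unfolding \<mu>_def by (rule I_nonneg) simp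
    fix \<tau> assume mt: "\<mu> \<tau> \<noteq> 0"
    obtain c E where cE: "f c \<noteq> 0" "P (2 * l) c E \<noteq> 0" "E ` {..<2 * l} = \<tau>"
      using wit[OF mt] by (elim exE conjE)
    show "\<tau> \<subseteq> G" using cE(3) Pprop(1)[OF cE(2)] by auto
    show "card \<tau> = 2 * l" using card_image[OF Einj[OF cE(2)]] cE(3) by simp
  qed
  have wd: "wdeg G \<mu> \<sigma> = I (\<lambda>E. of_bool (E ` {..<2 * l} \<subseteq> G \<and> \<sigma> \<subseteq> E ` {..<2 * l}))" for \<sigma>
  proof -
    have "wdeg G \<mu> \<sigma> = I (\<lambda>E. \<Sum>\<tau> | \<tau> \<subseteq> G \<and> \<sigma> \<subseteq> \<tau>. of_bool (E ` {..<2 * l} = \<tau>))"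
      unfolding wdeg_def \<mu>_def I_sum ..
    also have "(\<lambda>E. \<Sum>\<tau> | \<tau> \<subseteq> G \<and> \<sigma> \<subseteq> \<tau>. of_bool (E ` {..<2 * l} = \<tau>) :: real) = (\<lambda>E. of_bool (E ` {..<2 * l} \<subseteq> G \<and> \<sigma> \<subseteq> E ` {..<2 * l}))"
    proof
      fix E :: "nat \<Rightarrow> 'a set"
      have fin: "finite {\<tau>. \<tau> \<subseteq> G \<and> \<sigma> \<subseteq> \<tau>}" using finG by auto
      have "(\<Sum>\<tau> | \<tau> \<subseteq> G \<and> \<sigma> \<subseteq> \<tau>. of_bool (E ` {..<2 * l} = \<tau>) :: real) = (\<Sum>\<tau> | \<tau> \<subseteq> G \<and> \<sigma> \<subseteq> \<tau>. if E ` {..<2 * l} = \<tau> then 1 else 0)"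
        by (intro sum.cong) auto
      then show "(\<Sum>\<tau> | \<tau> \<subseteq> G \<and> \<sigma> \<subseteq> \<tau>. of_bool (E ` {..<2 * l} = \<tau>) :: real) = of_bool (E ` {..<2 * l} \<subseteq> G \<and> \<sigma> \<subseteq> E ` {..<2 * l})"
        using fin by (simp add: sum.delta)
    qed
    finally show ?thesis .
  qed
  have tot: "wdeg G \<mu> {} \<ge> a"
  proof -
    have "a \<le> isums V [0..<2 * l] f c0" by (rule fm)
    also have "\<dots> = I (\<lambda>_. 1)"
      unfolding I_def
    proof -
      have "f c * isums G [0..<2 * l] (\<lambda>E. P (2 * l) c E * 1) E0 = f c" for c
      proof (cases "f c = 0")
        case False
        then show ?thesis using P_one[OF False, of "2 * l" E0] by (simp only: mult_1_right order_refl)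
      qed simp
      then show "isums V [0..<2 * l] f c0 = isums V [0..<2 * l] (\<lambda>c. f c * isums G [0..<2 * l] (\<lambda>E. P (2 * l) c E * 1) E0) c0" by (simp only:)
    qed
    also have "\<dots> \<le> wdeg G \<mu> {}" unfolding wd
    proof (rule I_mono)
      fix c E assume "P (2 * l) c E \<noteq> 0"
      then have "E ` {..<2 * l} \<subseteq> G" using Pprop(1) by auto
      then show "(1::real) \<le> of_bool (E ` {..<2 * l} \<subseteq> G \<and> {} \<subseteq> E ` {..<2 * l})" by simp
    qed
    finally show ?thesis .
  qed
  have testI: "I (\<lambda>E. \<Prod>i\<in>J. of_bool (E i = S i)) \<le> B * (s ^ (card J - 1) * (real r ^ 3 / (2 * m)) ^ card J)"
    if J: "J \<subseteq> {..<2 * l}" "J \<noteq> {}" and S: "\<And>i. i \<in> J \<Longrightarrow> S i \<in> G" for J S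
  proof -
    have finJ: "finite J" using J(1) finite_subset by blast
    have Ji: "J \<inter> {..<2 * l} = J" using J(1) by auto
    have "I (\<lambda>E. \<Prod>i\<in>J. of_bool (E i = S i)) \<le> isums V [0..<2 * l] (\<lambda>c. f c * (\<Prod>i\<in>J. T S i (c i) (c (nx i)))) c0"
      unfolding I_def
    proof (rule isums_mono)
      fix c
      show "f c * isums G [0..<2 * l] (\<lambda>E. P (2 * l) c E * (\<Prod>i\<in>J. of_bool (E i = S i))) E0 \<le> f c * (\<Prod>i\<in>J. T S i (c i) (c (nx i)))"
      proof (cases "f c = 0")
        case False
        show ?thesis using P_test[OF False order_refl finJ, of S E0] unfolding Ji by (intro mult_left_mono f0)
      qed simp
    qed
    also have "\<dots> \<le> B * (s ^ (card J - 1) * (\<Prod>i\<in>J. rk.ang (T S i)))"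
      using fb[OF J, of "T S" c0] T0 unfolding nx_def by blast
    also have "\<dots> \<le> B * (s ^ (card J - 1) * (\<Prod>i\<in>J. real r ^ 3 / (2 * m)))"
    proof (intro mult_left_mono prod_mono conjI B)
      fix i assume i: "i \<in> J"
      show "0 \<le> rk.ang (T S i)" by (rule rk.ang_nonneg) (rule T0)
      have Si: "card (S i) = r" "S i \<subseteq> V" "finite (S i)" using S[OF i] G unfolding r_graph_on_def by auto
      have "rk.ang (T S i) \<le> (\<Sum>u\<in>V. \<Sum>v\<in>V. if u \<in> S i \<and> v \<in> S i then real r / (2 * m) else 0)"
        unfolding rk.ang_def
      proof (intro sum_mono)
        fix u v
        show "\<rho> u v * T S i u v \<le> (if u \<in> S i \<and> v \<in> S i then real r / (2 * m) else 0)"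
          unfolding T_def using m by (cases "\<rho> u v = 0") auto
      qed
      also have "\<dots> = (\<Sum>u\<in>V. if u \<in> S i then (\<Sum>v\<in>V. if v \<in> S i then real r / (2 * m) else 0) else 0)"
        by (intro sum.cong) auto
      also have "\<dots> = (\<Sum>u\<in>{u\<in>V. u \<in> S i}. \<Sum>v\<in>{v\<in>V. v \<in> S i}. real r / (2 * m))" using V by (simp only: sum.inter_filter)
      also have "{u\<in>V. u \<in> S i} = S i" using Si by auto
      also have "(\<Sum>u\<in>S i. \<Sum>v\<in>S i. real r / (2 * m)) = real r ^ 3 / (2 * m)" using Si by (simp add: power3_eq_cube)
      finally show "rk.ang (T S i) \<le> real r ^ 3 / (2 * m)" .
    qed (use s in auto)
    finally show ?thesis by simp
  qed
  have dg: "wdeg G \<mu> \<sigma> \<le> real (2 * l) ^ (2 * l) * (B * (s ^ (card \<sigma> - 1) * (real r ^ 3 / (2 * m)) ^ card \<sigma>))"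
    if c: "1 \<le> card \<sigma>" "card \<sigma> \<le> 2 * l" for \<sigma>
  proof (cases "\<sigma> \<subseteq> G")
    case False
    then have "{\<tau>. \<tau> \<subseteq> G \<and> \<sigma> \<subseteq> \<tau>} = {}" by auto
    then have "wdeg G \<mu> \<sigma> = 0" unfolding wdeg_def by (simp only: sum.empty)
    then show ?thesis using B s m by simp
  next
    case True
    have fins: "finite \<sigma>" using True finG finite_subset by blast
    \<comment> \<open>The edges of \<open>\<sigma>\<close> may occupy any positions. An injection
      \<open>h\<close> into the positions is one test with the image of \<open>h\<close> as
      \<open>J\<close>, and there are at most \<open>(2 * l) ^ (2 * l)\<close> injections.\<close>
    define Hs where "Hs = {h \<in> \<sigma> \<rightarrow>\<^sub>E {..<2 * l}. inj_on h \<sigma>}"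
    have finP: "finite (\<sigma> \<rightarrow>\<^sub>E {..<2 * l})" using fins by (intro finite_PiE) auto
    have finH: "finite Hs" unfolding Hs_def using finP by auto
    have "card Hs \<le> card (\<sigma> \<rightarrow>\<^sub>E {..<2 * l})" unfolding Hs_def using finP by (intro card_mono) auto
    also have "\<dots> = (2 * l) ^ card \<sigma>" using fins by (simp add: card_PiE)
    also have "\<dots> \<le> (2 * l) ^ (2 * l)" using c l by (intro power_increasing) auto
    finally have cH: "real (card Hs) \<le> real (2 * l) ^ (2 * l)" by (metis of_nat_le_iff of_nat_power)
    let ?R = "B * (s ^ (card \<sigma> - 1) * (real r ^ 3 / (2 * m)) ^ card \<sigma>)"
    have "wdeg G \<mu> \<sigma> \<le> I (\<lambda>E. \<Sum>h\<in>Hs. \<Prod>e\<in>\<sigma>. of_bool (E (h e) = e))"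
      unfolding wd
    proof (rule I_mono)
      fix c E assume P: "P (2 * l) c E \<noteq> 0"
      have s0: "0 \<le> (\<Sum>h\<in>Hs. \<Prod>e\<in>\<sigma>. of_bool (E (h e) = e) :: real)" by (intro sum_nonneg prod_nonneg) auto
      show "(of_bool (E ` {..<2 * l} \<subseteq> G \<and> \<sigma> \<subseteq> E ` {..<2 * l}) :: real) \<le> (\<Sum>h\<in>Hs. \<Prod>e\<in>\<sigma>. of_bool (E (h e) = e))"
      proof (cases "\<sigma> \<subseteq> E ` {..<2 * l}")
        case sub: True
        define h where "h = restrict (inv_into {..<2 * l} E) \<sigma>"
        have hE: "E (h e) = e" "h e \<in> {..<2 * l}" if "e \<in> \<sigma>" for e
          using that sub unfolding h_def by (auto simp: f_inv_into_f inv_into_into subsetD) (metis inv_into_into lessThan_iff subsetD)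
        have "h \<in> Hs" unfolding Hs_def
        proof (intro CollectI conjI)
          show "h \<in> \<sigma> \<rightarrow>\<^sub>E {..<2 * l}" using hE unfolding h_def by (auto simp: PiE_def Pi_def extensional_def)
          show "inj_on h \<sigma>" by (rule inj_onI) (metis hE(1))
        qed
        then have "(\<Prod>e\<in>\<sigma>. of_bool (E (h e) = e) :: real) \<le> (\<Sum>h\<in>Hs. \<Prod>e\<in>\<sigma>. of_bool (E (h e) = e))"
          using finH by (intro member_le_sum[where f = "\<lambda>h. \<Prod>e\<in>\<sigma>. of_bool (E (h e) = e)"]) (auto intro: prod_nonneg)
        moreover have "(\<Prod>e\<in>\<sigma>. of_bool (E (h e) = e) :: real) = 1" using hE by (intro prod.neutral) auto
        ultimately have "1 \<le> (\<Sum>h\<in>Hs. \<Prod>e\<in>\<sigma>. of_bool (E (h e) = e) :: real)" by simp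
        moreover have "(of_bool (E ` {..<2 * l} \<subseteq> G \<and> \<sigma> \<subseteq> E ` {..<2 * l}) :: real) \<le> 1" by simp
        ultimately show ?thesis by linarith
      next
        case False
        then show ?thesis using s0 by simp
      qed
    qed
    also have "\<dots> = (\<Sum>h\<in>Hs. I (\<lambda>E. \<Prod>e\<in>\<sigma>. of_bool (E (h e) = e)))" by (rule I_sum)
    also have "\<dots> \<le> (\<Sum>h\<in>Hs. ?R)"
    proof (rule sum_mono)
      fix h assume h: "h \<in> Hs"
      have inj: "inj_on h \<sigma>" and hm: "h ` \<sigma> \<subseteq> {..<2 * l}" using h unfolding Hs_def by auto
      have pe: "(\<Prod>e\<in>\<sigma>. of_bool (E (h e) = e) :: real) = (\<Prod>i\<in>h ` \<sigma>. of_bool (E i = inv_into \<sigma> h i))" for E :: "nat \<Rightarrow> 'a set"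
        using inj by (simp add: prod.reindex)
      have "I (\<lambda>E. \<Prod>i\<in>h ` \<sigma>. of_bool (E i = inv_into \<sigma> h i)) \<le> B * (s ^ (card (h ` \<sigma>) - 1) * (real r ^ 3 / (2 * m)) ^ card (h ` \<sigma>))"
      proof (rule testI[OF hm])
        show "h ` \<sigma> \<noteq> {}" using c by auto
        show "inv_into \<sigma> h i \<in> G" if "i \<in> h ` \<sigma>" for i using inv_into_into[OF that] True by blast
      qed
      then show "I (\<lambda>E. \<Prod>e\<in>\<sigma>. of_bool (E (h e) = e)) \<le> ?R" unfolding pe card_image[OF inj] .
    qed
    also have "\<dots> = real (card Hs) * ?R" by simp
    also have "\<dots> \<le> real (2 * l) ^ (2 * l) * ?R" using cH B s m by (intro mult_right_mono mult_nonneg_nonneg) auto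
    finally show ?thesis .
  qed
  have ind: "weight_indep \<mu> H" if H: "lin_cycle_free r (2 * l) V H" for H
    unfolding weight_indep_def
  proof (intro allI impI)
    fix \<tau> assume tH: "\<tau> \<subseteq> H"
    show "\<mu> \<tau> = 0"
    proof (rule ccontr)
      assume mt: "\<mu> \<tau> \<noteq> 0"
      obtain c E where cE: "f c \<noteq> 0" "P (2 * l) c E \<noteq> 0" "E ` {..<2 * l} = \<tau>"
        using wit[OF mt] by (elim exE conjE)
      have "\<not> lin_cycle_free r (2 * l) V H"
      proof (rule lin_cycle_copy[where c = c and E = E])
        fix i assume i: "i < 2 * l"
        note p = Pprop[OF cE(2) i]
        show "E i \<in> H" using cE(3) tH i by auto
        show "finite (E i)" "card (E i) = r" "E i \<subseteq> V" "c i \<in> E i" using p by auto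
        show "c (if Suc i = 2 * l then 0 else Suc i) \<in> E i" using p(3) unfolding nx_def .
        show "(E i - {c i, c (if Suc i = 2 * l then 0 else Suc i)}) \<inter> (c ` {..<2 * l} \<union> (\<Union>j<i. E j)) = {}" using p(4) unfolding nx_def .
      qed (use r l fs(1)[OF cE(1)] in auto)
      then show False using H by blast
    qed
  qed
  show ?thesis using uw tot dg ind by (intro exI[of _ \<mu>]) blast
qed

lemma card_r_graph_le:
  assumes "finite V" "r_graph_on r V G"
  shows "card G \<le> card V ^ r"
proof (cases "r \<le> card V")
  case True
  have "card G \<le> card {A. A \<subseteq> V \<and> card A = r}"
    using assms unfolding r_graph_on_def by (intro card_mono) auto
  then show ?thesis using n_subsets[OF assms(1), of r] binomial_le_pow[OF True] by simp
next
  case False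
  have "e \<notin> G" for e using assms False card_mono[of V e] unfolding r_graph_on_def by auto
  then have "G = {}" by auto
  then show ?thesis by simp
qed

lemma wdeg_uniform_weight_mono:
  assumes "uniform_weight G i \<mu>" "G \<subseteq> G'" "finite G'"
  shows "uniform_weight G' i \<mu>" "wdeg G' \<mu> \<sigma> = wdeg G \<mu> \<sigma>"
proof -
  show "uniform_weight G' i \<mu>" using assms unfolding uniform_weight_def by blast
  have fin: "finite {\<tau>. \<tau> \<subseteq> G' \<and> \<sigma> \<subseteq> \<tau>}" using assms(3) by auto
  show "wdeg G' \<mu> \<sigma> = wdeg G \<mu> \<sigma>"
    unfolding wdeg_def
    by (rule sum.mono_neutral_right[OF fin]) (use assms in \<open>auto simp: uniform_weight_def\<close>)
qed

section \<open>Iterating the container step\<close>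

text \<open>Each round refines the containers that still have \<open>B\<close> elements or more and
  keeps the others, hence the maximum; \<open>Q\<close> is inherited by subsets so that
  \<open>step\<close> stays applicable.\<close>

lemma covered_by_iterate:
  fixes d B :: real and X :: "'a set"
  assumes d: "d \<le> 1" and N: "N \<ge> 1" and X: "finite X" and Q: "\<And>G G'. Q G \<Longrightarrow> G' \<subseteq> G \<Longrightarrow> Q G'"
    and step: "\<And>G. G \<subseteq> X \<Longrightarrow> Q G \<Longrightarrow> B \<le> real (card G) \<Longrightarrow> covered_by G ((1 - d) * card G) N {H. H \<subseteq> G \<and> F H}"
  shows "G \<subseteq> X \<Longrightarrow> Q G \<Longrightarrow> covered_by G (max B ((1 - d) ^ j * card G)) (N ^ j) {H. H \<subseteq> G \<and> F H}"
proof (induction j arbitrary: G)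
  case 0
  show ?case by (rule covered_by_single[of G]) auto
next
  case (Suc j)
  show ?case
  proof (cases "B \<le> real (card G)")
    case False
    then show ?thesis using N by (intro covered_by_single[of G]) auto
  next
    case True
    obtain \<D> where D: "finite \<D>" "card \<D> \<le> N" "\<forall>D\<in>\<D>. D \<subseteq> G \<and> real (card D) \<le> (1 - d) * card G"
      "\<forall>H\<in>{H. H \<subseteq> G \<and> F H}. \<exists>D\<in>\<D>. H \<subseteq> D"
      using step[OF Suc.prems True] unfolding covered_by_def by (elim exE conjE)
    let ?P = "\<lambda>D \<E>. finite \<E> \<and> card \<E> \<le> N ^ j \<and> (\<forall>E\<in>\<E>. E \<subseteq> D \<and> real (card E) \<le> max B ((1 - d) ^ j * card D)) \<and>
      (\<forall>H\<in>{H. H \<subseteq> D \<and> F H}. \<exists>E\<in>\<E>. H \<subseteq> E)"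
    have "\<forall>D\<in>\<D>. \<exists>\<E>. ?P D \<E>"
    proof
      fix D assume "D \<in> \<D>"
      then have "D \<subseteq> G" using D(3) by blast
      then have "covered_by D (max B ((1 - d) ^ j * card D)) (N ^ j) {H. H \<subseteq> D \<and> F H}"
        using Suc.prems Q by (intro Suc.IH) auto
      then show "\<exists>\<E>. ?P D \<E>" unfolding covered_by_def .
    qed
    then obtain \<E> where "\<forall>D\<in>\<D>. ?P D (\<E> D)" by (drule_tac bchoice) (elim exE)
    then have E: "?P D (\<E> D)" if "D \<in> \<D>" for D using that by (rule bspec)
    have "card (\<Union>D\<in>\<D>. \<E> D) \<le> (\<Sum>D\<in>\<D>. card (\<E> D))" using D(1) by (rule card_UN_le)
    also have "\<dots> \<le> (\<Sum>D\<in>\<D>. N ^ j)" using E by (intro sum_mono) blast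
    also have "\<dots> \<le> N * N ^ j" using D(2) by simp
    finally have c: "card (\<Union>D\<in>\<D>. \<E> D) \<le> N ^ Suc j" by simp
    have s: "E \<subseteq> G \<and> real (card E) \<le> max B ((1 - d) ^ Suc j * card G)" if "D \<in> \<D>" "E \<in> \<E> D" for D E
    proof -
      have DE: "E \<subseteq> D" "real (card E) \<le> max B ((1 - d) ^ j * card D)" using E[OF that(1)] that(2) by auto
      have DG: "D \<subseteq> G" "real (card D) \<le> (1 - d) * card G" using D(3) that(1) by auto
      have "(1 - d) ^ j * real (card D) \<le> (1 - d) ^ j * ((1 - d) * card G)" using DG(2) d by (intro mult_left_mono) auto
      then show ?thesis using DE DG(1) by (auto simp: mult_ac)
    qed
    have h: "\<exists>E\<in>(\<Union>D\<in>\<D>. \<E> D). H \<subseteq> E" if H: "H \<subseteq> G" "F H" for H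
    proof -
      obtain D' where D': "D' \<in> \<D>" "H \<subseteq> D'" using D(4) H by blast
      then obtain E' where "E' \<in> \<E> D'" "H \<subseteq> E'" using E[OF D'(1)] H by blast
      then show ?thesis using D'(1) by blast
    qed
    show ?thesis unfolding covered_by_def
    proof (intro exI[of _ "\<Union>D\<in>\<D>. \<E> D"] conjI c)
      show "finite (\<Union>D\<in>\<D>. \<E> D)" using D(1) E by (intro finite_UN_I) blast+
      show "\<forall>E\<in>(\<Union>D\<in>\<D>. \<E> D). E \<subseteq> G \<and> real (card E) \<le> max B ((1 - d) ^ Suc j * card G)" by (intro ballI, elim UN_E) (rule s)
      show "\<forall>H\<in>{H. H \<subseteq> G \<and> F H}. \<exists>E\<in>(\<Union>D\<in>\<D>. \<E> D). H \<subseteq> E" by (intro ballI, elim CollectE conjE) (rule h)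
    qed
  qed
qed

text \<open>The weight lives on the full subgraph \<open>G1\<close>, which has at least half of the
  edges, and vanishes elsewhere; degrees in \<open>G\<close> and in \<open>G1\<close> therefore
  agree.\<close>

lemma dense_weight:
  fixes l r n K :: nat and \<delta> C :: real
  defines "K \<equiv> (r + 1) * (2 * l * (r + 1))" and "\<delta> \<equiv> 1/16 * (1 / (2 * real l ^ 2)) ^ l" and "C \<equiv> 64 * real r ^ 5"
  assumes l: "l \<ge> 2" and r: "r \<ge> 4" and n: "n \<ge> 1" and small: "C * real n powr (-2/3) * sqrt (C * real n) \<le> \<delta>^2 / (16 * real l ^ 2)"
    and G: "r_graph_on r {1..n} G" and big: "real (card G) \<ge> real (2 * K + 2) * real n ^ (r - 1)"
  shows "\<exists>\<mu>. uniform_weight G (2 * l) \<mu> \<and> wdeg G \<mu> {} \<ge> \<delta> / 2 \<and>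
    (\<forall>\<sigma>. 1 \<le> card \<sigma> \<longrightarrow> card \<sigma> \<le> 2 * l \<longrightarrow> wdeg G \<mu> \<sigma> \<le> real (2 * l) ^ (2 * l) * (2 * C^4 / \<delta>) ^ (2 * l + 2) * (4 * real r ^ 3) ^ (2 * l)
       / real (card G) * (real n powr (2 * real l / (2 * real l - 1)) / real (card G)) ^ (card \<sigma> - 1)) \<and>
    (\<forall>H. lin_cycle_free r (2 * l) {1..n} H \<longrightarrow> weight_indep \<mu> H)"
proof -
  let ?V = "{1..n}" and ?n = "real n"
  define D where "D = ?n powr (1 / (2 * real l - 1))"
  define \<kappa> where "\<kappa> = ?n powr (-2/3)"
  let ?s = "?n powr (2 * real l / (2 * real l - 1))"
  let ?B = "(2 * C^4 / \<delta>) ^ (2 * l + 2)"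
  have n0: "?n > 0" and n1: "?n \<ge> 1" using n by simp_all
  have l1: "2 * real l - 1 > 0" using l by simp
  have finG: "finite G" by (rule r_graph_finite[OF _ G]) simp
  have d0: "\<delta> > 0" unfolding \<delta>_def using l by simp
  have C0: "C \<ge> 0" unfolding C_def by simp
  obtain G1 where G1: "G1 \<subseteq> G" "real (card G1) \<ge> real (card G) - real K * real (card ?V) ^ (r - 1)"
    "\<And>A. A \<subseteq> ?V \<Longrightarrow> card A = r - 1 \<Longrightarrow> {e\<in>G1. A \<subseteq> e} = {} \<or> K \<le> card {e\<in>G1. A \<subseteq> e}"
    using full_subgraph[OF _ G, of K] by auto
  have np: "?n ^ (r - 1) \<ge> 1" using n1 by (rule one_le_power)
  \<comment> \<open>Of \<open>(2 * K + 2) * n ^ (r - 1)\<close> edges the cleaning removes at most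
    \<open>K * n ^ (r - 1)\<close>, so half of the edges and more than \<open>n ^ (r - 1)\<close> of
    them remain.\<close>
  have b: "real (card G) \<ge> 2 * (real K * ?n ^ (r - 1)) + 2 * ?n ^ (r - 1)" using big by (simp add: algebra_simps)
  have "real (card G1) \<ge> real (card G) - real K * ?n ^ (r - 1)" using G1(2) by simp
  then have g1: "real (card G1) \<ge> real (card G) / 2" "real (card G1) \<ge> ?n ^ (r - 1)"
    using b np by linarith+
  have g0: "real (card G) > 0" using b np by (smt (verit) mult_nonneg_nonneg of_nat_0_le_iff)
  have G1r: "r_graph_on r ?V G1" using G G1(1) unfolding r_graph_on_def by auto
  have k: "\<kappa> > 0" "\<kappa> ^ 3 * ?n ^ 2 = 1"
  proof -
    show "\<kappa> > 0" unfolding \<kappa>_def using n0 by simp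
    have "\<kappa> ^ 3 = ?n powr (-2)" unfolding \<kappa>_def using n0 by (simp add: powr_power)
    then show "\<kappa> ^ 3 * ?n ^ 2 = 1" using n0 by (simp add: powr_minus powr_numeral)
  qed
  have D1: "D \<ge> 1" unfolding D_def using n1 l1 by (intro ge_one_powr_ge_zero) auto
  have D2: "D ^ (2 * l - 1) = ?n"
  proof -
    have "D ^ (2 * l - 1) = ?n powr (1 / (2 * real l - 1) * real (2 * l - 1))" unfolding D_def using n0 by (simp add: powr_power)
    also have "1 / (2 * real l - 1) * real (2 * l - 1) = 1" using l1 l by (simp add: of_nat_diff)
    finally show ?thesis using n0 by simp
  qed
  \<comment> \<open>Amounts to \<open>1 / 3 \<le> (l - 1) / (2 * l - 1)\<close>, which is where
    \<open>l \<ge> 2\<close> enters.\<close>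
  have D3: "\<kappa> * ?n \<le> D ^ (l - 1)"
  proof -
    have "\<kappa> * ?n = ?n powr (-2/3) * ?n powr 1" unfolding \<kappa>_def using n0 by simp
    also have "\<dots> = ?n powr (1/3)" unfolding powr_add[symmetric] by simp
    also have "\<dots> \<le> ?n powr (1 / (2 * real l - 1) * real (l - 1))"
      using n1 l l1 by (intro powr_mono) (auto simp: field_simps of_nat_diff)
    also have "\<dots> = D ^ (l - 1)" unfolding D_def using n0 by (simp add: powr_power)
    finally show ?thesis .
  qed
  have nD: "?n * D = ?s"
  proof -
    have "?n * D = ?n powr 1 * ?n powr (1 / (2 * real l - 1))" unfolding D_def using n0 by simp
    also have "\<dots> = ?n powr (1 + 1 / (2 * real l - 1))" by (simp only: powr_add)
    also have "1 + 1 / (2 * real l - 1) = 2 * real l / (2 * real l - 1)" using l1 by (simp add: field_simps)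
    finally show ?thesis .
  qed
  obtain \<rho> m where sk: "spread_kernel ?V \<rho> ?n D \<kappa> C l" and m: "real (card G1) / 4 \<le> m"
    and rne: "\<And>u v. \<rho> u v \<noteq> 0 \<Longrightarrow> u \<noteq> v" and rle: "\<And>u v. 2 * m * \<rho> u v \<le> real (codeg G1 u v)"
  proof -
    have "\<exists>\<rho> m. spread_kernel ?V \<rho> (real (card ?V)) D \<kappa> (64 * real r ^ 5) l \<and> real (card G1) / 4 \<le> m \<and>
     (\<forall>u v. \<rho> u v \<noteq> 0 \<longrightarrow> u \<noteq> v) \<and> (\<forall>u v. 2 * m * \<rho> u v \<le> real (codeg G1 u v))"
      by (rule exists_spread_kernel[OF _ _ G1r r]) (use n k g1 D1 D2 D3 l in auto)
    then show thesis using that unfolding C_def card_atLeastAtMost diff_Suc_1 by (elim exE conjE) simp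
  qed
  interpret sk: spread_kernel ?V \<rho> ?n D \<kappa> C l by (rule sk)
  have sd: "sk.\<delta> = \<delta>" unfolding sk.\<delta>_def \<delta>_def ..
  have "sk.err \<le> sk.\<delta>^2 / (16 * real l ^ 2)" unfolding sd using small unfolding sk.err_def by (simp only: \<kappa>_def)
  from sk.cycle_measure[OF this, unfolded sd nD] obtain f where f: "\<forall>c. 0 \<le> f c"
    "\<forall>c. f c \<noteq> 0 \<longrightarrow> inj_on c {..<2 * l} \<and> (\<forall>i<2 * l. \<rho> (c i) (c (if Suc i = 2 * l then 0 else Suc i)) \<noteq> 0)"
    "\<forall>c. isums ?V [0..<2 * l] f c \<ge> \<delta> / 2"
    "\<forall>J T c. J \<subseteq> {..<2 * l} \<longrightarrow> J \<noteq> {} \<longrightarrow> (\<forall>i u v. 0 \<le> T i u v) \<longrightarrow>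
      isums ?V [0..<2 * l] (\<lambda>c. f c * (\<Prod>i\<in>J. T i (c i) (c (if Suc i = 2 * l then 0 else Suc i)))) c
        \<le> ?B * (?s ^ (card J - 1) * (\<Prod>i\<in>J. sk.ang (T i)))"
    by (elim exE conjE)
  have m8: "m \<ge> real (card G) / 8" using m g1(1) by simp
  have m0: "m > 0" using m8 g0 by simp
  have B0: "?B \<ge> 0" using C0 d0 by simp
  have s0: "?s \<ge> 0" by simp
  have "\<exists>\<mu>. uniform_weight G1 (2 * l) \<mu> \<and> wdeg G1 \<mu> {} \<ge> \<delta> / 2 \<and>
    (\<forall>\<sigma>. 1 \<le> card \<sigma> \<longrightarrow> card \<sigma> \<le> 2 * l \<longrightarrow> wdeg G1 \<mu> \<sigma> \<le> real (2 * l) ^ (2 * l) * (?B * (?s ^ (card \<sigma> - 1) * (real r ^ 3 / (2 * m)) ^ card \<sigma>))) \<and>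
    (\<forall>H. lin_cycle_free r (2 * l) ?V H \<longrightarrow> weight_indep \<mu> H)"
  proof (rule expansion_weight[OF _ G1r r l G1(3) _ sk.rev_kernel_axioms m0 rne rle])
    show "(r + 1) * (2 * l * (r + 1)) \<le> K" unfolding K_def ..
    show "0 \<le> f c" for c using f(1) by blast
    show "inj_on c {..<2 * l}" if "f c \<noteq> 0" for c using f(2) that by blast
    show "\<rho> (c i) (c (if Suc i = 2 * l then 0 else Suc i)) \<noteq> 0" if "f c \<noteq> 0" "i < 2 * l" for c i using f(2) that by blast
    show "isums ?V [0..<2 * l] f c \<ge> \<delta> / 2" for c using f(3) by blast
    show "isums ?V [0..<2 * l] (\<lambda>c. f c * (\<Prod>i\<in>J. T i (c i) (c (if Suc i = 2 * l then 0 else Suc i)))) c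
        \<le> ?B * (?s ^ (card J - 1) * (\<Prod>i\<in>J. sk.ang (T i)))" if "J \<subseteq> {..<2 * l}" "J \<noteq> {}" "\<And>i u v. 0 \<le> T i u v" for J T c
      using f(4)[rule_format, OF that] .
  qed (use B0 s0 in simp_all)
  then obtain \<mu> where mu: "uniform_weight G1 (2 * l) \<mu>" "wdeg G1 \<mu> {} \<ge> \<delta> / 2"
    "\<And>\<sigma>. 1 \<le> card \<sigma> \<Longrightarrow> card \<sigma> \<le> 2 * l \<Longrightarrow> wdeg G1 \<mu> \<sigma> \<le> real (2 * l) ^ (2 * l) * (?B * (?s ^ (card \<sigma> - 1) * (real r ^ 3 / (2 * m)) ^ card \<sigma>))"
    "\<And>H. lin_cycle_free r (2 * l) ?V H \<Longrightarrow> weight_indep \<mu> H" by (elim exE conjE) simp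
  note mono = wdeg_uniform_weight_mono[OF mu(1) G1(1) finG]
  show ?thesis
  proof (intro exI[of _ \<mu>] conjI allI impI mono(1))
    show "wdeg G \<mu> {} \<ge> \<delta> / 2" unfolding mono(2) by (rule mu(2))
    fix \<sigma> :: "nat set set" assume c: "1 \<le> card \<sigma>" "card \<sigma> \<le> 2 * l"
    let ?g = "real (card G)"
    obtain j where j: "card \<sigma> = Suc j" using c by (cases "card \<sigma>") auto
    have r4: "1 \<le> 4 * real r ^ 3" using one_le_power[of "real r" 3] r by linarith
    have "real r ^ 3 / (2 * m) \<le> real r ^ 3 / (2 * (?g / 8))" using m8 m0 g0 by (intro divide_left_mono) auto
    also have "\<dots> = 4 * real r ^ 3 / ?g" by simp
    finally have "(real r ^ 3 / (2 * m)) ^ card \<sigma> \<le> (4 * real r ^ 3 / ?g) ^ card \<sigma>" using m0 by (intro power_mono) auto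
    also have "\<dots> = (4 * real r ^ 3) ^ card \<sigma> / ?g ^ card \<sigma>" by (rule power_divide)
    also have "\<dots> \<le> (4 * real r ^ 3) ^ (2 * l) / ?g ^ card \<sigma>"
      using power_increasing[OF c(2) r4] g0 by (intro divide_right_mono) auto
    finally have pw: "(real r ^ 3 / (2 * m)) ^ card \<sigma> \<le> (4 * real r ^ 3) ^ (2 * l) / ?g ^ card \<sigma>" .
    have "wdeg G \<mu> \<sigma> \<le> real (2 * l) ^ (2 * l) * (?B * (?s ^ (card \<sigma> - 1) * (real r ^ 3 / (2 * m)) ^ card \<sigma>))"
      unfolding mono(2) by (rule mu(3)[OF c])
    also have "\<dots> \<le> real (2 * l) ^ (2 * l) * (?B * (?s ^ (card \<sigma> - 1) * ((4 * real r ^ 3) ^ (2 * l) / ?g ^ card \<sigma>)))"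
      using pw B0 by (intro mult_left_mono) auto
    also have "\<dots> = real (2 * l) ^ (2 * l) * ?B * (4 * real r ^ 3) ^ (2 * l) / ?g * (?s / ?g) ^ (card \<sigma> - 1)"
      unfolding j power_divide by (simp add: mult_ac)
    finally show "wdeg G \<mu> \<sigma> \<le> real (2 * l) ^ (2 * l) * ?B * (4 * real r ^ 3) ^ (2 * l) / ?g * (?s / ?g) ^ (card \<sigma> - 1)" .
  qed (rule mu(4))
qed

text \<open>With \<open>\<tau> = s / card G\<close> for
  \<open>s = n powr (2 * l / (2 * l - 1))\<close>, the number \<open>b\<close> of revealed edges is
  about \<open>s\<close> whatever the size of \<open>G\<close>, so all rounds of the iteration cost
  the same.\<close>

lemma container_step:
  fixes l r :: nat
  assumes l: "l \<ge> 2" and r: "r \<ge> 4"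
  shows "\<exists>K d :: real. K \<ge> 1 \<and> d > 0 \<and> d < 1 \<and> (\<forall>\<^sub>F n in sequentially. \<forall>G. r_graph_on r {1..n} G \<longrightarrow> K * real n ^ (r - 1) \<le> real (card G) \<longrightarrow>
    covered_by G ((1 - d) * card G) ((n ^ r + 1) ^ (nat \<lceil>real n powr (2 * real l / (2 * real l - 1))\<rceil> * (2 * l))) {H. H \<subseteq> G \<and> lin_cycle_free r (2 * l) {1..n} H})"
proof -
  define K where "K = (r + 1) * (2 * l * (r + 1))"
  define \<delta> :: real where "\<delta> = 1/16 * (1 / (2 * real l ^ 2)) ^ l"
  define C :: real where "C = 64 * real r ^ 5"
  define A where "A = real (2 * l) ^ (2 * l) * (2 * C^4 / \<delta>) ^ (2 * l + 2) * (4 * real r ^ 3) ^ (2 * l)"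
  define C2 where "C2 = max 1 (A / (\<delta> / 2))"
  have d0: "\<delta> > 0" unfolding \<delta>_def using l by simp
  have C0: "C > 0" unfolding C_def using r by simp
  have l1: "2 * l \<ge> 1" using l by simp
  have C21: "C2 \<ge> 1" unfolding C2_def by simp
  from weighted_containers[OF l1 C21, where 'a = "nat set"] obtain d :: real where d: "d > 0" "d < 1"
    and cont: "\<forall>(X :: nat set set) \<mu> (\<tau>::real) (b::nat) (m::real). finite X \<longrightarrow> X \<noteq> {} \<longrightarrow> \<tau> > 0 \<longrightarrow> \<tau> * card X \<le> b \<longrightarrow>
     b \<le> 2 * \<tau> * card X \<longrightarrow> b \<le> d * card X \<longrightarrow> m > 0 \<longrightarrow> uniform_weight X (2 * l) \<mu> \<longrightarrow> wdeg X \<mu> {} \<ge> m \<longrightarrow>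
     (\<forall>\<sigma>. 1 \<le> card \<sigma> \<longrightarrow> card \<sigma> \<le> 2 * l \<longrightarrow> wdeg X \<mu> \<sigma> \<le> C2 * (m / card X) * \<tau> ^ (card \<sigma> - 1)) \<longrightarrow>
     covered_by X ((1 - d) * card X) ((card X + 1) ^ (b * (2 * l))) {I. I \<subseteq> X \<and> weight_indep \<mu> I}"
    by (elim exE conjE)
  \<comment> \<open>This expression is \<open>err\<close> for
    \<open>\<kappa> = n powr (-2/3)\<close>.\<close>
  have lim: "(\<lambda>n. C * sqrt C * real n powr (-1/6)) \<longlonglongrightarrow> C * sqrt C * 0"
    by (intro tendsto_mult_left tendsto_neg_powr filterlim_real_sequentially) simp
  have "\<forall>\<^sub>F n in sequentially. C * sqrt C * real n powr (-1/6) < \<delta>^2 / (16 * real l ^ 2)"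
    using lim d0 l by (intro order_tendstoD) auto
  moreover have "\<forall>\<^sub>F n in sequentially. n \<ge> nat \<lceil>2 / d\<rceil>" by (rule eventually_ge_at_top)
  moreover have "\<forall>\<^sub>F n in sequentially. n \<ge> (1::nat)" by (rule eventually_ge_at_top)
  ultimately have "\<forall>\<^sub>F n in sequentially. \<forall>G. r_graph_on r {1..n} G \<longrightarrow> real (2 * K + 2) * real n ^ (r - 1) \<le> real (card G) \<longrightarrow>
    covered_by G ((1 - d) * card G) ((n ^ r + 1) ^ (nat \<lceil>real n powr (2 * real l / (2 * real l - 1))\<rceil> * (2 * l))) {H. H \<subseteq> G \<and> lin_cycle_free r (2 * l) {1..n} H}"
  proof eventually_elim
    case (elim n)
    show ?case
    proof (intro allI impI)
      fix G assume G: "r_graph_on r {1..n} G" and big: "real (2 * K + 2) * real n ^ (r - 1) \<le> real (card G)"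
      let ?n = "real n" and ?g = "real (card G)"
      let ?s = "?n powr (2 * real l / (2 * real l - 1))"
      let ?b = "nat \<lceil>?s\<rceil>"
      have n1: "?n \<ge> 1" using elim(3) by simp
      have "?n powr (-2/3) * sqrt ?n = ?n powr (-2/3) * ?n powr (1/2)" using n1 by (simp add: powr_half_sqrt)
      also have "\<dots> = ?n powr (-1/6)" unfolding powr_add[symmetric] by simp
      finally have eq: "C * ?n powr (-2/3) * sqrt (C * ?n) = C * sqrt C * ?n powr (-1/6)"
        by (simp add: real_sqrt_mult mult_ac)
      have small: "C * ?n powr (-2/3) * sqrt (C * ?n) \<le> \<delta>^2 / (16 * real l ^ 2)"
        unfolding eq using elim(1) by (rule less_imp_le)
      obtain \<mu> where mu: "uniform_weight G (2 * l) \<mu>" "wdeg G \<mu> {} \<ge> \<delta> / 2"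
        "\<And>\<sigma>. 1 \<le> card \<sigma> \<Longrightarrow> card \<sigma> \<le> 2 * l \<Longrightarrow> wdeg G \<mu> \<sigma> \<le> A / ?g * (?s / ?g) ^ (card \<sigma> - 1)"
        "\<And>H. lin_cycle_free r (2 * l) {1..n} H \<Longrightarrow> weight_indep \<mu> H"
        using dense_weight[OF l r elim(3) small[unfolded C_def \<delta>_def] G big[unfolded K_def]]
        unfolding A_def C_def \<delta>_def by (elim exE conjE) simp
      have s1: "?s \<ge> 1" using n1 l by (intro ge_one_powr_ge_zero) auto
      have b1: "?s \<le> real ?b" "real ?b \<le> 2 * ?s" using s1 by linarith+
      have np: "?n ^ 3 \<le> ?n ^ (r - 1)" using n1 r by (intro power_increasing) auto
      have n3: "1 \<le> ?n ^ 3" using n1 by (rule one_le_power)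
      have "1 * ?n ^ (r - 1) \<le> real (2 * K + 2) * ?n ^ (r - 1)" using n1 by (intro mult_right_mono) auto
      then have g3: "?n ^ 3 \<le> ?g" using np big by linarith
      have g0: "?g > 0" using g3 n3 by linarith
      have finG: "finite G" by (rule r_graph_finite[OF _ G]) simp
      have "?s \<le> ?n powr 2" using n1 l by (intro powr_mono) (auto simp: field_simps)
      then have s2: "?s \<le> ?n ^ 2" using n1 by (simp add: powr_numeral)
      \<comment> \<open>Since \<open>s \<le> n ^ 2\<close> and \<open>card G \<ge> n ^ 3\<close>,
        the requirement \<open>b \<le> d * card G\<close> only needs
        \<open>n \<ge> 2 / d\<close>.\<close>
      have "2 / d \<le> ?n" using elim(2) d by linarith
      then have "2 \<le> d * ?n" using d by (simp add: field_simps)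
      then have "2 * ?n ^ 2 \<le> d * ?n * ?n ^ 2" by (intro mult_right_mono) auto
      also have "\<dots> = d * ?n ^ 3" by (simp add: power2_eq_square power3_eq_cube)
      also have "\<dots> \<le> d * ?g" using g3 d by simp
      finally have b2: "real ?b \<le> d * ?g" using b1 s2 by linarith
      have "covered_by G ((1 - d) * card G) ((card G + 1) ^ (?b * (2 * l))) {I. I \<subseteq> G \<and> weight_indep \<mu> I}"
      proof (rule cont[rule_format, where \<tau> = "?s / ?g" and m = "\<delta> / 2"])
        show "finite G" by (rule finG)
        show "G \<noteq> {}" using g0 by auto
        show "?s / ?g > 0" using s1 g0 by (intro divide_pos_pos) linarith+
        show "?s / ?g * real (card G) \<le> real ?b" "real ?b \<le> 2 * (?s / ?g) * ?g" using g0 b1 by simp_all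
        show "real ?b \<le> d * ?g" by (rule b2)
        show "\<delta> / 2 > 0" using d0 by simp
        show "uniform_weight G (2 * l) \<mu>" "wdeg G \<mu> {} \<ge> \<delta> / 2" by (rule mu)+
        show "wdeg G \<mu> \<sigma> \<le> C2 * (\<delta> / 2 / ?g) * (?s / ?g) ^ (card \<sigma> - 1)" if c: "1 \<le> card \<sigma>" "card \<sigma> \<le> 2 * l" for \<sigma>
        proof -
          have "A = A / (\<delta> / 2) * (\<delta> / 2)" using d0 by simp
          also have "\<dots> \<le> C2 * (\<delta> / 2)" unfolding C2_def using d0 by (intro mult_right_mono) auto
          finally have "A / ?g \<le> C2 * (\<delta> / 2) / ?g" using g0 by (intro divide_right_mono) auto
          then have "A / ?g * (?s / ?g) ^ (card \<sigma> - 1) \<le> C2 * (\<delta> / 2 / ?g) * (?s / ?g) ^ (card \<sigma> - 1)"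
            using g0 by (intro mult_right_mono) auto
          then show ?thesis using mu(3)[OF c] by linarith
        qed
      qed
      then show "covered_by G ((1 - d) * card G) ((n ^ r + 1) ^ (?b * (2 * l))) {H. H \<subseteq> G \<and> lin_cycle_free r (2 * l) {1..n} H}"
      proof (rule covered_by_mono)
        show "(card G + 1) ^ (?b * (2 * l)) \<le> (n ^ r + 1) ^ (?b * (2 * l))"
          using card_r_graph_le[OF _ G] by (intro power_mono) auto
        show "{H. H \<subseteq> G \<and> lin_cycle_free r (2 * l) {1..n} H} \<subseteq> {I. I \<subseteq> G \<and> weight_indep \<mu> I}" using mu(4) by auto
      qed simp
    qed
  qed
  then show ?thesis using d by (intro exI[of _ "real (2 * K + 2)"] exI[of _ d]) auto
qed

theorem theorem3p5:
  fixes l r :: nat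
  assumes "l \<ge> 2" and "r \<ge> 4"
  shows "\<exists>(c::real) (K::real). c > 0 \<and> K > 0 \<and>
    (\<forall>\<^sub>F n in sequentially. \<forall>t::real. t \<ge> K \<longrightarrow>
      (\<exists>\<C> :: nat set set set.
        (\<forall>G\<in>\<C>. r_graph_on r {1..n} G) \<and>
        real (card \<C>) \<le> exp (c * ln (real n) ^ (2 * r - 2)
            * real n powr (2 * real l / (2 * real l - 1))) \<and>
        (\<forall>G\<in>\<C>. real (card G) \<le> t * real n ^ (r - 1)) \<and>
        (\<forall>H. r_graph_on r {1..n} H \<and> lin_cycle_free r (2 * l) {1..n} H
            \<longrightarrow> (\<exists>G\<in>\<C>. H \<subseteq> G))))"
proof -
  obtain K d :: real where K: "K \<ge> 1" and d: "d > 0" "d < 1" and step: "\<forall>\<^sub>F n in sequentially. \<forall>G. r_graph_on r {1..n} G \<longrightarrow> K * real n ^ (r - 1) \<le> real (card G) \<longrightarrow>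
    covered_by G ((1 - d) * card G) ((n ^ r + 1) ^ (nat \<lceil>real n powr (2 * real l / (2 * real l - 1))\<rceil> * (2 * l))) {H. H \<subseteq> G \<and> lin_cycle_free r (2 * l) {1..n} H}"
    using container_step[OF assms] by (elim exE conjE)
  \<comment> \<open>Collects \<open>2 * s\<close> as a bound for \<open>b\<close>, the uniformity
    \<open>2 * l\<close>, the number of rounds \<open>2 * ln n / d\<close> and
    \<open>(r + 1) * ln n\<close> for the logarithm of \<open>n ^ r + 1\<close>.\<close>
  define c where "c = 8 * real l * (real r + 1) / d"
  have "\<forall>\<^sub>F n in sequentially. n \<ge> (3::nat)" by (rule eventually_ge_at_top)
  with step have "\<forall>\<^sub>F n in sequentially. \<forall>t::real. t \<ge> K \<longrightarrow>
      (\<exists>\<C> :: nat set set set.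
        (\<forall>G\<in>\<C>. r_graph_on r {1..n} G) \<and>
        real (card \<C>) \<le> exp (c * ln (real n) ^ (2 * r - 2)
            * real n powr (2 * real l / (2 * real l - 1))) \<and>
        (\<forall>G\<in>\<C>. real (card G) \<le> t * real n ^ (r - 1)) \<and>
        (\<forall>H. r_graph_on r {1..n} H \<and> lin_cycle_free r (2 * l) {1..n} H
            \<longrightarrow> (\<exists>G\<in>\<C>. H \<subseteq> G)))"
  proof eventually_elim
    case (elim n)
    let ?n = "real n" and ?V = "{1..n}"
    let ?s = "?n powr (2 * real l / (2 * real l - 1))"
    let ?b = "nat \<lceil>?s\<rceil>"
    let ?N = "(n ^ r + 1) ^ (?b * (2 * l))"
    let ?F = "lin_cycle_free r (2 * l) ?V"
    \<comment> \<open>So many rounds that \<open>(1 - d) ^ j \<le> 1 / n\<close>, which brings the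
      complete \<open>r\<close>-graph from at most \<open>n ^ r\<close> edges down to
      \<open>n ^ (r - 1)\<close>.\<close>
    define j where "j = nat \<lceil>ln ?n / d\<rceil>"
    define X where "X = {e. e \<subseteq> ?V \<and> card e = r}"
    have n3: "?n \<ge> 3" using elim(2) by simp
    have "exp (1::real) \<le> 3" using exp_le by simp
    then have L1: "ln ?n \<ge> 1" using n3 by (simp add: ln_ge_iff)
    have s1: "?s \<ge> 1" using n3 assms by (intro ge_one_powr_ge_zero) auto
    have b1: "real ?b \<le> 2 * ?s" using s1 by linarith
    have Ld: "ln ?n / d \<ge> 1" using L1 d by (simp add: field_simps)
    have j1: "ln ?n / d \<le> real j" "real j \<le> 2 * (ln ?n / d)" unfolding j_def using Ld by linarith+
    have finX: "finite X" unfolding X_def by auto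
    have rX: "r_graph_on r ?V G" if "G \<subseteq> X" for G
      using that unfolding X_def r_graph_on_def by (auto intro: finite_subset)
    have Xr: "G \<subseteq> X" if "r_graph_on r ?V G" for G using that unfolding X_def r_graph_on_def by auto
    have "covered_by X (max (K * ?n ^ (r - 1)) ((1 - d) ^ j * card X)) (?N ^ j) {H. H \<subseteq> X \<and> ?F H}"
    proof (rule covered_by_iterate[where X = X and Q = "r_graph_on r ?V"])
      show "r_graph_on r ?V G'" if "r_graph_on r ?V G" "G' \<subseteq> G" for G G' using that unfolding r_graph_on_def by auto
      show "covered_by G ((1 - d) * card G) ?N {H. H \<subseteq> G \<and> ?F H}" if "r_graph_on r ?V G" "K * ?n ^ (r - 1) \<le> real (card G)" for G
        using elim(1) that by blast
    qed (use d finX rX in auto)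
    then obtain \<C> where C: "finite \<C>" "card \<C> \<le> ?N ^ j" "\<forall>G\<in>\<C>. G \<subseteq> X \<and> real (card G) \<le> max (K * ?n ^ (r - 1)) ((1 - d) ^ j * card X)"
      "\<forall>H\<in>{H. H \<subseteq> X \<and> ?F H}. \<exists>G\<in>\<C>. H \<subseteq> G" unfolding covered_by_def by (elim exE conjE)
    have "1 - d \<le> exp (- d)" using exp_ge_add_one_self[of "- d"] by simp
    then have "(1 - d) ^ j \<le> exp (- d) ^ j" using d by (intro power_mono) auto
    also have "\<dots> = exp (- (real j * d))" by (simp add: exp_of_nat_mult[symmetric])
    also have "\<dots> \<le> exp (- ln ?n)" using j1(1) d by (simp add: field_simps)
    also have "\<dots> = 1 / ?n" using n3 by (simp add: exp_minus inverse_eq_divide)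
    finally have "(1 - d) ^ j * card X \<le> 1 / ?n * real (card X)" by (rule mult_right_mono) simp
    also have "\<dots> \<le> 1 / ?n * ?n ^ r" using card_r_graph_le[OF _ rX[OF order_refl]]
      by (intro mult_left_mono) (simp_all flip: of_nat_power)
    also have "\<dots> = ?n ^ (r - 1)" using n3 assms(2) by (simp add: power_diff)
    also have "\<dots> \<le> K * ?n ^ (r - 1)" using K mult_right_mono[of 1 K "?n ^ (r - 1)"] by simp
    finally have sz: "max (K * ?n ^ (r - 1)) ((1 - d) ^ j * card X) = K * ?n ^ (r - 1)" by (simp add: max_absorb1)
    have "?n ^ r + 1 \<le> ?n ^ r * ?n" using n3 one_le_power[of ?n r] mult_left_mono[of 2 ?n "?n ^ r"] by linarith
    then have "ln (?n ^ r + 1) \<le> ln (?n ^ (r + 1))" using n3 by (intro ln_mono) (auto simp: mult.commute add_pos_nonneg)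
    also have "\<dots> = (real r + 1) * ln ?n" using n3 by (simp only: ln_realpow of_nat_add of_nat_1)
    finally have lnN: "ln (?n ^ r + 1) \<le> (real r + 1) * ln ?n" .
    have np: "?n ^ r + 1 > 0" using n3 by (simp add: add_nonneg_pos)
    have ln0: "0 \<le> ln (?n ^ r + 1)" using n3 by simp
    have "real (card \<C>) \<le> real (?N ^ j)" using C(2) by (rule of_nat_mono)
    also have "\<dots> = (?n ^ r + 1) ^ (?b * (2 * l) * j)" by (simp only: of_nat_power of_nat_add of_nat_1 power_mult)
    also have "\<dots> = exp (real (?b * (2 * l) * j) * ln (?n ^ r + 1))" using np by (simp only: exp_of_nat_mult exp_ln)
    also have "\<dots> \<le> exp (c * ln ?n ^ 2 * ?s)"
    proof -
      have "real (?b * (2 * l) * j) * ln (?n ^ r + 1) = real ?b * (real (2 * l) * (real j * ln (?n ^ r + 1)))" by simp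
      also have "\<dots> \<le> 2 * ?s * (real (2 * l) * (2 * (ln ?n / d) * ((real r + 1) * ln ?n)))"
        using b1 j1 lnN ln0 L1 d by (intro mult_mono mult_nonneg_nonneg order_refl) auto
      also have "\<dots> = c * ln ?n ^ 2 * ?s" unfolding c_def by (simp add: power2_eq_square)
      finally show ?thesis by simp
    qed
    \<comment> \<open>The logarithm occurs squared: once from the number of rounds, once from the
      number of choices for a revealed edge. As \<open>ln n \<ge> 1\<close>, the exponent may be
      raised to \<open>2 * r - 2\<close>.\<close>
    also have "\<dots> \<le> exp (c * ln ?n ^ (2 * r - 2) * ?s)"
      using L1 assms d by (simp add: c_def) (intro mult_right_mono mult_left_mono divide_right_mono power_increasing; simp)
    finally have cnt: "real (card \<C>) \<le> exp (c * ln ?n ^ (2 * r - 2) * ?s)" .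
    show ?case
    proof (intro allI impI exI[of _ \<C>] conjI ballI cnt)
      \<comment> \<open>The family is built for the edge bound with \<open>K\<close>, and the same
        family serves every larger \<open>t\<close>.\<close>
      fix t :: real and G assume t: "K \<le> t" and G: "G \<in> \<C>"
      show "r_graph_on r ?V G" using C(3) G rX by blast
      have "real (card G) \<le> K * ?n ^ (r - 1)" using C(3) G sz by metis
      also have "\<dots> \<le> t * ?n ^ (r - 1)" using t by (intro mult_right_mono) auto
      finally show "real (card G) \<le> t * ?n ^ (r - 1)" .
    next
      fix H assume "r_graph_on r ?V H \<and> ?F H"
      then show "\<exists>G\<in>\<C>. H \<subseteq> G" using C(4) Xr by blast
    qed
  qed
  moreover have "c > 0" unfolding c_def using assms d by simp
  ultimately show ?thesis using K by (intro exI[of _ c] exI[of _ K]) auto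
qed

end
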